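(* Let $\{\phi_n\}$ be a uniformly bounded sequence in $H^1(\mathbb{R}^2)$. Then for each $M\in\mathbb{N}$ there exists a subsequence of $\phi_n$ (also denoted $\phi_n$) such that, for each $1\le j\le M$, there exist a profile $\psi^j\in H^1(\mathbb{R}^2)$ (fixed in $n$), a sequence $t_n^j\in\mathbb{R}$ of time shifts, a sequence $x_n^j\in\mathbb{R}^2$ of space shifts, and a sequence $W_n^M$ of remainders in $H^1(\mathbb{R}^2)$, such that $$\phi_n(x)=\sum_{j=1}^Me^{-it_n^j\Delta}\psi^j(x-x_n^j)+W_n^M(x)$$ with the following properties: (1) (Pairwise divergence) for $1\le k\ne j\le M$, $\ \lim_{n\to\infty}|t_n^j-t_n^k|+|x_n^j-x_n^k|=+\infty$; (2) (Asymptotic smallness of the remainder) $\ \lim_{M\to\infty}\Big(\lim_{n\to\infty}\|e^{it\Delta}W_n^M\|_{S(\dot H^{1/2})}\Big)=0$; (3) (Asymptotic Pythagorean expansion) for fixed $M\in\mathbb{N}$ and any $0\le s\le1$, $$\|\phi_n\|_{\dot H^s}^2=\sum_{j=1}^M\|\psi^j\|_{\dot H^s}^2+\|W_n^M\|_{\dot H^s}^2+o_n(1).$$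
   Context: All spatial norms are over $\mathbb{R}^2$; $o_n(1)\to0$ as $n\to\infty$. As the indices indicate, the profiles $\psi^j$ and the shifts $t_n^j,x_n^j$ depend on $j$ (and $n$) but not on $M$; only the remainders depend on $M$. A pair $(q,r)$ is $\dot H^{1/2}$-admissible if $\frac2q+\frac2r=\frac12$, $2\le q,r\le\infty$, $(q,r)\ne(2,\infty)$. For $a>0$, $a^+$ is a fixed number slightly larger than $a$ and $(a^+)':=\frac{a^+a}{a^+-a}$. Then $$\|u\|_{S(\dot H^{1/2})}=\sup\big\{\|u\|_{L^q_tL^r_x}:(q,r)\ \dot H^{1/2}\text{-admissible},\ 4^+\le q\le\infty,\ 4^+\le r\le(4^+)'\big\}.$$ *)

theory Defs
  imports "HOL-Analysis.Analysis" "HOL-Probability.Essential_Supremum"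
begin

text \<open>
  Elements of a Lebesgue space are represented by Borel functions; two functions that agree
  almost everywhere represent the same element, so identities between them are stated
  almost everywhere.
\<close>

definition L2 :: "(real^2 \<Rightarrow> complex) set" where
  "L2 = {f. f \<in> borel_measurable lborel \<and> integrable lborel (\<lambda>x. (cmod (f x))\<^sup>2)}"

text \<open>
  The unitary Fourier transform on \<open>L\<^sup>2(\<real>\<^sup>2)\<close>, with kernel \<open>(2\<pi>)\<^sup>-\<^sup>1 exp (- i x \<bullet> \<xi>)\<close>. For \<open>f \<in> L\<^sup>2\<close>
  the Fourier integral need not converge absolutely, so the transform is the limit in \<open>L\<^sup>2\<close>, as
  \<open>R \<rightarrow> \<infinity>\<close>, of the Fourier integrals of \<open>f\<close> over the balls of radius \<open>R\<close> (Plancherel). The limit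
  is unique up to a null set; the choice operator picks one representative.
\<close>

definition truncated_fourier :: "real \<Rightarrow> (real^2 \<Rightarrow> complex) \<Rightarrow> real^2 \<Rightarrow> complex" where
  "truncated_fourier R f \<xi> =
     (LINT x : cball 0 R | lborel. cis (- (x \<bullet> \<xi>)) * f x) / complex_of_real (2 * pi)"

definition fourier :: "(real^2 \<Rightarrow> complex) \<Rightarrow> real^2 \<Rightarrow> complex" where
  "fourier f = (SOME g. g \<in> L2 \<and>
     ((\<lambda>R. \<integral>\<^sup>+ \<xi>. ennreal ((cmod (truncated_fourier R f \<xi> - g \<xi>))\<^sup>2) \<partial>lborel) \<longlongrightarrow> 0) at_top)"

definition inverse_fourier :: "(real^2 \<Rightarrow> complex) \<Rightarrow> real^2 \<Rightarrow> complex" where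
  "inverse_fourier g x = fourier g (- x)"

definition H1 :: "(real^2 \<Rightarrow> complex) set" where
  "H1 = {f \<in> L2. integrable lborel (\<lambda>\<xi>. (1 + (norm \<xi>)\<^sup>2) * (cmod (fourier f \<xi>))\<^sup>2)}"

definition H1_norm :: "(real^2 \<Rightarrow> complex) \<Rightarrow> real" where
  "H1_norm f = sqrt (LINT \<xi>|lborel. (1 + (norm \<xi>)\<^sup>2) * (cmod (fourier f \<xi>))\<^sup>2)"

text \<open>
  The homogeneous norm of \<open>\<dot>H\<^sup>s\<close>. It is only used for \<open>f \<in> H1\<close> and \<open>0 \<le> s \<le> 1\<close>, where the integral
  is finite. The convention \<open>0 powr 0 = 0\<close> only affects the null set \<open>{0}\<close>.
\<close>

definition Hdot_norm :: "real \<Rightarrow> (real^2 \<Rightarrow> complex) \<Rightarrow> real" where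
  "Hdot_norm s f = sqrt (LINT \<xi>|lborel. norm \<xi> powr (2 * s) * (cmod (fourier f \<xi>))\<^sup>2)"

text \<open>The free Schroedinger group \<open>exp (i t \<Delta>)\<close>, where \<open>\<Delta>\<close> has Fourier symbol \<open>- |\<xi>|\<^sup>2\<close>.\<close>

definition schroedinger :: "real \<Rightarrow> (real^2 \<Rightarrow> complex) \<Rightarrow> real^2 \<Rightarrow> complex" where
  "schroedinger t f = inverse_fourier (\<lambda>\<xi>. cis (- (t * (norm \<xi>)\<^sup>2)) * fourier f \<xi>)"

definition ennreal_power :: "ennreal \<Rightarrow> real \<Rightarrow> ennreal" where
  "ennreal_power y a = (if y = \<infinity> then \<infinity> else ennreal (enn2real y powr a))"

text \<open>Lebesgue norm of a nonnegative function, with exponent in \<open>(0, \<infinity>]\<close>.\<close>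

definition Lp_norm :: "ennreal \<Rightarrow> 'a measure \<Rightarrow> ('a \<Rightarrow> ennreal) \<Rightarrow> ennreal" where
  "Lp_norm p M g =
     (if p = \<infinity> then esssup M g
      else ennreal_power (\<integral>\<^sup>+ x. ennreal_power (g x) (enn2real p) \<partial>M) (1 / enn2real p))"

definition mixed_norm :: "ennreal \<Rightarrow> ennreal \<Rightarrow> (real \<Rightarrow> real^2 \<Rightarrow> complex) \<Rightarrow> ennreal" where
  "mixed_norm q r u = Lp_norm q lborel (\<lambda>t. Lp_norm r lborel (\<lambda>x. ennreal (cmod (u t x))))"

text \<open>Arithmetic is in \<open>[0, \<infinity>]\<close>, where \<open>2 / \<infinity> = 0\<close>.\<close>

definition admissible :: "ennreal \<Rightarrow> ennreal \<Rightarrow> bool" where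
  "admissible q r \<longleftrightarrow>
     2 / q + 2 / r = 1 / 2 \<and> 2 \<le> q \<and> q \<le> \<infinity> \<and> 2 \<le> r \<and> r \<le> \<infinity> \<and> (q, r) \<noteq> (2, \<infinity>)"

text \<open>\<open>plus_dual a b\<close> is \<open>(a\<^sup>+)'\<close> when \<open>b\<close> is the chosen number \<open>a\<^sup>+ > a\<close>.\<close>

definition plus_dual :: "real \<Rightarrow> real \<Rightarrow> real" where
  "plus_dual a b = b * a / (b - a)"

text \<open>The norm of \<open>S(\<dot>H\<^sup>1\<^sup>/\<^sup>2)\<close>; the parameter is the chosen number \<open>4\<^sup>+\<close>.\<close>

definition S_norm :: "real \<Rightarrow> (real \<Rightarrow> real^2 \<Rightarrow> complex) \<Rightarrow> ennreal" where
  "S_norm four_plus u =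
     Sup {mixed_norm q r u | q r. admissible q r \<and>
            ennreal four_plus \<le> q \<and> q \<le> \<infinity> \<and>
            ennreal four_plus \<le> r \<and> r \<le> ennreal (plus_dual 4 four_plus)}"

end

theory Submission
  imports Defs "HOL-Library.Diagonal_Subsequence" "HOL-Probability.Characteristic_Functions"
begin

text \<open>
  The decomposition is built on the Fourier side. Put \<open>F\<^sub>n(\<xi>) = (1 +
  |\<xi>|\<^sup>2)\<^sup>1\<^sup>/\<^sup>2\<close> times the Fourier transform of
  \<open>\<phi>\<^sub>n\<close>. Then the \<open>H\<^sup>1\<close> norm of
  \<open>\<phi>\<^sub>n\<close> is the \<open>L\<^sup>2\<close> norm of
  \<open>F\<^sub>n\<close>, translations and the free flow act as multiplication by the
  unimodular functions \<open>phase p\<close>, and every homogeneous norm of order between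
  \<open>0\<close> and \<open>1\<close> is an \<open>L\<^sup>2\<close> norm with a weight
  bounded by \<open>1\<close>.

  A profile is a weak \<open>L\<^sup>2\<close> limit of \<open>phase (- p\<^sub>n)
  W\<^sub>n\<close>, where \<open>W\<^sub>n\<close> is the current remainder. Subtracting
  \<open>phase p\<^sub>n\<close> times the profile splits all the weighted norms up to
  \<open>o(1)\<close>, because the cross term is a pairing with a function that converges weakly
  to zero (\<open>weakly_converges_Pythagoras\<close>). At each stage the profile is chosen so
  that no other such weak limit has more than twice its norm. The squared norms of the profiles
  are summable, so all weak limits of the later remainders are small
  (\<open>l2_pairing_vanishes\<close>). The parameters \<open>p\<^sub>n\<close> of different
  profiles separate since \<open>phase p\<^sub>n \<Psi>\<close> tends weakly to zero as
  \<open>|p\<^sub>n| \<rightarrow> \<infinity>\<close>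
  (\<open>phase_weakly_converges_0\<close>): if the parameters of two profiles stayed close
  along a subsequence, the later profile would be a weak limit of functions from which the
  earlier one has already been removed, hence zero.

  It remains to see that a remainder without concentration has a small space-time norm. Since
  \<open>|u|\<^sup>r\<close> is at most \<open>|u|\<^sup>r\<^sup>-\<^sup>4\<close> in the
  supremum norm times \<open>|u|\<^sup>4\<close>, the admissible norms of a free wave
  \<open>u\<close> are controlled by the norm in \<open>L\<^sup>4\<^sub>t
  L\<^sup>\<infinity>\<^sub>x\<close>, which is bounded by the \<open>H\<^sup>1\<close> norm,
  and by a positive power of the supremum over \<open>t\<close> of the norm in
  \<open>L\<^sup>4\<^sub>x\<close> (\<open>S_norm_interpolation\<close>). The latter is small:
  the high frequencies are small by a Sobolev estimate, and the value of the low frequencies at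
  a point of space-time is the pairing of the shifted remainder with one fixed function
  (\<open>L4_low_high_split\<close>).

  The \<open>L\<^sup>4\<^sub>t L\<^sup>\<infinity>\<^sub>x\<close> bound
  (\<open>strichartz_L4_Linfty\<close>) comes from the square of the wave. In terms of the mean
  \<open>m\<close> of two frequencies \<open>m + z\<close> and \<open>m - z\<close>, the
  spectrum of \<open>u\<^sup>2\<close> at \<open>2 m\<close> is an oscillatory integral over
  \<open>z\<close> with phase \<open>- 2 t |z|\<^sup>2\<close>. Its \<open>L\<^sup>2\<close>
  norm in \<open>t\<close> is estimated by the method of \<open>T T\<^sup>*\<close> and Schur's
  test (\<open>oscillatory_integral_l2_bound\<close>), with a constant that is integrable in
  \<open>m\<close>. The same general estimate contains the Plancherel inequality, from which the
  \<open>L\<^sup>2\<close> theory of the Fourier transform is derived.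
\<close>

section \<open>Square-integrable functions as a Hilbert space\<close>

definition square_integrable :: "'a measure \<Rightarrow> ('a \<Rightarrow> complex) set" where
  "square_integrable M = {f. f \<in> borel_measurable M \<and> integrable M (\<lambda>x. (cmod (f x))\<^sup>2)}"

definition sqnorm :: "'a measure \<Rightarrow> ('a \<Rightarrow> complex) \<Rightarrow> real" where
  "sqnorm M f = (LINT x|M. (cmod (f x))\<^sup>2)"

definition l2_inner :: "'a measure \<Rightarrow> ('a \<Rightarrow> complex) \<Rightarrow> ('a \<Rightarrow> complex) \<Rightarrow> complex" where
  "l2_inner M f g = (LINT x|M. f x * cnj (g x))"

lemma borel_measurable_cnj [measurable]: "f \<in> borel_measurable M \<Longrightarrow> (\<lambda>x. cnj (f x)) \<in> borel_measurable M"
  by (rule borel_measurable_continuous_on[OF continuous_on_cnj[OF continuous_on_id]]) auto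

lemma L2_eq_square_integrable: "L2 = square_integrable lborel"
  by (simp add: L2_def square_integrable_def)

lemma square_integrable_measurable[measurable_dest]:
  "f \<in> square_integrable M \<Longrightarrow> f \<in> borel_measurable M"
  by (simp add: square_integrable_def)

lemma square_integrable_integrable:
  "f \<in> square_integrable M \<Longrightarrow> integrable M (\<lambda>x. (cmod (f x))\<^sup>2)"
  by (simp add: square_integrable_def)

lemma square_integrable_bound:
  assumes "f \<in> borel_measurable M" "integrable M h" "\<And>x. x \<in> space M \<Longrightarrow> (cmod (f x))\<^sup>2 \<le> h x"
  shows "f \<in> square_integrable M"
  unfolding square_integrable_def using assms(1)
  by (auto intro!: Bochner_Integration.integrable_bound[OF assms(2)] AE_I2 order_trans[OF assms(3)])

lemma cmod_add_sq_le: "(cmod (a + b))\<^sup>2 \<le> 2 * (cmod a)\<^sup>2 + 2 * (cmod b)\<^sup>2"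
proof -
  have "(cmod (a + b))\<^sup>2 \<le> (cmod a + cmod b)\<^sup>2"
    by (simp add: norm_triangle_ineq power_mono)
  also have "\<dots> \<le> 2 * (cmod a)\<^sup>2 + 2 * (cmod b)\<^sup>2"
    using sum_squares_bound[of "cmod a" "cmod b"] by (simp add: power2_sum)
  finally show ?thesis .
qed

lemma square_integrable_add:
  assumes f: "f \<in> square_integrable M" and g: "g \<in> square_integrable M"
  shows "(\<lambda>x. f x + g x) \<in> square_integrable M"
  using square_integrable_integrable[OF f] square_integrable_integrable[OF g] f g
  by (intro square_integrable_bound[where h="\<lambda>x. 2 * (cmod (f x))\<^sup>2 + 2 * (cmod (g x))\<^sup>2"])
     (auto simp: cmod_add_sq_le)

lemma square_integrable_mult_bounded:
  assumes [measurable]: "m \<in> borel_measurable M" and f: "f \<in> square_integrable M"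
    and c: "\<And>x. x \<in> space M \<Longrightarrow> cmod (m x) \<le> c"
  shows "(\<lambda>x. m x * f x) \<in> square_integrable M"
proof (rule square_integrable_bound[where h="\<lambda>x. c\<^sup>2 * (cmod (f x))\<^sup>2"])
  show "(\<lambda>x. m x * f x) \<in> borel_measurable M"
    using f by measurable
  show "integrable M (\<lambda>x. c\<^sup>2 * (cmod (f x))\<^sup>2)"
    using square_integrable_integrable[OF f] by simp
qed (auto simp: norm_mult power_mult_distrib intro!: mult_right_mono power_mono c)

lemma square_integrable_scale: "f \<in> square_integrable M \<Longrightarrow> (\<lambda>x. c * f x) \<in> square_integrable M"
  by (rule square_integrable_mult_bounded[where c="cmod c"]) auto

lemma square_integrable_minus: "f \<in> square_integrable M \<Longrightarrow> (\<lambda>x. - f x) \<in> square_integrable M"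
  using square_integrable_scale[of f M "-1"] by simp

lemma square_integrable_diff:
  "f \<in> square_integrable M \<Longrightarrow> g \<in> square_integrable M \<Longrightarrow> (\<lambda>x. f x - g x) \<in> square_integrable M"
  using square_integrable_add[OF _ square_integrable_minus, of f M g] by simp

lemma square_integrable_zero: "(\<lambda>x. 0) \<in> square_integrable M"
  by (simp add: square_integrable_def)

lemma square_integrable_sum:
  "(\<And>i. i \<in> I \<Longrightarrow> f i \<in> square_integrable M) \<Longrightarrow> (\<lambda>x. \<Sum>i\<in>I. f i x) \<in> square_integrable M"
  by (induction I rule: infinite_finite_induct) (auto intro: square_integrable_add simp: square_integrable_zero)

lemma square_integrable_cnj: "f \<in> square_integrable M \<Longrightarrow> (\<lambda>x. cnj (f x)) \<in> square_integrable M"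
  by (auto simp: square_integrable_def)

lemma sqnorm_nonneg [simp]: "0 \<le> sqnorm M f"
  by (simp add: sqnorm_def)

lemma nn_integral_eq_sqnorm:
  assumes "f \<in> square_integrable M"
  shows "(\<integral>\<^sup>+ x. ennreal ((cmod (f x))\<^sup>2) \<partial>M) = ennreal (sqnorm M f)"
  unfolding sqnorm_def using square_integrable_integrable[OF assms]
  by (intro nn_integral_eq_integral) auto

lemma square_integrableI_nn_integral:
  assumes [measurable]: "f \<in> borel_measurable M" and le: "(\<integral>\<^sup>+ x. ennreal ((cmod (f x))\<^sup>2) \<partial>M) \<le> ennreal c"
  shows "f \<in> square_integrable M"
  unfolding square_integrable_def using le_less_trans[OF le ennreal_less_top]
  by (auto intro!: integrableI_nonneg)

lemma sqnorm_le_nn_integral: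
  assumes "f \<in> borel_measurable M" "0 \<le> c" "(\<integral>\<^sup>+ x. ennreal ((cmod (f x))\<^sup>2) \<partial>M) \<le> ennreal c"
  shows "sqnorm M f \<le> c"
  using nn_integral_eq_sqnorm[OF square_integrableI_nn_integral[OF assms(1,3)]] assms
  by (simp add: ennreal_le_iff)

lemma integrable_mult_square_integrable:
  assumes f: "f \<in> square_integrable M" and g: "g \<in> square_integrable M"
  shows "integrable M (\<lambda>x. f x * g x)"
proof (rule Bochner_Integration.integrable_bound)
  show "integrable M (\<lambda>x. ((cmod (f x))\<^sup>2 + (cmod (g x))\<^sup>2) / 2)"
    using square_integrable_integrable[OF f] square_integrable_integrable[OF g] by simp
  show "(\<lambda>x. f x * g x) \<in> borel_measurable M"
    using f g by measurable
  show "AE x in M. norm (f x * g x) \<le> norm (((cmod (f x))\<^sup>2 + (cmod (g x))\<^sup>2) / 2)"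
  proof (rule AE_I2)
    fix x show "norm (f x * g x) \<le> norm (((cmod (f x))\<^sup>2 + (cmod (g x))\<^sup>2) / 2)"
      using sum_squares_bound[of "cmod (f x)" "cmod (g x)"] by (simp add: norm_mult)
  qed
qed

lemma integrable_l2_inner:
  "f \<in> square_integrable M \<Longrightarrow> g \<in> square_integrable M \<Longrightarrow> integrable M (\<lambda>x. f x * cnj (g x))"
  by (intro integrable_mult_square_integrable square_integrable_cnj)

lemma l2_inner_self: "l2_inner M f f = complex_of_real (sqnorm M f)"
  unfolding l2_inner_def sqnorm_def
  by (simp add: complex_norm_square[symmetric] flip: integral_complex_of_real of_real_power)

lemma l2_inner_commute: "l2_inner M g f = cnj (l2_inner M f g)"
  unfolding l2_inner_def Bochner_Integration.integral_cnj[symmetric] by (simp add: mult.commute)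

lemma l2_inner_add_left:
  assumes "f \<in> square_integrable M" "g \<in> square_integrable M" "h \<in> square_integrable M"
  shows "l2_inner M (\<lambda>x. f x + g x) h = l2_inner M f h + l2_inner M g h"
  unfolding l2_inner_def using assms
  by (simp add: ring_distribs integrable_l2_inner)

lemma l2_inner_diff_left:
  assumes "f \<in> square_integrable M" "g \<in> square_integrable M" "h \<in> square_integrable M"
  shows "l2_inner M (\<lambda>x. f x - g x) h = l2_inner M f h - l2_inner M g h"
  unfolding l2_inner_def using assms
  by (simp add: ring_distribs integrable_l2_inner)

lemma l2_inner_scale_left: "l2_inner M (\<lambda>x. c * f x) h = c * l2_inner M f h"
  unfolding l2_inner_def by (simp add: mult.assoc)

lemma l2_inner_diff_right:
  assumes "f \<in> square_integrable M" "g \<in> square_integrable M" "h \<in> square_integrable M"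
  shows "l2_inner M h (\<lambda>x. f x - g x) = l2_inner M h f - l2_inner M h g"
  using l2_inner_diff_left[OF assms]
  by (simp add: l2_inner_commute[of M h "\<lambda>x. f x - g x"] l2_inner_commute[of M h f] l2_inner_commute[of M h g])

lemma sqnorm_add:
  assumes f: "f \<in> square_integrable M" and g: "g \<in> square_integrable M"
  shows "sqnorm M (\<lambda>x. f x + g x) = sqnorm M f + sqnorm M g + 2 * Re (l2_inner M f g)"
proof -
  have eq: "(cmod (f x + g x))\<^sup>2 = (cmod (f x))\<^sup>2 + (cmod (g x))\<^sup>2 + 2 * Re (f x * cnj (g x))" for x
    unfolding cmod_power2 by (simp add: power2_eq_square algebra_simps)
  have "2 * Re (l2_inner M f g) = (LINT x|M. 2 * Re (f x * cnj (g x)))"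
    unfolding l2_inner_def integral_mult_right_zero using integrable_l2_inner[OF f g]
    by (simp only: integral_Re)
  then show ?thesis
    unfolding sqnorm_def eq
    using square_integrable_integrable[OF f] square_integrable_integrable[OF g] integrable_Re[OF integrable_l2_inner[OF f g]]
    by (subst Bochner_Integration.integral_add) (auto simp del: times_complex.sel)
qed

lemma sqnorm_scale: "sqnorm M (\<lambda>x. c * f x) = (cmod c)\<^sup>2 * sqnorm M f"
  unfolding sqnorm_def by (simp add: norm_mult power_mult_distrib)

lemma sqnorm_diff:
  assumes f: "f \<in> square_integrable M" and g: "g \<in> square_integrable M"
  shows "sqnorm M (\<lambda>x. f x - g x) = sqnorm M f + sqnorm M g - 2 * Re (l2_inner M f g)"
proof -
  have "l2_inner M f (\<lambda>x. - g x) = - l2_inner M f g" "sqnorm M (\<lambda>x. - g x) = sqnorm M g"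
    unfolding l2_inner_def sqnorm_def by simp_all
  then show ?thesis
    using sqnorm_add[OF f square_integrable_minus[OF g]] by simp
qed

lemma sqnorm_diff_commute: "sqnorm M (\<lambda>x. f x - g x) = sqnorm M (\<lambda>x. g x - f x)"
  unfolding sqnorm_def by (simp add: norm_minus_commute)

lemma sqnorm_add_le:
  assumes f: "f \<in> square_integrable M" and g: "g \<in> square_integrable M"
  shows "sqnorm M (\<lambda>x. f x + g x) \<le> 2 * sqnorm M f + 2 * sqnorm M g"
proof -
  have "sqnorm M (\<lambda>x. f x + g x) \<le> (LINT x|M. 2 * (cmod (f x))\<^sup>2 + 2 * (cmod (g x))\<^sup>2)"
    unfolding sqnorm_def
    using square_integrable_integrable[OF f] square_integrable_integrable[OF g]
      square_integrable_integrable[OF square_integrable_add[OF f g]]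
    by (intro integral_mono) (auto simp: cmod_add_sq_le)
  also have "\<dots> = 2 * sqnorm M f + 2 * sqnorm M g"
    unfolding sqnorm_def using square_integrable_integrable[OF f] square_integrable_integrable[OF g] by simp
  finally show ?thesis .
qed

lemma sqnorm_diff_le:
  assumes f: "f \<in> square_integrable M" and g: "g \<in> square_integrable M"
  shows "sqnorm M (\<lambda>x. f x - g x) \<le> 2 * sqnorm M f + 2 * sqnorm M g"
  using sqnorm_add_le[OF f square_integrable_minus[OF g]] by (simp add: sqnorm_def)

lemma sqnorm_triangle3:
  assumes "f \<in> square_integrable M" "g \<in> square_integrable M" "h \<in> square_integrable M"
  shows "sqnorm M (\<lambda>x. f x - h x) \<le> 2 * sqnorm M (\<lambda>x. f x - g x) + 2 * sqnorm M (\<lambda>x. g x - h x)"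
  using sqnorm_add_le[of "\<lambda>x. f x - g x" M "\<lambda>x. g x - h x"] assms
  by (simp add: square_integrable_diff)

lemma l2_Cauchy_Schwarz:
  assumes f: "f \<in> square_integrable M" and g: "g \<in> square_integrable M"
  shows "(cmod (l2_inner M f g))\<^sup>2 \<le> sqnorm M f * sqnorm M g"
proof -
  have [measurable]: "f \<in> borel_measurable M" "g \<in> borel_measurable M"
    using f g by auto
  have "ennreal (cmod (l2_inner M f g)) \<le> (\<integral>\<^sup>+ x. ennreal (cmod (f x)) * ennreal (cmod (g x)) \<partial>M)"
    unfolding l2_inner_def using integrable_l2_inner[OF f g]
    by (intro order_trans[OF integral_norm_bound_ennreal]) (auto simp: norm_mult ennreal_mult)
  then have "(ennreal (cmod (l2_inner M f g)))\<^sup>2 \<le> (\<integral>\<^sup>+ x. ennreal (cmod (f x)) * ennreal (cmod (g x)) \<partial>M)\<^sup>2"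
    by (rule power_mono) simp
  also have "\<dots> \<le> (\<integral>\<^sup>+ x. ennreal (cmod (f x)) ^ 2 \<partial>M) * (\<integral>\<^sup>+ x. ennreal (cmod (g x)) ^ 2 \<partial>M)"
    by (rule Cauchy_Schwarz_nn_integral) measurable
  also have "\<dots> = ennreal (sqnorm M f * sqnorm M g)"
    using nn_integral_eq_sqnorm[OF f] nn_integral_eq_sqnorm[OF g]
    by (simp add: ennreal_power ennreal_mult)
  finally show ?thesis
    by (simp add: ennreal_power)
qed

lemma l2_inner_le: 
  assumes f: "f \<in> square_integrable M" and g: "g \<in> square_integrable M"
  shows "cmod (l2_inner M f g) \<le> sqrt (sqnorm M f) * sqrt (sqnorm M g)"
  using real_sqrt_le_mono[OF l2_Cauchy_Schwarz[OF f g]] by (simp add: real_sqrt_mult)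

lemma sqnorm_zero_iff:
  assumes "f \<in> square_integrable M"
  shows "sqnorm M f = 0 \<longleftrightarrow> (AE x in M. f x = 0)"
  unfolding sqnorm_def using integral_nonneg_eq_0_iff_AE[OF square_integrable_integrable[OF assms]] by simp

lemma sqnorm_cong_AE:
  assumes "f \<in> borel_measurable M" "g \<in> borel_measurable M" "AE x in M. f x = g x"
  shows "sqnorm M f = sqnorm M g"
  unfolding sqnorm_def using assms by (intro integral_cong_AE) auto

lemma l2_tendsto_inner:
  assumes f: "\<And>n. f n \<in> square_integrable M" and g: "g \<in> square_integrable M" and h: "h \<in> square_integrable M"
    and lim: "((\<lambda>n. sqnorm M (\<lambda>x. f n x - g x)) \<longlongrightarrow> 0) F"
  shows "((\<lambda>n. l2_inner M (f n) h) \<longlongrightarrow> l2_inner M g h) F"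
proof (rule Lim_transform[OF tendsto_const])
  have "((\<lambda>n. l2_inner M (\<lambda>x. f n x - g x) h) \<longlongrightarrow> 0) F"
  proof (rule Lim_null_comparison)
    show "\<forall>\<^sub>F n in F. norm (l2_inner M (\<lambda>x. f n x - g x) h) \<le> sqrt (sqnorm M (\<lambda>x. f n x - g x)) * sqrt (sqnorm M h)"
      using f g h by (auto intro!: always_eventually l2_inner_le square_integrable_diff)
    show "((\<lambda>n. sqrt (sqnorm M (\<lambda>x. f n x - g x)) * sqrt (sqnorm M h)) \<longlongrightarrow> 0) F"
      using tendsto_mult_left_zero[OF tendsto_real_sqrt[OF lim, unfolded real_sqrt_zero], of "sqrt (sqnorm M h)"] by simp
  qed
  then show "((\<lambda>n. l2_inner M (f n) h - l2_inner M g h) \<longlongrightarrow> 0) F"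
    using f g h by (simp add: l2_inner_diff_left)
qed

lemma l2_tendsto_sqnorm:
  assumes f: "\<And>n. f n \<in> square_integrable M" and g: "g \<in> square_integrable M"
    and lim: "((\<lambda>n. sqnorm M (\<lambda>x. f n x - g x)) \<longlongrightarrow> 0) F"
  shows "((\<lambda>n. sqnorm M (f n)) \<longlongrightarrow> sqnorm M g) F"
proof -
  have eq: "sqnorm M (f n) = sqnorm M (\<lambda>x. f n x - g x) - sqnorm M g + 2 * Re (l2_inner M (f n) g)" for n
    using sqnorm_diff[OF f g] by simp
  have "((\<lambda>n. sqnorm M (f n)) \<longlongrightarrow> 0 - sqnorm M g + 2 * Re (l2_inner M g g)) F"
    unfolding eq by (intro tendsto_intros lim l2_tendsto_inner f g)
  then show ?thesis by (simp add: l2_inner_self)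
qed

lemma l2_limit_unique:
  assumes f: "\<And>n. f n \<in> square_integrable M" and g: "g \<in> square_integrable M" and h: "h \<in> square_integrable M"
    and "((\<lambda>n. sqnorm M (\<lambda>x. f n x - g x)) \<longlongrightarrow> 0) F" "((\<lambda>n. sqnorm M (\<lambda>x. f n x - h x)) \<longlongrightarrow> 0) F"
    and F: "F \<noteq> bot"
  shows "AE x in M. g x = h x"
proof -
  have "sqnorm M (\<lambda>x. g x - h x) \<le> 2 * sqnorm M (\<lambda>x. f n x - g x) + 2 * sqnorm M (\<lambda>x. f n x - h x)" for n
    using sqnorm_triangle3[OF g f h, of n] by (simp add: sqnorm_diff_commute[of M g "f n"])
  moreover have "((\<lambda>n. 2 * sqnorm M (\<lambda>x. f n x - g x) + 2 * sqnorm M (\<lambda>x. f n x - h x)) \<longlongrightarrow> 2 * 0 + 2 * 0) F"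
    by (intro tendsto_intros assms)
  ultimately have "sqnorm M (\<lambda>x. g x - h x) \<le> 2 * 0 + 2 * 0"
    by (intro tendsto_le[OF F _ tendsto_const]) auto
  then have "sqnorm M (\<lambda>x. g x - h x) = 0"
    using sqnorm_nonneg[of M "\<lambda>x. g x - h x"] by linarith
  then show ?thesis
    using sqnorm_zero_iff[OF square_integrable_diff[OF g h]] by simp
qed

lemma l2_tendsto_AE_subseq:
  assumes f: "\<And>n. f n \<in> square_integrable M" and g: "g \<in> square_integrable M"
    and lim: "(\<lambda>n. sqnorm M (\<lambda>x. f n x - g x)) \<longlonglongrightarrow> 0"
  shows "\<exists>r::nat\<Rightarrow>nat. strict_mono r \<and> (AE x in M. (\<lambda>n. f (r n) x) \<longlonglongrightarrow> g x)"
proof -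
  have "\<exists>r::nat\<Rightarrow>nat. strict_mono r \<and> (AE x in M. (\<lambda>n. (cmod (f (r n) x - g x))\<^sup>2) \<longlonglongrightarrow> 0)"
    using lim square_integrable_integrable[OF square_integrable_diff[OF f g]]
    by (intro tendsto_L1_AE_subseq) (auto simp: sqnorm_def)
  then obtain r :: "nat \<Rightarrow> nat" where r: "strict_mono r" "AE x in M. (\<lambda>n. (cmod (f (r n) x - g x))\<^sup>2) \<longlonglongrightarrow> 0"
    by auto
  from r(2) have "AE x in M. (\<lambda>n. f (r n) x) \<longlonglongrightarrow> g x"
  proof eventually_elim
    case (elim x)
    then have "(\<lambda>n. cmod (f (r n) x - g x)) \<longlonglongrightarrow> 0"
      using tendsto_real_sqrt by fastforce
    then show ?case
      by (simp add: LIM_zero_iff tendsto_norm_zero_iff)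
  qed
  with r(1) show ?thesis by auto
qed

text \<open>
  Fatou's lemma in the form in which bounds are passed to limits of approximations, where the
  limit \<open>v\<close> is only known almost everywhere.
\<close>

lemma nn_integral_le_of_AE_tendsto:
  fixes u :: "nat \<Rightarrow> 'a \<Rightarrow> ennreal"
  assumes [measurable]: "\<And>k. u k \<in> borel_measurable M"
    and lim: "AE x in M. (\<lambda>k. u k x) \<longlonglongrightarrow> v x"
    and le: "\<forall>\<^sub>F k in sequentially. (\<integral>\<^sup>+ x. u k x \<partial>M) \<le> c"
  shows "(\<integral>\<^sup>+ x. v x \<partial>M) \<le> c"
proof -
  have "(\<integral>\<^sup>+ x. v x \<partial>M) = (\<integral>\<^sup>+ x. liminf (\<lambda>k. u k x) \<partial>M)"
    using lim by (intro nn_integral_cong_AE) (auto elim!: eventually_mono simp: lim_imp_Liminf)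
  also have "\<dots> \<le> liminf (\<lambda>k. \<integral>\<^sup>+ x. u k x \<partial>M)"
    by (rule nn_integral_liminf) measurable
  also have "\<dots> \<le> limsup (\<lambda>k. \<integral>\<^sup>+ x. u k x \<partial>M)"
    by (rule Liminf_le_Limsup) simp
  also have "\<dots> \<le> c"
    by (rule Limsup_bounded) (rule le)
  finally show ?thesis .
qed

text \<open>
  Riesz--Fischer. If successive differences along a subsequence have squared norm at most
  \<open>8\<^sup>-\<^sup>k\<close>, then the sum of the squared differences with weights
  \<open>2\<^sup>k\<close> is integrable, so the differences decay geometrically almost
  everywhere and the subsequence converges there. Fatou's lemma compares the whole sequence with
  this limit.
\<close>

theorem l2_complete:
  fixes f :: "nat \<Rightarrow> 'a \<Rightarrow> complex"
  assumes f: "\<And>n. f n \<in> square_integrable M"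
    and Cauchy: "\<And>e. 0 < e \<Longrightarrow> \<exists>N. \<forall>m\<ge>N. \<forall>n\<ge>N. sqnorm M (\<lambda>x. f m x - f n x) \<le> e"
  shows "\<exists>g\<in>square_integrable M. (\<lambda>n. sqnorm M (\<lambda>x. f n x - g x)) \<longlonglongrightarrow> 0"
proof -
  have fm[measurable]: "f n \<in> borel_measurable M" for n using f by auto
  have "\<exists>N. \<forall>k. \<forall>m\<ge>N k. \<forall>n\<ge>N k. sqnorm M (\<lambda>x. f m x - f n x) \<le> (1/8)^k"
    by (intro choice allI Cauchy) simp
  then obtain N :: "nat \<Rightarrow> nat" where N: "\<And>k m n. m \<ge> N k \<Longrightarrow> n \<ge> N k \<Longrightarrow> sqnorm M (\<lambda>x. f m x - f n x) \<le> (1/8)^k"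
    by auto
  \<comment> \<open>the sum makes \<open>r\<close> monotone with \<open>r k \<ge> N k\<close>,
  and the summand \<open>k\<close> makes it unbounded\<close>
  define r where "r k = (\<Sum>i\<le>k. N i) + k" for k
  have rN: "N k \<le> r k" for k
    unfolding r_def using member_le_sum[of k "{..k}" N] by simp
  have r_Suc: "r k \<le> r (Suc k)" for k by (simp add: r_def)
  have r_ge: "k \<le> r k" for k by (simp add: r_def)
  have d_le: "(\<integral>\<^sup>+ x. ennreal ((cmod (f (r (Suc k)) x - f (r k) x))\<^sup>2) \<partial>M) \<le> ennreal ((1/8)^k)" for k
    using N[of k "r (Suc k)" "r k"] rN[of k] r_Suc[of k]
    by (subst nn_integral_eq_sqnorm) (auto intro!: square_integrable_diff f ennreal_leI)
  have "(\<integral>\<^sup>+ x. (\<Sum>k. ennreal (2^k * (cmod (f (r (Suc k)) x - f (r k) x))\<^sup>2)) \<partial>M)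
      = (\<Sum>k. \<integral>\<^sup>+ x. ennreal (2^k * (cmod (f (r (Suc k)) x - f (r k) x))\<^sup>2) \<partial>M)"
    by (rule nn_integral_suminf) measurable
  also have "\<dots> \<le> (\<Sum>k. ennreal ((1/4)^k))"
  proof (intro suminf_le summableI)
    fix k
    have "(\<integral>\<^sup>+ x. ennreal (2^k * (cmod (f (r (Suc k)) x - f (r k) x))\<^sup>2) \<partial>M)
        = ennreal (2^k) * (\<integral>\<^sup>+ x. ennreal ((cmod (f (r (Suc k)) x - f (r k) x))\<^sup>2) \<partial>M)"
      by (simp add: ennreal_mult nn_integral_cmult)
    also have "\<dots> \<le> ennreal (2^k) * ennreal ((1/8)^k)"
      by (intro mult_left_mono d_le) simp
    also have "\<dots> = ennreal ((1/4)^k)"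
      by (simp add: ennreal_mult[symmetric] power_mult_distrib[symmetric])
    finally show "(\<integral>\<^sup>+ x. ennreal (2^k * (cmod (f (r (Suc k)) x - f (r k) x))\<^sup>2) \<partial>M) \<le> ennreal ((1/4)^k)" .
  qed
  also have "\<dots> = ennreal (\<Sum>k. (1/4)^k)"
    by (intro suminf_ennreal2) auto
  also have "\<dots> < \<infinity>" by simp
  finally have "AE x in M. (\<Sum>k. ennreal (2^k * (cmod (f (r (Suc k)) x - f (r k) x))\<^sup>2)) \<noteq> \<infinity>"
    by (intro nn_integral_PInf_AE) auto
  then have conv: "AE x in M. convergent (\<lambda>k. f (r k) x)"
  proof eventually_elim
    case (elim x)
    define d where "d k = cmod (f (r (Suc k)) x - f (r k) x)" for k
    have "summable (\<lambda>k. 2^k * (d k)\<^sup>2)"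
      using elim by (intro summable_suminf_not_top) (auto simp: d_def top_unique)
    then have "Bseq (\<lambda>k. 2^k * (d k)\<^sup>2)"
      using convergent_imp_Bseq convergentI summable_LIMSEQ_zero by blast
    then obtain K where K: "0 < K" "\<And>k. norm (2^k * (d k)\<^sup>2) \<le> K"
      by (auto elim: BseqE)
    have d_bound: "d k \<le> sqrt K * (sqrt (1/2))^k" for k
    proof -
      have "(d k)\<^sup>2 \<le> K * (1/2)^k"
        using K(2)[of k] by (simp add: field_simps)
      then have "d k \<le> sqrt (K * (1/2)^k)"
        by (rule real_le_rsqrt)
      then show ?thesis by (simp add: real_sqrt_mult real_sqrt_power real_sqrt_divide power_divide)
    qed
    have "summable (\<lambda>k. sqrt K * (sqrt (1/2))^k)"
      by (intro summable_mult summable_geometric) (simp add: real_sqrt_divide)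
    then have "summable (\<lambda>k. f (r (Suc k)) x - f (r k) x)"
      by (rule summable_comparison_test') (use d_bound in \<open>auto simp: d_def\<close>)
    then have "convergent (\<lambda>n. \<Sum>k<n. f (r (Suc k)) x - f (r k) x)"
      by (simp add: summable_iff_convergent)
    then have "convergent (\<lambda>n. f (r n) x - f (r 0) x)"
      by (simp add: sum_lessThan_telescope[of "\<lambda>k. f (r k) x"])
    then show ?case
      using convergent_add[OF _ convergent_const[of "f (r 0) x"]] by fastforce
  qed
  define g where "g x = lim (\<lambda>k. f (r k) x)" for x
  have gm[measurable]: "g \<in> borel_measurable M"
    unfolding g_def by measurable
  have bound: "(\<integral>\<^sup>+ x. ennreal ((cmod (f n x - g x))\<^sup>2) \<partial>M) \<le> ennreal ((1/8)^j)" if "N j \<le> n" for j n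
  proof (rule nn_integral_le_of_AE_tendsto[where u="\<lambda>k x. ennreal ((cmod (f n x - f (r k) x))\<^sup>2)"])
    show "AE x in M. (\<lambda>k. ennreal ((cmod (f n x - f (r k) x))\<^sup>2)) \<longlonglongrightarrow> ennreal ((cmod (f n x - g x))\<^sup>2)"
      using conv
    proof eventually_elim
      case (elim x)
      then have "(\<lambda>k. f (r k) x) \<longlonglongrightarrow> g x"
        by (simp add: g_def convergent_LIMSEQ_iff)
      then show ?case by (intro tendsto_intros tendsto_ennrealI)
    qed
    show "\<forall>\<^sub>F k in sequentially. (\<integral>\<^sup>+ x. ennreal ((cmod (f n x - f (r k) x))\<^sup>2) \<partial>M) \<le> ennreal ((1/8)^j)"
      using eventually_ge_at_top[of "N j"]
    proof eventually_elim
      case (elim k)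
      then show ?case
        using N[OF that, of "r k"] r_ge[of k]
        by (subst nn_integral_eq_sqnorm) (auto intro!: square_integrable_diff f ennreal_leI)
    qed
  qed measurable
  have gsq: "g \<in> square_integrable M"
    using square_integrable_diff[OF f square_integrableI_nn_integral[OF _ bound[of 0 "N 0"]], of "N 0"] by simp
  have "(\<lambda>n. sqnorm M (\<lambda>x. f n x - g x)) \<longlonglongrightarrow> 0"
  proof (rule LIMSEQ_I)
    fix e :: real assume "0 < e"
    then obtain j where j: "(1/8)^j < e"
      using real_arch_pow_inv[of e "1/8"] by auto
    have "norm (sqnorm M (\<lambda>x. f n x - g x) - 0) < e" if "n \<ge> N j" for n
      using sqnorm_le_nn_integral[OF _ _ bound[OF that]] j by simp
    then show "\<exists>N. \<forall>n\<ge>N. norm (sqnorm M (\<lambda>x. f n x - g x) - 0) < e" by blast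
  qed
  with gsq show ?thesis by blast
qed

section \<open>Weak compactness\<close>

text \<open>
  Closure under midpoints is what the parallelogram law uses to find elements of nearly minimal
  norm.
\<close>

inductive_set midpoint_hull :: "('a \<Rightarrow> complex) set \<Rightarrow> ('a \<Rightarrow> complex) set" for S where
  base: "f \<in> S \<Longrightarrow> f \<in> midpoint_hull S"
| mid: "f \<in> midpoint_hull S \<Longrightarrow> g \<in> midpoint_hull S \<Longrightarrow> (\<lambda>x. (f x + g x) / 2) \<in> midpoint_hull S"

lemma midpoint_hull_mono: "f \<in> midpoint_hull S \<Longrightarrow> S \<subseteq> T \<Longrightarrow> f \<in> midpoint_hull T"
  by (induction rule: midpoint_hull.induct) (auto intro: midpoint_hull.intros)

lemma square_integrable_midpoint:
  "f \<in> square_integrable M \<Longrightarrow> g \<in> square_integrable M \<Longrightarrow> (\<lambda>x. (f x + g x) / 2) \<in> square_integrable M"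
  using square_integrable_scale[OF square_integrable_add, of f M g "1/2"] by simp

lemma sqnorm_midpoint:
  assumes f: "f \<in> square_integrable M" and g: "g \<in> square_integrable M"
  shows "4 * sqnorm M (\<lambda>x. (f x + g x) / 2) = 2 * sqnorm M f + 2 * sqnorm M g - sqnorm M (\<lambda>x. f x - g x)"
proof -
  have "sqnorm M (\<lambda>x. (f x + g x) / 2) = sqnorm M (\<lambda>x. f x + g x) / 4"
    using sqnorm_scale[of M "1/2" "\<lambda>x. f x + g x"] by (simp add: power2_eq_square)
  then show ?thesis using sqnorm_add[OF f g] sqnorm_diff[OF f g] by simp
qed

lemma midpoint_hull_square_integrable:
  "f \<in> midpoint_hull S \<Longrightarrow> S \<subseteq> square_integrable M \<Longrightarrow> f \<in> square_integrable M"
  by (induction rule: midpoint_hull.induct) (auto intro: square_integrable_midpoint)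

lemma midpoint_hull_inner_near:
  assumes "f \<in> midpoint_hull S" "S \<subseteq> square_integrable M" "h \<in> square_integrable M"
    and "\<And>f. f \<in> S \<Longrightarrow> cmod (l2_inner M f h - l) \<le> e"
  shows "cmod (l2_inner M f h - l) \<le> e"
  using assms(1)
proof (induction rule: midpoint_hull.induct)
  case (mid f g)
  have "f \<in> square_integrable M" "g \<in> square_integrable M"
    using mid(1,2) assms(2) by (auto intro: midpoint_hull_square_integrable)
  then have "l2_inner M (\<lambda>x. (f x + g x) / 2) h = (l2_inner M f h + l2_inner M g h) / 2"
    using l2_inner_scale_left[of M "1/2" "\<lambda>x. f x + g x" h] l2_inner_add_left[of f M g h] assms(3) by simp
  then have "l2_inner M (\<lambda>x. (f x + g x) / 2) h - l = ((l2_inner M f h - l) + (l2_inner M g h - l)) / 2"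
    by (simp add: field_simps)
  then have "cmod (l2_inner M (\<lambda>x. (f x + g x) / 2) h - l) = cmod ((l2_inner M f h - l) + (l2_inner M g h - l)) / 2"
    by (simp only: norm_divide norm_numeral)
  also have "\<dots> \<le> e"
    using mid norm_triangle_ineq[of "l2_inner M f h - l" "l2_inner M g h - l"] by linarith
  finally show ?case .
qed (use assms(4) in auto)

text \<open>
  Elements of nearly minimal norm in the hulls of the tails of \<open>F\<close> form a Cauchy
  sequence by the parallelogram law, since a midpoint of two of them lies in the larger hull. If
  the pairings with \<open>h\<close> converge to \<open>l\<close>, they are close to
  \<open>l\<close> on the whole hull of a late tail, hence equal to \<open>l\<close> at the
  limit.
\<close>

lemma weak_limit_candidate:
  fixes F :: "nat \<Rightarrow> 'a \<Rightarrow> complex"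
  assumes F: "\<And>n. F n \<in> square_integrable M" and C: "\<And>n. sqnorm M (F n) \<le> C"
  shows "\<exists>\<Psi>\<in>square_integrable M. \<forall>h\<in>square_integrable M. \<forall>l.
    (\<lambda>n. l2_inner M (F n) h) \<longlonglongrightarrow> l \<longrightarrow> l2_inner M \<Psi> h = l"
proof -
  define H where "H n = midpoint_hull {F m |m. n \<le> m}" for n
  define d where "d n = (INF f\<in>H n. sqnorm M f)" for n
  have FH: "F n \<in> H n" for n
    unfolding H_def by (auto intro: midpoint_hull.base)
  have H_sq: "f \<in> square_integrable M" if "f \<in> H n" for f n
    using that F unfolding H_def by (auto intro: midpoint_hull_square_integrable)
  have H_mono: "H m \<subseteq> H n" if "n \<le> m" for n m
    unfolding H_def using that by (auto elim!: midpoint_hull_mono)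
  have bdd: "bdd_below (sqnorm M ` H n)" for n
    by (rule bdd_belowI[of _ 0]) auto
  have d_le: "d n \<le> sqnorm M f" if "f \<in> H n" for f n
    unfolding d_def using that bdd by (intro cINF_lower)
  have d_mono: "d n \<le> d m" if "n \<le> m" for n m
    unfolding d_def using FH[of m] H_mono[OF that] bdd by (intro cINF_superset_mono) auto
  have "convergent d"
  proof (rule Bseq_monoseq_convergent)
    have "\<bar>d n\<bar> \<le> C" for n
    proof -
      have "0 \<le> d n" unfolding d_def using FH[of n] by (intro cINF_greatest) auto
      then show ?thesis using d_le[OF FH[of n]] C[of n] by simp
    qed
    then show "Bseq d" by (intro BseqI'[of _ C]) auto
    show "monoseq d" using d_mono by (auto simp: monoseq_def)
  qed
  then have d_Cauchy: "Cauchy d" by (simp add: convergent_Cauchy)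
  have "\<exists>f\<in>H n. sqnorm M f < d n + 1 / Suc n" for n
  proof -
    have "(INF f\<in>H n. sqnorm M f) < d n + 1 / Suc n"
      unfolding d_def by simp
    then show ?thesis
      using FH[of n] bdd[of n] by (subst (asm) cINF_less_iff) auto
  qed
  then obtain g where gH: "\<And>n. g n \<in> H n" and g_le: "\<And>n. sqnorm M (g n) < d n + 1 / Suc n"
    by metis
  have g_sq: "g n \<in> square_integrable M" for n using H_sq[OF gH] .
  have g_close: "sqnorm M (\<lambda>x. g n x - g m x) \<le> 2 * (d m - d n) + 4 / Suc n" if "n \<le> m" for n m
  proof -
    have "(\<lambda>x. (g n x + g m x) / 2) \<in> H n"
      using gH[of n] gH[of m] H_mono[OF that] unfolding H_def by (intro midpoint_hull.mid) auto
    then have "d n \<le> sqnorm M (\<lambda>x. (g n x + g m x) / 2)" by (rule d_le)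
    moreover have "1 / real (Suc m) \<le> 1 / real (Suc n)"
      using that by (simp add: frac_le)
    ultimately show ?thesis
      using sqnorm_midpoint[OF g_sq[of n] g_sq[of m]] g_le[of n] g_le[of m]
      by (simp del: of_nat_Suc)
  qed
  have "\<exists>\<Psi>\<in>square_integrable M. (\<lambda>n. sqnorm M (\<lambda>x. g n x - \<Psi> x)) \<longlonglongrightarrow> 0"
  proof (rule l2_complete[OF g_sq])
    fix e :: real assume e: "0 < e"
    then obtain N1 where N1: "\<And>m n. m \<ge> N1 \<Longrightarrow> n \<ge> N1 \<Longrightarrow> \<bar>d m - d n\<bar> < e / 4"
      using CauchyD[OF d_Cauchy, of "e/4"] by auto
    obtain N2 :: nat where N2: "8 / e < real N2" using reals_Archimedean2 by blast
    have le: "sqnorm M (\<lambda>x. g n x - g m x) \<le> e" if "n \<le> m" "max N1 N2 \<le> n" for n m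
    proof -
      define q where "q = 4 / real (Suc n)"
      have "8 / e < real (Suc n)" using N2 that(2) by simp
      then have q: "q \<le> e / 2" unfolding q_def using e by (simp add: field_simps)
      have "d m - d n < e / 4"
        using abs_ge_self[of "d m - d n"] N1[of m n] that by (intro order.strict_trans1[OF _ N1]) auto
      then have "2 * (d m - d n) \<le> e / 2" by simp
      from order_trans[OF g_close[OF that(1), folded q_def] add_mono[OF this q]]
      show ?thesis by (simp only: field_sum_of_halves)
    qed
    show "\<exists>N. \<forall>m\<ge>N. \<forall>n\<ge>N. sqnorm M (\<lambda>x. g m x - g n x) \<le> e"
    proof (intro exI[of _ "max N1 N2"] allI impI)
      fix m n assume "max N1 N2 \<le> m" "max N1 N2 \<le> n"
      then show "sqnorm M (\<lambda>x. g m x - g n x) \<le> e"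
        using le[of m n] le[of n m] sqnorm_diff_commute[of M "g m" "g n"] by (cases "m \<le> n") auto
    qed
  qed
  then obtain \<Psi> where \<Psi>: "\<Psi> \<in> square_integrable M" and lim: "(\<lambda>n. sqnorm M (\<lambda>x. g n x - \<Psi> x)) \<longlonglongrightarrow> 0"
    by blast
  have "l2_inner M \<Psi> h = l" if h: "h \<in> square_integrable M" and l: "(\<lambda>n. l2_inner M (F n) h) \<longlonglongrightarrow> l" for h l
  proof -
    have "(\<lambda>n. l2_inner M (g n) h) \<longlonglongrightarrow> l"
    proof (rule LIMSEQ_I)
      fix e :: real assume "0 < e"
      then obtain N where N: "\<And>n. n \<ge> N \<Longrightarrow> cmod (l2_inner M (F n) h - l) < e / 2"
        using LIMSEQ_D[OF l, of "e/2"] by auto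
      have "cmod (l2_inner M (g n) h - l) \<le> e / 2" if "n \<ge> N" for n
      proof (rule midpoint_hull_inner_near[OF _ _ h])
        show "g n \<in> midpoint_hull {F m |m. n \<le> m}" using gH[of n] by (simp add: H_def)
        show "{F m |m. n \<le> m} \<subseteq> square_integrable M" using F by auto
        fix f assume "f \<in> {F m |m. n \<le> m}"
        then obtain m where "f = F m" "n \<le> m" by auto
        then show "cmod (l2_inner M f h - l) \<le> e / 2" using less_imp_le[OF N[of m]] that by simp
      qed
      moreover have "e / 2 < e" using \<open>0 < e\<close> by simp
      ultimately show "\<exists>N. \<forall>n\<ge>N. norm (l2_inner M (g n) h - l) < e"
        by (blast intro: le_less_trans)
    qed
    then show ?thesis
      using l2_tendsto_inner[OF g_sq \<Psi> h lim] LIMSEQ_unique by blast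
  qed
  with \<Psi> show ?thesis by blast
qed

definition weakly_converges :: "'a measure \<Rightarrow> (nat \<Rightarrow> 'a \<Rightarrow> complex) \<Rightarrow> ('a \<Rightarrow> complex) \<Rightarrow> bool" where
  "weakly_converges M F \<Psi> \<longleftrightarrow> \<Psi> \<in> square_integrable M \<and>
     (\<forall>h\<in>square_integrable M. (\<lambda>n. l2_inner M (F n) h) \<longlonglongrightarrow> l2_inner M \<Psi> h)"

lemma l2_inner_bounded_convergent_subseq:
  fixes F :: "nat \<Rightarrow> 'a \<Rightarrow> complex"
  assumes F: "\<And>n. F n \<in> square_integrable M" and C: "\<And>n. sqnorm M (F n) \<le> C"
    and h: "h \<in> square_integrable M"
  shows "\<exists>r. strict_mono r \<and> convergent (\<lambda>n. l2_inner M (F (r n)) h)"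
proof -
  have "bounded (range (\<lambda>n. l2_inner M (F n) h))"
  proof (rule boundedI)
    fix z assume "z \<in> range (\<lambda>n. l2_inner M (F n) h)"
    then obtain n where "z = l2_inner M (F n) h" by auto
    moreover have "cmod (l2_inner M (F n) h) \<le> sqrt (sqnorm M (F n)) * sqrt (sqnorm M h)"
      by (intro l2_inner_le F h)
    moreover have "\<dots> \<le> sqrt C * sqrt (sqnorm M h)"
      by (intro mult_right_mono) (simp_all add: C)
    ultimately show "norm z \<le> sqrt C * sqrt (sqnorm M h)" by simp
  qed
  then obtain l r where "strict_mono r" "((\<lambda>n. l2_inner M (F n) h) \<circ> r) \<longlonglongrightarrow> l"
    using bounded_imp_convergent_subsequence by blast
  then show ?thesis by (auto simp: o_def convergent_def)
qed

text \<open>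
  Pass to a subsequence along which the pairings with every \<open>F m\<close> converge. Any two
  candidates for the weak limit of further subsequences then differ by a function
  \<open>D\<close> orthogonal to every \<open>F m\<close>. Pairing with \<open>D\<close> is
  constantly zero along the sequence, so both candidates are orthogonal to \<open>D\<close> and
  \<open>D = 0\<close>.
\<close>

theorem l2_weak_compactness:
  fixes F :: "nat \<Rightarrow> 'a \<Rightarrow> complex"
  assumes F: "\<And>n. F n \<in> square_integrable M" and C: "\<And>n. sqnorm M (F n) \<le> C"
  shows "\<exists>r \<Psi>. strict_mono (r :: nat \<Rightarrow> nat) \<and> weakly_converges M (\<lambda>n. F (r n)) \<Psi>"
proof -
  interpret subseqs "\<lambda>m s. convergent (\<lambda>n. l2_inner M (F (s n)) (F m))"
    by unfold_locales (auto simp: o_def intro!: l2_inner_bounded_convergent_subseq[OF F C F])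
  define r where "r = diagseq"
  have r: "strict_mono r" unfolding r_def by (rule subseq_diagseq)
  have conv: "convergent (\<lambda>n. l2_inner M (F (r n)) (F m))" for m
  proof -
    have "convergent (\<lambda>n. l2_inner M (F ((diagseq \<circ> (+) (Suc m)) n)) (F m))"
      by (rule diagseq_holds) (auto simp: o_def intro: convergent_subseq_convergent[unfolded o_def])
    then have "convergent (\<lambda>n. l2_inner M (F (r (n + Suc m))) (F m))"
      by (simp add: r_def o_def add.commute)
    then show ?thesis by (rule convergent_ignore_initial_segment[THEN iffD1])
  qed
  obtain \<Psi> where \<Psi>: "\<Psi> \<in> square_integrable M"
    and P: "\<And>h l. h \<in> square_integrable M \<Longrightarrow> (\<lambda>n. l2_inner M (F (r n)) h) \<longlonglongrightarrow> l \<Longrightarrow> l2_inner M \<Psi> h = l"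
    using weak_limit_candidate[of "\<lambda>n. F (r n)" M C] F C by blast
  have "(\<lambda>n. l2_inner M (F (r n)) h) \<longlonglongrightarrow> l2_inner M \<Psi> h" if h: "h \<in> square_integrable M" for h
  proof (rule ccontr)
    assume "\<not> ?thesis"
    then obtain e where e: "0 < e" and inf: "\<exists>\<^sub>F n in sequentially. e \<le> dist (l2_inner M (F (r n)) h) (l2_inner M \<Psi> h)"
      unfolding tendsto_iff not_all frequently_def by (auto simp: not_le)
    obtain s :: "nat \<Rightarrow> nat" where s: "strict_mono s"
      and far: "\<And>n. e \<le> dist (l2_inner M (F (r (s n))) h) (l2_inner M \<Psi> h)"
      using inf infinite_enumerate[of "{n. e \<le> dist (l2_inner M (F (r n)) h) (l2_inner M \<Psi> h)}"]
      unfolding frequently_cofinite[symmetric] cofinite_eq_sequentially by auto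
    obtain q where q: "strict_mono q" "convergent (\<lambda>n. l2_inner M (F (r (s (q n)))) h)"
      using l2_inner_bounded_convergent_subseq[of "\<lambda>n. F (r (s n))" M C h] F C h by blast
    then obtain l where l: "(\<lambda>n. l2_inner M (F (r (s (q n)))) h) \<longlonglongrightarrow> l"
      by (auto simp: convergent_def)
    obtain \<Psi>' where \<Psi>': "\<Psi>' \<in> square_integrable M"
      and P': "\<And>h l. h \<in> square_integrable M \<Longrightarrow> (\<lambda>n. l2_inner M (F (r (s (q n)))) h) \<longlonglongrightarrow> l \<Longrightarrow> l2_inner M \<Psi>' h = l"
      using weak_limit_candidate[of "\<lambda>n. F (r (s (q n)))" M C] F C by blast
    define D where "D x = \<Psi> x - \<Psi>' x" for x
    have D: "D \<in> square_integrable M"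
      unfolding D_def using \<Psi> \<Psi>' by (rule square_integrable_diff)
    have "l2_inner M (F m) D = 0" for m
    proof -
      obtain c where c: "(\<lambda>n. l2_inner M (F (r n)) (F m)) \<longlonglongrightarrow> c"
        using conv by (auto simp: convergent_def)
      then have "(\<lambda>n. l2_inner M (F (r (s (q n)))) (F m)) \<longlonglongrightarrow> c"
        using LIMSEQ_subseq_LIMSEQ[OF c strict_mono_o[OF s q(1)]] by (simp add: o_def)
      then have "l2_inner M \<Psi> (F m) = l2_inner M \<Psi>' (F m)"
        using P[OF F c] P'[OF F] by simp
      then have "l2_inner M D (F m) = 0"
        unfolding D_def using l2_inner_diff_left[OF \<Psi> \<Psi>' F] by simp
      then show ?thesis using l2_inner_commute[of M "F m" D] by simp
    qed
    then have "l2_inner M \<Psi> D = 0" "l2_inner M \<Psi>' D = 0"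
      using P[OF D, of 0] P'[OF D, of 0] by simp_all
    then have "l2_inner M D D = 0"
      using l2_inner_diff_left[OF \<Psi> \<Psi>' D] unfolding D_def by simp
    then have "sqnorm M D = 0" by (simp add: l2_inner_self)
    then have "cmod (l2_inner M D h) \<le> 0"
      using l2_inner_le[OF D h] by simp
    then have "l2_inner M \<Psi> h = l2_inner M \<Psi>' h"
      unfolding D_def using l2_inner_diff_left[OF \<Psi> \<Psi>' h] by simp
    then have "l = l2_inner M \<Psi> h" using P'[OF h l] by simp
    then have "(\<lambda>n. dist (l2_inner M (F (r (s (q n)))) h) (l2_inner M \<Psi> h)) \<longlonglongrightarrow> 0"
      using tendsto_dist[OF l tendsto_const[of l]] by simp
    then have "e \<le> 0"
      by (rule LIMSEQ_le_const) (use far in auto)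
    then show False using e by simp
  qed
  with r \<Psi> show ?thesis unfolding weakly_converges_def by blast
qed

lemma weakly_converges_sqnorm_le:
  assumes F: "\<And>n. F n \<in> square_integrable M" and C: "\<And>n. sqnorm M (F n) \<le> C"
    and w: "weakly_converges M F \<Psi>"
  shows "sqnorm M \<Psi> \<le> C"
proof -
  have \<Psi>: "\<Psi> \<in> square_integrable M" using w by (simp add: weakly_converges_def)
  have C0: "0 \<le> C" using order_trans[OF sqnorm_nonneg C[of 0]] .
  have "(\<lambda>n. cmod (l2_inner M (F n) \<Psi>)) \<longlonglongrightarrow> cmod (l2_inner M \<Psi> \<Psi>)"
    using w \<Psi> by (intro tendsto_norm) (auto simp: weakly_converges_def)
  moreover have "cmod (l2_inner M (F n) \<Psi>) \<le> sqrt C * sqrt (sqnorm M \<Psi>)" for n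
    using l2_inner_le[OF F[of n] \<Psi>] C[of n] by (meson mult_right_mono order_trans real_sqrt_ge_zero real_sqrt_le_mono sqnorm_nonneg)
  ultimately have "cmod (l2_inner M \<Psi> \<Psi>) \<le> sqrt C * sqrt (sqnorm M \<Psi>)"
    by (intro LIMSEQ_le_const2) auto
  then have "sqrt (sqnorm M \<Psi>) * sqrt (sqnorm M \<Psi>) \<le> sqrt C * sqrt (sqnorm M \<Psi>)"
    by (simp add: l2_inner_self)
  then show ?thesis
    using C0 sqnorm_nonneg[of M \<Psi>] mult_right_le_imp_le[of "sqrt (sqnorm M \<Psi>)" "sqrt (sqnorm M \<Psi>)" "sqrt C"]
    by (cases "sqnorm M \<Psi> = 0") (simp_all only: real_sqrt_le_iff real_sqrt_gt_0_iff less_le, simp_all)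
qed

lemma weakly_converges_subseq:
  "weakly_converges M F \<Psi> \<Longrightarrow> strict_mono r \<Longrightarrow> weakly_converges M (\<lambda>n. F (r n)) \<Psi>"
  unfolding weakly_converges_def using LIMSEQ_subseq_LIMSEQ[of _ _ r] by (fastforce simp: o_def)

lemma weakly_converges_unique:
  assumes "weakly_converges M F \<Psi>" "weakly_converges M F \<Phi>"
  shows "AE x in M. \<Psi> x = \<Phi> x"
proof -
  have sq: "\<Psi> \<in> square_integrable M" "\<Phi> \<in> square_integrable M"
    using assms by (auto simp: weakly_converges_def)
  let ?D = "\<lambda>x. \<Psi> x - \<Phi> x"
  have D: "?D \<in> square_integrable M" using sq by (rule square_integrable_diff)
  then have "l2_inner M \<Psi> ?D = l2_inner M \<Phi> ?D"
    using assms LIMSEQ_unique unfolding weakly_converges_def by blast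
  then have "l2_inner M ?D ?D = 0" using l2_inner_diff_left[OF sq D] by simp
  then have "sqnorm M ?D = 0" by (simp add: l2_inner_self)
  then show ?thesis using sqnorm_zero_iff[OF D] by simp
qed

lemma weakly_converges_diff:
  assumes "weakly_converges M F \<Psi>" "weakly_converges M G \<Phi>"
    and F: "\<And>n. F n \<in> square_integrable M" and G: "\<And>n. G n \<in> square_integrable M"
  shows "weakly_converges M (\<lambda>n x. F n x - G n x) (\<lambda>x. \<Psi> x - \<Phi> x)"
  using assms by (auto simp: weakly_converges_def l2_inner_diff_left square_integrable_diff intro!: tendsto_diff)

text \<open>
  The multipliers are moved to the test function, where bounded pointwise convergence becomes
  convergence in norm.
\<close>

lemma weakly_converges_mult_tendsto:
  assumes w: "weakly_converges M F \<Psi>"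
    and F: "\<And>n. F n \<in> square_integrable M" and C: "\<And>n. sqnorm M (F n) \<le> C"
    and [measurable]: "\<And>n. a n \<in> borel_measurable M" "b \<in> borel_measurable M"
    and lim: "\<And>x. x \<in> space M \<Longrightarrow> (\<lambda>n. a n x) \<longlonglongrightarrow> b x"
    and le: "\<And>n x. x \<in> space M \<Longrightarrow> cmod (a n x) \<le> 1"
  shows "weakly_converges M (\<lambda>n x. a n x * F n x) (\<lambda>x. b x * \<Psi> x)"
  unfolding weakly_converges_def
proof (intro conjI ballI)
  have \<Psi>: "\<Psi> \<in> square_integrable M" using w by (simp add: weakly_converges_def)
  have b_le: "cmod (b x) \<le> 1" if "x \<in> space M" for x
    using le[OF that] by (intro LIMSEQ_le_const2[OF tendsto_norm[OF lim[OF that]]]) auto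
  show "(\<lambda>x. b x * \<Psi> x) \<in> square_integrable M"
    by (rule square_integrable_mult_bounded[OF _ \<Psi> b_le]) auto
  fix h assume h: "h \<in> square_integrable M"
  have hm[measurable]: "h \<in> borel_measurable M" using h by auto
  have ah: "(\<lambda>x. cnj (a n x) * h x) \<in> square_integrable M" for n
    by (rule square_integrable_mult_bounded[OF _ h, where c=1]) (auto simp: le)
  have bh: "(\<lambda>x. cnj (b x) * h x) \<in> square_integrable M"
    by (rule square_integrable_mult_bounded[OF _ h, where c=1]) (auto simp: b_le)
  have move: "l2_inner M (\<lambda>x. c x * f x) h = l2_inner M f (\<lambda>x. cnj (c x) * h x)" for c f
    unfolding l2_inner_def by (simp add: mult_ac)
  have "(\<lambda>n. sqnorm M (\<lambda>x. cnj (a n x) * h x - cnj (b x) * h x)) \<longlonglongrightarrow> (LINT x|M. 0)"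
    unfolding sqnorm_def
  proof (rule integral_dominated_convergence[where w="\<lambda>x. 4 * (cmod (h x))\<^sup>2"])
    show "integrable M (\<lambda>x. 4 * (cmod (h x))\<^sup>2)" using square_integrable_integrable[OF h] by simp
    show "AE x in M. (\<lambda>n. (cmod (cnj (a n x) * h x - cnj (b x) * h x))\<^sup>2) \<longlonglongrightarrow> 0"
    proof (rule AE_I2)
      fix x assume "x \<in> space M"
      then have "(\<lambda>n. (cmod (cnj (a n x) * h x - cnj (b x) * h x))\<^sup>2) \<longlonglongrightarrow> (cmod (cnj (b x) * h x - cnj (b x) * h x))\<^sup>2"
        by (intro tendsto_intros lim)
      then show "(\<lambda>n. (cmod (cnj (a n x) * h x - cnj (b x) * h x))\<^sup>2) \<longlonglongrightarrow> 0" by simp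
    qed
    fix n show "AE x in M. norm ((cmod (cnj (a n x) * h x - cnj (b x) * h x))\<^sup>2) \<le> 4 * (cmod (h x))\<^sup>2"
    proof (rule AE_I2)
      fix x assume x: "x \<in> space M"
      have "cmod (cnj (a n x) - cnj (b x)) \<le> 2"
        using norm_triangle_ineq4[of "cnj (a n x)" "cnj (b x)"] le[OF x, of n] b_le[OF x] by simp
      then have "(cmod (cnj (a n x) - cnj (b x)))\<^sup>2 * (cmod (h x))\<^sup>2 \<le> 2\<^sup>2 * (cmod (h x))\<^sup>2"
        by (intro mult_right_mono power_mono) auto
      then show "norm ((cmod (cnj (a n x) * h x - cnj (b x) * h x))\<^sup>2) \<le> 4 * (cmod (h x))\<^sup>2"
        by (simp add: left_diff_distrib[symmetric] norm_mult power_mult_distrib)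
    qed
  qed measurable
  then have to0: "(\<lambda>n. sqnorm M (\<lambda>x. cnj (a n x) * h x - cnj (b x) * h x)) \<longlonglongrightarrow> 0" by simp
  have "(\<lambda>n. l2_inner M (F n) (\<lambda>x. cnj (a n x) * h x) - l2_inner M (F n) (\<lambda>x. cnj (b x) * h x)) \<longlonglongrightarrow> 0"
  proof (rule Lim_null_comparison)
    show "\<forall>\<^sub>F n in sequentially. norm (l2_inner M (F n) (\<lambda>x. cnj (a n x) * h x) - l2_inner M (F n) (\<lambda>x. cnj (b x) * h x))
       \<le> sqrt C * sqrt (sqnorm M (\<lambda>x. cnj (a n x) * h x - cnj (b x) * h x))"
    proof (intro always_eventually allI)
      fix n
      have "norm (l2_inner M (F n) (\<lambda>x. cnj (a n x) * h x) - l2_inner M (F n) (\<lambda>x. cnj (b x) * h x))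
         = cmod (l2_inner M (F n) (\<lambda>x. cnj (a n x) * h x - cnj (b x) * h x))"
        using l2_inner_diff_right[OF ah bh F] by simp
      also have "\<dots> \<le> sqrt (sqnorm M (F n)) * sqrt (sqnorm M (\<lambda>x. cnj (a n x) * h x - cnj (b x) * h x))"
        by (intro l2_inner_le F square_integrable_diff ah bh)
      also have "\<dots> \<le> sqrt C * sqrt (sqnorm M (\<lambda>x. cnj (a n x) * h x - cnj (b x) * h x))"
        by (intro mult_right_mono) (simp_all add: C)
      finally show "norm (l2_inner M (F n) (\<lambda>x. cnj (a n x) * h x) - l2_inner M (F n) (\<lambda>x. cnj (b x) * h x))
       \<le> sqrt C * sqrt (sqnorm M (\<lambda>x. cnj (a n x) * h x - cnj (b x) * h x))" .
    qed
    show "(\<lambda>n. sqrt C * sqrt (sqnorm M (\<lambda>x. cnj (a n x) * h x - cnj (b x) * h x))) \<longlonglongrightarrow> 0"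
      using tendsto_mult_right_zero[OF tendsto_real_sqrt[OF to0, unfolded real_sqrt_zero], of "sqrt C"] .
  qed
  moreover have "(\<lambda>n. l2_inner M (F n) (\<lambda>x. cnj (b x) * h x)) \<longlonglongrightarrow> l2_inner M \<Psi> (\<lambda>x. cnj (b x) * h x)"
    using w bh by (simp add: weakly_converges_def)
  ultimately have "(\<lambda>n. l2_inner M (F n) (\<lambda>x. cnj (a n x) * h x)) \<longlonglongrightarrow> l2_inner M \<Psi> (\<lambda>x. cnj (b x) * h x)"
    using tendsto_add by fastforce
  then show "(\<lambda>n. l2_inner M (\<lambda>x. a n x * F n x) h) \<longlonglongrightarrow> l2_inner M (\<lambda>x. b x * \<Psi> x) h"
    by (simp add: move)
qed

text \<open>
  The error is twice the real part of the pairing of \<open>F n - \<Psi>\<close> with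
  \<open>\<omega> \<Psi>\<close>.
\<close>

lemma weakly_converges_Pythagoras:
  assumes w: "weakly_converges M F \<Psi>" and F: "\<And>n. F n \<in> square_integrable M"
    and [measurable]: "\<omega> \<in> borel_measurable M" and le: "\<And>x. x \<in> space M \<Longrightarrow> \<bar>\<omega> x\<bar> \<le> (1::real)"
  shows "(\<lambda>n. (LINT x|M. \<omega> x * (cmod (F n x))\<^sup>2)
     - ((LINT x|M. \<omega> x * (cmod (\<Psi> x))\<^sup>2) + (LINT x|M. \<omega> x * (cmod (F n x - \<Psi> x))\<^sup>2))) \<longlonglongrightarrow> 0"
proof -
  have \<Psi>: "\<Psi> \<in> square_integrable M" using w by (simp add: weakly_converges_def)
  have w\<Psi>: "(\<lambda>x. complex_of_real (\<omega> x) * \<Psi> x) \<in> square_integrable M"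
    by (rule square_integrable_mult_bounded[OF _ \<Psi>, where c=1]) (auto simp: le)
  have int: "integrable M (\<lambda>x. \<omega> x * (cmod (f x))\<^sup>2)" if f: "f \<in> square_integrable M" for f
    using f le by (intro Bochner_Integration.integrable_bound[OF square_integrable_integrable[OF f]])
      (auto simp: abs_mult intro!: AE_I2 mult_left_le_one_le)
  have "(LINT x|M. \<omega> x * (cmod (F n x))\<^sup>2)
     - ((LINT x|M. \<omega> x * (cmod (\<Psi> x))\<^sup>2) + (LINT x|M. \<omega> x * (cmod (F n x - \<Psi> x))\<^sup>2))
     = 2 * Re (l2_inner M (F n) (\<lambda>x. complex_of_real (\<omega> x) * \<Psi> x) - l2_inner M \<Psi> (\<lambda>x. complex_of_real (\<omega> x) * \<Psi> x))" for n
  proof -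
    have D: "(\<lambda>x. F n x - \<Psi> x) \<in> square_integrable M" using F \<Psi> by (intro square_integrable_diff)
    have "l2_inner M (F n) (\<lambda>x. complex_of_real (\<omega> x) * \<Psi> x) - l2_inner M \<Psi> (\<lambda>x. complex_of_real (\<omega> x) * \<Psi> x)
      = l2_inner M (\<lambda>x. F n x - \<Psi> x) (\<lambda>x. complex_of_real (\<omega> x) * \<Psi> x)"
      using l2_inner_diff_left[OF F \<Psi> w\<Psi>] by simp
    also have "2 * Re \<dots> = (LINT x|M. 2 * Re ((F n x - \<Psi> x) * cnj (complex_of_real (\<omega> x) * \<Psi> x)))"
      unfolding l2_inner_def integral_mult_right_zero using integrable_l2_inner[OF D w\<Psi>]
      by (simp only: integral_Re)
    also have "\<dots> = (LINT x|M. \<omega> x * (cmod (F n x))\<^sup>2 - (\<omega> x * (cmod (\<Psi> x))\<^sup>2 + \<omega> x * (cmod (F n x - \<Psi> x))\<^sup>2))"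
      by (intro Bochner_Integration.integral_cong refl, unfold cmod_power2) (simp add: power2_eq_square algebra_simps)
    also have "\<dots> = (LINT x|M. \<omega> x * (cmod (F n x))\<^sup>2)
     - ((LINT x|M. \<omega> x * (cmod (\<Psi> x))\<^sup>2) + (LINT x|M. \<omega> x * (cmod (F n x - \<Psi> x))\<^sup>2))"
      using int[OF F[of n]] int[OF \<Psi>] int[OF D] by simp
    finally show ?thesis by simp
  qed
  moreover have "(\<lambda>n. 2 * Re (l2_inner M (F n) (\<lambda>x. complex_of_real (\<omega> x) * \<Psi> x) - l2_inner M \<Psi> (\<lambda>x. complex_of_real (\<omega> x) * \<Psi> x)))
     \<longlonglongrightarrow> 2 * Re (l2_inner M \<Psi> (\<lambda>x. complex_of_real (\<omega> x) * \<Psi> x) - l2_inner M \<Psi> (\<lambda>x. complex_of_real (\<omega> x) * \<Psi> x))"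
    using w w\<Psi> by (intro tendsto_intros) (auto simp: weakly_converges_def)
  ultimately show ?thesis by simp
qed

section \<open>Gaussians and oscillatory integrals\<close>

lemma borel_measurable_cis [measurable]:
  "f \<in> borel_measurable M \<Longrightarrow> (\<lambda>x. cis (f x)) \<in> borel_measurable M"
  unfolding cis_conv_exp by measurable

definition gauss_weight :: "real \<Rightarrow> 'v::euclidean_space \<Rightarrow> real" where
  "gauss_weight s x = exp (- (s * norm x)\<^sup>2 / 2)"

text \<open>
  The Fourier transform of \<open>gauss_weight s\<close>, a Gaussian of width \<open>s\<close>
  and of mass \<open>(2 \<pi>)\<^sup>d\<close> for every \<open>s\<close>.
\<close>

definition heat :: "real \<Rightarrow> 'v::euclidean_space \<Rightarrow> real" where
  "heat s z = (sqrt (2 * pi) / s) ^ DIM('v) * exp (- (norm z / s)\<^sup>2 / 2)"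

lemma gauss_weight_measurable [measurable]: "gauss_weight s \<in> borel_measurable borel"
  unfolding gauss_weight_def[abs_def] by measurable

lemma heat_measurable [measurable]: "heat s \<in> borel_measurable borel"
  unfolding heat_def[abs_def] by measurable

lemma heat_nonneg: "0 < s \<Longrightarrow> 0 \<le> heat s z"
  by (simp add: heat_def)

lemma heat_abs_le: "0 < s \<Longrightarrow> \<bar>heat s (z :: 'v::euclidean_space)\<bar> \<le> (sqrt (2 * pi) / s) ^ DIM('v)"
  by (simp add: heat_def abs_mult mult_left_le)

lemma gauss_weight_pos: "0 < gauss_weight s x" and gauss_weight_le_1: "gauss_weight s x \<le> 1"
  by (simp_all add: gauss_weight_def)

lemma gauss_fourier_real:
  fixes s \<xi> :: real
  assumes s: "0 < s"
  shows "integrable lborel (\<lambda>x. cis (x * \<xi>) * complex_of_real (exp (- (s * x)\<^sup>2 / 2)))"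
    and "(LINT x|lborel. cis (x * \<xi>) * complex_of_real (exp (- (s * x)\<^sup>2 / 2)))
       = complex_of_real (sqrt (2 * pi) / s * exp (- (\<xi> / s)\<^sup>2 / 2))"
proof -
  define g where "g x = cis (x * (\<xi> / s)) * complex_of_real (exp (- x\<^sup>2 / 2))" for x :: real
  have int_std: "integrable lborel std_normal_density"
    using integrable_std_normal_moment[of 0] by simp
  have g_eq: "g x = complex_of_real (sqrt (2 * pi)) * (std_normal_density x *\<^sub>R iexp (\<xi> / s * x))" for x
    by (simp add: g_def std_normal_density_def cis_conv_exp scaleR_conv_of_real mult_ac)
  have "char std_normal_distribution (\<xi> / s) = (LINT x|lborel. std_normal_density x *\<^sub>R iexp (\<xi> / s * x))"
    unfolding char_def by (subst integral_density) auto
  then have std: "(LINT x|lborel. std_normal_density x *\<^sub>R iexp (\<xi> / s * x)) = complex_of_real (exp (- (\<xi> / s)\<^sup>2 / 2))"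
    by (simp only: char_std_normal_distribution)
  have val: "(LINT x|lborel. g x) = complex_of_real (sqrt (2 * pi) * exp (- (\<xi> / s)\<^sup>2 / 2))"
    unfolding g_eq integral_mult_right_zero std by simp
  have int: "integrable lborel g"
    unfolding g_eq[abs_def]
    by (intro integrable_mult_right integrable_scaleR_left Bochner_Integration.integrable_bound[OF int_std])
       (auto simp: norm_mult)
  have fs: "g (0 + s * x) = cis (x * \<xi>) * complex_of_real (exp (- (s * x)\<^sup>2 / 2))" for x
    using s by (simp add: g_def)
  show "integrable lborel (\<lambda>x. cis (x * \<xi>) * complex_of_real (exp (- (s * x)\<^sup>2 / 2)))"
    using lborel_integrable_real_affine[OF int, of s 0] s unfolding fs by simp
  have "(LINT x|lborel. g x) = s *\<^sub>R (LINT x|lborel. g (0 + s * x))"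
    using lborel_integral_real_affine[of s g 0] s by simp
  then have "complex_of_real s * (LINT x|lborel. cis (x * \<xi>) * complex_of_real (exp (- (s * x)\<^sup>2 / 2)))
       = complex_of_real (sqrt (2 * pi) * exp (- (\<xi> / s)\<^sup>2 / 2))"
    unfolding fs val by (simp add: scaleR_conv_of_real)
  then show "(LINT x|lborel. cis (x * \<xi>) * complex_of_real (exp (- (s * x)\<^sup>2 / 2)))
       = complex_of_real (sqrt (2 * pi) / s * exp (- (\<xi> / s)\<^sup>2 / 2))"
    using s by (simp add: field_simps)
qed

lemma lborel_integral_prod_Basis:
  fixes f :: "'v::euclidean_space \<Rightarrow> real \<Rightarrow> complex"
  assumes f: "\<And>b. b \<in> Basis \<Longrightarrow> integrable lborel (f b)"
  shows "integrable lborel (\<lambda>x::'v. \<Prod>b\<in>Basis. f b (x \<bullet> b))"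
    and "(LINT x|lborel. (\<Prod>b\<in>Basis. f b ((x::'v) \<bullet> b))) = (\<Prod>b\<in>Basis. LINT x|lborel. f b x)"
proof -
  interpret product_sigma_finite "\<lambda>_::'v. lborel :: real measure" ..
  have fm[measurable]: "b \<in> Basis \<Longrightarrow> f b \<in> borel_measurable borel" for b
    using borel_measurable_integrable[OF f] by simp
  have m: "(\<lambda>x::'v. \<Prod>b\<in>Basis. f b (x \<bullet> b)) \<in> borel_measurable borel"
    by measurable
  have p: "(\<lambda>f. \<Sum>b\<in>Basis. f b *\<^sub>R b) \<in> Pi\<^sub>M Basis (\<lambda>_. lborel) \<rightarrow>\<^sub>M (borel :: 'v measure)"
    by measurable
  have eq: "(\<Prod>b\<in>Basis. f b ((\<Sum>c\<in>Basis. x c *\<^sub>R c) \<bullet> b)) = (\<Prod>b\<in>Basis. f b (x b))" for x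
    by (intro prod.cong refl) (simp add: inner_sum_left_Basis)
  show "integrable lborel (\<lambda>x::'v. \<Prod>b\<in>Basis. f b (x \<bullet> b))"
    using product_integrable_prod[of Basis f, OF finite_Basis f]
    by (subst lborel_eq, subst integrable_distr_eq[OF p m]) (simp add: eq)
  show "(LINT x|lborel. (\<Prod>b\<in>Basis. f b ((x::'v) \<bullet> b))) = (\<Prod>b\<in>Basis. LINT x|lborel. f b x)"
    using product_integral_prod[of Basis f, OF finite_Basis f]
    by (subst lborel_eq, subst integral_distr[OF p m]) (simp add: eq)
qed

lemma cis_sum: "finite I \<Longrightarrow> cis (\<Sum>i\<in>I. f i) = (\<Prod>i\<in>I. cis (f i))"
  by (induction I rule: finite_induct) (auto simp: cis_mult[symmetric])

lemma norm_sq_eq_sum_Basis: "(norm (x::'v::euclidean_space))\<^sup>2 = (\<Sum>b\<in>Basis. (x \<bullet> b)\<^sup>2)"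
  unfolding power2_norm_eq_inner by (subst euclidean_inner) (simp add: power2_eq_square)

text \<open>
  Both factors of the integrand are products over the coordinates.
\<close>

lemma gauss_fourier:
  fixes \<xi> :: "'v::euclidean_space"
  assumes s: "0 < s"
  shows integrable_cis_gauss: "integrable lborel (\<lambda>x. cis (x \<bullet> \<xi>) * complex_of_real (gauss_weight s x))"
    and integral_cis_gauss: "(LINT x|lborel. cis (x \<bullet> \<xi>) * complex_of_real (gauss_weight s x)) = complex_of_real (heat s \<xi>)"
proof -
  have eq: "cis (x \<bullet> \<xi>) * complex_of_real (gauss_weight s x)
    = (\<Prod>b\<in>Basis. cis ((x \<bullet> b) * (\<xi> \<bullet> b)) * complex_of_real (exp (- (s * (x \<bullet> b))\<^sup>2 / 2)))" for x :: 'v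
  proof -
    have "- (s * norm x)\<^sup>2 / 2 = (\<Sum>b\<in>Basis. - (s * (x \<bullet> b))\<^sup>2 / 2)"
      by (simp add: power_mult_distrib norm_sq_eq_sum_Basis sum_distrib_left sum_negf sum_divide_distrib[symmetric])
    then show ?thesis
      by (simp add: gauss_weight_def euclidean_inner[of x \<xi>] cis_sum exp_sum prod.distrib)
  qed
  show "integrable lborel (\<lambda>x. cis (x \<bullet> \<xi>) * complex_of_real (gauss_weight s x))"
    unfolding eq by (intro lborel_integral_prod_Basis(1) gauss_fourier_real s)
  have "(LINT x|lborel. cis (x \<bullet> \<xi>) * complex_of_real (gauss_weight s x))
     = (\<Prod>b\<in>Basis. complex_of_real (sqrt (2 * pi) / s * exp (- ((\<xi> \<bullet> b) / s)\<^sup>2 / 2)))"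
    unfolding eq
    by (subst lborel_integral_prod_Basis(2)[OF gauss_fourier_real(1)[OF s]])
       (intro prod.cong refl gauss_fourier_real(2)[OF s])
  also have "\<dots> = complex_of_real (\<Prod>b\<in>Basis. sqrt (2 * pi) / s * exp (- ((\<xi> \<bullet> b) / s)\<^sup>2 / 2))"
    by simp
  also have "(\<Prod>b\<in>Basis. sqrt (2 * pi) / s * exp (- ((\<xi> \<bullet> b) / s)\<^sup>2 / 2)) = heat s \<xi>"
  proof -
    have "- (norm \<xi> / s)\<^sup>2 / 2 = (\<Sum>b\<in>Basis. - ((\<xi> \<bullet> b) / s)\<^sup>2 / 2)"
      by (simp add: power_divide norm_sq_eq_sum_Basis sum_negf sum_divide_distrib[symmetric])
    then show ?thesis
      by (simp only: heat_def prod.distrib prod_constant exp_sum[OF finite_Basis])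
  qed
  finally show "(LINT x|lborel. cis (x \<bullet> \<xi>) * complex_of_real (gauss_weight s x)) = complex_of_real (heat s \<xi>)" .
qed

lemma integrable_gauss_weight: "0 < s \<Longrightarrow> integrable lborel (gauss_weight s :: 'v::euclidean_space \<Rightarrow> real)"
  using integrable_cis_gauss[of s "0::'v"] by (simp add: complex_of_real_integrable_eq)

lemma integral_gauss_weight: "0 < s \<Longrightarrow> (LINT x|lborel. gauss_weight s (x::'v::euclidean_space)) = (sqrt (2 * pi) / s) ^ DIM('v)"
  using integral_cis_gauss[of s "0::'v"]
  by (simp add: heat_def flip: of_real_divide of_real_power)

lemma heat_eq_gauss_weight: "0 < s \<Longrightarrow> heat s (z::'v::euclidean_space) = (sqrt (2 * pi) / s) ^ DIM('v) * gauss_weight (1 / s) z"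
  by (simp add: heat_def gauss_weight_def)

lemma nn_integral_heat:
  assumes s: "0 < s"
  shows "(\<integral>\<^sup>+ z. ennreal (heat s (z::'v::euclidean_space)) \<partial>lborel) = ennreal ((2 * pi) ^ DIM('v))"
proof -
  have int: "integrable lborel (heat s :: 'v \<Rightarrow> real)"
    unfolding heat_eq_gauss_weight[OF s, abs_def]
    by (intro integrable_mult_right integrable_gauss_weight) (use s in simp)
  have "sqrt (2 * pi) / s * (sqrt (2 * pi) / (1 / s)) = 2 * pi" "0 < 1 / s"
    using s by simp_all
  then have "(LINT z|lborel. heat s (z::'v)) = (2 * pi) ^ DIM('v)"
    unfolding heat_eq_gauss_weight[OF s] integral_mult_right_zero
    by (simp only: integral_gauss_weight power_mult_distrib[symmetric])
  then show ?thesis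
    using nn_integral_eq_integral[OF int AE_I2[OF heat_nonneg[OF s]]] by simp
qed

lemma nn_integral_lborel_affine:
  fixes f :: "'v::euclidean_space \<Rightarrow> ennreal"
  assumes [measurable]: "f \<in> borel_measurable borel" and c: "c \<noteq> 0"
  shows "(\<integral>\<^sup>+ x. f x \<partial>lborel) = ennreal (\<bar>c\<bar> ^ DIM('v)) * (\<integral>\<^sup>+ x. f (t + c *\<^sub>R x) \<partial>lborel)"
  by (subst lborel_affine[OF c, of t]) (simp add: nn_integral_density nn_integral_distr nn_integral_cmult)

lemma nn_integral_lborel_reflect:
  fixes f :: "'v::euclidean_space \<Rightarrow> ennreal"
  assumes "f \<in> borel_measurable borel"
  shows "(\<integral>\<^sup>+ x. f (t - x) \<partial>lborel) = (\<integral>\<^sup>+ x. f x \<partial>lborel)"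
  using nn_integral_lborel_affine[OF assms, of "-1" t] by simp

lemma nn_integral_lborel_translate:
  fixes f :: "'v::euclidean_space \<Rightarrow> ennreal"
  assumes "f \<in> borel_measurable borel"
  shows "(\<integral>\<^sup>+ x. f (t + x) \<partial>lborel) = (\<integral>\<^sup>+ x. f x \<partial>lborel)"
  using nn_integral_lborel_affine[OF assms, of "1" t] by simp

lemma integrable_pair_mult:
  fixes f :: "'a \<Rightarrow> complex" and g :: "'b \<Rightarrow> complex"
  assumes "sigma_finite_measure M1" "sigma_finite_measure M2"
    and f: "integrable M1 f" and g: "integrable M2 g"
  shows "integrable (M1 \<Otimes>\<^sub>M M2) (\<lambda>p. f (fst p) * g (snd p))"
proof -
  interpret M1: sigma_finite_measure M1 by fact
  interpret M2: sigma_finite_measure M2 by fact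
  interpret pair_sigma_finite M1 M2 ..
  have [measurable]: "f \<in> borel_measurable M1" "g \<in> borel_measurable M2" using f g by auto
  show ?thesis
  proof (rule Fubini_integrable)
    show "(\<lambda>p. f (fst p) * g (snd p)) \<in> borel_measurable (M1 \<Otimes>\<^sub>M M2)" by measurable
    show "integrable M1 (\<lambda>x. LINT y|M2. norm (f (fst (x, y)) * g (snd (x, y))))"
      using f by (simp add: norm_mult)
    show "AE x in M1. integrable M2 (\<lambda>y. f (fst (x, y)) * g (snd (x, y)))"
      using g by simp
  qed
qed

lemma mult_le_weighted_squares:
  fixes a b c d :: real
  assumes "0 < c" "0 < d"
  shows "a * b \<le> (c * a\<^sup>2 / d + d * b\<^sup>2 / c) / 2"
proof -
  have "0 \<le> (c * a - d * b)\<^sup>2" by simp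
  then have "2 * (a * b) * (c * d) \<le> (c * a)\<^sup>2 + (d * b)\<^sup>2"
    by (simp add: power2_diff algebra_simps)
  then have "a * b * 2 \<le> ((c * a)\<^sup>2 + (d * b)\<^sup>2) / (c * d)"
    using assms by (simp add: pos_le_divide_eq algebra_simps)
  also have "\<dots> = c * a\<^sup>2 / d + d * b\<^sup>2 / c"
    using assms by (simp add: field_simps power2_eq_square)
  finally show ?thesis by simp
qed

lemma cis_mult_cnj_cis: "(cis a * z) * cnj (cis b * w) = cis (a - b) * (z * cnj w)"
  using cis_mult[of a "- b"] by (simp add: cis_cnj mult_ac)

text \<open>
  Multiply the square of the oscillatory integral by a Gaussian in \<open>t\<close>. Integrating
  in \<open>t\<close> first gives a double integral of \<open>f(y)\<close> and
  \<open>f(y')\<close> against the kernel \<open>heat s (\<Phi> y - \<Phi> y')\<close>, which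
  Schur's test with the weight \<open>w\<close> bounds uniformly in \<open>s\<close>. The
  Gaussian is then removed by letting \<open>s\<close> tend to zero. The phase
  \<open>\<Phi>\<close> enters only through the hypothesis on the kernel, so both the Plancherel
  inequality and the time decay of waves are instances.
\<close>

theorem oscillatory_integral_l2_bound:
  fixes \<Phi> :: "'a \<Rightarrow> 'v::euclidean_space" and f :: "'a \<Rightarrow> complex" and w :: "'a \<Rightarrow> real"
  assumes sf: "sigma_finite_measure M" and f: "integrable M f"
    and [measurable]: "\<Phi> \<in> borel_measurable M" "w \<in> borel_measurable M"
    and w: "\<And>y. 0 < w y"
    and K: "\<And>s y. 0 < s \<Longrightarrow> y \<in> space M \<Longrightarrow> (\<integral>\<^sup>+ y'. ennreal (heat s (\<Phi> y - \<Phi> y') / w y') \<partial>M) \<le> K"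
  shows "(\<integral>\<^sup>+ t. ennreal ((cmod (LINT y|M. cis (t \<bullet> \<Phi> y) * f y))\<^sup>2) \<partial>lborel)
       \<le> K * (\<integral>\<^sup>+ y. ennreal (w y * (cmod (f y))\<^sup>2) \<partial>M)"
proof -
  interpret M: sigma_finite_measure M by fact
  interpret MM: pair_sigma_finite M M ..
  interpret LM: pair_sigma_finite "lborel :: 'v measure" "M \<Otimes>\<^sub>M M" ..
  have fm[measurable]: "f \<in> borel_measurable M" using f by auto
  define E where "E t = (LINT y|M. cis (t \<bullet> \<Phi> y) * f y)" for t
  define k where "k p = f (fst p) * cnj (f (snd p))" for p
  define \<delta> where "\<delta> p = \<Phi> (fst p) - \<Phi> (snd p)" for p
  have km[measurable]: "k \<in> borel_measurable (M \<Otimes>\<^sub>M M)" and \<delta>m[measurable]: "\<delta> \<in> borel_measurable (M \<Otimes>\<^sub>M M)"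
    unfolding k_def[abs_def] \<delta>_def[abs_def] by measurable
  have Em[measurable]: "E \<in> borel_measurable borel"
    unfolding E_def[abs_def] by (intro M.borel_measurable_lebesgue_integral) measurable
  have int_cis: "integrable M (\<lambda>y. cis (t \<bullet> \<Phi> y) * f y)" for t
    by (rule Bochner_Integration.integrable_bound[OF f]) (auto simp: norm_mult)
  have kint: "integrable (M \<Otimes>\<^sub>M M) k"
    unfolding k_def using integrable_pair_mult[OF sf sf f, of "\<lambda>x. cnj (f x)"] f by simp
  have E_sq: "E t * cnj (E t) = (LINT p|(M \<Otimes>\<^sub>M M). cis (t \<bullet> \<delta> p) * k p)" for t
  proof -
    have "integrable (M \<Otimes>\<^sub>M M) (\<lambda>p. (cis (t \<bullet> \<Phi> (fst p)) * f (fst p)) * cnj (cis (t \<bullet> \<Phi> (snd p)) * f (snd p)))"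
      using integrable_pair_mult[OF sf sf int_cis[of t], of "\<lambda>y. cnj (cis (t \<bullet> \<Phi> y) * f y)"] int_cis[of t]
      by (simp only: integrable_cnj)
    then have "(LINT p|(M \<Otimes>\<^sub>M M). (cis (t \<bullet> \<Phi> (fst p)) * f (fst p)) * cnj (cis (t \<bullet> \<Phi> (snd p)) * f (snd p)))
       = (LINT x|M. LINT y|M. (cis (t \<bullet> \<Phi> x) * f x) * cnj (cis (t \<bullet> \<Phi> y) * f y))"
      using MM.integral_fst'[symmetric] by fastforce
    also have "\<dots> = E t * cnj (E t)"
      unfolding E_def by (simp only: integral_mult_right_zero integral_mult_left_zero Bochner_Integration.integral_cnj)
    finally show ?thesis
      unfolding k_def \<delta>_def inner_diff_right cis_mult_cnj_cis by simp
  qed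
  have E_le: "cmod (E t) \<le> (LINT y|M. cmod (f y))" for t
  proof -
    have "cmod (E t) \<le> (LINT y|M. norm (cis (t \<bullet> \<Phi> y) * f y))"
      unfolding E_def by (rule integral_norm_bound)
    then show ?thesis by (simp add: norm_mult)
  qed
  have damped: "(\<integral>\<^sup>+ t. ennreal (gauss_weight s t * (cmod (E t))\<^sup>2) \<partial>lborel)
       \<le> K * (\<integral>\<^sup>+ y. ennreal (w y * (cmod (f y))\<^sup>2) \<partial>M)" if s: "0 < s" for s
  proof -
    have gint: "integrable lborel (\<lambda>t::'v. complex_of_real (gauss_weight s t))"
      using integrable_gauss_weight[OF s, where 'v='v] by simp
    have int_damped: "integrable lborel (\<lambda>t. gauss_weight s t * (cmod (E t))\<^sup>2)"
    proof (rule Bochner_Integration.integrable_bound)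
      show "integrable lborel (\<lambda>t::'v. (LINT y|M. cmod (f y))\<^sup>2 * gauss_weight s t)"
        using integrable_gauss_weight[OF s, where 'v='v] by simp
      show "AE t in lborel. norm (gauss_weight s t * (cmod (E t))\<^sup>2) \<le> norm ((LINT y|M. cmod (f y))\<^sup>2 * gauss_weight s t)"
        using gauss_weight_pos[of s, where 'a='v] E_le
        by (intro AE_I2) (auto simp: abs_mult less_imp_le mult.commute intro!: mult_left_mono power_mono)
    qed measurable
    have FI: "integrable (lborel \<Otimes>\<^sub>M (M \<Otimes>\<^sub>M M)) (\<lambda>(t, p). cis (t \<bullet> \<delta> p) * (complex_of_real (gauss_weight s t) * k p))"
    proof (rule Bochner_Integration.integrable_bound[OF integrable_pair_mult[OF lborel.sigma_finite_measure_axioms MM.P.sigma_finite_measure_axioms gint kint]])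
      show "(\<lambda>(t, p). cis (t \<bullet> \<delta> p) * (complex_of_real (gauss_weight s t) * k p)) \<in> borel_measurable (lborel \<Otimes>\<^sub>M (M \<Otimes>\<^sub>M M))"
        by measurable
    qed (auto simp: norm_mult)
    have "complex_of_real (LINT t|lborel. gauss_weight s t * (cmod (E t))\<^sup>2)
       = (LINT t|lborel. complex_of_real (gauss_weight s t) * (E t * cnj (E t)))"
      by (simp add: complex_norm_square[symmetric] flip: integral_complex_of_real of_real_power)
    also have "\<dots> = (LINT t|lborel. LINT p|(M \<Otimes>\<^sub>M M). cis (t \<bullet> \<delta> p) * (complex_of_real (gauss_weight s t) * k p))"
      unfolding E_sq integral_mult_right_zero[symmetric] by (simp add: mult_ac)
    also have "\<dots> = (LINT p|(M \<Otimes>\<^sub>M M). LINT t|lborel. cis (t \<bullet> \<delta> p) * (complex_of_real (gauss_weight s t) * k p))"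
      using LM.Fubini_integral[OF FI] by simp
    also have "\<dots> = (LINT p|(M \<Otimes>\<^sub>M M). complex_of_real (heat s (\<delta> p)) * k p)"
      unfolding mult.assoc[symmetric] integral_mult_left_zero integral_cis_gauss[OF s] ..
    finally have eq: "complex_of_real (LINT t|lborel. gauss_weight s t * (cmod (E t))\<^sup>2)
       = (LINT p|(M \<Otimes>\<^sub>M M). complex_of_real (heat s (\<delta> p)) * k p)" .
    have hint: "integrable (M \<Otimes>\<^sub>M M) (\<lambda>p. complex_of_real (heat s (\<delta> p)) * k p)"
    proof -
      have "norm (complex_of_real (heat s (\<delta> p)) * k p) \<le> norm ((sqrt (2 * pi) / s) ^ DIM('v) *\<^sub>R k p)" for p
        using heat_abs_le[OF s, of "\<delta> p"] s
        unfolding norm_mult norm_of_real norm_scaleR by (intro mult_right_mono) auto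
      then show ?thesis
        by (intro Bochner_Integration.integrable_bound[OF integrable_scaleR_right[OF kint]] AE_I2) auto
    qed
    define T where "T y y' = ennreal (w y * (cmod (f y))\<^sup>2) * ennreal (heat s (\<Phi> y - \<Phi> y') / w y')" for y y'
    have Tm[measurable]: "case_prod T \<in> borel_measurable (M \<Otimes>\<^sub>M M)"
      unfolding T_def by measurable
    have Tm2[measurable]: "(\<lambda>p. T (snd p) (fst p)) \<in> borel_measurable (M \<Otimes>\<^sub>M M)"
      unfolding T_def by measurable
    have int_T: "(\<integral>\<^sup>+ y. \<integral>\<^sup>+ y'. T y y' \<partial>M \<partial>M) \<le> K * (\<integral>\<^sup>+ y. ennreal (w y * (cmod (f y))\<^sup>2) \<partial>M)"
    proof -
      have "(\<integral>\<^sup>+ y. \<integral>\<^sup>+ y'. T y y' \<partial>M \<partial>M) = (\<integral>\<^sup>+ y. ennreal (w y * (cmod (f y))\<^sup>2) * (\<integral>\<^sup>+ y'. ennreal (heat s (\<Phi> y - \<Phi> y') / w y') \<partial>M) \<partial>M)"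
        unfolding T_def by (intro nn_integral_cong nn_integral_cmult) measurable
      also have "\<dots> \<le> (\<integral>\<^sup>+ y. ennreal (w y * (cmod (f y))\<^sup>2) * K \<partial>M)"
        by (intro nn_integral_mono mult_left_mono K s) auto
      also have "\<dots> = K * (\<integral>\<^sup>+ y. ennreal (w y * (cmod (f y))\<^sup>2) \<partial>M)"
        by (subst nn_integral_multc) (auto simp: mult.commute)
      finally show ?thesis .
    qed
    have pw: "ennreal (norm (complex_of_real (heat s (\<delta> p)) * k p)) \<le> (T (fst p) (snd p) + T (snd p) (fst p)) / 2" for p
    proof -
      obtain y y' where p: "p = (y, y')" by (cases p)
      have sym: "heat s (\<Phi> y' - \<Phi> y) = heat s (\<Phi> y - \<Phi> y')"
        by (simp add: heat_def norm_minus_commute)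
      have h0: "0 \<le> heat s (\<Phi> y - \<Phi> y')" by (rule heat_nonneg[OF s])
      have "norm (complex_of_real (heat s (\<delta> p)) * k p) = heat s (\<Phi> y - \<Phi> y') * (cmod (f y) * cmod (f y'))"
        using h0 by (simp add: p k_def \<delta>_def norm_mult)
      also have "\<dots> \<le> heat s (\<Phi> y - \<Phi> y') * ((w y * (cmod (f y))\<^sup>2 / w y' + w y' * (cmod (f y'))\<^sup>2 / w y) / 2)"
        by (intro mult_left_mono mult_le_weighted_squares w h0)
      also have "\<dots> = (w y * (cmod (f y))\<^sup>2 * (heat s (\<Phi> y - \<Phi> y') / w y') + w y' * (cmod (f y'))\<^sup>2 * (heat s (\<Phi> y' - \<Phi> y) / w y)) / 2"
        by (simp add: sym field_simps)
      finally have "norm (complex_of_real (heat s (\<delta> p)) * k p) \<le> \<dots>" .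
      then have "ennreal (norm (complex_of_real (heat s (\<delta> p)) * k p)) \<le> ennreal ((w y * (cmod (f y))\<^sup>2 * (heat s (\<Phi> y - \<Phi> y') / w y') + w y' * (cmod (f y'))\<^sup>2 * (heat s (\<Phi> y' - \<Phi> y) / w y)) / 2)"
        by (rule ennreal_leI)
      also have "\<dots> = (T y y' + T y' y) / 2"
      proof -
        define A B where "A = w y * (cmod (f y))\<^sup>2 * (heat s (\<Phi> y - \<Phi> y') / w y')"
          and "B = w y' * (cmod (f y'))\<^sup>2 * (heat s (\<Phi> y' - \<Phi> y) / w y)"
        have nn: "0 \<le> A" "0 \<le> B"
          using h0 sym w[of y] w[of y'] by (simp_all add: A_def B_def)
        have "T y y' = ennreal A" "T y' y = ennreal B"
          unfolding T_def A_def B_def using h0 sym w[of y] w[of y']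
          by (subst ennreal_mult; simp)+
        then show ?thesis
          using nn divide_ennreal[of "A + B" 2] unfolding A_def[symmetric] B_def[symmetric]
          by (simp add: ennreal_plus)
      qed
      finally show ?thesis by (simp add: p)
    qed
    have "(\<integral>\<^sup>+ t. ennreal (gauss_weight s t * (cmod (E t))\<^sup>2) \<partial>lborel) = ennreal (LINT t|lborel. gauss_weight s t * (cmod (E t))\<^sup>2)"
      using gauss_weight_pos[of s, where 'a='v] by (intro nn_integral_eq_integral int_damped AE_I2) (simp add: less_imp_le)
    also have "\<dots> \<le> ennreal (cmod (LINT p|(M \<Otimes>\<^sub>M M). complex_of_real (heat s (\<delta> p)) * k p))"
      unfolding eq[symmetric] by (intro ennreal_leI) simp
    also have "\<dots> \<le> (\<integral>\<^sup>+ p. ennreal (norm (complex_of_real (heat s (\<delta> p)) * k p)) \<partial>(M \<Otimes>\<^sub>M M))"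
      by (rule integral_norm_bound_ennreal[OF hint])
    also have "\<dots> \<le> (\<integral>\<^sup>+ p. (T (fst p) (snd p) + T (snd p) (fst p)) / 2 \<partial>(M \<Otimes>\<^sub>M M))"
      by (intro nn_integral_mono pw)
    also have "\<dots> = ((\<integral>\<^sup>+ p. T (fst p) (snd p) \<partial>(M \<Otimes>\<^sub>M M)) + (\<integral>\<^sup>+ p. T (snd p) (fst p) \<partial>(M \<Otimes>\<^sub>M M))) / 2"
      using Tm by (simp add: nn_integral_divide nn_integral_add split_beta')
    also have "(\<integral>\<^sup>+ p. T (fst p) (snd p) \<partial>(M \<Otimes>\<^sub>M M)) = (\<integral>\<^sup>+ y. \<integral>\<^sup>+ y'. T y y' \<partial>M \<partial>M)"
      using M.nn_integral_fst[of "case_prod T" M] Tm by (simp add: split_beta')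
    also have "(\<integral>\<^sup>+ p. T (snd p) (fst p) \<partial>(M \<Otimes>\<^sub>M M)) = (\<integral>\<^sup>+ y. \<integral>\<^sup>+ y'. T y y' \<partial>M \<partial>M)"
      using MM.nn_integral_snd[of "\<lambda>p. T (snd p) (fst p)"] Tm2 by (simp add: split_beta')
    also have "(\<integral>\<^sup>+ y. \<integral>\<^sup>+ y'. T y y' \<partial>M \<partial>M) + (\<integral>\<^sup>+ y. \<integral>\<^sup>+ y'. T y y' \<partial>M \<partial>M) = 2 * (\<integral>\<^sup>+ y. \<integral>\<^sup>+ y'. T y y' \<partial>M \<partial>M)"
      by (simp add: mult_2)
    also have "\<dots> / 2 = (\<integral>\<^sup>+ y. \<integral>\<^sup>+ y'. T y y' \<partial>M \<partial>M)"
      by (subst mult.commute, subst ennreal_mult_divide_eq) simp_all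
    also note int_T
    finally show ?thesis .
  qed
  have "(\<integral>\<^sup>+ t. ennreal ((cmod (E t))\<^sup>2) \<partial>lborel) \<le> K * (\<integral>\<^sup>+ y. ennreal (w y * (cmod (f y))\<^sup>2) \<partial>M)"
  proof (rule nn_integral_le_of_AE_tendsto[where u="\<lambda>n t. ennreal (gauss_weight (1 / Suc n) t * (cmod (E t))\<^sup>2)"])
    show "AE t in lborel. (\<lambda>n. ennreal (gauss_weight (1 / Suc n) t * (cmod (E t))\<^sup>2)) \<longlonglongrightarrow> ennreal ((cmod (E t))\<^sup>2)"
    proof (intro AE_I2 tendsto_ennrealI)
      fix t :: 'v
      have "(\<lambda>n. exp (- (1 / real (Suc n) * norm t)\<^sup>2 / 2) * (cmod (E t))\<^sup>2) \<longlonglongrightarrow> exp (- (0 * norm t)\<^sup>2 / 2) * (cmod (E t))\<^sup>2"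
        by (intro tendsto_intros LIMSEQ_Suc[OF lim_1_over_n]) simp
      then show "(\<lambda>n. gauss_weight (1 / Suc n) t * (cmod (E t))\<^sup>2) \<longlonglongrightarrow> (cmod (E t))\<^sup>2"
        by (simp add: gauss_weight_def)
    qed
  qed (auto intro!: always_eventually damped)
  then show ?thesis unfolding E_def .
qed

text \<open>
  For \<open>\<Phi> y = y\<close> and \<open>w = 1\<close> the kernel has the mass \<open>(2
  \<pi>)\<^sup>d\<close> around every point.
\<close>

corollary Plancherel_bound:
  fixes f :: "'v::euclidean_space \<Rightarrow> complex"
  assumes f: "integrable lborel f"
  shows "(\<integral>\<^sup>+ t. ennreal ((cmod (LINT y|lborel. cis (t \<bullet> y) * f y))\<^sup>2) \<partial>lborel)
       \<le> ennreal ((2 * pi) ^ DIM('v)) * (\<integral>\<^sup>+ y. ennreal ((cmod (f y))\<^sup>2) \<partial>lborel)"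
proof -
  have "(\<integral>\<^sup>+ y'. ennreal (heat s (y - y') / 1) \<partial>lborel) \<le> ennreal ((2 * pi) ^ DIM('v))" if "0 < s" for s and y :: 'v
    using nn_integral_lborel_reflect[of "\<lambda>z. ennreal (heat s z)" y] nn_integral_heat[OF that, where 'v='v] by simp
  then show ?thesis
    using oscillatory_integral_l2_bound[where w="\<lambda>_. 1" and \<Phi>="\<lambda>y. y", OF lborel.sigma_finite_measure_axioms f]
    by simp
qed

section \<open>The Fourier transform on \<open>L\<^sup>2(\<real>\<^sup>2)\<close>\<close>

lemma lborel_distr_isometry:
  fixes t :: "'v::euclidean_space"
  assumes "\<bar>c\<bar> = 1"
  shows "distr lborel borel (\<lambda>x. t + c *\<^sub>R x) = lborel"
proof -
  have "c \<noteq> 0" using assms by auto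
  from lborel_affine[OF this, of t] show ?thesis
    using assms by (simp add: density_1)
qed

lemma lborel_integral_isometry:
  fixes t :: "'v::euclidean_space" and f :: "'v \<Rightarrow> 'b::{banach, second_countable_topology}"
  assumes c: "\<bar>c\<bar> = 1" and [measurable]: "f \<in> borel_measurable borel"
  shows "(LINT x|lborel. f (t + c *\<^sub>R x)) = (LINT x|lborel. f x)"
  by (subst (2) lborel_distr_isometry[OF c, symmetric, of t]) (subst integral_distr, auto)

lemma lborel_integrable_isometry:
  fixes t :: "'v::euclidean_space" and f :: "'v \<Rightarrow> 'b::{banach, second_countable_topology}"
  assumes c: "\<bar>c\<bar> = 1" and f: "integrable lborel f"
  shows "integrable lborel (\<lambda>x. f (t + c *\<^sub>R x))"
proof -
  have "integrable (distr lborel borel (\<lambda>x. t + c *\<^sub>R x)) f"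
    unfolding lborel_distr_isometry[OF c] by (rule f)
  then show ?thesis by (subst (asm) integrable_distr_eq) (use f in auto)
qed

lemma AE_lborel_isometry:
  fixes t :: "'v::euclidean_space"
  assumes c: "\<bar>c\<bar> = 1" and P: "AE x in lborel. P x"
  shows "AE x in lborel. P (t + c *\<^sub>R x)"
proof -
  have "AE x in distr lborel borel (\<lambda>x. t + c *\<^sub>R x). P x"
    unfolding lborel_distr_isometry[OF c] by (rule P)
  then show ?thesis by (rule AE_distrD[rotated]) measurable
qed

lemma AE_lborel_reflect:
  "AE x in lborel. P x \<Longrightarrow> AE x in lborel. P (- x :: 'v::euclidean_space)"
  using AE_lborel_isometry[of "-1" P 0] by simp

lemma sqnorm_isometry:
  fixes t :: "'v::euclidean_space"
  assumes c: "\<bar>c\<bar> = 1" and [measurable]: "f \<in> borel_measurable borel"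
  shows "sqnorm lborel (\<lambda>x. f (t + c *\<^sub>R x)) = sqnorm lborel f"
  unfolding sqnorm_def by (rule lborel_integral_isometry[OF c]) measurable

lemma square_integrable_isometry:
  fixes t :: "'v::euclidean_space"
  assumes c: "\<bar>c\<bar> = 1" and f: "f \<in> square_integrable lborel"
  shows "(\<lambda>x. f (t + c *\<^sub>R x)) \<in> square_integrable lborel"
proof -
  have [measurable]: "f \<in> borel_measurable borel" using f by (auto simp: square_integrable_def)
  show ?thesis
    using lborel_integrable_isometry[OF c square_integrable_integrable[OF f], of t]
    by (simp add: square_integrable_def)
qed

lemma cis_inner_diff: "cis (a \<bullet> (x - b)) = cis (a \<bullet> x) * cis (- (a \<bullet> b))"
  by (simp add: cis_mult inner_diff_right)

text \<open>
  Integrating the hypothesis against modulated Gaussians shows that all convolutions of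
  \<open>D\<close> with \<open>heat s\<close> vanish. Their integrals over a box tend, as
  \<open>s\<close> goes to zero, to a multiple of the integral of \<open>D\<close> over the box,
  because the smoothed indicator of the box converges off its frontier. Boxes generate the Borel
  sets.
\<close>

lemma L1_fourier_injective:
  fixes D :: "'v::euclidean_space \<Rightarrow> complex"
  assumes D: "integrable lborel D" and zero: "\<And>a. (LINT x|lborel. cis (a \<bullet> x) * D x) = 0"
  shows "AE x in lborel. D x = 0"
proof -
  have Dm[measurable]: "D \<in> borel_measurable borel" using D by auto
  have heat0: "(LINT x|lborel. complex_of_real (heat s (x - b)) * D x) = 0" if s: "0 < s" for s b
  proof -
    have gint: "integrable lborel (\<lambda>t::'v. complex_of_real (gauss_weight s t))"
      using integrable_gauss_weight[OF s, where 'v='v] by simp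
    have FI: "integrable (lborel \<Otimes>\<^sub>M lborel) (\<lambda>(a, x). cis (a \<bullet> (x - b)) * complex_of_real (gauss_weight s a) * D x)"
    proof (rule Bochner_Integration.integrable_bound[OF integrable_pair_mult[OF lborel.sigma_finite_measure_axioms lborel.sigma_finite_measure_axioms gint D]])
      show "(\<lambda>(a, x). cis (a \<bullet> (x - b)) * complex_of_real (gauss_weight s a) * D x) \<in> borel_measurable (lborel \<Otimes>\<^sub>M lborel)"
        by measurable
    qed (auto simp: norm_mult)
    have "(LINT x|lborel. complex_of_real (heat s (x - b)) * D x)
        = (LINT x|lborel. LINT a|lborel. cis (a \<bullet> (x - b)) * complex_of_real (gauss_weight s a) * D x)"
      unfolding integral_mult_left_zero integral_cis_gauss[OF s] ..
    also have "\<dots> = (LINT a|lborel. LINT x|lborel. cis (a \<bullet> (x - b)) * complex_of_real (gauss_weight s a) * D x)"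
      using lborel_pair.Fubini_integral[OF FI] by simp
    also have "\<dots> = (LINT a|lborel. (complex_of_real (gauss_weight s a) * cis (- (a \<bullet> b))) * (LINT x|lborel. cis (a \<bullet> x) * D x))"
      unfolding integral_mult_right_zero[symmetric]
      unfolding cis_inner_diff by (simp only: mult_ac)
    also have "\<dots> = 0" by (simp add: zero)
    finally show ?thesis .
  qed
  have box0: "(LINT x:box l u|lborel. D x) = 0" for l u :: 'v
  proof -
    define B where "B = box l u"
    have Bm[measurable]: "B \<in> sets borel" unfolding B_def by simp
    have Bint: "integrable lborel (\<lambda>b. complex_of_real (indicat_real B b))"
      unfolding B_def using emeasure_lborel_box_finite[of l u] by (simp add: integrable_of_real)
    define H where "H s x = (LINT z|lborel. complex_of_real (indicat_real B (x - s *\<^sub>R z)) * complex_of_real (heat 1 z))" for s :: real and x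
    have heat_int: "integrable lborel (\<lambda>z::'v. heat 1 z)"
      using nn_integral_heat[of 1, where 'v='v] heat_nonneg[of 1, where 'a='v]
      by (intro integrableI_nonneg) auto
    have heat_val: "(LINT z|lborel. heat 1 (z::'v)) = (2 * pi) ^ DIM('v)"
      using nn_integral_heat[of 1, where 'v='v] nn_integral_eq_integral[OF heat_int] heat_nonneg[of 1, where 'a='v]
      by (simp add: ennreal_inj integral_nonneg_AE)
    \<comment> \<open>after the substitution \<open>b = x - s z\<close> the kernel no longer
    depends on \<open>s\<close>, so dominated convergence applies as \<open>s\<close> tends to
    zero\<close>
    have H_eq: "(LINT b|lborel. complex_of_real (indicat_real B b) * complex_of_real (heat s (x - b))) = H s x" if s: "0 < s" for s x
    proof -
      have "(LINT b|lborel. complex_of_real (indicat_real B b) * complex_of_real (heat s (x - b)))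
         = (LINT b|density (distr lborel borel (\<lambda>z. x + (- s) *\<^sub>R z)) (\<lambda>_. ennreal (\<bar>- s\<bar>^DIM('v))).
              complex_of_real (indicat_real B b) * complex_of_real (heat s (x - b)))"
        using lborel_affine[of "- s" x] s by simp
      also have "\<dots> = (LINT z|lborel. (s ^ DIM('v)) *\<^sub>R (complex_of_real (indicat_real B (x - s *\<^sub>R z)) * complex_of_real (heat s (s *\<^sub>R z))))"
        using s by (subst integral_density, measurable) (auto simp: integral_distr)
      also have "\<dots> = H s x"
        unfolding H_def
        by (intro Bochner_Integration.integral_cong refl) (use s in \<open>simp add: heat_def scaleR_conv_of_real power_divide field_simps\<close>)
      finally show ?thesis .
    qed
    have H0: "(LINT x|lborel. H s x * D x) = 0" if s: "0 < s" for s
    proof -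
      have FI: "integrable (lborel \<Otimes>\<^sub>M lborel) (\<lambda>(b, x). complex_of_real (indicat_real B b) * complex_of_real (heat s (x - b)) * D x)"
      proof (rule Bochner_Integration.integrable_bound)
        show "integrable (lborel \<Otimes>\<^sub>M lborel) (\<lambda>p. (sqrt (2 * pi) / s) ^ DIM('v) *\<^sub>R (complex_of_real (indicat_real B (fst p)) * D (snd p)))"
          by (intro integrable_scaleR_right integrable_pair_mult lborel.sigma_finite_measure_axioms Bint D)
        show "(\<lambda>(b, x). complex_of_real (indicat_real B b) * complex_of_real (heat s (x - b)) * D x) \<in> borel_measurable (lborel \<Otimes>\<^sub>M lborel)"
          by measurable
        have "norm (complex_of_real (indicat_real B b) * complex_of_real (heat s (x - b)) * D x) \<le> norm ((sqrt (2 * pi) / s) ^ DIM('v) *\<^sub>R (complex_of_real (indicat_real B b) * D x))" for b x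
          using s heat_abs_le[OF s, of "x - b"] unfolding norm_mult norm_of_real norm_scaleR
          by (auto simp: indicator_def intro!: mult_right_mono)
        then show "AE p in lborel \<Otimes>\<^sub>M lborel. norm (case p of (b, x) \<Rightarrow> complex_of_real (indicat_real B b) * complex_of_real (heat s (x - b)) * D x) \<le> norm ((sqrt (2 * pi) / s) ^ DIM('v) *\<^sub>R (complex_of_real (indicat_real B (fst p)) * D (snd p)))"
          by (intro AE_I2) (auto simp: split_beta)
      qed
      have "(LINT x|lborel. H s x * D x) = (LINT x|lborel. LINT b|lborel. complex_of_real (indicat_real B b) * complex_of_real (heat s (x - b)) * D x)"
        unfolding integral_mult_left_zero H_eq[OF s] ..
      also have "\<dots> = (LINT b|lborel. LINT x|lborel. complex_of_real (indicat_real B b) * complex_of_real (heat s (x - b)) * D x)"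
        using lborel_pair.Fubini_integral[OF FI] by simp
      also have "\<dots> = 0"
        unfolding mult.assoc integral_mult_right_zero heat0[OF s] by simp
      finally show ?thesis .
    qed
    have H_le: "cmod (H s x) \<le> (2 * pi) ^ DIM('v)" for s x
    proof -
      have "cmod (H s x) \<le> (LINT z|lborel. norm (complex_of_real (indicat_real B (x - s *\<^sub>R z)) * complex_of_real (heat 1 z)))"
        unfolding H_def by (rule integral_norm_bound)
      also have "\<dots> \<le> (LINT z|lborel. heat 1 (z::'v))"
        using heat_int heat_nonneg[of 1, where 'a='v]
        by (intro integral_mono Bochner_Integration.integrable_bound[OF heat_int]) (auto simp: norm_mult indicator_def)
      finally show ?thesis by (simp add: heat_val)
    qed
    have H_meas[measurable]: "H s \<in> borel_measurable borel" for s
      unfolding H_def[abs_def] by measurable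
    have H_lim: "(\<lambda>n. H (1 / Suc n) x) \<longlonglongrightarrow> complex_of_real (indicat_real B x) * (2 * pi) ^ DIM('v)" if x: "x \<notin> frontier B" for x
    proof -
      have "(\<lambda>n. LINT z|lborel. complex_of_real (indicat_real B (x - (1 / Suc n) *\<^sub>R z)) * complex_of_real (heat 1 z))
         \<longlonglongrightarrow> (LINT z|lborel. complex_of_real (indicat_real B x) * complex_of_real (heat 1 (z::'v)))"
      proof (rule integral_dominated_convergence[where w="\<lambda>z. heat 1 z"])
        show "AE z in lborel. (\<lambda>n. complex_of_real (indicat_real B (x - (1 / Suc n) *\<^sub>R z)) * complex_of_real (heat 1 z))
             \<longlonglongrightarrow> complex_of_real (indicat_real B x) * complex_of_real (heat 1 z)"
        proof (rule AE_I2, rule tendsto_eventually)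
          fix z :: 'v
          have lim: "(\<lambda>n. x - (1 / Suc n) *\<^sub>R z) \<longlonglongrightarrow> x - 0 *\<^sub>R z"
            by (intro tendsto_intros LIMSEQ_Suc[OF lim_1_over_n])
          have "x \<in> interior B \<or> x \<in> - closure B"
            using x by (auto simp: frontier_def)
          then have "\<forall>\<^sub>F n in sequentially. indicat_real B (x - (1 / Suc n) *\<^sub>R z) = indicat_real B x"
          proof
            assume "x \<in> interior B"
            then have "\<forall>\<^sub>F n in sequentially. x - (1 / Suc n) *\<^sub>R z \<in> interior B"
              using topological_tendstoD[OF lim, of "interior B"] by simp
            then show ?thesis
              by eventually_elim (use \<open>x \<in> interior B\<close> interior_subset[of B] in \<open>auto simp: indicator_def\<close>)
          next
            assume "x \<in> - closure B"
            then have "\<forall>\<^sub>F n in sequentially. x - (1 / Suc n) *\<^sub>R z \<in> - closure B"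
              using topological_tendstoD[OF lim open_Compl[OF closed_closure]] by simp
            then show ?thesis
              by eventually_elim (use \<open>x \<in> - closure B\<close> closure_subset[of B] in \<open>auto simp: indicator_def\<close>)
          qed
          then show "\<forall>\<^sub>F n in sequentially. complex_of_real (indicat_real B (x - (1 / Suc n) *\<^sub>R z)) * complex_of_real (heat 1 z) = complex_of_real (indicat_real B x) * complex_of_real (heat 1 z)"
            by eventually_elim simp
        qed
        show "integrable lborel (\<lambda>z::'v. heat 1 z)" by (rule heat_int)
        show "AE z in lborel. norm (complex_of_real (indicat_real B (x - (1 / Suc n) *\<^sub>R z)) * complex_of_real (heat 1 z)) \<le> heat 1 z" for n
          using heat_nonneg[of 1, where 'a='v] by (intro AE_I2) (auto simp: norm_mult indicator_def)
      qed measurable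
      then show ?thesis
        unfolding H_def integral_mult_right_zero by (simp add: heat_val)
    qed
    have "AE x in lborel. x \<notin> frontier B"
      using null_sets_cbox_Diff_box[of l u] unfolding B_def
      by (intro AE_not_in) (simp add: frontier_box split: if_splits)
    then have "(\<lambda>n. LINT x|lborel. H (1 / Suc n) x * D x) \<longlonglongrightarrow> (LINT x|lborel. complex_of_real (indicat_real B x) * (2 * pi) ^ DIM('v) * D x)"
    proof (intro integral_dominated_convergence[where w="\<lambda>x. (2 * pi) ^ DIM('v) * cmod (D x)"])
      show "integrable lborel (\<lambda>x. (2 * pi) ^ DIM('v) * cmod (D x))" using D by simp
      assume "AE x in lborel. x \<notin> frontier B"
      then show "AE x in lborel. (\<lambda>n. H (1 / Suc n) x * D x) \<longlonglongrightarrow> complex_of_real (indicat_real B x) * (2 * pi) ^ DIM('v) * D x"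
        by eventually_elim (rule tendsto_mult[OF H_lim tendsto_const])
      show "AE x in lborel. norm (H (1 / Suc n) x * D x) \<le> (2 * pi) ^ DIM('v) * cmod (D x)" for n
        unfolding norm_mult by (intro AE_I2 mult_right_mono H_le) simp
    qed measurable
    then have "(LINT x|lborel. complex_of_real (indicat_real B x) * (2 * pi) ^ DIM('v) * D x) = 0"
      using LIMSEQ_unique[OF _ tendsto_const] by (simp add: H0)
    also have "(LINT x|lborel. complex_of_real (indicat_real B x) * (2 * pi) ^ DIM('v) * D x) = (2 * pi) ^ DIM('v) * (LINT x:B|lborel. D x)"
      unfolding set_lebesgue_integral_def integral_mult_right_zero[symmetric]
      by (simp add: scaleR_conv_of_real mult_ac)
    finally show ?thesis by (simp add: B_def)
  qed
  show ?thesis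
  proof (rule sigma_finite_measure.density_zero[OF lborel.sigma_finite_measure_axioms D])
    fix A :: "'v set" assume "A \<in> sets lborel"
    then have A: "A \<in> sigma_sets UNIV (range (\<lambda>(a, b). box a b))"
      by (simp add: borel_eq_box)
    have stable: "Int_stable (range (\<lambda>(a, b). box a b :: 'v set))" "range (\<lambda>(a, b). box a b :: 'v set) \<subseteq> Pow UNIV"
      by (auto simp: Int_stable_def box_Int_box)
    from stable A show "(LINT x:A|lborel. D x) = 0"
    proof (induction rule: sigma_sets_induct_disjoint)
      case (basic A) then show ?case using box0 by auto
    next
      case empty show ?case by (simp add: set_lebesgue_integral_def)
    next
      case (compl A)
      have [measurable]: "A \<in> sets borel" using compl by (simp add: borel_eq_box)
      have "(LINT x:UNIV - A|lborel. D x) = (LINT x|lborel. D x) - (LINT x:A|lborel. D x)"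
        unfolding set_lebesgue_integral_def
        by (subst Bochner_Integration.integral_diff[symmetric])
           (auto simp: D integrable_real_mult_indicator intro!: Bochner_Integration.integral_cong integrable_mult_indicator[of A lborel D, OF _ D] split: split_indicator)
      moreover have "(LINT x|lborel. D x) = 0" using zero[of 0] by simp
      ultimately show ?case using compl by simp
    next
      case (union A)
      then have [measurable]: "A i \<in> sets borel" for i by (auto simp: borel_eq_box)
      have "(LINT x:(\<Union>i. A i)|lborel. D x) = (\<Sum>i. (LINT x:(A i)|lborel. D x))"
        using union(1) unfolding disjoint_family_on_def
        by (intro lebesgue_integral_countable_add)
           (auto simp: set_integrable_def intro!: integrable_mult_indicator[OF _ D])
      then show ?case using union by simp
    qed
  qed
qed

lemma cball_borel [measurable]: "cball (a::'v::euclidean_space) R \<in> sets borel"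
  by (simp add: borel_closed)

definition l1_fourier :: "(real^2 \<Rightarrow> complex) \<Rightarrow> real^2 \<Rightarrow> complex" where
  "l1_fourier f \<xi> = (LINT x|lborel. cis (- (x \<bullet> \<xi>)) * f x) / complex_of_real (2 * pi)"

definition cutoff :: "real \<Rightarrow> ('v::euclidean_space \<Rightarrow> complex) \<Rightarrow> 'v \<Rightarrow> complex" where
  "cutoff R f x = indicat_real (cball 0 R) x *\<^sub>R f x"

lemma cutoff_eq_mult: "cutoff R f = (\<lambda>x. complex_of_real (indicat_real (cball 0 R) x) * f x)"
  by (auto simp: cutoff_def scaleR_conv_of_real)

lemma truncated_fourier_eq: "truncated_fourier R f = l1_fourier (cutoff R f)"
  unfolding truncated_fourier_def l1_fourier_def cutoff_def set_lebesgue_integral_def by auto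

lemma cutoff_square_integrable:
  "f \<in> square_integrable lborel \<Longrightarrow> cutoff R f \<in> square_integrable lborel"
  unfolding cutoff_eq_mult by (rule square_integrable_mult_bounded[where c=1]) (auto simp: indicator_def)

lemma indicator_cball_square_integrable:
  "(\<lambda>x. complex_of_real (indicat_real (cball (a::'v::euclidean_space) R) x)) \<in> square_integrable lborel"
  unfolding square_integrable_def
  using emeasure_lborel_cball_finite[of a R] by (auto simp: power2_eq_square intro!: integrable_real_mult_indicator)

lemma cutoff_integrable:
  assumes "f \<in> square_integrable lborel"
  shows "integrable lborel (cutoff R f)"
  unfolding cutoff_eq_mult by (intro integrable_mult_square_integrable indicator_cball_square_integrable assms)

lemma cutoff_measurable [measurable]:
  assumes [measurable]: "f \<in> borel_measurable borel"
  shows "cutoff R f \<in> borel_measurable borel"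
  unfolding cutoff_def[abs_def] by measurable

lemma norm_cutoff_le: "cmod (cutoff R f x) \<le> cmod (f x)"
  by (simp add: cutoff_def indicator_def)

lemma sqnorm_cutoff_le:
  assumes "f \<in> square_integrable lborel"
  shows "sqnorm lborel (cutoff R f) \<le> sqnorm lborel f"
  unfolding sqnorm_def
  using square_integrable_integrable[OF assms] square_integrable_integrable[OF cutoff_square_integrable[OF assms]]
  by (intro integral_mono power_mono norm_cutoff_le) auto

lemma cutoff_tendsto:
  fixes f :: "'v::euclidean_space \<Rightarrow> complex"
  assumes f: "f \<in> square_integrable lborel"
  shows "((\<lambda>R. sqnorm lborel (\<lambda>x. cutoff R f x - f x)) \<longlongrightarrow> 0) at_top"
proof -
  have [measurable]: "f \<in> borel_measurable borel" using f by (auto simp: square_integrable_def)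
  have "((\<lambda>R. LINT x|lborel. (cmod (cutoff R f x - f x))\<^sup>2) \<longlongrightarrow> (LINT x|(lborel::'v measure). 0)) at_top"
  proof (rule integral_dominated_convergence_at_top[where w="\<lambda>x. (cmod (f x))\<^sup>2"])
    show "AE x in lborel. ((\<lambda>R. (cmod (cutoff R f x - f x))\<^sup>2) \<longlongrightarrow> 0) at_top"
    proof (rule AE_I2, rule tendsto_eventually)
      fix x :: 'v
      show "\<forall>\<^sub>F R in at_top. (cmod (cutoff R f x - f x))\<^sup>2 = 0"
        using eventually_ge_at_top[of "norm x"] by eventually_elim (simp add: cutoff_def)
    qed
    show "\<forall>\<^sub>F R in at_top. AE x in lborel. norm ((cmod (cutoff R f x - f x))\<^sup>2) \<le> (cmod (f x))\<^sup>2"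
      by (intro always_eventually allI AE_I2) (simp add: cutoff_def indicator_def)
    show "integrable lborel (\<lambda>x. (cmod (f x))\<^sup>2)" by (rule square_integrable_integrable[OF f])
  qed measurable
  then show ?thesis by (simp add: sqnorm_def)
qed

lemma cutoff_tendsto_nat:
  fixes f :: "'v::euclidean_space \<Rightarrow> complex"
  assumes f: "f \<in> square_integrable lborel"
  shows "(\<lambda>n. sqnorm lborel (\<lambda>x. cutoff (real n) f x - f x)) \<longlonglongrightarrow> 0"
  using filterlim_compose[OF cutoff_tendsto[OF f] filterlim_real_sequentially] .

lemma l1_fourier_measurable [measurable]:
  assumes [measurable]: "f \<in> borel_measurable borel"
  shows "l1_fourier f \<in> borel_measurable borel"
  unfolding l1_fourier_def[abs_def]
  by (intro borel_measurable_divide borel_measurable_const lborel.borel_measurable_lebesgue_integral) measurable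

lemma cis_mult_integrable:
  fixes f :: "'a \<Rightarrow> complex"
  assumes "integrable M f" "h \<in> borel_measurable M"
  shows "integrable M (\<lambda>x. cis (h x) * f x)"
  using assms by (intro Bochner_Integration.integrable_bound[OF assms(1)]) (auto simp: norm_mult)

lemma l1_fourier_diff:
  assumes "integrable lborel f" "integrable lborel g"
  shows "l1_fourier (\<lambda>x. f x - g x) = (\<lambda>\<xi>. l1_fourier f \<xi> - l1_fourier g \<xi>)"
proof
  fix \<xi> :: "real^2"
  show "l1_fourier (\<lambda>x. f x - g x) \<xi> = l1_fourier f \<xi> - l1_fourier g \<xi>"
    unfolding l1_fourier_def right_diff_distrib using assms
    by (subst Bochner_Integration.integral_diff) (auto intro!: cis_mult_integrable simp: diff_divide_distrib)
qed

lemma l1_fourier_linear: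
  assumes "integrable lborel f" "integrable lborel g"
  shows "l1_fourier (\<lambda>x. a * f x + b * g x) = (\<lambda>\<xi>. a * l1_fourier f \<xi> + b * l1_fourier g \<xi>)"
proof
  fix \<xi> :: "real^2"
  have "(LINT x|lborel. cis (- (x \<bullet> \<xi>)) * (a * f x + b * g x))
      = (LINT x|lborel. a * (cis (- (x \<bullet> \<xi>)) * f x) + b * (cis (- (x \<bullet> \<xi>)) * g x))"
    by (simp add: algebra_simps)
  also have "\<dots> = a * (LINT x|lborel. cis (- (x \<bullet> \<xi>)) * f x) + b * (LINT x|lborel. cis (- (x \<bullet> \<xi>)) * g x)"
    using assms by (subst Bochner_Integration.integral_add) (auto intro!: integrable_mult_right cis_mult_integrable)
  finally show "l1_fourier (\<lambda>x. a * f x + b * g x) \<xi> = a * l1_fourier f \<xi> + b * l1_fourier g \<xi>"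
    by (simp add: l1_fourier_def add_divide_distrib)
qed

lemma l1_fourier_Plancherel:
  assumes int: "integrable lborel f" and f: "f \<in> square_integrable lborel"
  shows l1_fourier_square_integrable: "l1_fourier f \<in> square_integrable lborel"
    and sqnorm_l1_fourier_le: "sqnorm lborel (l1_fourier f) \<le> sqnorm lborel f"
proof -
  have [measurable]: "f \<in> borel_measurable borel" using f by (auto simp: square_integrable_def)
  define E where "E t = (LINT y|lborel. cis (t \<bullet> y) * f y)" for t
  have Em[measurable]: "E \<in> borel_measurable borel"
    unfolding E_def[abs_def] by (intro lborel.borel_measurable_lebesgue_integral) measurable
  have eq: "(cmod (l1_fourier f \<xi>))\<^sup>2 = 1 / (2 * pi)\<^sup>2 * (cmod (E (0 - \<xi>)))\<^sup>2" for \<xi>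
    by (simp add: l1_fourier_def E_def norm_divide power_divide inner_commute)
  have "(\<integral>\<^sup>+ \<xi>. ennreal ((cmod (l1_fourier f \<xi>))\<^sup>2) \<partial>lborel)
     = ennreal (1 / (2 * pi)\<^sup>2) * (\<integral>\<^sup>+ \<xi>. ennreal ((cmod (E (0 - \<xi>)))\<^sup>2) \<partial>lborel)"
    unfolding eq by (subst ennreal_mult) (auto simp: nn_integral_cmult)
  also have "(\<integral>\<^sup>+ \<xi>. ennreal ((cmod (E (0 - \<xi>)))\<^sup>2) \<partial>lborel) = (\<integral>\<^sup>+ \<xi>. ennreal ((cmod (E \<xi>))\<^sup>2) \<partial>lborel)"
    by (rule nn_integral_lborel_reflect) measurable
  also have "ennreal (1 / (2 * pi)\<^sup>2) * \<dots> \<le> ennreal (1 / (2 * pi)\<^sup>2) * (ennreal ((2 * pi)\<^sup>2) * ennreal (sqnorm lborel f))"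
    using Plancherel_bound[OF int] nn_integral_eq_sqnorm[OF f] unfolding E_def
    by (intro mult_left_mono) auto
  also have "\<dots> = ennreal (sqnorm lborel f)"
    by (subst mult.assoc[symmetric], subst ennreal_mult[symmetric]) auto
  finally have le: "(\<integral>\<^sup>+ \<xi>. ennreal ((cmod (l1_fourier f \<xi>))\<^sup>2) \<partial>lborel) \<le> ennreal (sqnorm lborel f)" .
  show "l1_fourier f \<in> square_integrable lborel"
    by (rule square_integrableI_nn_integral[OF _ le]) measurable
  show "sqnorm lborel (l1_fourier f) \<le> sqnorm lborel f"
    by (rule sqnorm_le_nn_integral[OF _ _ le]) auto
qed

lemma truncated_fourier_square_integrable:
  "f \<in> square_integrable lborel \<Longrightarrow> truncated_fourier R f \<in> square_integrable lborel"
  unfolding truncated_fourier_eq by (intro l1_fourier_square_integrable cutoff_integrable cutoff_square_integrable)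

lemma sqnorm_truncated_fourier_diff:
  assumes f: "f \<in> square_integrable lborel"
  shows "sqnorm lborel (\<lambda>\<xi>. truncated_fourier R f \<xi> - truncated_fourier S f \<xi>)
     \<le> 2 * sqnorm lborel (\<lambda>x. cutoff R f x - f x) + 2 * sqnorm lborel (\<lambda>x. cutoff S f x - f x)"
proof -
  have "sqnorm lborel (\<lambda>\<xi>. truncated_fourier R f \<xi> - truncated_fourier S f \<xi>)
      = sqnorm lborel (l1_fourier (\<lambda>x. cutoff R f x - cutoff S f x))"
    unfolding truncated_fourier_eq l1_fourier_diff[OF cutoff_integrable[OF f] cutoff_integrable[OF f]] ..
  also have "\<dots> \<le> sqnorm lborel (\<lambda>x. cutoff R f x - cutoff S f x)"
    by (intro sqnorm_l1_fourier_le Bochner_Integration.integrable_diff square_integrable_diff cutoff_integrable cutoff_square_integrable f)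
  also have "\<dots> \<le> 2 * sqnorm lborel (\<lambda>x. cutoff R f x - f x) + 2 * sqnorm lborel (\<lambda>x. f x - cutoff S f x)"
    by (intro sqnorm_triangle3 cutoff_square_integrable f)
  finally show ?thesis by (simp add: sqnorm_diff_commute[of _ f])
qed

text \<open>
  The Plancherel inequality carries the convergence of the truncations of \<open>f\<close> over
  to their transforms.
\<close>

lemma truncated_fourier_converges:
  assumes f: "f \<in> square_integrable lborel"
  shows "\<exists>g\<in>square_integrable lborel. ((\<lambda>R. sqnorm lborel (\<lambda>\<xi>. truncated_fourier R f \<xi> - g \<xi>)) \<longlongrightarrow> 0) at_top"
proof -
  define c where "c R = sqnorm lborel (\<lambda>x. cutoff R f x - f x)" for R
  have c: "(c \<longlongrightarrow> 0) at_top" unfolding c_def by (rule cutoff_tendsto[OF f])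
  have cn: "(\<lambda>n. c (real n)) \<longlonglongrightarrow> 0" unfolding c_def by (rule cutoff_tendsto_nat[OF f])
  have "\<exists>g\<in>square_integrable lborel. (\<lambda>n. sqnorm lborel (\<lambda>\<xi>. truncated_fourier (real n) f \<xi> - g \<xi>)) \<longlonglongrightarrow> 0"
  proof (rule l2_complete)
    show "truncated_fourier (real n) f \<in> square_integrable lborel" for n
      by (rule truncated_fourier_square_integrable[OF f])
    fix e :: real assume "0 < e"
    then obtain N where N: "\<And>n. n \<ge> N \<Longrightarrow> \<bar>c (real n)\<bar> < e / 4"
      using LIMSEQ_D[OF cn, of "e / 4"] by auto
    show "\<exists>N. \<forall>m\<ge>N. \<forall>n\<ge>N. sqnorm lborel (\<lambda>x. truncated_fourier (real m) f x - truncated_fourier (real n) f x) \<le> e"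
    proof (intro exI[of _ N] allI impI)
      fix m n assume "N \<le> m" "N \<le> n"
      then show "sqnorm lborel (\<lambda>x. truncated_fourier (real m) f x - truncated_fourier (real n) f x) \<le> e"
        using sqnorm_truncated_fourier_diff[OF f, of "real m" "real n"] N[of m] N[of n]
        unfolding c_def[symmetric] by (simp add: abs_less_iff)
    qed
  qed
  then obtain g where g: "g \<in> square_integrable lborel"
    and lim: "(\<lambda>n. sqnorm lborel (\<lambda>\<xi>. truncated_fourier (real n) f \<xi> - g \<xi>)) \<longlonglongrightarrow> 0" by blast
  have le: "sqnorm lborel (\<lambda>\<xi>. truncated_fourier R f \<xi> - g \<xi>) \<le> 4 * c R" for R
  proof -
    have "sqnorm lborel (\<lambda>\<xi>. truncated_fourier R f \<xi> - g \<xi>)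
       \<le> 2 * (2 * c R + 2 * c (real n)) + 2 * sqnorm lborel (\<lambda>\<xi>. truncated_fourier (real n) f \<xi> - g \<xi>)" for n
      using sqnorm_triangle3[OF truncated_fourier_square_integrable[OF f, of R] truncated_fourier_square_integrable[OF f, of "real n"] g]
        sqnorm_truncated_fourier_diff[OF f, of R "real n"] unfolding c_def by simp
    moreover have "(\<lambda>n. 2 * (2 * c R + 2 * c (real n)) + 2 * sqnorm lborel (\<lambda>\<xi>. truncated_fourier (real n) f \<xi> - g \<xi>)) \<longlonglongrightarrow> 2 * (2 * c R + 2 * 0) + 2 * 0"
      by (intro tendsto_intros cn lim)
    ultimately have "sqnorm lborel (\<lambda>\<xi>. truncated_fourier R f \<xi> - g \<xi>) \<le> 2 * (2 * c R + 2 * 0) + 2 * 0"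
      by (intro LIMSEQ_le_const) auto
    then show ?thesis by simp
  qed
  have "((\<lambda>R. sqnorm lborel (\<lambda>\<xi>. truncated_fourier R f \<xi> - g \<xi>)) \<longlongrightarrow> 0) at_top"
  proof (rule tendsto_sandwich[OF _ _ tendsto_const])
    show "((\<lambda>R. 4 * c R) \<longlongrightarrow> 0) at_top" using tendsto_mult_right_zero[OF c] .
  qed (auto simp: le)
  with g show ?thesis by blast
qed

lemma truncated_fourier_nn_limit_iff:
  assumes f: "f \<in> square_integrable lborel" and g: "g \<in> square_integrable lborel"
  shows "((\<lambda>R. \<integral>\<^sup>+ \<xi>. ennreal ((cmod (truncated_fourier R f \<xi> - g \<xi>))\<^sup>2) \<partial>lborel) \<longlongrightarrow> 0) at_top
    \<longleftrightarrow> ((\<lambda>R. sqnorm lborel (\<lambda>\<xi>. truncated_fourier R f \<xi> - g \<xi>)) \<longlongrightarrow> 0) at_top"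
  using nn_integral_eq_sqnorm[OF square_integrable_diff[OF truncated_fourier_square_integrable[OF f] g]]
    tendsto_ennreal_iff[where F=at_top and f="\<lambda>R. sqnorm lborel (\<lambda>\<xi>. truncated_fourier R f \<xi> - g \<xi>)" and x=0]
  by simp

lemma fourier_spec:
  assumes f: "f \<in> square_integrable lborel"
  shows fourier_square_integrable: "fourier f \<in> square_integrable lborel"
    and fourier_tendsto: "((\<lambda>R. sqnorm lborel (\<lambda>\<xi>. truncated_fourier R f \<xi> - fourier f \<xi>)) \<longlongrightarrow> 0) at_top"
proof -
  obtain g where "g \<in> L2" "((\<lambda>R. \<integral>\<^sup>+ \<xi>. ennreal ((cmod (truncated_fourier R f \<xi> - g \<xi>))\<^sup>2) \<partial>lborel) \<longlongrightarrow> 0) at_top"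
    using truncated_fourier_converges[OF f] truncated_fourier_nn_limit_iff[OF f] by (auto simp: L2_eq_square_integrable)
  then have *: "fourier f \<in> L2 \<and> ((\<lambda>R. \<integral>\<^sup>+ \<xi>. ennreal ((cmod (truncated_fourier R f \<xi> - fourier f \<xi>))\<^sup>2) \<partial>lborel) \<longlongrightarrow> 0) at_top"
    unfolding fourier_def by (intro someI2_ex[where Q="\<lambda>g. g \<in> L2 \<and> ((\<lambda>R. \<integral>\<^sup>+ \<xi>. ennreal ((cmod (truncated_fourier R f \<xi> - g \<xi>))\<^sup>2) \<partial>lborel) \<longlongrightarrow> 0) at_top"]) blast+
  then show F: "fourier f \<in> square_integrable lborel" by (simp add: L2_eq_square_integrable)
  show "((\<lambda>R. sqnorm lborel (\<lambda>\<xi>. truncated_fourier R f \<xi> - fourier f \<xi>)) \<longlongrightarrow> 0) at_top"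
    using * truncated_fourier_nn_limit_iff[OF f F] by blast
qed

lemma sqnorm_fourier_le:
  assumes f: "f \<in> square_integrable lborel"
  shows "sqnorm lborel (fourier f) \<le> sqnorm lborel f"
proof (rule tendsto_upperbound)
  show "((\<lambda>R. sqnorm lborel (truncated_fourier R f)) \<longlongrightarrow> sqnorm lborel (fourier f)) at_top"
    by (intro l2_tendsto_sqnorm truncated_fourier_square_integrable fourier_spec f)
  show "\<forall>\<^sub>F R in at_top. sqnorm lborel (truncated_fourier R f) \<le> sqnorm lborel f"
    unfolding truncated_fourier_eq
    by (intro always_eventually allI order_trans[OF sqnorm_l1_fourier_le sqnorm_cutoff_le] cutoff_integrable cutoff_square_integrable f)
qed simp

text \<open>
  The identities for \<open>fourier\<close> below hold for the truncated transforms up to an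
  error that tends to zero in \<open>L\<^sup>2\<close>; this lemma transfers them to the chosen
  representative.
\<close>

lemma fourier_unique:
  assumes f: "f \<in> square_integrable lborel" and g: "g \<in> square_integrable lborel"
    and lim: "((\<lambda>R. sqnorm lborel (\<lambda>\<xi>. truncated_fourier R f \<xi> - g \<xi>)) \<longlongrightarrow> 0) at_top"
  shows "AE \<xi> in lborel. fourier f \<xi> = g \<xi>"
  by (rule l2_limit_unique[where f="\<lambda>R. truncated_fourier R f" and F=at_top, OF truncated_fourier_square_integrable[OF f]
      fourier_square_integrable[OF f] g fourier_tendsto[OF f] lim]) simp

lemma fourier_cong_AE:
  assumes [measurable]: "f \<in> borel_measurable borel" "g \<in> borel_measurable borel" and eq: "AE x in lborel. f x = g x"
  shows "fourier f = fourier g"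
proof -
  have "truncated_fourier R f \<xi> = truncated_fourier R g \<xi>" for R \<xi>
  proof -
    have "(LINT x : cball 0 R | lborel. cis (- (x \<bullet> \<xi>)) * f x) = (LINT x : cball 0 R | lborel. cis (- (x \<bullet> \<xi>)) * g x)"
      unfolding set_lebesgue_integral_def
    proof (rule integral_cong_AE)
      show "AE x in lborel. indicat_real (cball 0 R) x *\<^sub>R (cis (- (x \<bullet> \<xi>)) * f x) = indicat_real (cball 0 R) x *\<^sub>R (cis (- (x \<bullet> \<xi>)) * g x)"
        using eq by eventually_elim simp
    qed measurable
    then show ?thesis by (simp add: truncated_fourier_def)
  qed
  then show ?thesis unfolding fourier_def by simp
qed

lemma fourier_linear:
  assumes f: "f \<in> square_integrable lborel" and g: "g \<in> square_integrable lborel"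
  shows "AE \<xi> in lborel. fourier (\<lambda>x. a * f x + b * g x) \<xi> = a * fourier f \<xi> + b * fourier g \<xi>"
proof (rule fourier_unique)
  show "(\<lambda>x. a * f x + b * g x) \<in> square_integrable lborel"
    by (intro square_integrable_add square_integrable_scale f g)
  show "(\<lambda>\<xi>. a * fourier f \<xi> + b * fourier g \<xi>) \<in> square_integrable lborel"
    by (intro square_integrable_add square_integrable_scale fourier_square_integrable f g)
  have T: "truncated_fourier R (\<lambda>x. a * f x + b * g x) = (\<lambda>\<xi>. a * truncated_fourier R f \<xi> + b * truncated_fourier R g \<xi>)" for R
  proof -
    have "cutoff R (\<lambda>x. a * f x + b * g x) = (\<lambda>x. a * cutoff R f x + b * cutoff R g x)"
      by (auto simp: cutoff_eq_mult algebra_simps)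
    then show ?thesis
      unfolding truncated_fourier_eq by (simp add: l1_fourier_linear cutoff_integrable f g)
  qed
  have D: "(\<lambda>\<xi>. truncated_fourier R h \<xi> - fourier h \<xi>) \<in> square_integrable lborel" if "h \<in> square_integrable lborel" for R h
    using that by (intro square_integrable_diff truncated_fourier_square_integrable fourier_square_integrable)
  have le: "sqnorm lborel (\<lambda>\<xi>. truncated_fourier R (\<lambda>x. a * f x + b * g x) \<xi> - (a * fourier f \<xi> + b * fourier g \<xi>))
     \<le> 2 * ((cmod a)\<^sup>2 * sqnorm lborel (\<lambda>\<xi>. truncated_fourier R f \<xi> - fourier f \<xi>))
       + 2 * ((cmod b)\<^sup>2 * sqnorm lborel (\<lambda>\<xi>. truncated_fourier R g \<xi> - fourier g \<xi>))" for R
    using sqnorm_add_le[OF square_integrable_scale[OF D[OF f, of R], of a] square_integrable_scale[OF D[OF g, of R], of b]]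
    unfolding sqnorm_scale T by (simp add: algebra_simps)
  show "((\<lambda>R. sqnorm lborel (\<lambda>\<xi>. truncated_fourier R (\<lambda>x. a * f x + b * g x) \<xi> - (a * fourier f \<xi> + b * fourier g \<xi>))) \<longlongrightarrow> 0) at_top"
  proof (rule tendsto_sandwich[OF _ _ tendsto_const])
    have "((\<lambda>R. 2 * ((cmod a)\<^sup>2 * sqnorm lborel (\<lambda>\<xi>. truncated_fourier R f \<xi> - fourier f \<xi>))
       + 2 * ((cmod b)\<^sup>2 * sqnorm lborel (\<lambda>\<xi>. truncated_fourier R g \<xi> - fourier g \<xi>))) \<longlongrightarrow> 2 * ((cmod a)\<^sup>2 * 0) + 2 * ((cmod b)\<^sup>2 * 0)) at_top"
      by (intro tendsto_intros fourier_tendsto f g)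
    then show "((\<lambda>R. 2 * ((cmod a)\<^sup>2 * sqnorm lborel (\<lambda>\<xi>. truncated_fourier R f \<xi> - fourier f \<xi>))
       + 2 * ((cmod b)\<^sup>2 * sqnorm lborel (\<lambda>\<xi>. truncated_fourier R g \<xi> - fourier g \<xi>))) \<longlongrightarrow> 0) at_top"
      by simp
  qed (auto intro!: always_eventually le)
qed

lemma fourier_eq_l1_fourier:
  assumes f: "f \<in> square_integrable lborel" and int: "integrable lborel f"
  shows "AE \<xi> in lborel. fourier f \<xi> = l1_fourier f \<xi>"
proof (rule fourier_unique[OF f l1_fourier_square_integrable[OF int f]])
  have le: "sqnorm lborel (\<lambda>\<xi>. truncated_fourier R f \<xi> - l1_fourier f \<xi>) \<le> sqnorm lborel (\<lambda>x. cutoff R f x - f x)" for R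
    unfolding truncated_fourier_eq l1_fourier_diff[OF cutoff_integrable[OF f] int, symmetric]
    by (intro sqnorm_l1_fourier_le Bochner_Integration.integrable_diff square_integrable_diff cutoff_integrable cutoff_square_integrable f int)
  show "((\<lambda>R. sqnorm lborel (\<lambda>\<xi>. truncated_fourier R f \<xi> - l1_fourier f \<xi>)) \<longlongrightarrow> 0) at_top"
    by (rule tendsto_sandwich[OF _ _ tendsto_const cutoff_tendsto[OF f]]) (auto simp: le)
qed

lemma fourier_modulation:
  assumes f: "f \<in> square_integrable lborel"
  shows "AE \<xi> in lborel. fourier (\<lambda>x. cis (a \<bullet> x) * f x) \<xi> = fourier f (\<xi> - a)"
proof (rule fourier_unique)
  have [measurable]: "f \<in> borel_measurable borel" using f by (auto simp: square_integrable_def)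
  show "(\<lambda>x. cis (a \<bullet> x) * f x) \<in> square_integrable lborel"
    by (rule square_integrable_mult_bounded[OF _ f, where c=1]) auto
  show "(\<lambda>\<xi>. fourier f (\<xi> - a)) \<in> square_integrable lborel"
    using square_integrable_isometry[of 1 "fourier f" "- a"] fourier_square_integrable[OF f] by simp
  have T: "truncated_fourier R (\<lambda>x. cis (a \<bullet> x) * f x) \<xi> = truncated_fourier R f (\<xi> - a)" for R \<xi>
    unfolding truncated_fourier_def mult.assoc[symmetric] cis_mult
    by (simp add: inner_diff_right inner_commute)
  have [measurable]: "truncated_fourier R f \<in> borel_measurable borel" "fourier f \<in> borel_measurable borel" for R
    using truncated_fourier_square_integrable[OF f] fourier_square_integrable[OF f] by (auto simp: square_integrable_def)
  have "sqnorm lborel (\<lambda>\<xi>. truncated_fourier R f (\<xi> - a) - fourier f (\<xi> - a)) = sqnorm lborel (\<lambda>\<xi>. truncated_fourier R f \<xi> - fourier f \<xi>)" for R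
    using sqnorm_isometry[of 1 "\<lambda>\<xi>. truncated_fourier R f \<xi> - fourier f \<xi>" "- a"] by simp
  then show "((\<lambda>R. sqnorm lborel (\<lambda>\<xi>. truncated_fourier R (\<lambda>x. cis (a \<bullet> x) * f x) \<xi> - fourier f (\<xi> - a))) \<longlongrightarrow> 0) at_top"
    unfolding T using fourier_tendsto[OF f] by simp
qed

lemma fourier_reflection:
  assumes f: "f \<in> square_integrable lborel"
  shows "AE \<xi> in lborel. fourier (\<lambda>x. f (- x)) \<xi> = fourier f (- \<xi>)"
proof (rule fourier_unique)
  have [measurable]: "f \<in> borel_measurable borel" using f by (auto simp: square_integrable_def)
  show "(\<lambda>x. f (- x)) \<in> square_integrable lborel"
    using square_integrable_isometry[of "-1" f 0] f by simp
  show "(\<lambda>\<xi>. fourier f (- \<xi>)) \<in> square_integrable lborel"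
    using square_integrable_isometry[of "-1" "fourier f" 0] fourier_square_integrable[OF f] by simp
  have T: "truncated_fourier R (\<lambda>x. f (- x)) \<xi> = truncated_fourier R f (- \<xi>)" for R \<xi>
    using lborel_integral_isometry[of "-1" "\<lambda>x. indicat_real (cball 0 R) x *\<^sub>R (cis (- (x \<bullet> - \<xi>)) * f x)" 0]
    unfolding truncated_fourier_def set_lebesgue_integral_def by (simp add: indicator_def)
  have [measurable]: "truncated_fourier R f \<in> borel_measurable borel" "fourier f \<in> borel_measurable borel" for R
    using truncated_fourier_square_integrable[OF f] fourier_square_integrable[OF f] by (auto simp: square_integrable_def)
  have "sqnorm lborel (\<lambda>\<xi>. truncated_fourier R f (- \<xi>) - fourier f (- \<xi>)) = sqnorm lborel (\<lambda>\<xi>. truncated_fourier R f \<xi> - fourier f \<xi>)" for R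
    using sqnorm_isometry[of "-1" "\<lambda>\<xi>. truncated_fourier R f \<xi> - fourier f \<xi>" 0] by simp
  then show "((\<lambda>R. sqnorm lborel (\<lambda>\<xi>. truncated_fourier R (\<lambda>x. f (- x)) \<xi> - fourier f (- \<xi>))) \<longlongrightarrow> 0) at_top"
    unfolding T using fourier_tendsto[OF f] by simp
qed

lemma l1_fourier_multiplication_formula:
  assumes f: "integrable lborel f" and g: "integrable lborel g"
  shows "(LINT x|lborel. l1_fourier f x * g x) = (LINT x|lborel. f x * l1_fourier g x)"
proof -
  have [measurable]: "f \<in> borel_measurable borel" "g \<in> borel_measurable borel" using f g by auto
  have FI: "integrable (lborel \<Otimes>\<^sub>M lborel) (\<lambda>(x, y). cis (- (x \<bullet> y)) * f x * g y)"
    by (rule Bochner_Integration.integrable_bound[OF integrable_pair_mult[OF lborel.sigma_finite_measure_axioms lborel.sigma_finite_measure_axioms f g]])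
       (auto simp: norm_mult split_beta)
  have "(LINT y|lborel. (LINT x|lborel. cis (- (x \<bullet> y)) * f x) * g y) = (LINT y|lborel. LINT x|lborel. cis (- (x \<bullet> y)) * f x * g y)"
    by simp
  also have "\<dots> = (LINT x|lborel. LINT y|lborel. cis (- (x \<bullet> y)) * f x * g y)"
    using lborel_pair.Fubini_integral[OF FI] by simp
  also have "\<dots> = (LINT x|lborel. f x * (LINT y|lborel. cis (- (y \<bullet> x)) * g y))"
    unfolding integral_mult_right_zero[symmetric] by (simp add: mult_ac inner_commute)
  finally show ?thesis by (simp add: l1_fourier_def)
qed

text \<open>
  For truncated functions this is Fubini's theorem. The two truncations are removed one after
  the other.
\<close>

lemma fourier_multiplication_formula:
  assumes f: "f \<in> square_integrable lborel" and g: "g \<in> square_integrable lborel"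
  shows "(LINT x|lborel. fourier f x * g x) = (LINT x|lborel. f x * fourier g x)"
proof -
  have pair: "(LINT x|lborel. u x * v x) = l2_inner lborel u (\<lambda>x. cnj (v x))" for u v :: "real^2 \<Rightarrow> complex"
    by (simp add: l2_inner_def)
  have comm: "(LINT x|lborel. u x * v x) = (LINT x|lborel. v x * u x)" for u v :: "real^2 \<Rightarrow> complex"
    by (simp add: mult.commute)
  have lim: "((\<lambda>R. LINT x|lborel. u R x * v x) \<longlongrightarrow> (LINT x|lborel. w x * v x)) at_top"
    if "\<And>R. u R \<in> square_integrable lborel" "w \<in> square_integrable lborel" "v \<in> square_integrable lborel"
      "((\<lambda>R. sqnorm lborel (\<lambda>x. u R x - w x)) \<longlongrightarrow> 0) at_top" for u :: "real \<Rightarrow> real^2 \<Rightarrow> complex" and v w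
    unfolding pair by (intro l2_tendsto_inner that square_integrable_cnj)
  have step1: "(LINT x|lborel. fourier f x * cutoff S g x) = (LINT x|lborel. f x * truncated_fourier S g x)" for S
  proof (rule tendsto_unique)
    have eq: "(LINT x|lborel. truncated_fourier R f x * cutoff S g x) = (LINT x|lborel. cutoff R f x * truncated_fourier S g x)" for R
      unfolding truncated_fourier_eq by (intro l1_fourier_multiplication_formula cutoff_integrable f g)
    show "((\<lambda>R. LINT x|lborel. truncated_fourier R f x * cutoff S g x) \<longlongrightarrow> (LINT x|lborel. fourier f x * cutoff S g x)) at_top"
      by (intro lim truncated_fourier_square_integrable fourier_spec cutoff_square_integrable f g)
    show "((\<lambda>R. LINT x|lborel. truncated_fourier R f x * cutoff S g x) \<longlongrightarrow> (LINT x|lborel. f x * truncated_fourier S g x)) at_top"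
      unfolding eq by (intro lim truncated_fourier_square_integrable cutoff_square_integrable cutoff_tendsto f g)
  qed simp
  show ?thesis
  proof (rule tendsto_unique)
    show "((\<lambda>S. LINT x|lborel. fourier f x * cutoff S g x) \<longlongrightarrow> (LINT x|lborel. fourier f x * g x)) at_top"
      unfolding comm[of "fourier f"]
      by (intro lim fourier_square_integrable cutoff_square_integrable cutoff_tendsto f g)
    show "((\<lambda>S. LINT x|lborel. fourier f x * cutoff S g x) \<longlongrightarrow> (LINT x|lborel. f x * fourier g x)) at_top"
      unfolding step1 comm[of f]
      by (intro lim fourier_spec truncated_fourier_square_integrable f g)
  qed simp
qed

lemma gauss_weight_square_integrable:
  "(\<lambda>x::'v::euclidean_space. complex_of_real (gauss_weight 1 x)) \<in> square_integrable lborel"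
proof (rule square_integrable_bound)
  show "integrable lborel (gauss_weight 1 :: 'v \<Rightarrow> real)" by (rule integrable_gauss_weight) simp
  show "(cmod (complex_of_real (gauss_weight 1 x)))\<^sup>2 \<le> gauss_weight 1 x" for x :: 'v
    using gauss_weight_pos[of 1 x] gauss_weight_le_1[of 1 x] by (simp add: power2_eq_square mult_left_le)
qed measurable

text \<open>
  The double transform of a modulated Gaussian is computed explicitly. By the multiplication
  formula, \<open>fourier (fourier f)\<close> and the reflection of \<open>f\<close> have the
  same pairings with all of them, so their difference times the Gaussian has vanishing Fourier
  transform.
\<close>

theorem fourier_fourier:
  assumes f: "f \<in> square_integrable lborel"
  shows "AE x in lborel. fourier (fourier f) x = f (- x)"
proof -
  define \<gamma> :: "real^2 \<Rightarrow> complex" where "\<gamma> x = complex_of_real (gauss_weight 1 x)" for x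
  have \<gamma>m[measurable]: "\<gamma> \<in> borel_measurable borel" unfolding \<gamma>_def[abs_def] by measurable
  have \<gamma>: "\<gamma> \<in> square_integrable lborel" "integrable lborel \<gamma>"
    unfolding \<gamma>_def[abs_def] using integrable_gauss_weight[of 1, where 'v="real^2"]
    by (auto intro!: gauss_weight_square_integrable integrable_of_real)
  have \<gamma>_hat: "l1_fourier (\<lambda>x. cis (a \<bullet> x) * \<gamma> x) \<xi> = \<gamma> (a - \<xi>)" for a \<xi>
  proof -
    have "(LINT x|lborel. cis (- (x \<bullet> \<xi>)) * (cis (a \<bullet> x) * \<gamma> x)) = (LINT x|lborel. cis (x \<bullet> (a - \<xi>)) * complex_of_real (gauss_weight 1 x))"
      unfolding mult.assoc[symmetric] cis_mult \<gamma>_def by (simp add: inner_diff_right inner_commute)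
    also have "\<dots> = complex_of_real (heat 1 (a - \<xi>))" by (rule integral_cis_gauss) simp
    also have "heat 1 (a - \<xi>) = 2 * pi * gauss_weight 1 (a - \<xi>)" by (simp add: heat_eq_gauss_weight power_mult_distrib[symmetric])
    finally show ?thesis by (simp add: l1_fourier_def \<gamma>_def)
  qed
  have even: "\<gamma> (- x) = \<gamma> x" for x by (simp add: \<gamma>_def gauss_weight_def)
  have ka: "(\<lambda>x. cis (a \<bullet> x) * \<gamma> x) \<in> square_integrable lborel" "integrable lborel (\<lambda>x. cis (a \<bullet> x) * \<gamma> x)" for a
    by (rule square_integrable_mult_bounded[OF _ \<gamma>(1), where c=1]) (auto intro!: cis_mult_integrable \<gamma>)
  have ga: "(\<lambda>x. \<gamma> (a - x)) \<in> square_integrable lborel" "integrable lborel (\<lambda>x. \<gamma> (a - x))" for a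
    using square_integrable_isometry[of "-1" \<gamma> a] lborel_integrable_isometry[of "-1" \<gamma> a] \<gamma> by simp_all
  have Fka: "fourier (fourier (\<lambda>x. cis (a \<bullet> x) * \<gamma> x)) = fourier (\<lambda>x. \<gamma> (a - x))" for a
    using fourier_eq_l1_fourier[OF ka] fourier_square_integrable[OF ka(1)] unfolding \<gamma>_hat
    by (intro fourier_cong_AE) (auto simp: square_integrable_def)
  have Fga: "l1_fourier (\<lambda>x. \<gamma> (a - x)) \<xi> = cis (a \<bullet> (- \<xi>)) * \<gamma> (- \<xi>)" for a \<xi>
  proof -
    have "(LINT x|lborel. cis (- (x \<bullet> \<xi>)) * \<gamma> (a - x)) = (LINT x|lborel. cis (- ((a - x) \<bullet> \<xi>)) * \<gamma> (a - (a - x)))"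
      using lborel_integral_isometry[of "-1" "\<lambda>x. cis (- (x \<bullet> \<xi>)) * \<gamma> (a - x)" a] by simp
    also have "\<dots> = (LINT x|lborel. cis (a \<bullet> (- \<xi>)) * (cis (x \<bullet> \<xi>) * \<gamma> x))"
      unfolding mult.assoc[symmetric] cis_mult by (simp add: inner_diff_left)
    also have "\<dots> = cis (a \<bullet> (- \<xi>)) * complex_of_real (heat 1 \<xi>)"
      unfolding \<gamma>_def integral_mult_right_zero by (subst integral_cis_gauss) auto
    also have "heat 1 \<xi> = 2 * pi * gauss_weight 1 \<xi>" by (simp add: heat_eq_gauss_weight power_mult_distrib[symmetric])
    finally show ?thesis by (simp add: l1_fourier_def even) (simp add: \<gamma>_def)
  qed
  have FFka: "AE x in lborel. fourier (fourier (\<lambda>x. cis (a \<bullet> x) * \<gamma> x)) x = cis (a \<bullet> (- x)) * \<gamma> (- x)" for a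
    unfolding Fka using fourier_eq_l1_fourier[OF ga] unfolding Fga .
  define D where "D x = fourier (fourier f) x - f (- x)" for x
  have fr: "(\<lambda>x. f (- x)) \<in> square_integrable lborel"
    using square_integrable_isometry[of "-1" f 0] f by simp
  have FF: "fourier (fourier f) \<in> square_integrable lborel" by (intro fourier_square_integrable f)
  have D: "D \<in> square_integrable lborel"
    unfolding D_def using FF fr by (rule square_integrable_diff)
  have fm[measurable]: "f \<in> borel_measurable borel" using f by (auto simp: square_integrable_def)
  have "(LINT x|lborel. cis (a \<bullet> x) * (D x * \<gamma> x)) = 0" for a
  proof -
    let ?k = "\<lambda>x. cis (a \<bullet> x) * \<gamma> x"
    have FFkm[measurable]: "fourier (fourier ?k) \<in> borel_measurable borel"
      using fourier_square_integrable[OF fourier_square_integrable[OF ka(1)[of a]]] by (auto simp: square_integrable_def)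
    have "(LINT x|lborel. fourier (fourier f) x * ?k x) = (LINT x|lborel. fourier f x * fourier ?k x)"
      by (intro fourier_multiplication_formula fourier_square_integrable f ka)
    also have "\<dots> = (LINT x|lborel. f x * fourier (fourier ?k) x)"
      by (intro fourier_multiplication_formula fourier_square_integrable f ka)
    also have "\<dots> = (LINT x|lborel. f x * ?k (- x))"
      by (intro integral_cong_AE) (use FFka[of a] in auto)
    also have "\<dots> = (LINT x|lborel. f (- x) * ?k x)"
      using lborel_integral_isometry[of "-1" "\<lambda>x. f x * ?k (- x)" 0] by simp
    finally have "(LINT x|lborel. fourier (fourier f) x * ?k x) - (LINT x|lborel. f (- x) * ?k x) = 0" by simp
    then have "(LINT x|lborel. fourier (fourier f) x * ?k x - f (- x) * ?k x) = 0"
      by (subst Bochner_Integration.integral_diff) (auto intro!: integrable_mult_square_integrable FF fr ka)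
    moreover have "fourier (fourier f) x * ?k x - f (- x) * ?k x = cis (a \<bullet> x) * (D x * \<gamma> x)" for x
      unfolding D_def by (simp only: left_diff_distrib right_diff_distrib mult.assoc mult.left_commute)
    ultimately show ?thesis by simp
  qed
  then have "AE x in lborel. D x * \<gamma> x = 0"
    by (intro L1_fourier_injective integrable_mult_square_integrable D \<gamma>)
  then show ?thesis
  proof eventually_elim
    case (elim x)
    have "\<gamma> x \<noteq> 0" using gauss_weight_pos[of 1 x] by (simp add: \<gamma>_def)
    then show ?case using elim by (simp add: D_def)
  qed
qed

lemma inverse_fourier_square_integrable:
  "g \<in> square_integrable lborel \<Longrightarrow> inverse_fourier g \<in> square_integrable lborel"
  using square_integrable_isometry[of "-1" "fourier g" 0] fourier_square_integrable[of g]
  by (simp add: inverse_fourier_def[abs_def])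

lemma sqnorm_inverse_fourier_le:
  assumes g: "g \<in> square_integrable lborel"
  shows "sqnorm lborel (inverse_fourier g) \<le> sqnorm lborel g"
proof -
  have "fourier g \<in> borel_measurable borel" using fourier_square_integrable[OF g] by (auto simp: square_integrable_def)
  then have "sqnorm lborel (inverse_fourier g) = sqnorm lborel (fourier g)"
    using sqnorm_isometry[of "-1" "fourier g" 0] by (simp add: inverse_fourier_def[abs_def])
  then show ?thesis using sqnorm_fourier_le[OF g] by simp
qed

lemma fourier_inverse_fourier:
  assumes g: "g \<in> square_integrable lborel"
  shows "AE \<xi> in lborel. fourier (inverse_fourier g) \<xi> = g \<xi>"
  using fourier_reflection[OF fourier_square_integrable[OF g]] AE_lborel_reflect[OF fourier_fourier[OF g]]
  unfolding inverse_fourier_def[abs_def] by eventually_elim simp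

lemma inverse_fourier_fourier:
  assumes f: "f \<in> square_integrable lborel"
  shows "AE x in lborel. inverse_fourier (fourier f) x = f x"
  using AE_lborel_reflect[OF fourier_fourier[OF f]]
  unfolding inverse_fourier_def by eventually_elim simp

lemma inverse_fourier_cong_AE:
  "f \<in> borel_measurable borel \<Longrightarrow> g \<in> borel_measurable borel \<Longrightarrow> AE x in lborel. f x = g x \<Longrightarrow> inverse_fourier f = inverse_fourier g"
  unfolding inverse_fourier_def[abs_def] using fourier_cong_AE[of f g] by simp

lemma inverse_fourier_linear:
  assumes "f \<in> square_integrable lborel" "g \<in> square_integrable lborel"
  shows "AE x in lborel. inverse_fourier (\<lambda>x. a * f x + b * g x) x = a * inverse_fourier f x + b * inverse_fourier g x"
  using AE_lborel_reflect[OF fourier_linear[OF assms, of a b]]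
  unfolding inverse_fourier_def by eventually_elim simp

lemma inverse_fourier_add:
  assumes "f \<in> square_integrable lborel" "g \<in> square_integrable lborel"
  shows "AE x in lborel. inverse_fourier (\<lambda>x. f x + g x) x = inverse_fourier f x + inverse_fourier g x"
  using inverse_fourier_linear[OF assms, of 1 1] by simp

lemma inverse_fourier_diff:
  assumes "f \<in> square_integrable lborel" "g \<in> square_integrable lborel"
  shows "AE x in lborel. inverse_fourier (\<lambda>x. f x - g x) x = inverse_fourier f x - inverse_fourier g x"
  using inverse_fourier_linear[OF assms, of 1 "-1"] by simp

lemma inverse_fourier_modulation:
  assumes "f \<in> square_integrable lborel"
  shows "AE x in lborel. inverse_fourier (\<lambda>\<xi>. cis (- (a \<bullet> \<xi>)) * f \<xi>) x = inverse_fourier f (x - a)"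
  using AE_lborel_reflect[OF fourier_modulation[OF assms, of "- a"]]
  unfolding inverse_fourier_def by eventually_elim simp

lemma inverse_fourier_eq_l1:
  assumes f: "f \<in> square_integrable lborel" and int: "integrable lborel f"
  shows "AE x in lborel. inverse_fourier f x = (LINT \<xi>|lborel. cis (x \<bullet> \<xi>) * f \<xi>) / complex_of_real (2 * pi)"
  using AE_lborel_reflect[OF fourier_eq_l1_fourier[OF f int]]
  unfolding inverse_fourier_def l1_fourier_def by eventually_elim (simp add: inner_commute)

section \<open>The square of a free wave\<close>

text \<open>
  The map \<open>(m, z) \<mapsto> (m + z, m - z)\<close> has Jacobian determinant
  \<open>2\<^sup>d\<close> in absolute value.
\<close>

lemma nn_integral_sum_difference:
  fixes h k :: "'v::euclidean_space \<Rightarrow> ennreal"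
  assumes [measurable]: "h \<in> borel_measurable borel" "k \<in> borel_measurable borel"
  shows "ennreal (2 ^ DIM('v)) * (\<integral>\<^sup>+ m. \<integral>\<^sup>+ z. h (m + z) * k (m - z) \<partial>lborel \<partial>lborel)
    = (\<integral>\<^sup>+ x. h x \<partial>lborel) * (\<integral>\<^sup>+ x. k x \<partial>lborel)"
proof -
  have "(\<integral>\<^sup>+ z. h (m + z) * k (m - z) \<partial>lborel) = (\<integral>\<^sup>+ y. h (- y + 2 *\<^sub>R m) * k y \<partial>lborel)" for m
    using nn_integral_lborel_reflect[of "\<lambda>z. h (m + z) * k (m - z)" m]
    by (simp add: scaleR_2 algebra_simps)
  then have "(\<integral>\<^sup>+ m. \<integral>\<^sup>+ z. h (m + z) * k (m - z) \<partial>lborel \<partial>lborel)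
     = (\<integral>\<^sup>+ m. \<integral>\<^sup>+ y. h (- y + 2 *\<^sub>R m) * k y \<partial>lborel \<partial>lborel)" by simp
  also have "\<dots> = (\<integral>\<^sup>+ y. \<integral>\<^sup>+ m. h (- y + 2 *\<^sub>R m) * k y \<partial>lborel \<partial>lborel)"
    by (rule lborel_pair.Fubini') measurable
  also have "\<dots> = (\<integral>\<^sup>+ y. (\<integral>\<^sup>+ m. h (- y + 2 *\<^sub>R m) \<partial>lborel) * k y \<partial>lborel)"
    by (intro nn_integral_cong nn_integral_multc) measurable
  finally have "ennreal (2 ^ DIM('v)) * (\<integral>\<^sup>+ m. \<integral>\<^sup>+ z. h (m + z) * k (m - z) \<partial>lborel \<partial>lborel)
     = ennreal (2 ^ DIM('v)) * (\<integral>\<^sup>+ y. (\<integral>\<^sup>+ m. h (- y + 2 *\<^sub>R m) \<partial>lborel) * k y \<partial>lborel)"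
    by simp
  also have "\<dots> = (\<integral>\<^sup>+ y. ennreal (2 ^ DIM('v)) * ((\<integral>\<^sup>+ m. h (- y + 2 *\<^sub>R m) \<partial>lborel) * k y) \<partial>lborel)"
    by (rule nn_integral_cmult[symmetric]) measurable
  also have "\<dots> = (\<integral>\<^sup>+ y. (\<integral>\<^sup>+ x. h x \<partial>lborel) * k y \<partial>lborel)"
  proof (rule nn_integral_cong)
    fix y :: 'v
    have "ennreal (2 ^ DIM('v)) * (\<integral>\<^sup>+ m. h (- y + 2 *\<^sub>R m) \<partial>lborel) = (\<integral>\<^sup>+ x. h x \<partial>lborel)"
      using nn_integral_lborel_affine[of h 2 "- y"] by simp
    then show "ennreal (2 ^ DIM('v)) * ((\<integral>\<^sup>+ m. h (- y + 2 *\<^sub>R m) \<partial>lborel) * k y) = (\<integral>\<^sup>+ x. h x \<partial>lborel) * k y"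
      by (simp only: mult.assoc[symmetric])
  qed
  also have "\<dots> = (\<integral>\<^sup>+ x. h x \<partial>lborel) * (\<integral>\<^sup>+ x. k x \<partial>lborel)"
    by (rule nn_integral_cmult) measurable
  finally show ?thesis .
qed

lemma integrable_sum_difference:
  fixes a b :: "'v::euclidean_space \<Rightarrow> complex"
  assumes a: "integrable lborel a" and b: "integrable lborel b"
  shows "integrable (lborel \<Otimes>\<^sub>M lborel) (\<lambda>(m, z). a (m + z) * b (m - z))"
proof (rule integrableI_bounded)
  have [measurable]: "a \<in> borel_measurable borel" "b \<in> borel_measurable borel" using a b by auto
  show "(\<lambda>(m, z). a (m + z) * b (m - z)) \<in> borel_measurable (lborel \<Otimes>\<^sub>M lborel)" by measurable
  have "(\<integral>\<^sup>+ p. ennreal (norm (case p of (m, z) \<Rightarrow> a (m + z) * b (m - z))) \<partial>(lborel \<Otimes>\<^sub>M lborel))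
     = (\<integral>\<^sup>+ m. \<integral>\<^sup>+ z. ennreal (norm (a (m + z))) * ennreal (norm (b (m - z))) \<partial>lborel \<partial>lborel)"
    by (subst lborel.nn_integral_fst[symmetric]) (auto simp: norm_mult ennreal_mult)
  also have "\<dots> \<le> ennreal (2 ^ DIM('v)) * \<dots>"
  proof -
    have "1 \<le> ennreal (2 ^ DIM('v))"
      by (subst ennreal_1[symmetric], rule ennreal_leI) simp
    from mult_right_mono[OF this] show ?thesis by fastforce
  qed
  also have "\<dots> = (\<integral>\<^sup>+ x. ennreal (norm (a x)) \<partial>lborel) * (\<integral>\<^sup>+ x. ennreal (norm (b x)) \<partial>lborel)"
    by (rule nn_integral_sum_difference) measurable
  also have "\<dots> < \<infinity>"
    using a b by (simp add: integrable_iff_bounded ennreal_mult_less_top)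
  finally show "(\<integral>\<^sup>+ p. ennreal (norm (case p of (m, z) \<Rightarrow> a (m + z) * b (m - z))) \<partial>(lborel \<Otimes>\<^sub>M lborel)) < \<infinity>" .
qed

lemma integral_square_sum_difference:
  fixes a :: "'v::euclidean_space \<Rightarrow> complex"
  assumes a: "integrable lborel a"
  shows "(LINT x|lborel. a x)\<^sup>2 = 2 ^ DIM('v) * (LINT m|lborel. LINT z|lborel. a (m + z) * a (m - z))"
proof -
  have am[measurable]: "a \<in> borel_measurable borel" using a by auto
  have aff: "(LINT x|lborel. a x) = 2 ^ DIM('v) * (LINT m|lborel. a (2 *\<^sub>R m - y))" for y
  proof -
    have "(LINT x|lborel. a x) = (LINT x|density (distr lborel borel (\<lambda>x. - y + 2 *\<^sub>R x)) (\<lambda>_. ennreal (\<bar>2\<bar> ^ DIM('v))). a x)"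
      using lborel_affine[of 2 "- y"] by simp
    also have "\<dots> = (LINT m|lborel. (2 ^ DIM('v)) *\<^sub>R a (2 *\<^sub>R m - y))"
      by (subst integral_density, measurable) (auto simp: integral_distr)
    finally show ?thesis by (simp add: scaleR_conv_of_real)
  qed
  have inner: "(LINT z|lborel. a (m + z) * a (m - z)) = (LINT y|lborel. a y * a (2 *\<^sub>R m - y))" for m
    using lborel_integral_isometry[of "-1" "\<lambda>z. a (m + z) * a (m - z)" m]
    by (simp add: scaleR_2 algebra_simps)
  have FI: "integrable (lborel \<Otimes>\<^sub>M lborel) (\<lambda>(m, y). a y * a (2 *\<^sub>R m - y))"
  proof (rule integrableI_bounded)
    show "(\<lambda>(m, y). a y * a (2 *\<^sub>R m - y)) \<in> borel_measurable (lborel \<Otimes>\<^sub>M lborel)" by measurable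
    have "(\<integral>\<^sup>+ p. ennreal (norm (case p of (m, y) \<Rightarrow> a y * a (2 *\<^sub>R m - y))) \<partial>(lborel \<Otimes>\<^sub>M lborel))
      = (\<integral>\<^sup>+ m. \<integral>\<^sup>+ y. ennreal (norm (a y * a (2 *\<^sub>R m - y))) \<partial>lborel \<partial>lborel)"
      by (subst lborel.nn_integral_fst[symmetric]) auto
    also have "\<dots> = (\<integral>\<^sup>+ m. \<integral>\<^sup>+ z. ennreal (norm (a (m + z) * a (m - z))) \<partial>lborel \<partial>lborel)"
    proof (rule nn_integral_cong)
      fix m :: 'v
      show "(\<integral>\<^sup>+ y. ennreal (norm (a y * a (2 *\<^sub>R m - y))) \<partial>lborel) = (\<integral>\<^sup>+ z. ennreal (norm (a (m + z) * a (m - z))) \<partial>lborel)"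
        using nn_integral_lborel_reflect[of "\<lambda>z. ennreal (norm (a (m + z) * a (m - z)))" m]
        by (simp add: scaleR_2 algebra_simps)
    qed
    also have "\<dots> = (\<integral>\<^sup>+ p. ennreal (norm (case p of (m, z) \<Rightarrow> a (m + z) * a (m - z))) \<partial>(lborel \<Otimes>\<^sub>M lborel))"
      by (subst lborel.nn_integral_fst[symmetric]) auto
    also have "\<dots> < \<infinity>"
      using integrable_sum_difference[OF a a] unfolding integrable_iff_bounded by simp
    finally show "(\<integral>\<^sup>+ p. ennreal (norm (case p of (m, y) \<Rightarrow> a y * a (2 *\<^sub>R m - y))) \<partial>(lborel \<Otimes>\<^sub>M lborel)) < \<infinity>" .
  qed
  have "2 ^ DIM('v) * (LINT m|lborel. LINT z|lborel. a (m + z) * a (m - z))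
    = 2 ^ DIM('v) * (LINT y|lborel. LINT m|lborel. a y * a (2 *\<^sub>R m - y))"
    unfolding inner using lborel_pair.Fubini_integral[OF FI] by simp
  also have "\<dots> = (LINT y|lborel. a y * (2 ^ DIM('v) * (LINT m|lborel. a (2 *\<^sub>R m - y))))"
    unfolding integral_mult_right_zero by (simp add: mult_ac flip: integral_mult_right_zero)
  also have "\<dots> = (LINT x|lborel. a x)\<^sup>2"
    unfolding aff[symmetric] by (simp add: power2_eq_square)
  finally show ?thesis by simp
qed

text \<open>
  The solution of the free equation with initial spectrum \<open>G\<close>, as an absolutely
  convergent integral.
\<close>

definition free_wave :: "(real^2 \<Rightarrow> complex) \<Rightarrow> real \<Rightarrow> real^2 \<Rightarrow> complex" where
  "free_wave G t x = (LINT \<xi>|lborel. cis (x \<bullet> \<xi> - t * (norm \<xi>)\<^sup>2) * G \<xi>) / complex_of_real (2 * pi)"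

text \<open>
  Up to a unimodular factor and a constant, the spectrum at frequency \<open>2 m\<close> of the
  square of the free wave at time \<open>t\<close>.
\<close>

definition pair_wave :: "(real^2 \<Rightarrow> complex) \<Rightarrow> real \<Rightarrow> real^2 \<Rightarrow> complex" where
  "pair_wave G t m = (LINT z|lborel. cis (t * (- 2 * (norm z)\<^sup>2)) * (G (m + z) * G (m - z)))"

lemma pair_wave_measurable [measurable]:
  assumes [measurable]: "G \<in> borel_measurable borel"
  shows "(\<lambda>(t, m). pair_wave G t m) \<in> borel_measurable (borel \<Otimes>\<^sub>M borel)"
  unfolding pair_wave_def split_beta'
  by (intro lborel.borel_measurable_lebesgue_integral) measurable

lemma norm_parallelogram:
  "(norm (m + z))\<^sup>2 + (norm (m - z))\<^sup>2 = 2 * (norm m)\<^sup>2 + 2 * (norm (z::'v::euclidean_space))\<^sup>2"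
  by (simp add: power2_norm_eq_inner inner_add_left inner_add_right inner_diff_left inner_diff_right inner_commute)

text \<open>
  The product of the waves at the frequencies \<open>m + z\<close> and \<open>m - z\<close>
  oscillates in time with the sum of the squares of the two frequencies, which the parallelogram
  law splits into a part depending on \<open>m\<close> and a part depending on \<open>z\<close>.
\<close>

lemma free_wave_square:
  assumes G: "integrable lborel G"
  shows "(free_wave G t x)\<^sup>2 = (LINT m|lborel. cis ((2 *\<^sub>R x) \<bullet> m) * (cis (- (2 * t * (norm m)\<^sup>2)) * pair_wave G t m)) / complex_of_real (pi\<^sup>2)"
    and "integrable lborel (\<lambda>m. cis (- (2 * t * (norm m)\<^sup>2)) * pair_wave G t m)"
proof -
  have Gm[measurable]: "G \<in> borel_measurable borel" using G by auto
  have key: "cis (x \<bullet> (m + z) - t * (norm (m + z))\<^sup>2) * G (m + z) * (cis (x \<bullet> (m - z) - t * (norm (m - z))\<^sup>2) * G (m - z))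
    = cis ((2 *\<^sub>R x) \<bullet> m) * cis (- (2 * t * (norm m)\<^sup>2)) * (cis (t * (- 2 * (norm z)\<^sup>2)) * (G (m + z) * G (m - z)))" for x m z t
  proof -
    have "(x \<bullet> (m + z) - t * (norm (m + z))\<^sup>2) + (x \<bullet> (m - z) - t * (norm (m - z))\<^sup>2)
        = (2 *\<^sub>R x) \<bullet> m - t * ((norm (m + z))\<^sup>2 + (norm (m - z))\<^sup>2)"
      by (simp add: inner_add_right inner_diff_right algebra_simps)
    also have "\<dots> = (2 *\<^sub>R x) \<bullet> m + - (2 * t * (norm m)\<^sup>2) + t * (- 2 * (norm z)\<^sup>2)"
      unfolding norm_parallelogram by (simp add: algebra_simps)
    finally have "cis (x \<bullet> (m + z) - t * (norm (m + z))\<^sup>2) * cis (x \<bullet> (m - z) - t * (norm (m - z))\<^sup>2)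
       = cis ((2 *\<^sub>R x) \<bullet> m) * cis (- (2 * t * (norm m)\<^sup>2)) * cis (t * (- 2 * (norm z)\<^sup>2))"
      by (simp only: cis_mult)
    then show ?thesis by (simp only: mult_ac)
  qed
  define a where "a x \<xi> = cis (x \<bullet> \<xi> - t * (norm \<xi>)\<^sup>2) * G \<xi>" for x \<xi>
  have a: "integrable lborel (a x)" for x
    unfolding a_def by (intro cis_mult_integrable G) measurable
  have inner: "(LINT z|lborel. a x (m + z) * a x (m - z)) = cis ((2 *\<^sub>R x) \<bullet> m) * (cis (- (2 * t * (norm m)\<^sup>2)) * pair_wave G t m)" for x m
    unfolding a_def key pair_wave_def by (simp only: integral_mult_right_zero mult.assoc)
  have "integrable lborel (\<lambda>m. LINT z|lborel. a 0 (m + z) * a 0 (m - z))"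
    using lborel_pair.integrable_fst[OF integrable_sum_difference[OF a a, of 0 0]] .
  then show "integrable lborel (\<lambda>m. cis (- (2 * t * (norm m)\<^sup>2)) * pair_wave G t m)"
    unfolding inner by simp
  have "(free_wave G t x)\<^sup>2 = (LINT \<xi>|lborel. a x \<xi>)\<^sup>2 / (complex_of_real (2 * pi))\<^sup>2"
    by (simp add: free_wave_def a_def power_divide)
  also have "\<dots> = (4 * (LINT m|lborel. cis ((2 *\<^sub>R x) \<bullet> m) * (cis (- (2 * t * (norm m)\<^sup>2)) * pair_wave G t m))) / (complex_of_real (2 * pi))\<^sup>2"
    unfolding integral_square_sum_difference[OF a] inner by simp
  finally show "(free_wave G t x)\<^sup>2 = (LINT m|lborel. cis ((2 *\<^sub>R x) \<bullet> m) * (cis (- (2 * t * (norm m)\<^sup>2)) * pair_wave G t m)) / complex_of_real (pi\<^sup>2)"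
    by (simp add: power_mult_distrib)
qed

lemma free_wave_le_pair_wave:
  assumes G: "integrable lborel G"
  shows "ennreal ((cmod (free_wave G t x))\<^sup>2) \<le> ennreal (1 / pi\<^sup>2) * (\<integral>\<^sup>+ m. ennreal (cmod (pair_wave G t m)) \<partial>lborel)"
proof -
  let ?b = "\<lambda>m. cis ((2 *\<^sub>R x) \<bullet> m) * (cis (- (2 * t * (norm m)\<^sup>2)) * pair_wave G t m)"
  have int: "integrable lborel ?b"
    by (intro cis_mult_integrable free_wave_square[OF G]) measurable
  have "(cmod (free_wave G t x))\<^sup>2 = 1 / pi\<^sup>2 * cmod (LINT m|lborel. ?b m)"
    unfolding norm_power[symmetric] free_wave_square(1)[OF G] by (simp add: norm_divide norm_power)
  then have "ennreal ((cmod (free_wave G t x))\<^sup>2) = ennreal (1 / pi\<^sup>2) * ennreal (cmod (LINT m|lborel. ?b m))"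
    using ennreal_mult[of "1 / pi\<^sup>2" "cmod (LINT m|lborel. ?b m)"] by simp
  also have "\<dots> \<le> ennreal (1 / pi\<^sup>2) * (\<integral>\<^sup>+ m. ennreal (norm (?b m)) \<partial>lborel)"
    by (intro mult_left_mono integral_norm_bound_ennreal int) simp
  finally show ?thesis by (simp add: norm_mult)
qed

text \<open>
  A disc of radius \<open>\<surd>v\<close> has area \<open>\<pi> v\<close>, so
  \<open>|z|\<^sup>2\<close> has constant density \<open>\<pi>\<close> on the half-line.
\<close>

lemma nn_integral_norm_square:
  fixes g :: "real \<Rightarrow> ennreal"
  assumes [measurable]: "g \<in> borel_measurable borel"
  shows "(\<integral>\<^sup>+ z. g ((norm (z::real^2))\<^sup>2) \<partial>lborel) = ennreal pi * (\<integral>\<^sup>+ v. g v * indicator {0..} v \<partial>lborel)"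
proof -
  have "distr lborel borel (\<lambda>z::real^2. (norm z)\<^sup>2) = density lborel (\<lambda>v. ennreal pi * indicator {0..} v)"
  proof (rule measure_eqI_generator_eq)
    let ?E = "range (\<lambda>a::real. {..a})"
    have em: "emeasure (distr lborel borel (\<lambda>z::real^2. (norm z)\<^sup>2)) {..a} = (if a < 0 then 0 else ennreal (pi * a))" for a :: real
    proof -
      have "emeasure (distr lborel borel (\<lambda>z::real^2. (norm z)\<^sup>2)) {..a} = emeasure lborel ((\<lambda>z::real^2. (norm z)\<^sup>2) -` {..a})"
        by (subst emeasure_distr) auto
      also have "\<dots> = (if a < 0 then 0 else ennreal (pi * a))"
      proof (cases "a < 0")
        case True
        have "\<not> (norm z)\<^sup>2 \<le> a" for z :: "real^2"
          using True zero_le_power2[of "norm z"] by linarith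
        then have "(\<lambda>z::real^2. (norm z)\<^sup>2) -` {..a} = {}" by auto
        then show ?thesis using True by simp
      next
        case False
        have "(norm z)\<^sup>2 \<le> a \<longleftrightarrow> norm z \<le> sqrt a" for z :: "real^2"
          using real_sqrt_le_iff[of "(norm z)\<^sup>2" a] by simp
        then have "(\<lambda>z::real^2. (norm z)\<^sup>2) -` {..a} = cball 0 (sqrt a)" by auto
        then show ?thesis
          using False by (simp add: emeasure_cball unit_ball_vol_2)
      qed
      finally show ?thesis .
    qed
    have em2: "emeasure (density lborel (\<lambda>v. ennreal pi * indicator {0..} v)) {..a} = (if a < 0 then 0 else ennreal (pi * a))" for a :: real
    proof -
      have "emeasure (density lborel (\<lambda>v. ennreal pi * indicator {0..} v)) {..a} = (\<integral>\<^sup>+ v. ennreal pi * indicator {0..a} v \<partial>lborel)"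
        by (subst emeasure_density) (auto intro!: nn_integral_cong split: split_indicator)
      also have "\<dots> = (if a < 0 then 0 else ennreal (pi * a))"
        by (subst nn_integral_cmult) (auto simp: ennreal_mult)
      finally show ?thesis .
    qed
    show "Int_stable ?E" by (auto simp: Int_stable_def)
    show "?E \<subseteq> Pow UNIV" by auto
    show "emeasure (distr lborel borel (\<lambda>z::real^2. (norm z)\<^sup>2)) X = emeasure (density lborel (\<lambda>v. ennreal pi * indicator {0..} v)) X" if "X \<in> ?E" for X
      using that em em2 by auto
    show "sets (distr lborel borel (\<lambda>z::real^2. (norm z)\<^sup>2)) = sigma_sets UNIV ?E"
      "sets (density lborel (\<lambda>v. ennreal pi * indicator {0..} v)) = sigma_sets UNIV ?E"
      by (simp_all add: borel_eq_atMost)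
    show "range (\<lambda>n::nat. {..real n}) \<subseteq> ?E" "(\<Union>n. {..real n}) = UNIV"
      by (auto intro: real_arch_simple)
    show "emeasure (distr lborel borel (\<lambda>z::real^2. (norm z)\<^sup>2)) {..real n} \<noteq> \<infinity>" for n :: nat
      unfolding em by simp
  qed
  then have "(\<integral>\<^sup>+ z. g ((norm (z::real^2))\<^sup>2) \<partial>lborel) = (\<integral>\<^sup>+ v. g v \<partial>density lborel (\<lambda>v. ennreal pi * indicator {0..} v))"
    by (subst nn_integral_distr[symmetric, of "\<lambda>z::real^2. (norm z)\<^sup>2" lborel borel g]) auto
  also have "\<dots> = (\<integral>\<^sup>+ v. ennreal pi * (g v * indicator {0..} v) \<partial>lborel)"
    by (subst nn_integral_density) (auto simp: mult_ac)
  also have "\<dots> = ennreal pi * (\<integral>\<^sup>+ v. g v * indicator {0..} v \<partial>lborel)"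
    by (rule nn_integral_cmult) measurable
  finally show ?thesis .
qed

lemma nn_integral_norm_square_le:
  fixes g :: "real \<Rightarrow> ennreal"
  assumes "g \<in> borel_measurable borel"
  shows "(\<integral>\<^sup>+ z. g ((norm (z::real^2))\<^sup>2) \<partial>lborel) \<le> ennreal pi * (\<integral>\<^sup>+ v. g v \<partial>lborel)"
  unfolding nn_integral_norm_square[OF assms]
  by (intro mult_left_mono nn_integral_mono) (auto split: split_indicator)

text \<open>
  Substitution \<open>v = a\<^sup>2 + c\<close>, where \<open>dv = 2 a da\<close> and \<open>a
  \<ge> \<delta>\<close>.
\<close>

lemma nn_integral_square_far_half:
  fixes f :: "real \<Rightarrow> real"
  assumes [measurable]: "f \<in> borel_measurable borel" and nn: "\<And>x. 0 \<le> f x" and \<delta>: "0 < \<delta>"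
  shows "ennreal (2 * \<delta>) * (\<integral>\<^sup>+ a. ennreal (f (a\<^sup>2 + c)) * indicator {\<delta>..} a \<partial>lborel) \<le> (\<integral>\<^sup>+ v. ennreal (f v) \<partial>lborel)"
proof -
  have "ennreal (2 * \<delta>) * (\<integral>\<^sup>+ a. ennreal (f (a\<^sup>2 + c)) * indicator {\<delta>..} a \<partial>lborel)
      = (\<integral>\<^sup>+ a. ennreal (2 * \<delta>) * (ennreal (f (a\<^sup>2 + c)) * indicator {\<delta>..} a) \<partial>lborel)"
    by (rule nn_integral_cmult[symmetric]) measurable
  also have "\<dots> \<le> (\<integral>\<^sup>+ v. ennreal (f v) \<partial>lborel)"
  proof (rule nn_integral_le_of_AE_tendsto[where u="\<lambda>n a. ennreal (2 * \<delta>) * (ennreal (f (a\<^sup>2 + c)) * indicator {\<delta>..\<delta> + real n} a)"])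
    show "AE a in lborel. (\<lambda>n. ennreal (2 * \<delta>) * (ennreal (f (a\<^sup>2 + c)) * indicator {\<delta>..\<delta> + real n} a)) \<longlonglongrightarrow> ennreal (2 * \<delta>) * (ennreal (f (a\<^sup>2 + c)) * indicator {\<delta>..} a)"
    proof (rule AE_I2, rule tendsto_eventually)
      fix a :: real
      obtain N :: nat where N: "a - \<delta> \<le> real N" using real_arch_simple by blast
      show "\<forall>\<^sub>F n in sequentially. ennreal (2 * \<delta>) * (ennreal (f (a\<^sup>2 + c)) * indicator {\<delta>..\<delta> + real n} a) = ennreal (2 * \<delta>) * (ennreal (f (a\<^sup>2 + c)) * indicator {\<delta>..} a)"
        using eventually_ge_at_top[of N] by eventually_elim (use N in \<open>auto simp: indicator_def\<close>)
    qed
    show "\<forall>\<^sub>F n in sequentially. (\<integral>\<^sup>+ a. ennreal (2 * \<delta>) * (ennreal (f (a\<^sup>2 + c)) * indicator {\<delta>..\<delta> + real n} a) \<partial>lborel) \<le> (\<integral>\<^sup>+ v. ennreal (f v) \<partial>lborel)"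
    proof (intro always_eventually allI)
      fix n :: nat
      have "(\<integral>\<^sup>+ a. ennreal (2 * \<delta>) * (ennreal (f (a\<^sup>2 + c)) * indicator {\<delta>..\<delta> + real n} a) \<partial>lborel)
         \<le> (\<integral>\<^sup>+ a. ennreal (f (a\<^sup>2 + c) * (2 * a) * indicator {\<delta>..\<delta> + real n} a) \<partial>lborel)"
        using nn \<delta> by (intro nn_integral_mono)
          (auto simp: indicator_def ennreal_mult[symmetric] mult.commute intro!: ennreal_leI mult_right_mono)
      also have "\<dots> = (\<integral>\<^sup>+ v. ennreal (f v * indicator {\<delta>\<^sup>2 + c..(\<delta> + real n)\<^sup>2 + c} v) \<partial>lborel)"
      proof (rule nn_integral_substitution[symmetric, where g="\<lambda>a. a\<^sup>2 + c" and g'="\<lambda>a. 2 * a"])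
        show "set_borel_measurable borel {\<delta>\<^sup>2 + c..(\<delta> + real n)\<^sup>2 + c} f"
          unfolding set_borel_measurable_def by measurable
        show "((\<lambda>a. a\<^sup>2 + c) has_real_derivative 2 * a) (at a)" for a
          by (auto intro!: derivative_eq_intros)
      qed (use \<delta> in \<open>auto intro!: continuous_intros\<close>)
      also have "\<dots> \<le> (\<integral>\<^sup>+ v. ennreal (f v) \<partial>lborel)"
        using nn by (intro nn_integral_mono) (auto simp: indicator_def)
      finally show "(\<integral>\<^sup>+ a. ennreal (2 * \<delta>) * (ennreal (f (a\<^sup>2 + c)) * indicator {\<delta>..\<delta> + real n} a) \<partial>lborel) \<le> (\<integral>\<^sup>+ v. ennreal (f v) \<partial>lborel)" .
    qed
  qed measurable
  finally show ?thesis .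
qed

lemma nn_integral_square_far:
  fixes f :: "real \<Rightarrow> real"
  assumes [measurable]: "f \<in> borel_measurable borel" and nn: "\<And>x. 0 \<le> f x" and \<delta>: "0 < \<delta>"
  shows "ennreal \<delta> * (\<integral>\<^sup>+ a. ennreal (f (a\<^sup>2 + c)) * indicator {a. \<delta> \<le> \<bar>a\<bar>} a \<partial>lborel) \<le> (\<integral>\<^sup>+ v. ennreal (f v) \<partial>lborel)"
proof -
  define I where "I = (\<integral>\<^sup>+ a. ennreal (f (a\<^sup>2 + c)) * indicator {\<delta>..} a \<partial>lborel)"
  have "(\<integral>\<^sup>+ a. ennreal (f (a\<^sup>2 + c)) * indicator {a. \<delta> \<le> \<bar>a\<bar>} a \<partial>lborel)
     \<le> (\<integral>\<^sup>+ a. ennreal (f (a\<^sup>2 + c)) * indicator {\<delta>..} a + ennreal (f ((0 - a)\<^sup>2 + c)) * indicator {\<delta>..} (0 - a) \<partial>lborel)"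
    by (intro nn_integral_mono) (auto simp: indicator_def abs_if)
  also have "\<dots> = I + (\<integral>\<^sup>+ a. ennreal (f ((0 - a)\<^sup>2 + c)) * indicator {\<delta>..} (0 - a) \<partial>lborel)"
    unfolding I_def by (rule nn_integral_add) measurable
  also have "(\<integral>\<^sup>+ a. ennreal (f ((0 - a)\<^sup>2 + c)) * indicator {\<delta>..} (0 - a) \<partial>lborel) = I"
    unfolding I_def by (rule nn_integral_lborel_reflect) measurable
  finally have "ennreal \<delta> * (\<integral>\<^sup>+ a. ennreal (f (a\<^sup>2 + c)) * indicator {a. \<delta> \<le> \<bar>a\<bar>} a \<partial>lborel) \<le> ennreal \<delta> * (I + I)"
    by (intro mult_left_mono) auto
  also have "\<dots> = ennreal (2 * \<delta>) * I"
    using \<delta> by (simp add: ennreal_mult mult_2[symmetric] mult_ac)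
  also have "\<dots> \<le> (\<integral>\<^sup>+ v. ennreal (f v) \<partial>lborel)"
    unfolding I_def by (rule nn_integral_square_far_half[OF _ nn \<delta>]) measurable
  finally show ?thesis .
qed

lemma UNIV_2_eq: "i \<noteq> k \<Longrightarrow> (UNIV :: 2 set) = {i, k}"
  by (metis (no_types) UNIV_2 exhaust_2 insert_commute)

lemma all_2_iff: "i \<noteq> k \<Longrightarrow> (\<forall>l::2. P l) \<longleftrightarrow> P i \<and> P k"
  using UNIV_2_eq[of i k] by (metis UNIV_I insertE singletonD)

lemma real2_pairing_measurable:
  "(\<lambda>(b, a). \<chi> l::2. if l = i then (a::real) else (b::real)) \<in> lborel \<Otimes>\<^sub>M lborel \<rightarrow>\<^sub>M borel"
proof -
  have "continuous_on UNIV (\<lambda>p::real \<times> real. \<chi> l::2. if l = i then snd p else fst p)"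
  proof (rule continuous_on_vec_lambda)
    fix l :: 2
    show "continuous_on UNIV (\<lambda>p::real \<times> real. if l = i then snd p else fst p)"
      by (cases "l = i") (auto intro!: continuous_on_fst continuous_on_snd continuous_on_id)
  qed
  then show ?thesis
    unfolding lborel_prod by (simp add: split_beta' borel_measurable_continuous_onI)
qed

text \<open>
  Fubini's theorem on \<open>\<real>\<^sup>2\<close> with a free choice \<open>i\<close> of the
  coordinate that is integrated first.
\<close>

lemma lborel_real2_eq_distr:
  fixes i k :: 2
  assumes ik: "i \<noteq> k"
  shows "lborel = distr (lborel \<Otimes>\<^sub>M lborel) borel (\<lambda>(b, a). \<chi> l. if l = i then (a::real) else (b::real))"
proof (rule lborel_eqI)
  let ?T = "\<lambda>(b, a). \<chi> l::2. if l = i then (a::real) else (b::real)"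
  have T[measurable]: "?T \<in> lborel \<Otimes>\<^sub>M lborel \<rightarrow>\<^sub>M borel"
    by (rule real2_pairing_measurable)
  fix l u :: "real^2" assume le: "\<And>b. b \<in> Basis \<Longrightarrow> l \<bullet> b \<le> u \<bullet> b"
  have lu: "l $ j \<le> u $ j" for j
    using le[of "axis j 1"] by (auto simp: Basis_vec_def inner_axis)
  have "?T -` box l u \<inter> space (lborel \<Otimes>\<^sub>M lborel) = {l $ k<..<u $ k} \<times> {l $ i<..<u $ i}"
    using ik by (auto simp: mem_box_cart space_pair_measure all_2_iff[OF ik])
  then have "emeasure (distr (lborel \<Otimes>\<^sub>M lborel) borel ?T) (box l u) = ennreal (u $ k - l $ k) * ennreal (u $ i - l $ i)"
    using lu by (subst emeasure_distr[OF T]) (auto simp: lborel.emeasure_pair_measure_Times)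
  also have "\<dots> = ennreal ((u $ k - l $ k) * (u $ i - l $ i))"
    using lu by (simp add: ennreal_mult)
  also have "(u $ k - l $ k) * (u $ i - l $ i) = (\<Prod>b\<in>Basis. (u - l) \<bullet> b)"
  proof -
    have B: "(Basis :: (real^2) set) = {axis k 1, axis i 1}"
      using UNIV_2_eq[OF ik] by (auto simp: Basis_vec_def)
    have "axis k (1::real) \<noteq> axis i 1" using ik by (simp add: axis_eq_axis)
    then show ?thesis unfolding B by (simp add: inner_axis)
  qed
  finally show "emeasure (distr (lborel \<Otimes>\<^sub>M lborel) borel ?T) (box l u) = ennreal (\<Prod>b\<in>Basis. (u - l) \<bullet> b)" .
qed simp

lemma norm_real2_square:
  fixes z :: "real^2"
  assumes "i \<noteq> k"
  shows "(norm z)\<^sup>2 = (z $ i)\<^sup>2 + (z $ k)\<^sup>2"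
  unfolding power2_norm_eq_inner inner_vec_def UNIV_2_eq[OF assms] using assms by (simp add: power2_eq_square)

text \<open>
  In the strip the coordinate \<open>i\<close> is at least \<open>\<delta>\<close> in modulus,
  so \<open>|z|\<^sup>2\<close> varies at least at the rate \<open>2 \<delta>\<close> in this
  coordinate; the other coordinate ranges over an interval of length \<open>2 L\<close>.
\<close>

lemma nn_integral_strip:
  fixes f :: "real \<Rightarrow> real" and i k :: 2
  assumes [measurable]: "f \<in> borel_measurable borel" and nn: "\<And>x. 0 \<le> f x" and \<delta>: "0 < \<delta>" and L: "0 \<le> L" and ik: "i \<noteq> k"
  shows "ennreal \<delta> * (\<integral>\<^sup>+ z. ennreal (f ((norm z)\<^sup>2)) * indicator {z. \<delta> \<le> \<bar>z $ i\<bar> \<and> \<bar>z $ k - c\<bar> \<le> L} z \<partial>lborel)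
      \<le> ennreal (2 * L) * (\<integral>\<^sup>+ v. ennreal (f v) \<partial>lborel)"
proof -
  let ?T = "\<lambda>(b, a). \<chi> l::2. if l = i then (a::real) else (b::real)"
  have T[measurable]: "?T \<in> lborel \<Otimes>\<^sub>M lborel \<rightarrow>\<^sub>M borel"
    by (rule real2_pairing_measurable)
  have [measurable]: "{z::real^2. \<delta> \<le> \<bar>z $ i\<bar> \<and> \<bar>z $ k - c\<bar> \<le> L} \<in> sets borel"
    by measurable
  have "(\<integral>\<^sup>+ z. ennreal (f ((norm z)\<^sup>2)) * indicator {z. \<delta> \<le> \<bar>z $ i\<bar> \<and> \<bar>z $ k - c\<bar> \<le> L} z \<partial>lborel)
     = (\<integral>\<^sup>+ p. ennreal (f ((norm (?T p))\<^sup>2)) * indicator {z. \<delta> \<le> \<bar>z $ i\<bar> \<and> \<bar>z $ k - c\<bar> \<le> L} (?T p) \<partial>(lborel \<Otimes>\<^sub>M lborel))"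
    by (subst lborel_real2_eq_distr[OF ik]) (rule nn_integral_distr, measurable)
  also have "\<dots> = (\<integral>\<^sup>+ b. \<integral>\<^sup>+ a. ennreal (f (a\<^sup>2 + b\<^sup>2)) * indicator {a. \<delta> \<le> \<bar>a\<bar>} a * indicator {c - L..c + L} b \<partial>lborel \<partial>lborel)"
    by (subst lborel.nn_integral_fst[symmetric], measurable)
       (use ik in \<open>auto simp: norm_real2_square[OF ik] indicator_def intro!: nn_integral_cong\<close>)
  also have "\<dots> = (\<integral>\<^sup>+ b. (\<integral>\<^sup>+ a. ennreal (f (a\<^sup>2 + b\<^sup>2)) * indicator {a. \<delta> \<le> \<bar>a\<bar>} a \<partial>lborel) * indicator {c - L..c + L} b \<partial>lborel)"
    by (intro nn_integral_cong nn_integral_multc) measurable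
  finally have "ennreal \<delta> * (\<integral>\<^sup>+ z. ennreal (f ((norm z)\<^sup>2)) * indicator {z. \<delta> \<le> \<bar>z $ i\<bar> \<and> \<bar>z $ k - c\<bar> \<le> L} z \<partial>lborel)
     = ennreal \<delta> * (\<integral>\<^sup>+ b. (\<integral>\<^sup>+ a. ennreal (f (a\<^sup>2 + b\<^sup>2)) * indicator {a. \<delta> \<le> \<bar>a\<bar>} a \<partial>lborel) * indicator {c - L..c + L} b \<partial>lborel)" by simp
  also have "\<dots> = (\<integral>\<^sup>+ b. ennreal \<delta> * ((\<integral>\<^sup>+ a. ennreal (f (a\<^sup>2 + b\<^sup>2)) * indicator {a. \<delta> \<le> \<bar>a\<bar>} a \<partial>lborel) * indicator {c - L..c + L} b) \<partial>lborel)"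
    by (rule nn_integral_cmult[symmetric]) measurable
  also have "\<dots> \<le> (\<integral>\<^sup>+ b. (\<integral>\<^sup>+ v. ennreal (f v) \<partial>lborel) * indicator {c - L..c + L} b \<partial>lborel)"
    unfolding mult.assoc[symmetric]
    by (intro nn_integral_mono mult_right_mono nn_integral_square_far nn \<delta>) auto
  also have "\<dots> = ennreal (2 * L) * (\<integral>\<^sup>+ v. ennreal (f v) \<partial>lborel)"
    using L by (subst nn_integral_cmult) (auto simp: mult.commute)
  finally show ?thesis .
qed

section \<open>Strichartz and Sobolev estimates\<close>

lemma square_integrable_borel: "f \<in> square_integrable lborel \<Longrightarrow> f \<in> borel_measurable borel"
  by (simp add: square_integrable_def)

definition pair_weight :: "real^2 \<Rightarrow> real^2 \<Rightarrow> real" where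
  "pair_weight m z = (1 + (norm (m + z))\<^sup>2) * (1 + (norm (m - z))\<^sup>2)"

lemma pair_weight_measurable [measurable]: "pair_weight m \<in> borel_measurable borel"
  unfolding pair_weight_def[abs_def] by measurable

lemma pair_weight_ge_1: "1 \<le> pair_weight m z"
  unfolding pair_weight_def by (rule order_trans[OF _ mult_mono[of 1 _ 1]]) auto

lemma pair_weight_pos: "0 < pair_weight m z"
  using pair_weight_ge_1[of m z] by linarith

lemma pair_weight_ge_square: "(norm m)\<^sup>2 \<le> pair_weight m z"
proof -
  have "(norm m)\<^sup>2 \<le> 1 + ((norm (m + z))\<^sup>2 + (norm (m - z))\<^sup>2)"
    unfolding norm_parallelogram using zero_le_power2[of "norm m"] zero_le_power2[of "norm z"] by linarith
  also have "\<dots> \<le> pair_weight m z"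
    unfolding pair_weight_def by (simp add: algebra_simps)
  finally show ?thesis .
qed

text \<open>
  One of the two frequencies has modulus at least \<open>|m|\<close>; the assumption provides
  the remaining factor \<open>|m|\<close>.
\<close>

lemma pair_weight_ge_cube:
  assumes "norm m \<le> (norm (m + z))\<^sup>2" "norm m \<le> (norm (m - z))\<^sup>2"
  shows "norm m ^ 3 \<le> pair_weight m z"
proof -
  have max: "(norm m)\<^sup>2 \<le> (norm (m + z))\<^sup>2 \<or> (norm m)\<^sup>2 \<le> (norm (m - z))\<^sup>2"
    using norm_parallelogram[of m z] zero_le_power2[of "norm z"] by linarith
  have "norm m ^ 3 \<le> (norm (m + z))\<^sup>2 * (norm (m - z))\<^sup>2"
    using max
  proof
    assume "(norm m)\<^sup>2 \<le> (norm (m + z))\<^sup>2"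
    then show ?thesis using mult_mono[OF _ assms(2), of "(norm m)\<^sup>2" "(norm (m + z))\<^sup>2"]
      by (simp add: power3_eq_cube power2_eq_square)
  next
    assume "(norm m)\<^sup>2 \<le> (norm (m - z))\<^sup>2"
    then show ?thesis using mult_mono[OF assms(1), of "(norm m)\<^sup>2" "(norm (m - z))\<^sup>2"]
      by (simp add: power3_eq_cube power2_eq_square mult_ac)
  qed
  also have "\<dots> \<le> pair_weight m z"
    unfolding pair_weight_def by (simp add: algebra_simps)
  finally show ?thesis .
qed

lemma strip_of_near:
  fixes m z :: "real^2"
  assumes i: "norm m / 2 \<le> \<bar>m $ i\<bar>" and big: "16 \<le> norm m" and near: "(norm (z - m))\<^sup>2 < norm m"
  shows "norm m / 4 \<le> \<bar>z $ i\<bar> \<and> \<bar>z $ k - m $ k\<bar> \<le> sqrt (norm m)"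
proof -
  have n: "norm (z - m) \<le> sqrt (norm m)"
    using near by (intro real_le_rsqrt) simp
  have "\<bar>(z - m) $ i\<bar> \<le> sqrt (norm m)" "\<bar>(z - m) $ k\<bar> \<le> sqrt (norm m)"
    using component_le_norm_cart[of "z - m" i] component_le_norm_cart[of "z - m" k] n by linarith+
  moreover have "sqrt (norm m) \<le> norm m / 4"
  proof (rule real_le_lsqrt)
    have "16 * norm m \<le> norm m * norm m" using big by (intro mult_right_mono) auto
    then show "norm m \<le> (norm m / 4)\<^sup>2" by (simp add: power2_eq_square)
  qed auto
  ultimately show ?thesis using i by (auto simp: abs_if split: if_splits)
qed

text \<open>
  If both frequencies \<open>m + z\<close> and \<open>m - z\<close> have modulus at least
  \<open>\<surd>|m|\<close>, the weight is at least \<open>|m|\<^sup>3\<close>. Otherwise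
  \<open>z\<close> is within \<open>\<surd>|m|\<close> of \<open>m\<close> or \<open>-
  m\<close>, hence in a strip, and the larger frequency alone gives \<open>|m|\<^sup>2\<close>.
  From \<open>|m| \<ge> 16\<close> on, \<open>\<surd>|m|\<close> is at most \<open>|m| /
  4\<close>, which keeps both strips away from \<open>z $ i = 0\<close>.
\<close>

lemma inverse_pair_weight_le:
  fixes m z :: "real^2"
  assumes i: "norm m / 2 \<le> \<bar>m $ i\<bar>" and big: "16 \<le> norm m"
  shows "1 / pair_weight m z \<le> 1 / norm m ^ 3
    + 1 / (norm m)\<^sup>2 * indicator {z. norm m / 4 \<le> \<bar>z $ i\<bar> \<and> \<bar>z $ k - m $ k\<bar> \<le> sqrt (norm m)} z
    + 1 / (norm m)\<^sup>2 * indicator {z. norm m / 4 \<le> \<bar>z $ i\<bar> \<and> \<bar>z $ k - (- m) $ k\<bar> \<le> sqrt (norm m)} z"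
    (is "_ \<le> ?a + ?b + ?c")
proof -
  have m0: "0 < norm m" using big by linarith
  have nn: "0 \<le> ?a" "0 \<le> ?b" "0 \<le> ?c" by simp_all
  have sq: "1 / pair_weight m z \<le> 1 / (norm m)\<^sup>2"
    using m0 by (intro divide_left_mono pair_weight_ge_square) (auto intro: pair_weight_pos mult_pos_pos)
  consider "(norm (z - m))\<^sup>2 < norm m" | "(norm (z - (- m)))\<^sup>2 < norm m"
    | "norm m \<le> (norm (m + z))\<^sup>2" "norm m \<le> (norm (m - z))\<^sup>2"
    by (force simp: norm_minus_commute add.commute)
  then show ?thesis
  proof cases
    case 1
    then have "?b = 1 / (norm m)\<^sup>2" using strip_of_near[OF i big, of z k] by simp
    then show ?thesis using sq nn by linarith
  next
    case 2
    then have "?c = 1 / (norm m)\<^sup>2" using strip_of_near[of "- m" i z k] i big by simp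
    then show ?thesis using sq nn by linarith
  next
    case 3
    have "1 / pair_weight m z \<le> 1 / norm m ^ 3"
      using m0 by (intro divide_left_mono pair_weight_ge_cube 3) (auto intro: pair_weight_pos mult_pos_pos)
    then show ?thesis using nn by linarith
  qed
qed

text \<open>
  The summands serve the ranges \<open>|m| < 16\<close> and \<open>|m| \<ge> 16\<close>; note
  that \<open>257 = 1 + 16\<^sup>2\<close>.
\<close>

definition kernel_const :: real where
  "kernel_const = pi * 257 powr (5/4) + (pi + 16) * 2 powr (5/4)"

text \<open>
  The exponent is what a strip of width \<open>\<surd>|m|\<close> yields:
  \<open>|m|\<^sup>-\<^sup>2\<close> from the weight and \<open>\<surd>|m| / |m|\<close> from
  the strip make \<open>|m|\<^sup>-\<^sup>5\<^sup>/\<^sup>2\<close>. The bare weight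
  \<open>|m|\<^sup>-\<^sup>2\<close> would fail to be integrable by a logarithm.
\<close>

definition kernel_bound :: "real^2 \<Rightarrow> real" where
  "kernel_bound m = kernel_const * (1 + (norm m)\<^sup>2) powr (- (5/4))"

lemma kernel_const_pos: "0 < kernel_const"
  unfolding kernel_const_def by (intro add_pos_pos mult_pos_pos) (auto intro: pi_gt_zero add_pos_pos)

lemma kernel_bound_pos: "0 < kernel_bound m"
proof -
  have "0 < 1 + (norm m)\<^sup>2" by (simp add: add_pos_nonneg)
  then show ?thesis unfolding kernel_bound_def using kernel_const_pos by simp
qed

lemma kernel_bound_measurable [measurable]: "kernel_bound \<in> borel_measurable borel"
  unfolding kernel_bound_def[abs_def] by measurable

lemma pair_kernel_small:
  assumes [measurable]: "f \<in> borel_measurable borel" and nn: "\<And>x. 0 \<le> f x" and m: "norm (m::real^2) < 16"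
  shows "(\<integral>\<^sup>+ z. ennreal (f ((norm z)\<^sup>2) / pair_weight m z) \<partial>lborel) \<le> ennreal (kernel_bound m) * (\<integral>\<^sup>+ v. ennreal (f v) \<partial>lborel)"
proof -
  have "(\<integral>\<^sup>+ z. ennreal (f ((norm z)\<^sup>2) / pair_weight m z) \<partial>lborel) \<le> (\<integral>\<^sup>+ z. ennreal (f ((norm (z::real^2))\<^sup>2)) \<partial>lborel)"
  proof (intro nn_integral_mono ennreal_leI)
    fix z :: "real^2"
    show "f ((norm z)\<^sup>2) / pair_weight m z \<le> f ((norm z)\<^sup>2)"
      using mult_left_mono[OF pair_weight_ge_1[of m z] nn[of "(norm z)\<^sup>2"]] pair_weight_pos[of m z]
      by (simp add: divide_le_eq)
  qed
  also have "\<dots> \<le> ennreal pi * (\<integral>\<^sup>+ v. ennreal (f v) \<partial>lborel)"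
    by (rule nn_integral_norm_square_le) measurable
  also have "\<dots> \<le> ennreal (kernel_bound m) * (\<integral>\<^sup>+ v. ennreal (f v) \<partial>lborel)"
  proof (intro mult_right_mono ennreal_leI)
    have "(norm m)\<^sup>2 \<le> 16\<^sup>2" using m by (intro power_mono) auto
    then have "257 powr (- (5/4)) \<le> (1 + (norm m)\<^sup>2) powr (- (5/4))"
      by (intro powr_mono2') (auto simp: add_pos_nonneg)
    then have "pi * 257 powr (5/4) * 257 powr (- (5/4)) \<le> kernel_const * (1 + (norm m)\<^sup>2) powr (- (5/4))"
      unfolding kernel_const_def by (intro mult_mono) auto
    then show "pi \<le> kernel_bound m"
      unfolding kernel_bound_def mult.assoc powr_add[symmetric] by simp
  qed simp
  finally show ?thesis .
qed

lemma pair_kernel_large: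
  assumes [measurable]: "f \<in> borel_measurable borel" and nn: "\<And>x. 0 \<le> f x" and m: "16 \<le> norm (m::real^2)"
  shows "(\<integral>\<^sup>+ z. ennreal (f ((norm z)\<^sup>2) / pair_weight m z) \<partial>lborel) \<le> ennreal (kernel_bound m) * (\<integral>\<^sup>+ v. ennreal (f v) \<partial>lborel)"
proof -
  define r where "r = norm m"
  have r: "16 \<le> r" "0 < r" using m by (auto simp: r_def)
  define P where "P = (\<integral>\<^sup>+ v. ennreal (f v) \<partial>lborel)"
  have "\<exists>i k::2. i \<noteq> k \<and> \<bar>m $ k\<bar> \<le> \<bar>m $ i\<bar>"
  proof (cases "\<bar>m $ 1\<bar> \<le> \<bar>m $ 2\<bar>")
    case True
    then have "(2::2) \<noteq> 1 \<and> \<bar>m $ 1\<bar> \<le> \<bar>m $ 2\<bar>" by simp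
    then show ?thesis by blast
  next
    case False
    then have "(1::2) \<noteq> 2 \<and> \<bar>m $ 2\<bar> \<le> \<bar>m $ 1\<bar>" by simp
    then show ?thesis by blast
  qed
  then obtain i k :: 2 where ik: "i \<noteq> k" and le: "\<bar>m $ k\<bar> \<le> \<bar>m $ i\<bar>" by auto
  have i: "norm m / 2 \<le> \<bar>m $ i\<bar>"
  proof -
    have "(m $ k)\<^sup>2 \<le> (m $ i)\<^sup>2" using le by (simp add: abs_le_square_iff)
    then have "(norm m)\<^sup>2 \<le> 4 * (m $ i)\<^sup>2"
      using norm_real2_square[OF ik, of m] zero_le_power2[of "m $ i"] by linarith
    then have "(norm m / 2)\<^sup>2 \<le> \<bar>m $ i\<bar>\<^sup>2" by (simp add: power_divide)
    then show ?thesis by (rule power2_le_imp_le) simp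
  qed
  define S where "S c = {z::real^2. r / 4 \<le> \<bar>z $ i\<bar> \<and> \<bar>z $ k - c\<bar> \<le> sqrt r}" for c
  have Sm[measurable]: "S c \<in> sets borel" for c unfolding S_def by measurable
  have strip: "(\<integral>\<^sup>+ z. ennreal (f ((norm z)\<^sup>2)) * indicator (S c) z \<partial>lborel) \<le> ennreal (8 / sqrt r) * P" (is "?X \<le> _") for c
  proof -
    have "?X = ennreal (4 / r) * (ennreal (r / 4) * ?X)"
      using r by (simp add: mult.assoc[symmetric] ennreal_mult[symmetric])
    also have "\<dots> \<le> ennreal (4 / r) * (ennreal (2 * sqrt r) * P)"
      unfolding P_def S_def using r by (intro mult_left_mono nn_integral_strip nn ik) auto
    also have "\<dots> = ennreal (8 / sqrt r) * P"
    proof -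
      have "4 / r * (2 * sqrt r) = 8 / sqrt r" using r by (simp add: field_simps real_sqrt_mult_self)
      then show ?thesis using r by (simp add: mult.assoc[symmetric] ennreal_mult[symmetric])
    qed
    finally show ?thesis .
  qed
  have "(\<integral>\<^sup>+ z. ennreal (f ((norm z)\<^sup>2) / pair_weight m z) \<partial>lborel)
     \<le> (\<integral>\<^sup>+ z. ennreal (1 / r ^ 3) * ennreal (f ((norm z)\<^sup>2)) + ennreal (1 / r\<^sup>2) * (ennreal (f ((norm z)\<^sup>2)) * indicator (S (m $ k)) z)
         + ennreal (1 / r\<^sup>2) * (ennreal (f ((norm z)\<^sup>2)) * indicator (S ((- m) $ k)) z) \<partial>lborel)"
  proof (rule nn_integral_mono)
    fix z :: "real^2"
    have f0: "0 \<le> f ((norm z)\<^sup>2)" by (rule nn)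
    have "f ((norm z)\<^sup>2) / pair_weight m z = f ((norm z)\<^sup>2) * (1 / pair_weight m z)" by simp
    also have "\<dots> \<le> f ((norm z)\<^sup>2) * (1 / r ^ 3 + 1 / r\<^sup>2 * indicator (S (m $ k)) z + 1 / r\<^sup>2 * indicator (S ((- m) $ k)) z)"
      unfolding S_def r_def by (intro mult_left_mono inverse_pair_weight_le i m f0)
    finally have "ennreal (f ((norm z)\<^sup>2) / pair_weight m z) \<le> ennreal (f ((norm z)\<^sup>2) * (1 / r ^ 3 + 1 / r\<^sup>2 * indicator (S (m $ k)) z + 1 / r\<^sup>2 * indicator (S ((- m) $ k)) z))"
      by (rule ennreal_leI)
    also have "\<dots> = ennreal (1 / r ^ 3) * ennreal (f ((norm z)\<^sup>2)) + ennreal (1 / r\<^sup>2) * (ennreal (f ((norm z)\<^sup>2)) * indicator (S (m $ k)) z)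
         + ennreal (1 / r\<^sup>2) * (ennreal (f ((norm z)\<^sup>2)) * indicator (S ((- m) $ k)) z)"
      using r f0 by (auto simp: indicator_def ennreal_mult[symmetric] algebra_simps simp flip: ennreal_plus)
    finally show "ennreal (f ((norm z)\<^sup>2) / pair_weight m z) \<le> ennreal (1 / r ^ 3) * ennreal (f ((norm z)\<^sup>2)) + ennreal (1 / r\<^sup>2) * (ennreal (f ((norm z)\<^sup>2)) * indicator (S (m $ k)) z)
         + ennreal (1 / r\<^sup>2) * (ennreal (f ((norm z)\<^sup>2)) * indicator (S ((- m) $ k)) z)" .
  qed
  also have "\<dots> = ennreal (1 / r ^ 3) * (\<integral>\<^sup>+ z. ennreal (f ((norm (z::real^2))\<^sup>2)) \<partial>lborel)
      + ennreal (1 / r\<^sup>2) * (\<integral>\<^sup>+ z. ennreal (f ((norm z)\<^sup>2)) * indicator (S (m $ k)) z \<partial>lborel)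
      + ennreal (1 / r\<^sup>2) * (\<integral>\<^sup>+ z. ennreal (f ((norm z)\<^sup>2)) * indicator (S ((- m) $ k)) z \<partial>lborel)"
    by (simp add: nn_integral_add nn_integral_cmult)
  also have "\<dots> \<le> ennreal (1 / r ^ 3) * (ennreal pi * P) + ennreal (1 / r\<^sup>2) * (ennreal (8 / sqrt r) * P) + ennreal (1 / r\<^sup>2) * (ennreal (8 / sqrt r) * P)"
    unfolding P_def by (intro add_mono mult_left_mono nn_integral_norm_square_le strip[unfolded P_def]) auto
  also have "\<dots> = ennreal (pi / r ^ 3 + 16 / (r\<^sup>2 * sqrt r)) * P"
  proof -
    have "ennreal (1 / r ^ 3) * (ennreal pi * P) + ennreal (1 / r\<^sup>2) * (ennreal (8 / sqrt r) * P) + ennreal (1 / r\<^sup>2) * (ennreal (8 / sqrt r) * P)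
       = (ennreal (1 / r ^ 3) * ennreal pi + ennreal (1 / r\<^sup>2) * ennreal (8 / sqrt r) + ennreal (1 / r\<^sup>2) * ennreal (8 / sqrt r)) * P"
      by (simp add: distrib_right mult.assoc)
    also have "ennreal (1 / r ^ 3) * ennreal pi + ennreal (1 / r\<^sup>2) * ennreal (8 / sqrt r) + ennreal (1 / r\<^sup>2) * ennreal (8 / sqrt r)
       = ennreal (1 / r ^ 3 * pi + 1 / r\<^sup>2 * (8 / sqrt r) + 1 / r\<^sup>2 * (8 / sqrt r))"
      using r by (simp add: ennreal_mult[symmetric] flip: ennreal_plus)
    also have "1 / r ^ 3 * pi + 1 / r\<^sup>2 * (8 / sqrt r) + 1 / r\<^sup>2 * (8 / sqrt r) = pi / r ^ 3 + 16 / (r\<^sup>2 * sqrt r)"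
      by simp
    finally show ?thesis .
  qed
  also have "\<dots> \<le> ennreal (kernel_bound m) * P"
  proof (intro mult_right_mono ennreal_leI)
    have pw: "r\<^sup>2 * sqrt r = (r\<^sup>2) powr (5/4)"
    proof -
      have "(r\<^sup>2) powr (5/4) = r powr (2 + 1/2)"
        using r by (simp add: powr_powr flip: powr_numeral)
      also have "\<dots> = r\<^sup>2 * sqrt r"
        using r unfolding powr_add by (simp add: powr_half_sqrt)
      finally show ?thesis by simp
    qed
    have le3: "r\<^sup>2 * sqrt r \<le> r ^ 3"
    proof -
      have "sqrt r \<le> sqrt (r * r)" using r by (intro real_sqrt_le_mono) (simp add: mult_le_cancel_left1)
      then have "r\<^sup>2 * sqrt r \<le> r\<^sup>2 * r" using r by (intro mult_left_mono) auto
      then show ?thesis by (simp add: power3_eq_cube power2_eq_square)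
    qed
    have "pi / r ^ 3 + 16 / (r\<^sup>2 * sqrt r) \<le> pi / (r\<^sup>2 * sqrt r) + 16 / (r\<^sup>2 * sqrt r)"
      using r le3 by (intro add_mono divide_left_mono) auto
    also have "\<dots> = (pi + 16) * (r\<^sup>2) powr (- (5/4))"
      unfolding pw using r by (simp add: powr_minus field_simps)
    also have "\<dots> = (pi + 16) * 2 powr (5/4) * (2 * r\<^sup>2) powr (- (5/4))"
      using r by (simp add: powr_mult powr_minus field_simps)
    also have "\<dots> \<le> kernel_const * (1 + (norm m)\<^sup>2) powr (- (5/4))"
    proof (intro mult_mono)
      have "1 * 1 \<le> r * r" using r by (intro mult_mono) auto
      then show "(2 * r\<^sup>2) powr (- (5/4)) \<le> (1 + (norm m)\<^sup>2) powr (- (5/4))"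
        unfolding r_def by (intro powr_mono2') (auto simp: power2_eq_square add_pos_nonneg)
    qed (auto simp: kernel_const_def)
    finally show "pi / r ^ 3 + 16 / (r\<^sup>2 * sqrt r) \<le> kernel_bound m" by (simp add: kernel_bound_def)
  qed simp
  finally show ?thesis unfolding P_def .
qed

text \<open>
  The bound depends on \<open>f\<close> only through its integral, so it is uniform in the width
  and the centre of a Gaussian \<open>f\<close>.
\<close>

lemma pair_kernel:
  assumes "f \<in> borel_measurable borel" "\<And>x. 0 \<le> f x"
  shows "(\<integral>\<^sup>+ z. ennreal (f ((norm z)\<^sup>2) / pair_weight m z) \<partial>lborel) \<le> ennreal (kernel_bound m) * (\<integral>\<^sup>+ v. ennreal (f v) \<partial>lborel)"
  using pair_kernel_small[OF assms, of m] pair_kernel_large[OF assms, of m] by (cases "norm m < 16") auto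

lemma nn_integral_kernel_bound: "(\<integral>\<^sup>+ m. ennreal (kernel_bound m) \<partial>lborel) = ennreal (kernel_const * (4 * pi))"
proof -
  have "(\<integral>\<^sup>+ m. ennreal (kernel_bound m) \<partial>lborel) = ennreal pi * (\<integral>\<^sup>+ v. ennreal (kernel_const * (1 + v) powr (- (5/4))) * indicator {0..} v \<partial>lborel)"
    unfolding kernel_bound_def by (rule nn_integral_norm_square) measurable
  also have "(\<integral>\<^sup>+ v. ennreal (kernel_const * (1 + v) powr (- (5/4))) * indicator {0..} v \<partial>lborel)
     = ennreal (0 - kernel_const * (- 4 * (1 + 0) powr (- (1/4))))"
  proof (rule nn_integral_FTC_atLeast)
    show "(\<lambda>v. kernel_const * (1 + v) powr (- (5/4))) \<in> borel_measurable borel" by measurable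
    show "((\<lambda>v. kernel_const * (- 4 * (1 + v) powr (- (1/4)))) has_real_derivative kernel_const * (1 + v) powr (- (5/4))) (at v)" if "0 \<le> v" for v
      using that by (auto intro!: derivative_eq_intros simp: powr_diff[symmetric] field_simps)
    show "((\<lambda>v. kernel_const * (- 4 * (1 + v) powr (- (1/4)))) \<longlongrightarrow> 0) at_top"
    proof -
      have "((\<lambda>v::real. (1 + v) powr (- (1/4))) \<longlongrightarrow> 0) at_top"
        by (intro tendsto_neg_powr filterlim_tendsto_add_at_top[OF tendsto_const filterlim_ident]) auto
      from tendsto_mult_right_zero[OF tendsto_mult_right_zero[OF this]] show ?thesis .
    qed
    show "0 \<le> kernel_const * (1 + v) powr (- (5/4))" for v
      using kernel_const_pos by simp
  qed
  finally show ?thesis using kernel_const_pos by (simp add: ennreal_mult[symmetric] mult_ac)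
qed

lemma product_square_integrable_integrable:
  assumes G: "G \<in> square_integrable lborel"
  shows "integrable lborel (\<lambda>z. G (m + z) * G (m - z :: real^2))"
  using square_integrable_isometry[of 1 G m] square_integrable_isometry[of "-1" G m] G
  by (intro integrable_mult_square_integrable) simp_all

text \<open>
  An instance of \<open>oscillatory_integral_l2_bound\<close> with one-dimensional dual variable
  \<open>t\<close> and phase \<open>- 2 |z|\<^sup>2\<close>.
\<close>

lemma pair_wave_time_bound:
  assumes G: "G \<in> square_integrable lborel"
  shows "(\<integral>\<^sup>+ t. ennreal ((cmod (pair_wave G t m))\<^sup>2) \<partial>lborel)
    \<le> ennreal (pi * kernel_bound m) * (\<integral>\<^sup>+ z. ennreal (pair_weight m z * (cmod (G (m + z) * G (m - z)))\<^sup>2) \<partial>lborel)"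
proof -
  have K: "(\<integral>\<^sup>+ z. ennreal (heat s (- 2 * (norm y)\<^sup>2 - - 2 * (norm z)\<^sup>2) / pair_weight m z) \<partial>lborel) \<le> ennreal (pi * kernel_bound m)"
    if s: "0 < s" for s and y :: "real^2"
  proof -
    let ?f = "\<lambda>v::real. heat s (- 2 * (norm y)\<^sup>2 + 2 *\<^sub>R v)"
    have "ennreal 2 * (\<integral>\<^sup>+ v. ennreal (?f v) \<partial>lborel) = ennreal (2 * pi)"
      using nn_integral_lborel_affine[of "\<lambda>v::real. ennreal (heat s v)" 2 "- 2 * (norm y)\<^sup>2"] nn_integral_heat[OF s, where 'v=real] by simp
    moreover have "ennreal (1/2) * ennreal 2 = 1" "ennreal (1/2) * ennreal (2 * pi) = ennreal pi"
      by (subst ennreal_mult[symmetric]; simp)+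
    ultimately have f: "(\<integral>\<^sup>+ v. ennreal (?f v) \<partial>lborel) = ennreal pi"
      by (metis mult.assoc mult_1)
    have "(\<integral>\<^sup>+ z. ennreal (heat s (- 2 * (norm y)\<^sup>2 - - 2 * (norm z)\<^sup>2) / pair_weight m z) \<partial>lborel)
       = (\<integral>\<^sup>+ z. ennreal (?f ((norm z)\<^sup>2) / pair_weight m z) \<partial>lborel)" by simp
    also have "\<dots> \<le> ennreal (kernel_bound m) * (\<integral>\<^sup>+ v. ennreal (?f v) \<partial>lborel)"
      by (rule pair_kernel) (auto intro: heat_nonneg[OF s])
    also have "\<dots> = ennreal (pi * kernel_bound m)"
      unfolding f using kernel_bound_pos[of m] by (simp add: ennreal_mult[symmetric] mult.commute)
    finally show ?thesis .
  qed
  show ?thesis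
    using oscillatory_integral_l2_bound[where \<Phi>="\<lambda>z::real^2. - 2 * (norm z)\<^sup>2" and w="pair_weight m",
        OF lborel.sigma_finite_measure_axioms product_square_integrable_integrable[OF G, of m] _ _ pair_weight_pos K]
    unfolding pair_wave_def by simp
qed

definition h1_energy :: "(real^2 \<Rightarrow> complex) \<Rightarrow> ennreal" where
  "h1_energy G = (\<integral>\<^sup>+ \<xi>. ennreal ((1 + (norm \<xi>)\<^sup>2) * (cmod (G \<xi>))\<^sup>2) \<partial>lborel)"

lemma nn_integral_pair_weight:
  assumes [measurable]: "G \<in> borel_measurable borel"
  shows "(\<integral>\<^sup>+ m. \<integral>\<^sup>+ z. ennreal (pair_weight m z * (cmod (G (m + z) * G (m - z)))\<^sup>2) \<partial>lborel \<partial>lborel) \<le> (h1_energy G)\<^sup>2"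
proof -
  let ?h = "\<lambda>\<xi>. ennreal ((1 + (norm \<xi>)\<^sup>2) * (cmod (G \<xi>))\<^sup>2)"
  have eq: "ennreal (pair_weight m z * (cmod (G (m + z) * G (m - z)))\<^sup>2) = ?h (m + z) * ?h (m - z)" for m z
    by (simp add: pair_weight_def norm_mult power_mult_distrib ennreal_mult[symmetric] mult_ac)
  let ?X = "\<integral>\<^sup>+ m. \<integral>\<^sup>+ z. ?h (m + z) * ?h (m - z) \<partial>lborel \<partial>lborel"
  have "1 * ?X \<le> ennreal (2 ^ DIM(real^2)) * ?X"
    by (intro mult_right_mono) (auto intro: order_trans[OF _ ennreal_leI[of 1 4]])
  also have "\<dots> = (h1_energy G)\<^sup>2"
    unfolding h1_energy_def power2_eq_square by (rule nn_integral_sum_difference) measurable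
  finally show ?thesis unfolding eq by simp
qed

text \<open>
  A bound for \<open>|free_wave G t x|\<^sup>2\<close> that is independent of \<open>x\<close>
  and measurable in \<open>t\<close>.
\<close>

definition wave_majorant :: "(real^2 \<Rightarrow> complex) \<Rightarrow> real \<Rightarrow> ennreal" where
  "wave_majorant G t = ennreal (1 / pi\<^sup>2) * (\<integral>\<^sup>+ m. ennreal (cmod (pair_wave G t m)) \<partial>lborel)"

lemma wave_majorant_measurable [measurable]:
  assumes [measurable]: "G \<in> borel_measurable borel"
  shows "wave_majorant G \<in> borel_measurable borel"
  unfolding wave_majorant_def[abs_def] by measurable

definition strichartz_const :: real where
  "strichartz_const = (1 / pi\<^sup>2)\<^sup>2 * (pi * (kernel_const * (4 * pi)))"

text \<open>
  The Cauchy--Schwarz inequality in \<open>m\<close> with the weight \<open>kernel_bound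
  m\<close>; its finite integral is what allows the supremum in \<open>x\<close> to be estimated
  by the \<open>L\<^sup>1\<close> norm of the spectrum.
\<close>

lemma wave_majorant_bound:
  assumes G: "G \<in> square_integrable lborel"
  shows "(\<integral>\<^sup>+ t. (wave_majorant G t)\<^sup>2 \<partial>lborel) \<le> ennreal strichartz_const * (h1_energy G)\<^sup>2"
proof -
  have [measurable]: "G \<in> borel_measurable borel" using G by (auto simp: square_integrable_def)
  define \<kappa> where "\<kappa> m = pi * kernel_bound m" for m
  have \<kappa>pos: "0 < \<kappa> m" for m using kernel_bound_pos[of m] by (simp add: \<kappa>_def)
  have [measurable]: "\<kappa> \<in> borel_measurable borel" unfolding \<kappa>_def[abs_def] by measurable
  have int\<kappa>: "(\<integral>\<^sup>+ m. ennreal (\<kappa> m) \<partial>lborel) = ennreal (pi * (kernel_const * (4 * pi)))"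
    unfolding \<kappa>_def using kernel_bound_pos kernel_const_pos
    by (simp add: ennreal_mult' nn_integral_cmult nn_integral_kernel_bound)
  have CS: "(\<integral>\<^sup>+ m. ennreal (cmod (pair_wave G t m)) \<partial>lborel)\<^sup>2
     \<le> ennreal (pi * (kernel_const * (4 * pi))) * (\<integral>\<^sup>+ m. ennreal ((cmod (pair_wave G t m))\<^sup>2 / \<kappa> m) \<partial>lborel)" for t
  proof -
    have "(\<integral>\<^sup>+ m. ennreal (cmod (pair_wave G t m)) \<partial>lborel)
       = (\<integral>\<^sup>+ m. ennreal (sqrt (\<kappa> m)) * ennreal (cmod (pair_wave G t m) / sqrt (\<kappa> m)) \<partial>lborel)"
    proof (rule nn_integral_cong)
      fix m
      show "ennreal (cmod (pair_wave G t m)) = ennreal (sqrt (\<kappa> m)) * ennreal (cmod (pair_wave G t m) / sqrt (\<kappa> m))"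
        using \<kappa>pos[of m] by (subst ennreal_mult[symmetric]) auto
    qed
    also have "\<dots>\<^sup>2 \<le> (\<integral>\<^sup>+ m. (ennreal (sqrt (\<kappa> m)))\<^sup>2 \<partial>lborel) * (\<integral>\<^sup>+ m. (ennreal (cmod (pair_wave G t m) / sqrt (\<kappa> m)))\<^sup>2 \<partial>lborel)"
      by (rule Cauchy_Schwarz_nn_integral) measurable
    also have "\<dots> = (\<integral>\<^sup>+ m. ennreal (\<kappa> m) \<partial>lborel) * (\<integral>\<^sup>+ m. ennreal ((cmod (pair_wave G t m))\<^sup>2 / \<kappa> m) \<partial>lborel)"
      using \<kappa>pos by (simp add: ennreal_power power_divide less_imp_le)
    finally show ?thesis unfolding int\<kappa> .
  qed
  have dbl: "(\<integral>\<^sup>+ t. \<integral>\<^sup>+ m. ennreal ((cmod (pair_wave G t m))\<^sup>2 / \<kappa> m) \<partial>lborel \<partial>lborel) \<le> (h1_energy G)\<^sup>2"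
  proof -
    have "(\<integral>\<^sup>+ t. \<integral>\<^sup>+ m. ennreal ((cmod (pair_wave G t m))\<^sup>2 / \<kappa> m) \<partial>lborel \<partial>lborel)
       = (\<integral>\<^sup>+ m. \<integral>\<^sup>+ t. ennreal (1 / \<kappa> m) * ennreal ((cmod (pair_wave G t m))\<^sup>2) \<partial>lborel \<partial>lborel)"
      using \<kappa>pos by (subst lborel_pair.Fubini') (auto intro!: nn_integral_cong simp: ennreal_mult[symmetric] less_imp_le)
    also have "\<dots> = (\<integral>\<^sup>+ m. ennreal (1 / \<kappa> m) * (\<integral>\<^sup>+ t. ennreal ((cmod (pair_wave G t m))\<^sup>2) \<partial>lborel) \<partial>lborel)"
      by (intro nn_integral_cong nn_integral_cmult) measurable
    also have "\<dots> \<le> (\<integral>\<^sup>+ m. ennreal (1 / \<kappa> m) * (ennreal (\<kappa> m) * (\<integral>\<^sup>+ z. ennreal (pair_weight m z * (cmod (G (m + z) * G (m - z)))\<^sup>2) \<partial>lborel)) \<partial>lborel)"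
      unfolding \<kappa>_def by (intro nn_integral_mono mult_left_mono pair_wave_time_bound G) simp
    also have "\<dots> = (\<integral>\<^sup>+ m. \<integral>\<^sup>+ z. ennreal (pair_weight m z * (cmod (G (m + z) * G (m - z)))\<^sup>2) \<partial>lborel \<partial>lborel)"
    proof (rule nn_integral_cong)
      fix m :: "real^2"
      have "ennreal (1 / \<kappa> m) * ennreal (\<kappa> m) = 1"
        using \<kappa>pos[of m] by (simp add: ennreal_mult[symmetric])
      then show "ennreal (1 / \<kappa> m) * (ennreal (\<kappa> m) * (\<integral>\<^sup>+ z. ennreal (pair_weight m z * (cmod (G (m + z) * G (m - z)))\<^sup>2) \<partial>lborel))
        = (\<integral>\<^sup>+ z. ennreal (pair_weight m z * (cmod (G (m + z) * G (m - z)))\<^sup>2) \<partial>lborel)"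
        by (simp add: mult.assoc[symmetric])
    qed
    also have "\<dots> \<le> (h1_energy G)\<^sup>2" by (rule nn_integral_pair_weight) measurable
    finally show ?thesis .
  qed
  have "(\<integral>\<^sup>+ t. (wave_majorant G t)\<^sup>2 \<partial>lborel)
     \<le> (\<integral>\<^sup>+ t. ennreal strichartz_const * (\<integral>\<^sup>+ m. ennreal ((cmod (pair_wave G t m))\<^sup>2 / \<kappa> m) \<partial>lborel) \<partial>lborel)"
  proof (rule nn_integral_mono)
    fix t :: real
    have "(wave_majorant G t)\<^sup>2 = ennreal ((1 / pi\<^sup>2)\<^sup>2) * (\<integral>\<^sup>+ m. ennreal (cmod (pair_wave G t m)) \<partial>lborel)\<^sup>2"
      unfolding wave_majorant_def power_mult_distrib by (simp add: ennreal_power)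
    also have "\<dots> \<le> ennreal ((1 / pi\<^sup>2)\<^sup>2) * (ennreal (pi * (kernel_const * (4 * pi))) * (\<integral>\<^sup>+ m. ennreal ((cmod (pair_wave G t m))\<^sup>2 / \<kappa> m) \<partial>lborel))"
      by (intro mult_left_mono CS) simp
    also have "\<dots> = ennreal strichartz_const * (\<integral>\<^sup>+ m. ennreal ((cmod (pair_wave G t m))\<^sup>2 / \<kappa> m) \<partial>lborel)"
    proof -
      have "ennreal strichartz_const = ennreal ((1 / pi\<^sup>2)\<^sup>2) * ennreal (pi * (kernel_const * (4 * pi)))"
        unfolding strichartz_const_def using kernel_const_pos by (intro ennreal_mult) auto
      then show ?thesis by (simp only: mult.assoc)
    qed
    finally show "(wave_majorant G t)\<^sup>2 \<le> ennreal strichartz_const * (\<integral>\<^sup>+ m. ennreal ((cmod (pair_wave G t m))\<^sup>2 / \<kappa> m) \<partial>lborel)" .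
  qed
  also have "\<dots> = ennreal strichartz_const * (\<integral>\<^sup>+ t. \<integral>\<^sup>+ m. ennreal ((cmod (pair_wave G t m))\<^sup>2 / \<kappa> m) \<partial>lborel \<partial>lborel)"
    by (rule nn_integral_cmult) measurable
  also have "\<dots> \<le> ennreal strichartz_const * (h1_energy G)\<^sup>2"
    by (intro mult_left_mono dbl) simp
  finally show ?thesis .
qed

definition propagate :: "real \<Rightarrow> (real^2 \<Rightarrow> complex) \<Rightarrow> real^2 \<Rightarrow> complex" where
  "propagate t G \<xi> = cis (- (t * (norm \<xi>)\<^sup>2)) * G \<xi>"

lemma schroedinger_eq: "schroedinger t f = inverse_fourier (propagate t (fourier f))"
  unfolding schroedinger_def propagate_def ..

lemma propagate_square_integrable:
  "G \<in> square_integrable lborel \<Longrightarrow> propagate t G \<in> square_integrable lborel"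
  unfolding propagate_def by (rule square_integrable_mult_bounded[where c=1]) auto

lemma propagate_integrable: "integrable lborel G \<Longrightarrow> integrable lborel (propagate t G)"
  unfolding propagate_def by (rule cis_mult_integrable) auto

lemma inverse_fourier_propagate:
  assumes "G \<in> square_integrable lborel" "integrable lborel G"
  shows "AE x in lborel. inverse_fourier (propagate t G) x = free_wave G t x"
proof -
  have "cis (x \<bullet> \<xi> - t * (norm \<xi>)\<^sup>2) * G \<xi> = cis (x \<bullet> \<xi>) * propagate t G \<xi>" for x \<xi>
    by (simp add: propagate_def mult.assoc[symmetric] cis_mult)
  then show ?thesis
    using inverse_fourier_eq_l1[OF propagate_square_integrable propagate_integrable] assms unfolding free_wave_def by simp
qed

lemma sqnorm_inverse_fourier_propagate_diff:
  assumes G: "G \<in> square_integrable lborel" and H: "H \<in> square_integrable lborel"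
  shows "sqnorm lborel (\<lambda>x. inverse_fourier (propagate t G) x - inverse_fourier (propagate t H) x) \<le> sqnorm lborel (\<lambda>\<xi>. G \<xi> - H \<xi>)"
proof -
  have D: "(\<lambda>\<xi>. propagate t G \<xi> - propagate t H \<xi>) \<in> square_integrable lborel"
    by (intro square_integrable_diff propagate_square_integrable G H)
  have m: "inverse_fourier (propagate t G) \<in> borel_measurable lborel" "inverse_fourier (propagate t H) \<in> borel_measurable lborel"
      "inverse_fourier (\<lambda>\<xi>. propagate t G \<xi> - propagate t H \<xi>) \<in> borel_measurable lborel"
    using inverse_fourier_square_integrable[OF propagate_square_integrable[OF G]]
      inverse_fourier_square_integrable[OF propagate_square_integrable[OF H]] inverse_fourier_square_integrable[OF D]
    by (auto intro: square_integrable_borel)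
  have "sqnorm lborel (\<lambda>x. inverse_fourier (propagate t G) x - inverse_fourier (propagate t H) x)
     = sqnorm lborel (inverse_fourier (\<lambda>\<xi>. propagate t G \<xi> - propagate t H \<xi>))"
  proof (rule sqnorm_cong_AE)
    show "AE x in lborel. inverse_fourier (propagate t G) x - inverse_fourier (propagate t H) x = inverse_fourier (\<lambda>\<xi>. propagate t G \<xi> - propagate t H \<xi>) x"
      using inverse_fourier_diff[OF propagate_square_integrable[OF G, of t] propagate_square_integrable[OF H, of t]] by eventually_elim simp
  qed (use m in auto)
  also have "\<dots> \<le> sqnorm lborel (\<lambda>\<xi>. propagate t G \<xi> - propagate t H \<xi>)"
    by (rule sqnorm_inverse_fourier_le[OF D])
  also have "\<dots> = sqnorm lborel (\<lambda>\<xi>. G \<xi> - H \<xi>)"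
    unfolding sqnorm_def propagate_def right_diff_distrib[symmetric] by (simp add: norm_mult)
  finally show ?thesis .
qed

text \<open>
  The convergence is in \<open>L\<^sup>2\<close> by unitarity, hence almost everywhere along a
  subsequence, which may depend on \<open>t\<close>.
\<close>

lemma free_wave_approximation:
  fixes r :: "nat \<Rightarrow> nat"
  assumes G: "G \<in> square_integrable lborel" and r: "strict_mono r"
  shows "\<exists>s::nat\<Rightarrow>nat. strict_mono s \<and> (AE x in lborel. (\<lambda>k. free_wave (cutoff (real (r (s k))) G) t x) \<longlonglongrightarrow> inverse_fourier (propagate t G) x)"
proof -
  let ?f = "\<lambda>k. inverse_fourier (propagate t (cutoff (real (r k)) G))"
  have "(\<lambda>k. sqnorm lborel (\<lambda>x. ?f k x - inverse_fourier (propagate t G) x)) \<longlonglongrightarrow> 0"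
  proof (rule tendsto_sandwich[OF _ _ tendsto_const])
    show "(\<lambda>k. sqnorm lborel (\<lambda>x. cutoff (real (r k)) G x - G x)) \<longlonglongrightarrow> 0"
      using LIMSEQ_subseq_LIMSEQ[OF cutoff_tendsto_nat[OF G] r] by (simp add: o_def)
  qed (auto intro!: always_eventually sqnorm_inverse_fourier_propagate_diff cutoff_square_integrable G)
  then obtain s :: "nat \<Rightarrow> nat" where s: "strict_mono s" "AE x in lborel. (\<lambda>k. ?f (s k) x) \<longlonglongrightarrow> inverse_fourier (propagate t G) x"
    using l2_tendsto_AE_subseq[of ?f lborel "inverse_fourier (propagate t G)"]
    by (auto intro!: inverse_fourier_square_integrable propagate_square_integrable cutoff_square_integrable G)
  have "AE x in lborel. \<forall>k. ?f (s k) x = free_wave (cutoff (real (r (s k))) G) t x"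
    unfolding AE_all_countable by (intro allI inverse_fourier_propagate cutoff_square_integrable cutoff_integrable G)
  with s(2) have "AE x in lborel. (\<lambda>k. free_wave (cutoff (real (r (s k))) G) t x) \<longlonglongrightarrow> inverse_fourier (propagate t G) x"
    by eventually_elim simp
  with s(1) show ?thesis by blast
qed

lemma h1_energy_cutoff_le: "h1_energy (cutoff R G) \<le> h1_energy G"
  unfolding h1_energy_def by (intro nn_integral_mono ennreal_leI mult_left_mono power_mono norm_cutoff_le) auto

text \<open>
  The wave of a general spectrum is defined at each time only up to a null set, so its supremum
  in \<open>x\<close> is replaced by a measurable majorant \<open>N\<close> of its fourth power,
  the lower limit of the majorants of the frequency truncations. At each time a subsequence that
  realises the lower limit is used for the almost everywhere convergence.
\<close>

theorem strichartz_L4_Linfty: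
  assumes G: "G \<in> square_integrable lborel"
  shows "\<exists>N\<in>borel_measurable borel. (\<forall>t. AE x in lborel. ennreal (cmod (inverse_fourier (propagate t G) x) ^ 4) \<le> N t) \<and>
     (\<integral>\<^sup>+ t. N t \<partial>lborel) \<le> ennreal strichartz_const * (h1_energy G)\<^sup>2"
proof -
  have [measurable]: "G \<in> borel_measurable borel" using G by (auto simp: square_integrable_def)
  define a where "a t k = (wave_majorant (cutoff (real k) G) t)\<^sup>2" for t k
  have am[measurable]: "(\<lambda>t. a t k) \<in> borel_measurable borel" for k
    unfolding a_def by measurable
  define N where "N t = liminf (\<lambda>k. a t k)" for t
  have Nm: "N \<in> borel_measurable borel" unfolding N_def[abs_def] by measurable
  have le: "ennreal (cmod (free_wave (cutoff (real k) G) t x) ^ 4) \<le> a t k" for k t x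
  proof -
    have "ennreal (cmod (free_wave (cutoff (real k) G) t x) ^ 4) = (ennreal ((cmod (free_wave (cutoff (real k) G) t x))\<^sup>2))\<^sup>2"
      by (simp add: ennreal_power power_mult[symmetric])
    also have "\<dots> \<le> a t k"
      unfolding a_def wave_majorant_def by (intro power_mono free_wave_le_pair_wave cutoff_integrable G) simp
    finally show ?thesis .
  qed
  have "AE x in lborel. ennreal (cmod (inverse_fourier (propagate t G) x) ^ 4) \<le> N t" for t
  proof -
    obtain r :: "nat \<Rightarrow> nat" where r: "strict_mono r" "(a t \<circ> r) \<longlonglongrightarrow> N t"
      using liminf_subseq_lim[of "a t"] unfolding N_def by auto
    obtain s :: "nat \<Rightarrow> nat" where s: "strict_mono s"
      "AE x in lborel. (\<lambda>k. free_wave (cutoff (real (r (s k))) G) t x) \<longlonglongrightarrow> inverse_fourier (propagate t G) x"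
      using free_wave_approximation[OF G r(1)] by blast
    have lim: "(\<lambda>k. a t (r (s k))) \<longlonglongrightarrow> N t"
      using LIMSEQ_subseq_LIMSEQ[OF r(2) s(1)] by (simp add: o_def)
    from s(2) show ?thesis
    proof eventually_elim
      case (elim x)
      have "(\<lambda>k. ennreal (cmod (free_wave (cutoff (real (r (s k))) G) t x) ^ 4)) \<longlonglongrightarrow> ennreal (cmod (inverse_fourier (propagate t G) x) ^ 4)"
        by (intro tendsto_ennrealI tendsto_power tendsto_norm elim)
      then show ?case by (rule LIMSEQ_le[OF _ lim]) (use le in auto)
    qed
  qed
  moreover have "(\<integral>\<^sup>+ t. N t \<partial>lborel) \<le> ennreal strichartz_const * (h1_energy G)\<^sup>2"
  proof -
    have "(\<integral>\<^sup>+ t. N t \<partial>lborel) \<le> liminf (\<lambda>k. \<integral>\<^sup>+ t. a t k \<partial>lborel)"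
      unfolding N_def by (rule nn_integral_liminf) measurable
    also have "\<dots> \<le> limsup (\<lambda>k. \<integral>\<^sup>+ t. a t k \<partial>lborel)" by (rule Liminf_le_Limsup) simp
    also have "\<dots> \<le> ennreal strichartz_const * (h1_energy G)\<^sup>2"
    proof (intro Limsup_bounded always_eventually allI)
      fix k
      have "(\<integral>\<^sup>+ t. a t k \<partial>lborel) \<le> ennreal strichartz_const * (h1_energy (cutoff (real k) G))\<^sup>2"
        unfolding a_def by (intro wave_majorant_bound cutoff_square_integrable G)
      also have "\<dots> \<le> ennreal strichartz_const * (h1_energy G)\<^sup>2"
        by (intro mult_left_mono power_mono h1_energy_cutoff_le) auto
      finally show "(\<integral>\<^sup>+ t. a t k \<partial>lborel) \<le> ennreal strichartz_const * (h1_energy G)\<^sup>2" .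
    qed
    finally show ?thesis .
  qed
  ultimately show ?thesis using Nm by blast
qed

text \<open>
  The squared \<open>L\<^sup>2\<close> norm of \<open>(1 +
  |\<xi>|\<^sup>2)\<^sup>-\<^sup>1\<close> over \<open>A\<close>, finite in dimension two.
\<close>

definition sobolev_tail :: "(real^2) set \<Rightarrow> ennreal" where
  "sobolev_tail A = (\<integral>\<^sup>+ \<xi>. ennreal (1 / (1 + (norm \<xi>)\<^sup>2)\<^sup>2) * indicator A \<xi> \<partial>lborel)"

text \<open>
  The Cauchy--Schwarz inequality in \<open>z\<close> with the weights \<open>(1 + |m
  \<plusminus> z|\<^sup>2)\<^sup>1\<^sup>/\<^sup>2\<close>; the product of the squared inverse
  weights is at most the mean of their fourth powers, whose integral is \<open>sobolev_tail
  A\<close>.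
\<close>

lemma pair_wave_L2_bound:
  assumes G: "G \<in> square_integrable lborel" and [measurable]: "A \<in> sets borel" and A: "\<And>\<xi>. \<xi> \<notin> A \<Longrightarrow> G \<xi> = 0"
  shows "(\<integral>\<^sup>+ m. ennreal ((cmod (pair_wave G t m))\<^sup>2) \<partial>lborel) \<le> sobolev_tail A * (h1_energy G)\<^sup>2"
proof -
  have [measurable]: "G \<in> borel_measurable borel" using G by (auto simp: square_integrable_def)
  define w where "w \<xi> = sqrt (1 + (norm \<xi>)\<^sup>2)" for \<xi> :: "real^2"
  have wm[measurable]: "w \<in> borel_measurable borel" unfolding w_def[abs_def] by measurable
  have wpos: "0 < w \<xi>" for \<xi> by (simp add: w_def add_pos_nonneg)
  have w2: "(w \<xi>)\<^sup>2 = 1 + (norm \<xi>)\<^sup>2" for \<xi> by (simp add: w_def)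
  define \<alpha> where "\<alpha> \<xi> = ennreal (1 / w \<xi>) * indicator A \<xi>" for \<xi>
  define \<beta> where "\<beta> \<xi> = ennreal (w \<xi> * cmod (G \<xi>))" for \<xi>
  have [measurable]: "\<alpha> \<in> borel_measurable borel" "\<beta> \<in> borel_measurable borel"
    unfolding \<alpha>_def[abs_def] \<beta>_def[abs_def] by measurable
  have ab: "ennreal (cmod (G \<xi>)) = \<alpha> \<xi> * \<beta> \<xi>" for \<xi>
    using A[of \<xi>] wpos[of \<xi>] by (cases "\<xi> \<in> A") (auto simp: \<alpha>_def \<beta>_def ennreal_mult[symmetric])
  have \<beta>2: "(\<beta> \<xi>)\<^sup>2 = ennreal ((1 + (norm \<xi>)\<^sup>2) * (cmod (G \<xi>))\<^sup>2)" for \<xi>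
    using wpos[of \<xi>] by (simp add: \<beta>_def ennreal_power power_mult_distrib w2 less_imp_le)
  have \<alpha>4: "(\<alpha> \<xi>) ^ 4 = ennreal (1 / (1 + (norm \<xi>)\<^sup>2)\<^sup>2) * indicator A \<xi>" for \<xi>
  proof -
    have "w \<xi> ^ 4 = (1 + (norm \<xi>)\<^sup>2)\<^sup>2" unfolding w2[symmetric] by (simp add: power_mult[symmetric])
    then show ?thesis using wpos[of \<xi>]
      by (cases "\<xi> \<in> A") (simp_all add: \<alpha>_def ennreal_power power_one_over)
  qed
  have \<alpha>_int: "(\<integral>\<^sup>+ z. (\<alpha> (m + z) * \<alpha> (m - z))\<^sup>2 \<partial>lborel) \<le> sobolev_tail A" for m
  proof -
    have am: "x\<^sup>2 * y\<^sup>2 \<le> (x ^ 4 + y ^ 4) / 2" if "x < top" "y < top" for x y :: ennreal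
    proof -
      obtain p q where pq: "x = ennreal p" "y = ennreal q" "0 \<le> p" "0 \<le> q"
        using \<open>x < top\<close> \<open>y < top\<close> by (cases x; cases y) auto
      have "p\<^sup>2 * q\<^sup>2 \<le> (p ^ 4 + q ^ 4) / 2"
        using sum_squares_bound[of "p\<^sup>2" "q\<^sup>2"] by (simp add: power_mult[symmetric])
      then have "ennreal (p\<^sup>2 * q\<^sup>2) \<le> ennreal ((p ^ 4 + q ^ 4) / 2)" by (rule ennreal_leI)
      then show ?thesis using pq divide_ennreal[of "p ^ 4 + q ^ 4" 2]
        by (simp add: ennreal_power ennreal_mult)
    qed
    have fin: "\<alpha> \<xi> < top" for \<xi> by (simp add: \<alpha>_def indicator_def)
    have "(\<integral>\<^sup>+ z. (\<alpha> (m + z) * \<alpha> (m - z))\<^sup>2 \<partial>lborel) \<le> (\<integral>\<^sup>+ z. (\<alpha> (m + z) ^ 4 + \<alpha> (m - z) ^ 4) / 2 \<partial>lborel)"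
      unfolding power_mult_distrib by (intro nn_integral_mono am fin)
    also have "\<dots> = ((\<integral>\<^sup>+ z. \<alpha> (m + z) ^ 4 \<partial>lborel) + (\<integral>\<^sup>+ z. \<alpha> (m - z) ^ 4 \<partial>lborel)) / 2"
      by (simp add: nn_integral_divide nn_integral_add)
    also have "(\<integral>\<^sup>+ z. \<alpha> (m + z) ^ 4 \<partial>lborel) = sobolev_tail A"
      unfolding sobolev_tail_def \<alpha>4[symmetric] by (rule nn_integral_lborel_translate) measurable
    also have "(\<integral>\<^sup>+ z. \<alpha> (m - z) ^ 4 \<partial>lborel) = sobolev_tail A"
      unfolding sobolev_tail_def \<alpha>4[symmetric] by (rule nn_integral_lborel_reflect) measurable
    also have "(sobolev_tail A + sobolev_tail A) / 2 = sobolev_tail A"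
      unfolding mult_2[symmetric] by (subst mult.commute, subst ennreal_mult_divide_eq) simp_all
    finally show ?thesis .
  qed
  have pw: "ennreal ((cmod (pair_wave G t m))\<^sup>2) \<le> sobolev_tail A * (\<integral>\<^sup>+ z. ennreal (pair_weight m z * (cmod (G (m + z) * G (m - z)))\<^sup>2) \<partial>lborel)" for m
  proof -
    have "ennreal (cmod (pair_wave G t m)) \<le> (\<integral>\<^sup>+ z. ennreal (norm (cis (t * (- 2 * (norm z)\<^sup>2)) * (G (m + z) * G (m - z)))) \<partial>lborel)"
      unfolding pair_wave_def
      by (intro integral_norm_bound_ennreal cis_mult_integrable product_square_integrable_integrable G) measurable
    also have "\<dots> = (\<integral>\<^sup>+ z. (\<alpha> (m + z) * \<alpha> (m - z)) * (\<beta> (m + z) * \<beta> (m - z)) \<partial>lborel)"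
      by (simp add: norm_mult ennreal_mult ab mult_ac)
    finally have "(ennreal (cmod (pair_wave G t m)))\<^sup>2 \<le> (\<integral>\<^sup>+ z. (\<alpha> (m + z) * \<alpha> (m - z)) * (\<beta> (m + z) * \<beta> (m - z)) \<partial>lborel)\<^sup>2"
      by (rule power_mono) simp
    also have "\<dots> \<le> (\<integral>\<^sup>+ z. (\<alpha> (m + z) * \<alpha> (m - z))\<^sup>2 \<partial>lborel) * (\<integral>\<^sup>+ z. (\<beta> (m + z) * \<beta> (m - z))\<^sup>2 \<partial>lborel)"
      by (rule Cauchy_Schwarz_nn_integral) measurable
    also have "\<dots> \<le> sobolev_tail A * (\<integral>\<^sup>+ z. (\<beta> (m + z) * \<beta> (m - z))\<^sup>2 \<partial>lborel)"
      by (intro mult_right_mono \<alpha>_int) simp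
    also have "(\<integral>\<^sup>+ z. (\<beta> (m + z) * \<beta> (m - z))\<^sup>2 \<partial>lborel) = (\<integral>\<^sup>+ z. ennreal (pair_weight m z * (cmod (G (m + z) * G (m - z)))\<^sup>2) \<partial>lborel)"
      unfolding power_mult_distrib \<beta>2
      by (simp add: pair_weight_def norm_mult power_mult_distrib ennreal_mult[symmetric] mult_ac)
    finally show ?thesis by (simp add: ennreal_power)
  qed
  have "(\<integral>\<^sup>+ m. ennreal ((cmod (pair_wave G t m))\<^sup>2) \<partial>lborel)
     \<le> (\<integral>\<^sup>+ m. sobolev_tail A * (\<integral>\<^sup>+ z. ennreal (pair_weight m z * (cmod (G (m + z) * G (m - z)))\<^sup>2) \<partial>lborel) \<partial>lborel)"
    by (intro nn_integral_mono pw)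
  also have "\<dots> = sobolev_tail A * (\<integral>\<^sup>+ m. \<integral>\<^sup>+ z. ennreal (pair_weight m z * (cmod (G (m + z) * G (m - z)))\<^sup>2) \<partial>lborel \<partial>lborel)"
    by (rule nn_integral_cmult) (unfold pair_weight_def, measurable)
  also have "\<dots> \<le> sobolev_tail A * (h1_energy G)\<^sup>2"
    by (intro mult_left_mono nn_integral_pair_weight) auto
  finally show ?thesis .
qed

lemma free_wave_L4:
  assumes G: "G \<in> square_integrable lborel" and int: "integrable lborel G"
    and A: "A \<in> sets borel" "\<And>\<xi>. \<xi> \<notin> A \<Longrightarrow> G \<xi> = 0"
  shows "(\<integral>\<^sup>+ x. ennreal (cmod (free_wave G t x) ^ 4) \<partial>lborel) \<le> sobolev_tail A * (h1_energy G)\<^sup>2"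
proof -
  have [measurable]: "G \<in> borel_measurable borel" using int by auto
  define b where "b m = cis (- (2 * t * (norm m)\<^sup>2)) * pair_wave G t m" for m
  have bint: "integrable lborel b" unfolding b_def by (rule free_wave_square[OF int])
  have [measurable]: "b \<in> borel_measurable borel" using bint by auto
  define F where "F y = ennreal ((cmod (LINT m|lborel. cis (y \<bullet> m) * b m))\<^sup>2)" for y
  have Fm[measurable]: "F \<in> borel_measurable borel"
    unfolding F_def[abs_def] by measurable
  have eq: "ennreal (cmod (free_wave G t x) ^ 4) = ennreal (1 / pi ^ 4) * F (0 + 2 *\<^sub>R x)" for x
  proof -
    have "cmod (free_wave G t x) ^ 4 = (cmod ((free_wave G t x)\<^sup>2))\<^sup>2"
      by (simp add: norm_power power_mult[symmetric])
    also have "\<dots> = 1 / pi ^ 4 * (cmod (LINT m|lborel. cis ((2 *\<^sub>R x) \<bullet> m) * b m))\<^sup>2"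
      unfolding free_wave_square(1)[OF int] b_def by (simp add: norm_divide norm_power power_divide power_mult[symmetric])
    finally show ?thesis
      unfolding F_def using ennreal_mult[of "1 / pi ^ 4" "(cmod (LINT m|lborel. cis ((2 *\<^sub>R x) \<bullet> m) * b m))\<^sup>2"] by simp
  qed
  have "(\<integral>\<^sup>+ y. F y \<partial>lborel) \<le> ennreal ((2 * pi)\<^sup>2) * (\<integral>\<^sup>+ m. ennreal ((cmod (b m))\<^sup>2) \<partial>lborel)"
    unfolding F_def using Plancherel_bound[OF bint] by simp
  also have "(\<integral>\<^sup>+ m. ennreal ((cmod (b m))\<^sup>2) \<partial>lborel) = (\<integral>\<^sup>+ m. ennreal ((cmod (pair_wave G t m))\<^sup>2) \<partial>lborel)"
    by (simp add: b_def norm_mult)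
  also have "ennreal ((2 * pi)\<^sup>2) * \<dots> \<le> ennreal ((2 * pi)\<^sup>2) * (sobolev_tail A * (h1_energy G)\<^sup>2)"
    by (intro mult_left_mono pair_wave_L2_bound G A) auto
  finally have F_le: "(\<integral>\<^sup>+ y. F y \<partial>lborel) \<le> ennreal ((2 * pi)\<^sup>2) * (sobolev_tail A * (h1_energy G)\<^sup>2)" .
  have F4: "(\<integral>\<^sup>+ y. F y \<partial>lborel) = ennreal 4 * (\<integral>\<^sup>+ x. F (0 + 2 *\<^sub>R x) \<partial>lborel)"
    using nn_integral_lborel_affine[of F 2 0] by simp
  have "(\<integral>\<^sup>+ x. ennreal (cmod (free_wave G t x) ^ 4) \<partial>lborel) = ennreal (1 / pi ^ 4) * (\<integral>\<^sup>+ x. F (0 + 2 *\<^sub>R x) \<partial>lborel)"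
    unfolding eq by (rule nn_integral_cmult) measurable
  also have "\<dots> = ennreal (1 / (4 * pi ^ 4)) * (\<integral>\<^sup>+ y. F y \<partial>lborel)"
    unfolding F4 mult.assoc[symmetric] by (subst ennreal_mult[symmetric]) auto
  also have "\<dots> \<le> ennreal (1 / (4 * pi ^ 4)) * (ennreal ((2 * pi)\<^sup>2) * (sobolev_tail A * (h1_energy G)\<^sup>2))"
    by (intro mult_left_mono F_le) simp
  also have "\<dots> = ennreal (1 / pi\<^sup>2) * (sobolev_tail A * (h1_energy G)\<^sup>2)"
    unfolding mult.assoc[symmetric]
    by (subst ennreal_mult[symmetric]) (auto simp: power_mult_distrib field_simps power2_eq_square power4_eq_xxxx)
  also have "\<dots> \<le> 1 * (sobolev_tail A * (h1_energy G)\<^sup>2)"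
  proof (intro mult_right_mono)
    have "1 * 1 \<le> pi * pi" using pi_ge_two by (intro mult_mono) linarith+
    then have "1 / pi\<^sup>2 \<le> 1" by (simp add: power2_eq_square divide_le_eq_1)
    then show "ennreal (1 / pi\<^sup>2) \<le> 1" using ennreal_leI by fastforce
  qed simp
  finally show ?thesis by simp
qed

text \<open>
  The \<open>L\<^sup>4\<close> norm of a wave is the \<open>L\<^sup>2\<close> norm of its
  square, to which the Plancherel inequality applies. The support condition makes the constant
  small for high frequencies.
\<close>

theorem sobolev_L4:
  assumes G: "G \<in> square_integrable lborel" and A: "A \<in> sets borel" "\<And>\<xi>. \<xi> \<notin> A \<Longrightarrow> G \<xi> = 0"
  shows "(\<integral>\<^sup>+ x. ennreal (cmod (inverse_fourier (propagate t G) x) ^ 4) \<partial>lborel) \<le> sobolev_tail A * (h1_energy G)\<^sup>2"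
proof -
  have [measurable]: "G \<in> borel_measurable borel" using G by (auto simp: square_integrable_def)
  obtain s :: "nat \<Rightarrow> nat" where s: "strict_mono s"
      "AE x in lborel. (\<lambda>k. free_wave (cutoff (real (s k)) G) t x) \<longlonglongrightarrow> inverse_fourier (propagate t G) x"
    using free_wave_approximation[OF G strict_mono_id] by auto
  show ?thesis
  proof (rule nn_integral_le_of_AE_tendsto[where u="\<lambda>k x. ennreal (cmod (free_wave (cutoff (real (s k)) G) t x) ^ 4)"])
    show "(\<lambda>x. ennreal (cmod (free_wave (cutoff (real (s k)) G) t x) ^ 4)) \<in> borel_measurable lborel" for k
      unfolding free_wave_def by measurable
    show "AE x in lborel. (\<lambda>k. ennreal (cmod (free_wave (cutoff (real (s k)) G) t x) ^ 4)) \<longlonglongrightarrow> ennreal (cmod (inverse_fourier (propagate t G) x) ^ 4)"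
      using s(2) by eventually_elim (intro tendsto_ennrealI tendsto_power tendsto_norm)
    show "\<forall>\<^sub>F k in sequentially. (\<integral>\<^sup>+ x. ennreal (cmod (free_wave (cutoff (real (s k)) G) t x) ^ 4) \<partial>lborel) \<le> sobolev_tail A * (h1_energy G)\<^sup>2"
    proof (intro always_eventually allI)
      fix k
      have "(\<integral>\<^sup>+ x. ennreal (cmod (free_wave (cutoff (real (s k)) G) t x) ^ 4) \<partial>lborel) \<le> sobolev_tail A * (h1_energy (cutoff (real (s k)) G))\<^sup>2"
        by (intro free_wave_L4 cutoff_square_integrable cutoff_integrable G A) (simp add: cutoff_def A)
      also have "\<dots> \<le> sobolev_tail A * (h1_energy G)\<^sup>2"
        by (intro mult_left_mono power_mono h1_energy_cutoff_le) auto
      finally show "(\<integral>\<^sup>+ x. ennreal (cmod (free_wave (cutoff (real (s k)) G) t x) ^ 4) \<partial>lborel) \<le> sobolev_tail A * (h1_energy G)\<^sup>2" .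
    qed
  qed
qed

lemma sobolev_tail_outside_ball:
  "sobolev_tail {\<xi>. R\<^sup>2 \<le> (norm \<xi>)\<^sup>2} = ennreal (pi / (1 + R\<^sup>2))"
proof -
  have "sobolev_tail {\<xi>. R\<^sup>2 \<le> (norm \<xi>)\<^sup>2} = (\<integral>\<^sup>+ \<xi>. ennreal (1 / (1 + (norm (\<xi>::real^2))\<^sup>2)\<^sup>2) * indicator {R\<^sup>2..} ((norm \<xi>)\<^sup>2) \<partial>lborel)"
    unfolding sobolev_tail_def by (simp add: indicator_def)
  also have "\<dots> = ennreal pi * (\<integral>\<^sup>+ v. ennreal (1 / (1 + v)\<^sup>2) * indicator {R\<^sup>2..} v * indicator {0..} v \<partial>lborel)"
    by (rule nn_integral_norm_square) measurable
  also have "(\<integral>\<^sup>+ v. ennreal (1 / (1 + v)\<^sup>2) * indicator {R\<^sup>2..} v * indicator {0..} v \<partial>lborel)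
     = (\<integral>\<^sup>+ v. ennreal (1 / (1 + v)\<^sup>2) * indicator {R\<^sup>2..} v \<partial>lborel)"
    by (intro nn_integral_cong) (auto simp: indicator_def intro: order_trans[OF zero_le_power2])
  also have "\<dots> = ennreal (0 - (- 1 / (1 + R\<^sup>2)))"
  proof (rule nn_integral_FTC_atLeast)
    show "((\<lambda>v. - 1 / (1 + v)) has_real_derivative 1 / (1 + v)\<^sup>2) (at v)" if "R\<^sup>2 \<le> v" for v
    proof -
      have "1 + v \<noteq> 0" using that zero_le_power2[of R] by linarith
      then show ?thesis by (auto intro!: derivative_eq_intros simp: power2_eq_square)
    qed
    show "((\<lambda>v::real. - 1 / (1 + v)) \<longlongrightarrow> 0) at_top"
      by (intro real_tendsto_divide_at_top[OF tendsto_const] filterlim_tendsto_add_at_top[OF tendsto_const filterlim_ident])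
  qed auto
  finally show ?thesis by (simp add: ennreal_mult[symmetric])
qed

section \<open>Decay of the action of the symmetry group\<close>

text \<open>
  The symmetries on the Fourier side: multiplication by \<open>phase (t, x)\<close> is the free
  flow over the time \<open>- t\<close> followed by the translation by \<open>x\<close>.
  Addition of parameters corresponds to multiplication.
\<close>

definition phase :: "real \<times> (real^2) \<Rightarrow> real^2 \<Rightarrow> complex" where
  "phase p \<xi> = cis (fst p * (norm \<xi>)\<^sup>2 - snd p \<bullet> \<xi>)"

lemma phase_measurable [measurable]: "phase p \<in> borel_measurable borel"
  unfolding phase_def[abs_def] by measurable

lemma norm_phase [simp]: "cmod (phase p \<xi>) = 1"
  by (simp add: phase_def)

lemma phase_add: "phase (p + q) \<xi> = phase p \<xi> * phase q \<xi>"
  by (simp add: phase_def cis_mult algebra_simps inner_add_left)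

lemma phase_zero [simp]: "phase 0 \<xi> = 1"
  by (simp add: phase_def)

lemma phase_minus_mult: "phase (- p) \<xi> * phase p \<xi> = 1"
  using phase_add[of "- p" p \<xi>] by simp

lemma free_wave_eq_phase:
  "free_wave G t x = (LINT \<xi>|lborel. phase (- t, - x) \<xi> * G \<xi>) / complex_of_real (2 * pi)"
  by (simp add: free_wave_def phase_def algebra_simps)

lemma norm_cis_diff_le: "cmod (cis a - cis b) \<le> \<bar>a - b\<bar>"
proof -
  have "cmod (cis (a - b) - 1) \<le> \<bar>a - b\<bar>"
    using iexp_approx1[of "a - b" 0] by (simp add: cis_conv_exp)
  moreover have "cis a - cis b = cis b * (cis (a - b) - 1)"
    by (simp add: right_diff_distrib cis_mult)
  ultimately show ?thesis by (simp add: norm_mult)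
qed

lemma phase_integral_lipschitz:
  assumes h: "integrable lborel h" and R: "0 \<le> R" and supp: "\<And>\<xi>. R < norm \<xi> \<Longrightarrow> h \<xi> = 0"
  shows "cmod ((LINT \<xi>|lborel. phase p \<xi> * h \<xi>) - (LINT \<xi>|lborel. phase q \<xi> * h \<xi>))
    \<le> (R\<^sup>2 + R) * (LINT \<xi>|lborel. cmod (h \<xi>)) * norm (p - q)"
proof -
  have [measurable]: "h \<in> borel_measurable borel" using h by auto
  have int: "integrable lborel (\<lambda>\<xi>. phase p \<xi> * h \<xi>)" for p
    using cis_mult_integrable[OF h] unfolding phase_def by simp
  have "(LINT \<xi>|lborel. phase p \<xi> * h \<xi>) - (LINT \<xi>|lborel. phase q \<xi> * h \<xi>) = (LINT \<xi>|lborel. (phase p \<xi> - phase q \<xi>) * h \<xi>)"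
    by (simp add: left_diff_distrib int)
  also have "cmod \<dots> \<le> (LINT \<xi>|lborel. norm ((phase p \<xi> - phase q \<xi>) * h \<xi>))"
    by (rule integral_norm_bound)
  also have "\<dots> \<le> (LINT \<xi>|lborel. ((R\<^sup>2 + R) * norm (p - q)) * cmod (h \<xi>))"
  proof (rule integral_mono)
    show "integrable lborel (\<lambda>\<xi>. norm ((phase p \<xi> - phase q \<xi>) * h \<xi>))"
      using int by (simp add: left_diff_distrib)
    show "integrable lborel (\<lambda>\<xi>. ((R\<^sup>2 + R) * norm (p - q)) * cmod (h \<xi>))" using h by simp
    fix \<xi> :: "real^2"
    show "norm ((phase p \<xi> - phase q \<xi>) * h \<xi>) \<le> ((R\<^sup>2 + R) * norm (p - q)) * cmod (h \<xi>)"
    proof (cases "R < norm \<xi>")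
      case True then show ?thesis by (simp add: supp)
    next
      case False
      have a: "fst p * (norm \<xi>)\<^sup>2 - snd p \<bullet> \<xi> - (fst q * (norm \<xi>)\<^sup>2 - snd q \<bullet> \<xi>) = fst (p - q) * (norm \<xi>)\<^sup>2 - snd (p - q) \<bullet> \<xi>"
        by (simp add: algebra_simps inner_diff_left)
      have "cmod (phase p \<xi> - phase q \<xi>) \<le> \<bar>fst (p - q) * (norm \<xi>)\<^sup>2 - snd (p - q) \<bullet> \<xi>\<bar>"
        unfolding phase_def by (rule order_trans[OF norm_cis_diff_le]) (simp only: a order_refl)
      also have "\<dots> \<le> \<bar>fst (p - q)\<bar> * (norm \<xi>)\<^sup>2 + norm (snd (p - q)) * norm \<xi>"
        by (rule order_trans[OF abs_triangle_ineq4]) (intro add_mono Cauchy_Schwarz_ineq2, simp add: abs_mult)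
      also have "\<dots> \<le> norm (p - q) * R\<^sup>2 + norm (p - q) * R"
      proof (intro add_mono mult_mono power_mono)
        show "\<bar>fst (p - q)\<bar> \<le> norm (p - q)"
          using norm_fst_le[of "fst (p - q)" "snd (p - q)"] by (simp only: prod.collapse real_norm_def)
        show "norm (snd (p - q)) \<le> norm (p - q)"
          using norm_snd_le[of "snd (p - q)" "fst (p - q)"] by (simp only: prod.collapse)
      qed (use False R in auto)
      finally have "cmod (phase p \<xi> - phase q \<xi>) \<le> (R\<^sup>2 + R) * norm (p - q)" by (simp add: algebra_simps)
      then show ?thesis unfolding norm_mult by (rule mult_right_mono) simp
    qed
  qed
  also have "\<dots> = (R\<^sup>2 + R) * (LINT \<xi>|lborel. cmod (h \<xi>)) * norm (p - q)"
    by simp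
  finally show ?thesis .
qed

text \<open>
  If \<open>|g|\<close> is at least \<open>\<epsilon>\<close> at a far point, it is at least
  \<open>\<epsilon> / 2\<close> on a ball of fixed radius around it. The integral over this ball
  is bounded below, while the tails of the integral tend to zero.
\<close>

lemma lipschitz_integrable_vanishes_at_infinity:
  fixes g :: "'v::euclidean_space \<Rightarrow> complex"
  assumes lip: "\<And>p q. cmod (g p - g q) \<le> L * norm (p - q)"
    and [measurable]: "g \<in> borel_measurable borel"
    and fin: "(\<integral>\<^sup>+ p. ennreal (cmod (g p) ^ k) \<partial>lborel) < \<infinity>"
    and lim: "filterlim (\<lambda>n. norm (p n)) at_top sequentially"
  shows "(\<lambda>n. g (p n)) \<longlonglongrightarrow> 0"
proof (rule LIMSEQ_I, rule ccontr)
  fix \<epsilon> :: real assume \<epsilon>: "0 < \<epsilon>" and no: "\<not> (\<exists>N. \<forall>n\<ge>N. norm (g (p n) - 0) < \<epsilon>)"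
  define \<delta> where "\<delta> = \<epsilon> / (2 * (\<bar>L\<bar> + 1))"
  have \<delta>: "0 < \<delta>" using \<epsilon> by (simp add: \<delta>_def add_pos_pos)
  have L\<delta>: "\<bar>L\<bar> * \<delta> \<le> \<epsilon> / 2"
  proof -
    have "\<bar>L\<bar> * \<delta> \<le> (\<bar>L\<bar> + 1) * \<delta>" using \<delta> by (intro mult_right_mono) auto
    also have "\<dots> = \<epsilon> / 2" by (simp add: \<delta>_def field_simps)
    finally show ?thesis .
  qed
  \<comment> \<open>the lower bound for the integral over a ball of radius
  \<open>\<delta>\<close> on which \<open>|g| \<ge> \<epsilon> / 2\<close>\<close>
  define c where "c = ennreal ((\<epsilon> / 2) ^ k) * ennreal (unit_ball_vol (DIM('v)) * \<delta> ^ DIM('v))"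
  have c: "0 < c"
    unfolding c_def using \<epsilon> \<delta> by (simp add: ennreal_zero_less_mult_iff)
  have tail: "(\<lambda>N. \<integral>\<^sup>+ q. ennreal (cmod (g q) ^ k) * indicator {q. real N \<le> norm q} q \<partial>lborel) \<longlonglongrightarrow> (\<integral>\<^sup>+ q. 0 \<partial>(lborel :: 'v measure))"
  proof (rule nn_integral_dominated_convergence[where w="\<lambda>q. ennreal (cmod (g q) ^ k)"])
    show "AE q in lborel. (\<lambda>N. ennreal (cmod (g q) ^ k) * indicator {q. real N \<le> norm q} q) \<longlonglongrightarrow> 0"
    proof (rule AE_I2, rule tendsto_eventually)
      fix q :: 'v
      obtain N0 :: nat where N0: "norm q < real N0" using reals_Archimedean2 by blast
      show "\<forall>\<^sub>F N in sequentially. ennreal (cmod (g q) ^ k) * indicator {q. real N \<le> norm q} q = 0"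
        using eventually_ge_at_top[of N0] by eventually_elim (use N0 in auto)
    qed
  qed (use fin in \<open>auto simp: indicator_def\<close>)
  then have "\<forall>\<^sub>F N in sequentially. (\<integral>\<^sup>+ q. ennreal (cmod (g q) ^ k) * indicator {q. real N \<le> norm q} q \<partial>lborel) < c"
    using c by (intro order_tendstoD(2)[where y="\<integral>\<^sup>+ q. 0 \<partial>(lborel :: 'v measure)"]) auto
  then obtain N where N: "(\<integral>\<^sup>+ q. ennreal (cmod (g q) ^ k) * indicator {q. real N \<le> norm q} q \<partial>lborel) < c"
    by (auto simp: eventually_sequentially)
  have "\<forall>\<^sub>F n in sequentially. real N + \<delta> \<le> norm (p n)"
    using lim unfolding filterlim_at_top by blast
  then obtain n0 where n0: "\<And>n. n \<ge> n0 \<Longrightarrow> real N + \<delta> \<le> norm (p n)"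
    by (auto simp: eventually_sequentially)
  obtain n where n: "n \<ge> n0" "\<epsilon> \<le> cmod (g (p n))"
    using no by (auto simp: not_less)
  have near: "\<epsilon> / 2 \<le> cmod (g q) \<and> real N \<le> norm q" if q: "q \<in> ball (p n) \<delta>" for q
  proof -
    have d: "norm (p n - q) < \<delta>" using q by (simp add: dist_norm)
    have "cmod (g (p n) - g q) \<le> \<bar>L\<bar> * norm (p n - q)"
      by (rule order_trans[OF lip]) (intro mult_right_mono, auto)
    also have "\<dots> \<le> \<bar>L\<bar> * \<delta>" using d by (intro mult_left_mono) auto
    finally have "cmod (g (p n) - g q) \<le> \<epsilon> / 2" using L\<delta> by linarith
    moreover have "cmod (g (p n)) \<le> cmod (g q) + cmod (g (p n) - g q)"
      using norm_triangle_ineq[of "g q" "g (p n) - g q"] by simp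
    moreover have "norm (p n) \<le> norm q + norm (p n - q)"
      using norm_triangle_ineq[of q "p n - q"] by simp
    ultimately show ?thesis using n(2) n0[OF n(1)] d by (auto intro: less_imp_le)
  qed
  have "c = (\<integral>\<^sup>+ q. ennreal ((\<epsilon> / 2) ^ k) * indicator (ball (p n) \<delta>) q \<partial>lborel)"
    unfolding c_def using \<delta> by (subst nn_integral_cmult_indicator) (auto simp: emeasure_ball)
  also have "\<dots> \<le> (\<integral>\<^sup>+ q. ennreal (cmod (g q) ^ k) * indicator {q. real N \<le> norm q} q \<partial>lborel)"
  proof (rule nn_integral_mono)
    fix q :: 'v
    show "ennreal ((\<epsilon> / 2) ^ k) * indicator (ball (p n) \<delta>) q \<le> ennreal (cmod (g q) ^ k) * indicator {q. real N \<le> norm q} q"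
    proof (cases "q \<in> ball (p n) \<delta>")
      case True
      then show ?thesis using near[OF True] \<epsilon> by (auto intro!: ennreal_leI power_mono)
    qed simp
  qed
  finally show False using N by simp
qed

text \<open>
  As a function of \<open>p\<close>, the integral is a free wave. Four of the six powers are
  absorbed by the majorant that is integrable in time, and the other two by the conserved
  \<open>L\<^sup>2\<close> norm in space.
\<close>

lemma phase_integral_L6:
  assumes h: "h \<in> square_integrable lborel" and int: "integrable lborel h" and fin: "h1_energy h < \<infinity>"
  shows "(\<integral>\<^sup>+ p. ennreal (cmod (LINT \<xi>|lborel. phase p \<xi> * h \<xi>) ^ 6) \<partial>lborel) < \<infinity>"
proof -
  have hm[measurable]: "h \<in> borel_measurable borel" using int by auto
  have fm[measurable]: "(\<lambda>(t, x). free_wave h t x) \<in> borel_measurable (borel \<Otimes>\<^sub>M borel)"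
    unfolding free_wave_def split_beta'
    by (intro borel_measurable_divide borel_measurable_const lborel.borel_measurable_lebesgue_integral) measurable
  define J where "J t x = ennreal (cmod (LINT \<xi>|lborel. phase (t, x) \<xi> * h \<xi>) ^ 6)" for t and x :: "real^2"
  have J: "J t x = ennreal ((2 * pi) ^ 6) * ennreal (cmod (free_wave h (0 - t) (0 - x)) ^ 6)" for t x
    unfolding J_def free_wave_eq_phase
    by (subst ennreal_mult[symmetric]) (auto simp: norm_divide power_divide)
  have sq: "(\<integral>\<^sup>+ x. ennreal ((cmod (free_wave h t x))\<^sup>2) \<partial>lborel) \<le> ennreal (sqnorm lborel h)" for t
  proof -
    have "(\<integral>\<^sup>+ x. ennreal ((cmod (free_wave h t x))\<^sup>2) \<partial>lborel) = (\<integral>\<^sup>+ x. ennreal ((cmod (inverse_fourier (propagate t h) x))\<^sup>2) \<partial>lborel)"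
      using inverse_fourier_propagate[OF h int, of t] by (intro nn_integral_cong_AE) (auto elim!: eventually_mono)
    also have "\<dots> = ennreal (sqnorm lborel (inverse_fourier (propagate t h)))"
      by (intro nn_integral_eq_sqnorm inverse_fourier_square_integrable propagate_square_integrable h)
    also have "\<dots> \<le> ennreal (sqnorm lborel (propagate t h))"
      by (intro ennreal_leI sqnorm_inverse_fourier_le propagate_square_integrable h)
    also have "sqnorm lborel (propagate t h) = sqnorm lborel h"
      by (simp add: sqnorm_def propagate_def norm_mult)
    finally show ?thesis .
  qed
  have inner: "(\<integral>\<^sup>+ x. ennreal (cmod (free_wave h t x) ^ 6) \<partial>lborel) \<le> ennreal (sqnorm lborel h) * (wave_majorant h t)\<^sup>2" for t
  proof -
    have "(\<integral>\<^sup>+ x. ennreal (cmod (free_wave h t x) ^ 6) \<partial>lborel) \<le> (\<integral>\<^sup>+ x. (wave_majorant h t)\<^sup>2 * ennreal ((cmod (free_wave h t x))\<^sup>2) \<partial>lborel)"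
    proof (rule nn_integral_mono)
      fix x
      have "ennreal (cmod (free_wave h t x) ^ 6) = (ennreal ((cmod (free_wave h t x))\<^sup>2))\<^sup>2 * ennreal ((cmod (free_wave h t x))\<^sup>2)"
        by (simp add: ennreal_power ennreal_mult[symmetric] power_mult[symmetric] power_add[symmetric])
      also have "\<dots> \<le> (wave_majorant h t)\<^sup>2 * ennreal ((cmod (free_wave h t x))\<^sup>2)"
        unfolding wave_majorant_def by (intro mult_right_mono power_mono free_wave_le_pair_wave int) auto
      finally show "ennreal (cmod (free_wave h t x) ^ 6) \<le> (wave_majorant h t)\<^sup>2 * ennreal ((cmod (free_wave h t x))\<^sup>2)" .
    qed
    also have "\<dots> = (wave_majorant h t)\<^sup>2 * (\<integral>\<^sup>+ x. ennreal ((cmod (free_wave h t x))\<^sup>2) \<partial>lborel)"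
      by (rule nn_integral_cmult) measurable
    also have "\<dots> \<le> (wave_majorant h t)\<^sup>2 * ennreal (sqnorm lborel h)"
      by (intro mult_left_mono sq) simp
    finally show ?thesis by (simp add: mult.commute)
  qed
  have "(\<integral>\<^sup>+ p. ennreal (cmod (LINT \<xi>|lborel. phase p \<xi> * h \<xi>) ^ 6) \<partial>lborel) = (\<integral>\<^sup>+ t. \<integral>\<^sup>+ x. J t x \<partial>lborel \<partial>lborel)"
    unfolding lborel_prod[symmetric] J_def
    by (subst lborel.nn_integral_fst[symmetric]) (auto simp: phase_def)
  also have "\<dots> = (\<integral>\<^sup>+ t. ennreal ((2 * pi) ^ 6) * (\<integral>\<^sup>+ x. ennreal (cmod (free_wave h (0 - t) (0 - x)) ^ 6) \<partial>lborel) \<partial>lborel)"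
    unfolding J by (intro nn_integral_cong nn_integral_cmult) measurable
  also have "\<dots> = (\<integral>\<^sup>+ t. ennreal ((2 * pi) ^ 6) * (\<integral>\<^sup>+ x. ennreal (cmod (free_wave h (0 - t) x) ^ 6) \<partial>lborel) \<partial>lborel)"
    by (intro nn_integral_cong arg_cong2[where f="(*)"] refl nn_integral_lborel_reflect) measurable
  also have "\<dots> = (\<integral>\<^sup>+ t. ennreal ((2 * pi) ^ 6) * (\<integral>\<^sup>+ x. ennreal (cmod (free_wave h t x) ^ 6) \<partial>lborel) \<partial>lborel)"
    by (rule nn_integral_lborel_reflect) measurable
  also have "\<dots> \<le> (\<integral>\<^sup>+ t. ennreal ((2 * pi) ^ 6) * (ennreal (sqnorm lborel h) * (wave_majorant h t)\<^sup>2) \<partial>lborel)"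
    by (intro nn_integral_mono mult_left_mono inner) simp
  also have "\<dots> = ennreal ((2 * pi) ^ 6) * (ennreal (sqnorm lborel h) * (\<integral>\<^sup>+ t. (wave_majorant h t)\<^sup>2 \<partial>lborel))"
    by (subst nn_integral_cmult, measurable, subst nn_integral_cmult, measurable)
  also have "\<dots> < \<infinity>"
  proof -
    have "(\<integral>\<^sup>+ t. (wave_majorant h t)\<^sup>2 \<partial>lborel) < \<infinity>"
      using le_less_trans[OF wave_majorant_bound[OF h]] fin by (simp add: ennreal_mult_less_top power2_eq_square)
    then show ?thesis by (simp add: ennreal_mult_less_top)
  qed
  finally show ?thesis .
qed

lemma h1_energy_finite_of_bounded_support:
  assumes h: "h \<in> square_integrable lborel" and supp: "\<And>\<xi>. R < norm \<xi> \<Longrightarrow> h \<xi> = 0"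
  shows "h1_energy h < \<infinity>"
proof -
  have hm[measurable]: "h \<in> borel_measurable borel" using h by (rule square_integrable_borel)
  have "h1_energy h \<le> (\<integral>\<^sup>+ \<xi>. ennreal (1 + R\<^sup>2) * ennreal ((cmod (h \<xi>))\<^sup>2) \<partial>lborel)"
    unfolding h1_energy_def
  proof (rule nn_integral_mono)
    fix \<xi> :: "real^2"
    show "ennreal ((1 + (norm \<xi>)\<^sup>2) * (cmod (h \<xi>))\<^sup>2) \<le> ennreal (1 + R\<^sup>2) * ennreal ((cmod (h \<xi>))\<^sup>2)"
    proof (cases "R < norm \<xi>")
      case True then show ?thesis by (simp add: supp)
    next
      case False
      then show ?thesis
        by (subst ennreal_mult[symmetric]) (auto intro!: ennreal_leI mult_right_mono add_left_mono power_mono)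
    qed
  qed
  also have "\<dots> = ennreal (1 + R\<^sup>2) * ennreal (sqnorm lborel h)"
    by (subst nn_integral_cmult) (auto simp: nn_integral_eq_sqnorm[OF h])
  also have "\<dots> < \<infinity>" by (simp add: ennreal_mult_less_top)
  finally show ?thesis .
qed

lemma phase_integral_tendsto_0_nice:
  assumes h: "h \<in> square_integrable lborel" and int: "integrable lborel h" and R: "0 \<le> R" and supp: "\<And>\<xi>. R < norm \<xi> \<Longrightarrow> h \<xi> = 0"
    and lim: "filterlim (\<lambda>n. norm (p n)) at_top sequentially"
  shows "(\<lambda>n. LINT \<xi>|lborel. phase (p n) \<xi> * h \<xi>) \<longlonglongrightarrow> 0"
proof (rule lipschitz_integrable_vanishes_at_infinity[where g="\<lambda>p. LINT \<xi>|lborel. phase p \<xi> * h \<xi>" and k=6, OF _ _ _ lim])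
  have hm[measurable]: "h \<in> borel_measurable borel" using int by auto
  show "(\<lambda>p. LINT \<xi>|lborel. phase p \<xi> * h \<xi>) \<in> borel_measurable borel"
    unfolding phase_def by (intro lborel.borel_measurable_lebesgue_integral) (unfold borel_prod[symmetric], measurable)
  show "(\<integral>\<^sup>+ p. ennreal (cmod (LINT \<xi>|lborel. phase p \<xi> * h \<xi>) ^ 6) \<partial>lborel) < \<infinity>"
    by (intro phase_integral_L6 h int h1_energy_finite_of_bounded_support[OF h supp])
qed (rule phase_integral_lipschitz[OF int R supp])

text \<open>
  For bounded \<open>h\<close> of bounded support the integral is Lipschitz in \<open>p\<close>
  and lies in \<open>L\<^sup>6\<close>; such functions are dense in \<open>L\<^sup>1\<close>.
\<close>

theorem phase_integral_tendsto_0: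
  assumes h: "integrable lborel h"
    and lim: "filterlim (\<lambda>n. norm (p n)) at_top sequentially"
  shows "(\<lambda>n. LINT \<xi>|lborel. phase (p n) \<xi> * h \<xi>) \<longlonglongrightarrow> 0"
proof (rule LIMSEQ_I)
  fix e :: real assume e: "0 < e"
  have hm[measurable]: "h \<in> borel_measurable borel" using h by auto
  \<comment> \<open>truncation of both the frequency and the values, so that the truncations are
  square-integrable as well\<close>
  define A where "A k = {\<xi>. norm \<xi> \<le> real k \<and> cmod (h \<xi>) \<le> real k}" for k :: nat
  have Am[measurable]: "A k \<in> sets borel" for k unfolding A_def by measurable
  define hk where "hk k \<xi> = complex_of_real (indicat_real (A k) \<xi>) * h \<xi>" for k \<xi>
  have hkm[measurable]: "hk k \<in> borel_measurable borel" for k unfolding hk_def[abs_def] by measurable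
  have hk_int: "integrable lborel (hk k)" for k
    by (rule Bochner_Integration.integrable_bound[OF h]) (auto simp: hk_def norm_mult indicator_def)
  have hk_sq: "hk k \<in> square_integrable lborel" for k
  proof (rule square_integrable_bound[where h="\<lambda>\<xi>. real k * cmod (h \<xi>)"])
    show "integrable lborel (\<lambda>\<xi>. real k * cmod (h \<xi>))" using h by simp
    show "(cmod (hk k \<xi>))\<^sup>2 \<le> real k * cmod (h \<xi>)" for \<xi>
      by (auto simp: hk_def A_def indicator_def power2_eq_square intro: mult_right_mono)
  qed measurable
  have "(\<lambda>k. LINT \<xi>|lborel. cmod (hk k \<xi> - h \<xi>)) \<longlonglongrightarrow> (LINT \<xi>|(lborel :: (real^2) measure). 0)"
  proof (rule integral_dominated_convergence[where w="\<lambda>\<xi>. cmod (h \<xi>)"])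
    show "AE \<xi> in lborel. (\<lambda>k. cmod (hk k \<xi> - h \<xi>)) \<longlonglongrightarrow> 0"
    proof (rule AE_I2, rule tendsto_eventually)
      fix \<xi> :: "real^2"
      obtain N :: nat where N: "max (norm \<xi>) (cmod (h \<xi>)) \<le> real N" using real_arch_simple by blast
      show "\<forall>\<^sub>F k in sequentially. cmod (hk k \<xi> - h \<xi>) = 0"
        using eventually_ge_at_top[of N] by eventually_elim (use N in \<open>auto simp: hk_def A_def\<close>)
    qed
    show "AE \<xi> in lborel. norm (cmod (hk k \<xi> - h \<xi>)) \<le> cmod (h \<xi>)" for k
      by (auto simp: hk_def indicator_def)
    show "integrable lborel (\<lambda>\<xi>. cmod (h \<xi>))" using h by simp
  qed measurable
  then have lim1: "(\<lambda>k. LINT \<xi>|lborel. cmod (hk k \<xi> - h \<xi>)) \<longlonglongrightarrow> 0" by simp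
  have e2: "0 < e / 2" using e by simp
  obtain k where "norm ((LINT \<xi>|lborel. cmod (hk k \<xi> - h \<xi>)) - 0) < e / 2"
    using LIMSEQ_D[OF lim1 e2] by blast
  then have k: "(LINT \<xi>|lborel. cmod (hk k \<xi> - h \<xi>)) < e / 2"
    by simp
  have lim2: "(\<lambda>n. LINT \<xi>|lborel. phase (p n) \<xi> * hk k \<xi>) \<longlonglongrightarrow> 0"
    by (rule phase_integral_tendsto_0_nice[where R="real k", OF hk_sq hk_int _ _ lim]) (auto simp: hk_def A_def)
  obtain N where N: "\<And>n. n \<ge> N \<Longrightarrow> cmod (LINT \<xi>|lborel. phase (p n) \<xi> * hk k \<xi>) < e / 2"
    using LIMSEQ_D[OF lim2 e2] by auto
  have diff: "cmod ((LINT \<xi>|lborel. phase q \<xi> * hk k \<xi>) - (LINT \<xi>|lborel. phase q \<xi> * h \<xi>)) < e / 2" for q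
  proof -
    have i: "integrable lborel (\<lambda>\<xi>. phase q \<xi> * f \<xi>)" if "integrable lborel f" for f
      using cis_mult_integrable[OF that] unfolding phase_def by simp
    have "(LINT \<xi>|lborel. phase q \<xi> * hk k \<xi>) - (LINT \<xi>|lborel. phase q \<xi> * h \<xi>) = (LINT \<xi>|lborel. phase q \<xi> * (hk k \<xi> - h \<xi>))"
      by (simp add: right_diff_distrib i h hk_int)
    also have "cmod \<dots> \<le> (LINT \<xi>|lborel. norm (phase q \<xi> * (hk k \<xi> - h \<xi>)))" by (rule integral_norm_bound)
    finally show ?thesis using k by (simp add: norm_mult)
  qed
  have "norm ((LINT \<xi>|lborel. phase (p n) \<xi> * h \<xi>) - 0) < e" if "n \<ge> N" for n
    using norm_triangle_ineq4[of "LINT \<xi>|lborel. phase (p n) \<xi> * hk k \<xi>" "(LINT \<xi>|lborel. phase (p n) \<xi> * hk k \<xi>) - (LINT \<xi>|lborel. phase (p n) \<xi> * h \<xi>)"]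
      N[OF that] diff[of "p n"] by simp
  then show "\<exists>N. \<forall>n\<ge>N. norm ((LINT \<xi>|lborel. phase (p n) \<xi> * h \<xi>) - 0) < e" by blast
qed

lemma phase_weakly_converges_0:
  assumes \<Psi>: "\<Psi> \<in> square_integrable lborel"
    and lim: "filterlim (\<lambda>n. norm (p n)) at_top sequentially"
  shows "weakly_converges lborel (\<lambda>n \<xi>. phase (p n) \<xi> * \<Psi> \<xi>) (\<lambda>\<xi>. 0)"
  unfolding weakly_converges_def
proof (intro conjI ballI)
  show "(\<lambda>\<xi>. 0) \<in> square_integrable lborel" by (rule square_integrable_zero)
  fix h :: "real^2 \<Rightarrow> complex" assume h: "h \<in> square_integrable lborel"
  show "(\<lambda>n. l2_inner lborel (\<lambda>\<xi>. phase (p n) \<xi> * \<Psi> \<xi>) h) \<longlonglongrightarrow> l2_inner lborel (\<lambda>\<xi>. 0) h"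
    using phase_integral_tendsto_0[OF integrable_l2_inner[OF \<Psi> h] lim] by (simp add: l2_inner_def mult.assoc)
qed

lemma phase_square_integrable:
  "f \<in> square_integrable lborel \<Longrightarrow> (\<lambda>\<xi>. phase p \<xi> * f \<xi>) \<in> square_integrable lborel"
  by (rule square_integrable_mult_bounded[where c=1]) auto

lemma sqnorm_phase: "sqnorm lborel (\<lambda>\<xi>. phase p \<xi> * f \<xi>) = sqnorm lborel f"
  by (simp add: sqnorm_def norm_mult)

lemma phase_tendsto: "p \<longlonglongrightarrow> q \<Longrightarrow> (\<lambda>n. phase (p n) \<xi>) \<longlonglongrightarrow> phase q \<xi>"
  unfolding phase_def cis_conv_exp by (intro tendsto_intros)

section \<open>Smallness of the space-time norm\<close>

lemma ennreal_power_ennreal: "0 \<le> a \<Longrightarrow> ennreal_power (ennreal a) p = ennreal (a powr p)"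
  by (simp add: ennreal_power_def)

lemma ennreal_power_le_ennreal:
  assumes "y \<le> ennreal a" "0 \<le> a" "0 \<le> p"
  shows "ennreal_power y p \<le> ennreal (a powr p)"
proof -
  obtain b where b: "y = ennreal b" "0 \<le> b" "b \<le> a"
    using assms by (cases y) (auto simp: ennreal_le_iff top_unique)
  then show ?thesis using assms by (simp add: ennreal_power_ennreal ennreal_leI powr_mono2)
qed

text \<open>
  With \<open>|u|\<^sup>r \<le> \<nu>\<^sup>(\<^sup>r\<^sup>-\<^sup>4\<^sup>)\<^sup>/\<^sup>4
  |u|\<^sup>4\<close>, the relation between the exponents makes the final power of
  \<open>\<nu>\<close> equal to one. This is the power that can be integrated in time.
\<close>

lemma Lr_norm_interpolation:
  fixes u :: "'a \<Rightarrow> complex"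
  assumes [measurable]: "u \<in> borel_measurable M"
    and r: "4 < r" and q: "0 < q" and qr: "1 / q + 1 / r = 1 / 4"
    and \<nu>: "0 \<le> \<nu>" "AE x in M. cmod (u x) ^ 4 \<le> \<nu>"
    and d: "0 \<le> d" "(\<integral>\<^sup>+ x. ennreal (cmod (u x) ^ 4) \<partial>M) \<le> ennreal d"
  shows "ennreal_power (Lp_norm (ennreal r) M (\<lambda>x. ennreal (cmod (u x)))) q \<le> ennreal (\<nu> * d powr (q / r))"
proof -
  define X where "X = \<nu> powr ((r - 4) / 4) * d"
  have X0: "0 \<le> X" using d by (simp add: X_def)
  have "(\<integral>\<^sup>+ x. ennreal_power (ennreal (cmod (u x))) r \<partial>M) = (\<integral>\<^sup>+ x. ennreal (cmod (u x) powr r) \<partial>M)"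
    by (simp add: ennreal_power_ennreal)
  also have "\<dots> \<le> (\<integral>\<^sup>+ x. ennreal (\<nu> powr ((r - 4) / 4)) * ennreal (cmod (u x) ^ 4) \<partial>M)"
  proof (rule nn_integral_mono_AE)
    show "AE x in M. ennreal (cmod (u x) powr r) \<le> ennreal (\<nu> powr ((r - 4) / 4)) * ennreal (cmod (u x) ^ 4)"
      using \<nu>(2)
    proof eventually_elim
      case (elim x)
      show ?case
      proof (cases "u x = 0")
        case False
        then have pos: "0 < cmod (u x)" by simp
        have c4: "cmod (u x) powr 4 = cmod (u x) ^ 4"
          using powr_realpow[OF pos, of 4] by simp
        have "r = 4 * ((r - 4) / 4) + 4" by (simp add: field_simps)
        then have "cmod (u x) powr r = cmod (u x) powr (4 * ((r - 4) / 4) + 4)" by (rule arg_cong)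
        also have "\<dots> = (cmod (u x) powr 4) powr ((r - 4) / 4) * cmod (u x) powr 4"
          by (simp only: powr_add powr_powr)
        also have "\<dots> = (cmod (u x) ^ 4) powr ((r - 4) / 4) * cmod (u x) ^ 4"
          unfolding c4 ..
        also have "\<dots> \<le> \<nu> powr ((r - 4) / 4) * cmod (u x) ^ 4"
          using elim r by (intro mult_right_mono powr_mono2) auto
        finally show ?thesis by (simp add: ennreal_mult[symmetric] ennreal_leI)
      qed simp
    qed
  qed
  also have "\<dots> = ennreal (\<nu> powr ((r - 4) / 4)) * (\<integral>\<^sup>+ x. ennreal (cmod (u x) ^ 4) \<partial>M)"
    by (rule nn_integral_cmult) measurable
  also have "\<dots> \<le> ennreal X"
    unfolding X_def using d by (subst ennreal_mult) (auto intro: mult_left_mono)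
  finally have I: "(\<integral>\<^sup>+ x. ennreal_power (ennreal (cmod (u x))) r \<partial>M) \<le> ennreal X" .
  have "Lp_norm (ennreal r) M (\<lambda>x. ennreal (cmod (u x))) \<le> ennreal (X powr (1 / r))"
    unfolding Lp_norm_def using r ennreal_power_le_ennreal[OF I X0, of "1 / r"] by simp
  then have "ennreal_power (Lp_norm (ennreal r) M (\<lambda>x. ennreal (cmod (u x)))) q \<le> ennreal ((X powr (1 / r)) powr q)"
    using q by (intro ennreal_power_le_ennreal) auto
  also have "(X powr (1 / r)) powr q = \<nu> * d powr (q / r)"
  proof -
    have e: "(r - 4) / 4 * (q / r) = 1"
    proof -
      have "(r - 4) / 4 * (q / r) = q * (1 / 4 - 1 / r)" using r by (simp add: field_simps)
      also have "1 / 4 - 1 / r = 1 / q" using qr by linarith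
      also have "q * (1 / q) = 1" using q by simp
      finally show ?thesis .
    qed
    have "(X powr (1 / r)) powr q = X powr (q / r)" by (simp add: powr_powr)
    also have "\<dots> = \<nu> powr ((r - 4) / 4 * (q / r)) * d powr (q / r)"
      unfolding X_def using d by (simp add: powr_mult powr_powr)
    finally show ?thesis unfolding e using \<nu>(1) by simp
  qed
  finally show ?thesis .
qed

lemma mixed_norm_interpolation:
  assumes G: "G \<in> square_integrable lborel"
    and E: "0 \<le> E" "h1_energy G \<le> ennreal E"
    and d: "0 < d" "\<And>t. (\<integral>\<^sup>+ x. ennreal (cmod (inverse_fourier (propagate t G) x) ^ 4) \<partial>lborel) \<le> ennreal d"
    and r: "4 < r" and q: "4 < q" and qr: "1 / q + 1 / r = 1 / 4"
  shows "mixed_norm (ennreal q) (ennreal r) (\<lambda>t. inverse_fourier (propagate t G))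
     \<le> ennreal ((strichartz_const * E\<^sup>2) powr (1 / q) * d powr (1 / r))"
proof -
  have C0: "0 \<le> strichartz_const" unfolding strichartz_const_def using kernel_const_pos by simp
  obtain N where [measurable]: "N \<in> borel_measurable borel"
    and N: "\<And>t. AE x in lborel. ennreal (cmod (inverse_fourier (propagate t G) x) ^ 4) \<le> N t"
    and N_int: "(\<integral>\<^sup>+ t. N t \<partial>lborel) \<le> ennreal strichartz_const * (h1_energy G)\<^sup>2"
    using strichartz_L4_Linfty[OF G] by blast
  define Y where "Y = strichartz_const * E\<^sup>2 * d powr (q / r)"
  have Y0: "0 \<le> Y" unfolding Y_def using C0 by simp
  have um: "inverse_fourier (propagate t G) \<in> borel_measurable lborel" for t
    by (rule square_integrable_measurable[OF inverse_fourier_square_integrable[OF propagate_square_integrable[OF G]]])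
  have pt: "ennreal_power (Lp_norm (ennreal r) lborel (\<lambda>x. ennreal (cmod (inverse_fourier (propagate t G) x)))) q \<le> N t * ennreal (d powr (q / r))" for t
  proof (cases "N t")
    case (real \<nu>)
    have "AE x in lborel. cmod (inverse_fourier (propagate t G) x) ^ 4 \<le> \<nu>"
      using N[of t] by eventually_elim (use real in simp)
    then show ?thesis
      using Lr_norm_interpolation[OF um r _ qr real(1) _ _ d(2), of t] q d(1) real by (simp add: ennreal_mult)
  next
    case top
    then show ?thesis using d(1) by (simp add: ennreal_top_mult)
  qed
  have "(\<integral>\<^sup>+ t. ennreal_power (Lp_norm (ennreal r) lborel (\<lambda>x. ennreal (cmod (inverse_fourier (propagate t G) x)))) q \<partial>lborel)
     \<le> (\<integral>\<^sup>+ t. N t * ennreal (d powr (q / r)) \<partial>lborel)"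
    by (intro nn_integral_mono pt)
  also have "\<dots> = (\<integral>\<^sup>+ t. N t \<partial>lborel) * ennreal (d powr (q / r))"
    by (rule nn_integral_multc) measurable
  also have "\<dots> \<le> (ennreal strichartz_const * (ennreal E)\<^sup>2) * ennreal (d powr (q / r))"
    by (intro mult_right_mono order_trans[OF N_int] mult_left_mono power_mono E) auto
  also have "\<dots> = ennreal Y"
    unfolding Y_def using C0 E by (simp add: ennreal_power ennreal_mult)
  finally have I: "(\<integral>\<^sup>+ t. ennreal_power (Lp_norm (ennreal r) lborel (\<lambda>x. ennreal (cmod (inverse_fourier (propagate t G) x)))) q \<partial>lborel) \<le> ennreal Y" .
  have "mixed_norm (ennreal q) (ennreal r) (\<lambda>t. inverse_fourier (propagate t G)) \<le> ennreal (Y powr (1 / q))"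
    unfolding mixed_norm_def Lp_norm_def[of "ennreal q"]
    using q ennreal_power_le_ennreal[OF I Y0, of "1 / q"] by simp
  also have "Y powr (1 / q) = (strichartz_const * E\<^sup>2) powr (1 / q) * d powr (1 / r)"
    unfolding Y_def using C0 d q by (simp add: powr_mult powr_powr)
  finally show ?thesis .
qed

lemma admissible_finite:
  assumes "4 < b" "admissible q r" "ennreal b \<le> q" "ennreal b \<le> r" "r \<le> ennreal c"
  shows "\<exists>q' r'. q = ennreal q' \<and> r = ennreal r' \<and> 4 < q' \<and> 4 < r' \<and> r' \<le> c \<and> 1 / q' + 1 / r' = 1 / 4"
proof -
  have sum: "2 / q + 2 / r = 1 / 2" using assms(2) by (simp add: admissible_def)
  obtain r' where r': "r = ennreal r'" "0 \<le> r'" using assms(5) by (cases r) (auto simp: top_unique)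
  have "b \<le> r'" using assms(1,4) r' by (simp add: ennreal_le_iff)
  then have r4: "4 < r'" using assms(1) by linarith
  have rc: "r' \<le> c"
  proof (rule ccontr)
    assume "\<not> r' \<le> c"
    then have "ennreal c < ennreal r'" using r4 by (intro ennreal_lessI) auto
    then show False using assms(5) r' by simp
  qed
  have two: "(2::ennreal) / ennreal x = ennreal (2 / x)" if "0 < x" for x
    using divide_ennreal[of 2 x] that by simp
  have half: "(1::ennreal) / 2 = ennreal (1 / 2)"
    using divide_ennreal[of 1 2] by simp
  show ?thesis
  proof (cases q)
    case (real q')
    have "b \<le> q'" using assms(1,3) real by (simp add: ennreal_le_iff)
    then have q4: "4 < q'" using assms(1) by linarith
    have "ennreal (2 / q' + 2 / r') = ennreal (1 / 2)"
      using sum q4 r4 unfolding real r' half by (simp add: two ennreal_plus)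
    then have "2 / q' + 2 / r' = 1 / 2" using q4 r4 by (subst (asm) ennreal_inj) auto
    then have "1 / q' + 1 / r' = 1 / 4" by simp
    then show ?thesis using real r' q4 r4 rc by blast
  next
    case top
    then have "ennreal (2 / r') = ennreal (1 / 2)"
      using sum r4 unfolding r' half by (simp add: two)
    then have "2 / r' = 1 / 2" using r4 by (subst (asm) ennreal_inj) auto
    then show ?thesis using r4 by (simp add: field_simps)
  qed
qed

text \<open>
  Admissible exponents in the given range satisfy \<open>1/q + 1/r = 1/4\<close> with \<open>4 <
  q\<close> and \<open>4 < r \<le> plus_dual 4 b\<close>. As \<open>d \<le> 1\<close>, the
  largest \<open>r\<close> gives the worst power of \<open>d\<close>.
\<close>

theorem S_norm_interpolation:
  assumes b: "4 < b" and G: "G \<in> square_integrable lborel"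
    and E: "0 \<le> E" "h1_energy G \<le> ennreal E"
    and d: "0 < d" "d \<le> 1" "\<And>t. (\<integral>\<^sup>+ x. ennreal (cmod (inverse_fourier (propagate t G) x) ^ 4) \<partial>lborel) \<le> ennreal d"
  shows "S_norm b (\<lambda>t. inverse_fourier (propagate t G))
     \<le> ennreal (max 1 (strichartz_const * E\<^sup>2) * d powr (1 / plus_dual 4 b))"
  unfolding S_norm_def
proof (rule Sup_least)
  fix y assume "y \<in> {mixed_norm q r (\<lambda>t. inverse_fourier (propagate t G)) | q r. admissible q r \<and>
            ennreal b \<le> q \<and> q \<le> \<infinity> \<and> ennreal b \<le> r \<and> r \<le> ennreal (plus_dual 4 b)}"
  then obtain q r where y: "y = mixed_norm q r (\<lambda>t. inverse_fourier (propagate t G))"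
    and adm: "admissible q r" "ennreal b \<le> q" "ennreal b \<le> r" "r \<le> ennreal (plus_dual 4 b)" by auto
  obtain q' r' where qr: "q = ennreal q'" "r = ennreal r'" "4 < q'" "4 < r'" "r' \<le> plus_dual 4 b" "1 / q' + 1 / r' = 1 / 4"
    using admissible_finite[OF b adm] by blast
  have "y \<le> ennreal ((strichartz_const * E\<^sup>2) powr (1 / q') * d powr (1 / r'))"
    unfolding y qr(1,2) by (intro mixed_norm_interpolation G E d qr)
  also have "\<dots> \<le> ennreal (max 1 (strichartz_const * E\<^sup>2) * d powr (1 / plus_dual 4 b))"
  proof (intro ennreal_leI mult_mono)
    have C0: "0 \<le> strichartz_const * E\<^sup>2" unfolding strichartz_const_def using kernel_const_pos by simp
    have "(strichartz_const * E\<^sup>2) powr (1 / q') \<le> max 1 (strichartz_const * E\<^sup>2) powr (1 / q')"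
      using C0 qr by (intro powr_mono2) auto
    also have "\<dots> \<le> max 1 (strichartz_const * E\<^sup>2) powr 1"
      using qr by (intro powr_mono) auto
    finally show "(strichartz_const * E\<^sup>2) powr (1 / q') \<le> max 1 (strichartz_const * E\<^sup>2)" by simp
    show "d powr (1 / r') \<le> d powr (1 / plus_dual 4 b)"
      using d qr by (intro powr_mono') (auto intro!: divide_left_mono)
  qed auto
  finally show "y \<le> ennreal (max 1 (strichartz_const * E\<^sup>2) * d powr (1 / plus_dual 4 b))" .
qed

lemma sqnorm_le_h1_energy:
  assumes G: "G \<in> square_integrable lborel" and E: "0 \<le> E" "h1_energy G \<le> ennreal E"
  shows "sqnorm lborel G \<le> E"
proof (rule sqnorm_le_nn_integral[OF square_integrable_measurable[OF G] E(1)])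
  have "(\<integral>\<^sup>+ x. ennreal ((cmod (G x))\<^sup>2) \<partial>lborel) \<le> h1_energy G"
    unfolding h1_energy_def by (intro nn_integral_mono ennreal_leI) (simp add: mult_le_cancel_right1)
  then show "(\<integral>\<^sup>+ x. ennreal ((cmod (G x))\<^sup>2) \<partial>lborel) \<le> ennreal E" using E by simp
qed

lemma four_power_add_le: "cmod (a + b) ^ 4 \<le> 8 * (cmod a ^ 4 + cmod b ^ 4)"
proof -
  have p4: "x ^ 4 = (x\<^sup>2)\<^sup>2" for x :: real by (simp add: power_mult[symmetric])
  have "(cmod (a + b))\<^sup>2 \<le> 2 * (cmod a)\<^sup>2 + 2 * (cmod b)\<^sup>2" by (rule cmod_add_sq_le)
  then have "((cmod (a + b))\<^sup>2)\<^sup>2 \<le> (2 * (cmod a)\<^sup>2 + 2 * (cmod b)\<^sup>2)\<^sup>2" by (intro power_mono) auto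
  also have "\<dots> \<le> 8 * (((cmod a)\<^sup>2)\<^sup>2 + ((cmod b)\<^sup>2)\<^sup>2)"
    using sum_squares_bound[of "(cmod a)\<^sup>2" "(cmod b)\<^sup>2"] by (simp add: power2_sum power_mult_distrib)
  finally show ?thesis by (simp only: p4)
qed

text \<open>
  The frequencies up to \<open>R\<close> are estimated by their supremum \<open>s\<close> and
  the conserved \<open>L\<^sup>2\<close> norm, the others by \<open>sobolev_L4\<close>.
\<close>

lemma L4_low_high_split:
  assumes G: "G \<in> square_integrable lborel" and E: "0 \<le> E" "h1_energy G \<le> ennreal E"
    and R: "0 \<le> R" and s: "\<And>t x. cmod (free_wave (cutoff R G) t x) \<le> s"
  shows "(\<integral>\<^sup>+ x. ennreal (cmod (inverse_fourier (propagate t G) x) ^ 4) \<partial>lborel) \<le> ennreal (8 * (s\<^sup>2 * E + pi / (1 + R\<^sup>2) * E\<^sup>2))"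
proof -
  define lo where "lo = inverse_fourier (propagate t (cutoff R G))"
  define H where "H \<xi> = G \<xi> - cutoff R G \<xi>" for \<xi>
  define hi where "hi = inverse_fourier (propagate t H)"
  have loG: "cutoff R G \<in> square_integrable lborel" by (rule cutoff_square_integrable[OF G])
  have H: "H \<in> square_integrable lborel" unfolding H_def by (rule square_integrable_diff[OF G loG])
  have s0: "0 \<le> s" using order_trans[OF norm_ge_zero s] .
  have lo_sq: "lo \<in> square_integrable lborel" and hi_sq: "hi \<in> square_integrable lborel"
    unfolding lo_def hi_def by (intro inverse_fourier_square_integrable propagate_square_integrable loG H)+
  have [measurable]: "lo \<in> borel_measurable borel" "hi \<in> borel_measurable borel"
    using lo_sq hi_sq by (auto intro: square_integrable_borel)
  have "propagate t G = (\<lambda>\<xi>. propagate t (cutoff R G) \<xi> + propagate t H \<xi>)"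
    by (auto simp: propagate_def H_def algebra_simps)
  then have split: "AE x in lborel. inverse_fourier (propagate t G) x = lo x + hi x"
    unfolding lo_def hi_def using inverse_fourier_add[OF propagate_square_integrable[OF loG] propagate_square_integrable[OF H]] by simp
  have "(\<integral>\<^sup>+ x. ennreal (cmod (inverse_fourier (propagate t G) x) ^ 4) \<partial>lborel) \<le> (\<integral>\<^sup>+ x. ennreal 8 * (ennreal (cmod (lo x) ^ 4) + ennreal (cmod (hi x) ^ 4)) \<partial>lborel)"
  proof (rule nn_integral_mono_AE)
    show "AE x in lborel. ennreal (cmod (inverse_fourier (propagate t G) x) ^ 4) \<le> ennreal 8 * (ennreal (cmod (lo x) ^ 4) + ennreal (cmod (hi x) ^ 4))"
      using split
    proof eventually_elim
      case (elim x)
      have "ennreal (cmod (lo x + hi x) ^ 4) \<le> ennreal (8 * (cmod (lo x) ^ 4 + cmod (hi x) ^ 4))"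
        by (intro ennreal_leI four_power_add_le)
      then show ?case unfolding elim by (simp add: ennreal_mult ennreal_plus)
    qed
  qed
  also have "\<dots> = ennreal 8 * ((\<integral>\<^sup>+ x. ennreal (cmod (lo x) ^ 4) \<partial>lborel) + (\<integral>\<^sup>+ x. ennreal (cmod (hi x) ^ 4) \<partial>lborel))"
    by (subst nn_integral_cmult, measurable, subst nn_integral_add, auto)
  also have "\<dots> \<le> ennreal 8 * (ennreal (s\<^sup>2 * E) + ennreal (pi / (1 + R\<^sup>2) * E\<^sup>2))"
  proof (intro mult_left_mono add_mono)
    have "(\<integral>\<^sup>+ x. ennreal (cmod (lo x) ^ 4) \<partial>lborel) \<le> (\<integral>\<^sup>+ x. ennreal (s\<^sup>2) * ennreal ((cmod (lo x))\<^sup>2) \<partial>lborel)"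
    proof (rule nn_integral_mono_AE)
      show "AE x in lborel. ennreal (cmod (lo x) ^ 4) \<le> ennreal (s\<^sup>2) * ennreal ((cmod (lo x))\<^sup>2)"
        using inverse_fourier_propagate[OF loG cutoff_integrable[OF G], of t]
      proof eventually_elim
        case (elim x)
        have "cmod (lo x) \<le> s" unfolding lo_def elim by (rule s)
        then have "(cmod (lo x))\<^sup>2 * (cmod (lo x))\<^sup>2 \<le> s\<^sup>2 * (cmod (lo x))\<^sup>2"
          by (intro mult_right_mono power_mono) auto
        then show ?case by (simp add: ennreal_mult[symmetric] power_add[symmetric] ennreal_leI)
      qed
    qed
    also have "\<dots> = ennreal (s\<^sup>2) * ennreal (sqnorm lborel lo)"
      by (subst nn_integral_cmult) (auto simp: nn_integral_eq_sqnorm[OF lo_sq])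
    also have "\<dots> \<le> ennreal (s\<^sup>2) * ennreal E"
    proof (intro mult_left_mono ennreal_leI)
      have "sqnorm lborel lo \<le> sqnorm lborel (propagate t (cutoff R G))"
        unfolding lo_def by (intro sqnorm_inverse_fourier_le propagate_square_integrable loG)
      also have "\<dots> = sqnorm lborel (cutoff R G)" by (simp add: sqnorm_def propagate_def norm_mult)
      also have "\<dots> \<le> sqnorm lborel G" by (rule sqnorm_cutoff_le[OF G])
      also have "\<dots> \<le> E" by (rule sqnorm_le_h1_energy[OF G E])
      finally show "sqnorm lborel lo \<le> E" .
    qed simp
    finally show "(\<integral>\<^sup>+ x. ennreal (cmod (lo x) ^ 4) \<partial>lborel) \<le> ennreal (s\<^sup>2 * E)"
      using E by (simp add: ennreal_mult)
    have "(\<integral>\<^sup>+ x. ennreal (cmod (hi x) ^ 4) \<partial>lborel) \<le> sobolev_tail {\<xi>. R\<^sup>2 \<le> (norm \<xi>)\<^sup>2} * (h1_energy H)\<^sup>2"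
      unfolding hi_def
    proof (rule sobolev_L4[OF H])
      fix \<xi> :: "real^2" assume "\<xi> \<notin> {\<xi>. R\<^sup>2 \<le> (norm \<xi>)\<^sup>2}"
      then have "norm \<xi> < R" using R by (simp add: not_le power_less_imp_less_base)
      then show "H \<xi> = 0" by (simp add: H_def cutoff_def)
    qed measurable
    also have "\<dots> \<le> ennreal (pi / (1 + R\<^sup>2)) * (ennreal E)\<^sup>2"
    proof -
      have "h1_energy H \<le> h1_energy G"
        unfolding h1_energy_def H_def cutoff_def
        by (intro nn_integral_mono ennreal_leI mult_left_mono power_mono) (auto simp: indicator_def)
      then show ?thesis unfolding sobolev_tail_outside_ball by (intro mult_left_mono power_mono order_trans[OF _ E(2)]) auto
    qed
    also have "\<dots> = ennreal (pi / (1 + R\<^sup>2) * E\<^sup>2)"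
      using E by (subst ennreal_mult) (auto simp: ennreal_power add_pos_nonneg)
    finally show "(\<integral>\<^sup>+ x. ennreal (cmod (hi x) ^ 4) \<partial>lborel) \<le> ennreal (pi / (1 + R\<^sup>2) * E\<^sup>2)" .
  qed simp
  also have "\<dots> = ennreal (8 * (s\<^sup>2 * E + pi / (1 + R\<^sup>2) * E\<^sup>2))"
    using E by (subst ennreal_mult, auto simp: ennreal_plus add_nonneg_nonneg)
  finally show ?thesis .
qed

section \<open>Extraction of profiles\<close>

type_synonym spectrum = "real^2 \<Rightarrow> complex"

text \<open>
  \<open>\<Psi>\<close> is a weak limit along a subsequence after suitable symmetries have been
  undone.
\<close>

definition concentrates_to :: "(nat \<Rightarrow> spectrum) \<Rightarrow> spectrum \<Rightarrow> bool" where
  "concentrates_to W \<Psi> \<longleftrightarrow> (\<exists>p (r :: nat \<Rightarrow> nat). strict_mono r \<and>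
     weakly_converges lborel (\<lambda>n \<xi>. phase (- p n) \<xi> * W (r n) \<xi>) \<Psi>)"

text \<open>
  The state after some extractions. Remainders and shifts are indexed by the original index, so
  that a subsequence chosen later applies to all of them at once; the radius dominates the norms
  of all shifts chosen so far.
\<close>

datatype stage = Stage (stage_subseq: "nat \<Rightarrow> nat") (stage_rem: "nat \<Rightarrow> spectrum") (stage_profile: spectrum)
  (stage_shift: "nat \<Rightarrow> real \<times> (real^2)") (stage_radius: "nat \<Rightarrow> real")

definition valid_stage :: "stage \<Rightarrow> bool" where
  "valid_stage a \<longleftrightarrow> strict_mono (stage_subseq a) \<and> (\<forall>n. stage_rem a n \<in> square_integrable lborel) \<and>
     (\<exists>C. \<forall>n. sqnorm lborel (stage_rem a n) \<le> C) \<and> (\<forall>n. 0 \<le> stage_radius a n)"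

text \<open>
  The constant \<open>4\<close> for squared norms means that the new profile has at least half
  of the largest norm available. A zero profile receives a shift far outside the radius, so that
  its parameters separate from the earlier ones by construction. The functional \<open>S\<close>
  stands for the space-time norm of the wave; its convergence along the subsequence is what
  makes the limit in \<open>n\<close> exist for every number of profiles.
\<close>

definition extraction_step :: "(spectrum \<Rightarrow> ennreal) \<Rightarrow> stage \<Rightarrow> stage \<Rightarrow> bool" where
  "extraction_step S a b \<longleftrightarrow>
     (\<exists>\<tau>. strict_mono \<tau> \<and> stage_subseq b = stage_subseq a \<circ> \<tau>) \<and>
     (\<forall>n. stage_rem b n = (\<lambda>\<xi>. stage_rem a n \<xi> - phase (stage_shift b n) \<xi> * stage_profile b \<xi>)) \<and>
     weakly_converges lborel
       (\<lambda>n \<xi>. phase (- stage_shift b (stage_subseq b n)) \<xi> * stage_rem a (stage_subseq b n) \<xi>) (stage_profile b) \<and>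
     (\<forall>\<Psi>. concentrates_to (\<lambda>n. stage_rem a (stage_subseq a n)) \<Psi> \<longrightarrow> sqnorm lborel \<Psi> \<le> 4 * sqnorm lborel (stage_profile b)) \<and>
     (sqnorm lborel (stage_profile b) = 0 \<longrightarrow> (\<forall>n. stage_shift b n = (stage_radius a n + real n, 0))) \<and>
     (\<forall>n. stage_radius b n = max (stage_radius a n) (norm (stage_shift b n))) \<and>
     convergent (\<lambda>n. S (stage_rem b (stage_subseq b n)))"

lemma ennreal_convergent_subseq:
  fixes X :: "nat \<Rightarrow> ennreal"
  shows "\<exists>r. strict_mono r \<and> convergent (\<lambda>n. X (r n))"
  using compact_complete_linorder[of X] by (auto simp: convergent_def o_def)

lemma concentrates_to_sqnorm_le:
  assumes W: "\<And>n. W n \<in> square_integrable lborel" and C: "\<And>n. sqnorm lborel (W n) \<le> C" and c: "concentrates_to W \<Psi>"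
  shows "sqnorm lborel \<Psi> \<le> C"
proof -
  obtain p r where w: "weakly_converges lborel (\<lambda>n \<xi>. phase (- p n) \<xi> * W (r n) \<xi>) \<Psi>"
    using c unfolding concentrates_to_def by blast
  show ?thesis
    by (rule weakly_converges_sqnorm_le[OF _ _ w]) (auto intro: phase_square_integrable W simp: sqnorm_phase C)
qed

lemma concentration_exists:
  assumes W: "\<And>n. W n \<in> square_integrable lborel" and C: "\<And>n. sqnorm lborel (W n) \<le> C"
  shows "\<exists>r \<Psi>. strict_mono (r :: nat \<Rightarrow> nat) \<and> weakly_converges lborel (\<lambda>n \<xi>. phase (- p (r n)) \<xi> * W (r n) \<xi>) \<Psi>"
  using l2_weak_compactness[of "\<lambda>n \<xi>. phase (- p n) \<xi> * W n \<xi>" lborel C] W C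
  by (simp add: phase_square_integrable sqnorm_phase)

text \<open>
  The squared norms of all weak limits are bounded by \<open>C\<close>. If their supremum is
  positive, a weak limit with more than a quarter of it is taken. Otherwise all weak limits
  vanish and the shift is free to be chosen.
\<close>

lemma almost_largest_concentration:
  assumes W: "\<And>n. W n \<in> square_integrable lborel" and C: "\<And>n. sqnorm lborel (W n) \<le> C"
    and \<sigma>: "strict_mono \<sigma>" and \<rho>: "\<And>n. 0 \<le> \<rho> n"
  shows "\<exists>\<tau> \<Psi> p. strict_mono \<tau> \<and> weakly_converges lborel (\<lambda>n \<xi>. phase (- p (\<sigma> (\<tau> n))) \<xi> * W (\<sigma> (\<tau> n)) \<xi>) \<Psi> \<and>
     (\<forall>\<Psi>'. concentrates_to (\<lambda>n. W (\<sigma> n)) \<Psi>' \<longrightarrow> sqnorm lborel \<Psi>' \<le> 4 * sqnorm lborel \<Psi>) \<and>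
     (sqnorm lborel \<Psi> = 0 \<longrightarrow> (\<forall>n. p n = (\<rho> n + real n, 0)))"
proof -
  define A where "A = {sqnorm lborel \<Psi> | \<Psi>. concentrates_to (\<lambda>n. W (\<sigma> n)) \<Psi>}"
  define s where "s = Sup A"
  have bdd: "bdd_above A"
    unfolding A_def using concentrates_to_sqnorm_le[of "\<lambda>n. W (\<sigma> n)" C] W C by (intro bdd_aboveI[of _ C]) auto
  have conc: "concentrates_to (\<lambda>n. W (\<sigma> n)) \<Psi>" if "strict_mono r" "weakly_converges lborel (\<lambda>n \<xi>. phase (- q (r n)) \<xi> * W (\<sigma> (r n)) \<xi>) \<Psi>" for r q \<Psi>
    using that unfolding concentrates_to_def by (intro exI[of _ "\<lambda>n. q (r n)"] exI[of _ r]) auto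
  have le_s: "sqnorm lborel \<Psi> \<le> s" if "concentrates_to (\<lambda>n. W (\<sigma> n)) \<Psi>" for \<Psi>
    unfolding s_def using bdd that by (intro cSup_upper) (auto simp: A_def)
  show ?thesis
  proof (cases "s > 0")
    case True
    then have "s / 4 < s" by simp
    moreover have "A \<noteq> {}"
      using concentration_exists[of "\<lambda>n. W (\<sigma> n)" C "\<lambda>_. 0"] W C conc[of _ "\<lambda>_. 0"] unfolding A_def by blast
    ultimately obtain \<Psi> where \<Psi>: "concentrates_to (\<lambda>n. W (\<sigma> n)) \<Psi>" "s / 4 < sqnorm lborel \<Psi>"
      using less_cSupD[of A "s / 4"] unfolding s_def A_def by auto
    obtain q r where r: "strict_mono r" and w: "weakly_converges lborel (\<lambda>n \<xi>. phase (- q n) \<xi> * W (\<sigma> (r n)) \<xi>) \<Psi>"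
      using \<Psi>(1) unfolding concentrates_to_def by blast
    have inj: "inj (\<lambda>n. \<sigma> (r n))"
      using strict_mono_imp_inj_on[OF strict_mono_o[OF \<sigma> r]] by (simp add: o_def)
    \<comment> \<open>shifts are indexed by the original index, while \<open>q\<close> is
    indexed along the subsequence \<open>\<sigma> \<circ> r\<close>\<close>
    define p where "p n = q (inv (\<lambda>n. \<sigma> (r n)) n)" for n
    have "p (\<sigma> (r n)) = q n" for n
      unfolding p_def using inv_f_f[OF inj, of n] by simp
    then have "weakly_converges lborel (\<lambda>n \<xi>. phase (- p (\<sigma> (r n))) \<xi> * W (\<sigma> (r n)) \<xi>) \<Psi>"
      using w by simp
    moreover have "sqnorm lborel \<Psi>' \<le> 4 * sqnorm lborel \<Psi>" if "concentrates_to (\<lambda>n. W (\<sigma> n)) \<Psi>'" for \<Psi>'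
      using le_s[OF that] \<Psi>(2) by simp
    moreover have "sqnorm lborel \<Psi> \<noteq> 0" using \<Psi>(2) True by simp
    ultimately show ?thesis using r by blast
  next
    case False
    \<comment> \<open>at distance at least \<open>n\<close> from all parameters of norm at most
    \<open>\<rho> n\<close>\<close>
    define p where "p n = (\<rho> n + real n, 0 :: real^2)" for n
    obtain r \<Psi> where r: "strict_mono r" and w: "weakly_converges lborel (\<lambda>n \<xi>. phase (- p (\<sigma> (r n))) \<xi> * W (\<sigma> (r n)) \<xi>) \<Psi>"
      using concentration_exists[of "\<lambda>n. W (\<sigma> n)" C "\<lambda>n. p (\<sigma> n)"] W C by blast
    have z: "sqnorm lborel \<Psi>' \<le> 0" if "concentrates_to (\<lambda>n. W (\<sigma> n)) \<Psi>'" for \<Psi>'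
      using le_s[OF that] False by simp
    have "sqnorm lborel \<Psi>' \<le> 4 * sqnorm lborel \<Psi>" if "concentrates_to (\<lambda>n. W (\<sigma> n)) \<Psi>'" for \<Psi>'
      using order_trans[OF z[OF that]] by simp
    moreover have "\<forall>n. p n = (\<rho> n + real n, 0)" by (simp add: p_def)
    ultimately show ?thesis using r w by blast
  qed
qed

lemma extraction_step_exists:
  assumes "valid_stage a"
  shows "\<exists>b. valid_stage b \<and> extraction_step S a b"
proof -
  obtain C where \<sigma>: "strict_mono (stage_subseq a)" and W: "\<And>n. stage_rem a n \<in> square_integrable lborel"
    and C: "\<And>n. sqnorm lborel (stage_rem a n) \<le> C" and \<rho>: "\<And>n. 0 \<le> stage_radius a n"
    using assms unfolding valid_stage_def by blast
  obtain \<tau> \<Psi> p where \<tau>: "strict_mono \<tau>"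
    and w: "weakly_converges lborel (\<lambda>n \<xi>. phase (- p (stage_subseq a (\<tau> n))) \<xi> * stage_rem a (stage_subseq a (\<tau> n)) \<xi>) \<Psi>"
    and big: "\<And>\<Psi>'. concentrates_to (\<lambda>n. stage_rem a (stage_subseq a n)) \<Psi>' \<Longrightarrow> sqnorm lborel \<Psi>' \<le> 4 * sqnorm lborel \<Psi>"
    and far: "sqnorm lborel \<Psi> = 0 \<longrightarrow> (\<forall>n. p n = (stage_radius a n + real n, 0))"
    using almost_largest_concentration[of "stage_rem a" C "stage_subseq a" "stage_radius a"] W C \<sigma> \<rho> by blast
  have \<Psi>: "\<Psi> \<in> square_integrable lborel" using w by (simp add: weakly_converges_def)
  define W' where "W' n = (\<lambda>\<xi>. stage_rem a n \<xi> - phase (p n) \<xi> * \<Psi> \<xi>)" for n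
  obtain r where r: "strict_mono r" "convergent (\<lambda>n. S (W' (stage_subseq a (\<tau> (r n)))))"
    using ennreal_convergent_subseq[of "\<lambda>n. S (W' (stage_subseq a (\<tau> n)))"] by blast
  define b where "b = Stage (stage_subseq a \<circ> (\<tau> \<circ> r)) W' \<Psi> p (\<lambda>n. max (stage_radius a n) (norm (p n)))"
  have "sqnorm lborel (W' n) \<le> 2 * C + 2 * sqnorm lborel \<Psi>" for n
    unfolding W'_def using sqnorm_diff_le[OF W[of n] phase_square_integrable[OF \<Psi>, of "p n"]] C[of n] by (simp add: sqnorm_phase)
  then have "valid_stage b"
    unfolding valid_stage_def b_def W'_def using \<sigma> \<tau> r \<rho> W
    by (auto intro!: strict_mono_o square_integrable_diff phase_square_integrable \<Psi> simp: le_max_iff_disj)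
  moreover have "extraction_step S a b"
    unfolding extraction_step_def
  proof (intro conjI)
    show "\<exists>\<tau>. strict_mono \<tau> \<and> stage_subseq b = stage_subseq a \<circ> \<tau>"
      by (rule exI[of _ "\<tau> \<circ> r"]) (simp add: b_def strict_mono_o \<tau> r)
    show "weakly_converges lborel (\<lambda>n \<xi>. phase (- stage_shift b (stage_subseq b n)) \<xi> * stage_rem a (stage_subseq b n) \<xi>) (stage_profile b)"
      using weakly_converges_subseq[OF w r(1)] by (simp add: b_def)
  qed (use big far r in \<open>auto simp: b_def W'_def\<close>)
  ultimately show ?thesis by blast
qed

lemma extraction_sequence_exists:
  assumes F: "\<And>n. F n \<in> square_integrable lborel" and C: "\<And>n. sqnorm lborel (F n) \<le> C"
  shows "\<exists>a :: nat \<Rightarrow> stage. stage_subseq (a 0) = id \<and> stage_rem (a 0) = F \<and>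
     (\<forall>j. valid_stage (a j) \<and> extraction_step S (a j) (a (Suc j)))"
proof -
  let ?P = "\<lambda>(j::nat) a. valid_stage a \<and> (j = 0 \<longrightarrow> stage_subseq a = id \<and> stage_rem a = F)"
  have "\<exists>f. \<forall>j. ?P j (f j) \<and> extraction_step S (f j) (f (Suc j))"
  proof (rule dependent_nat_choice)
    show "\<exists>a. ?P 0 a"
      using F C by (intro exI[of _ "Stage id F (\<lambda>_. 0) (\<lambda>_. 0) (\<lambda>_. 0)"]) (auto simp: valid_stage_def strict_mono_def)
    show "\<exists>b. ?P (Suc j) b \<and> extraction_step S a b" if "?P j a" for a j
      using extraction_step_exists[of a S] that by auto
  qed
  then show ?thesis by blast
qed

lemma weakly_converges_offset:
  "weakly_converges M (\<lambda>n. F (n + k)) \<Psi> \<Longrightarrow> weakly_converges M F \<Psi>"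
  unfolding weakly_converges_def by (auto intro: LIMSEQ_offset)

text \<open>
  From index \<open>j\<close> on, the diagonal sequence is a subsequence of the
  \<open>j\<close>-th sequence.
\<close>

lemma diagonal_subsequence:
  fixes \<sigma> :: "nat \<Rightarrow> nat \<Rightarrow> nat"
  assumes 0: "strict_mono (\<sigma> 0)" and step: "\<And>j. \<exists>\<tau>. strict_mono \<tau> \<and> \<sigma> (Suc j) = \<sigma> j \<circ> \<tau>"
  shows "strict_mono (\<lambda>n. \<sigma> n n)" "\<exists>\<theta>. strict_mono \<theta> \<and> (\<forall>n. \<sigma> (n + j) (n + j) = \<sigma> j (\<theta> n))"
proof -
  have mono: "strict_mono (\<sigma> j)" for j
  proof (induction j)
    case (Suc j)
    obtain \<tau> where \<tau>: "strict_mono \<tau>" "\<sigma> (Suc j) = \<sigma> j \<circ> \<tau>" using step by blast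
    show ?case unfolding \<tau>(2) by (rule strict_mono_o[OF Suc \<tau>(1)])
  qed (rule 0)
  have diag_less: "\<sigma> n n < \<sigma> (Suc n) (Suc n)" for n
  proof -
    obtain \<tau> where \<tau>: "strict_mono \<tau>" "\<sigma> (Suc n) = \<sigma> n \<circ> \<tau>" using step by blast
    have "n < \<tau> (Suc n)" using seq_suble[OF \<tau>(1), of "Suc n"] by simp
    then show ?thesis using strict_monoD[OF mono, of n "\<tau> (Suc n)" n] \<tau>(2) by simp
  qed
  then show diag: "strict_mono (\<lambda>n. \<sigma> n n)" by (simp add: strict_mono_Suc_iff)
  have "\<exists>T. \<sigma> (k + j) = \<sigma> j \<circ> T" for k
  proof (induction k)
    case 0 show ?case by (intro exI[of _ id]) simp
  next
    case (Suc k)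
    then obtain T where "\<sigma> (k + j) = \<sigma> j \<circ> T" by blast
    moreover obtain \<tau> where "\<sigma> (Suc (k + j)) = \<sigma> (k + j) \<circ> \<tau>" using step by blast
    ultimately show ?case by (intro exI[of _ "T \<circ> \<tau>"]) (simp add: o_assoc)
  qed
  then obtain T where T: "\<And>k. \<sigma> (k + j) = \<sigma> j \<circ> T k" by metis
  define \<theta> where "\<theta> n = T n (n + j)" for n
  have eq: "\<sigma> (n + j) (n + j) = \<sigma> j (\<theta> n)" for n
    by (simp add: T \<theta>_def)
  have "strict_mono \<theta>"
  proof (rule strict_monoI)
    fix m n :: nat assume "m < n"
    then have "\<sigma> (m + j) (m + j) < \<sigma> (n + j) (n + j)"
      using strict_monoD[OF diag, of "m + j" "n + j"] by simp
    then show "\<theta> m < \<theta> n" unfolding eq using strict_mono_less[OF mono] by blast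
  qed
  with eq show "\<exists>\<theta>. strict_mono \<theta> \<and> (\<forall>n. \<sigma> (n + j) (n + j) = \<sigma> j (\<theta> n))" by blast
qed

lemma not_at_top_subsequence:
  fixes f :: "nat \<Rightarrow> real"
  assumes "\<not> filterlim f at_top sequentially"
  shows "\<exists>B (r::nat\<Rightarrow>nat). strict_mono r \<and> (\<forall>n. f (r n) < B)"
proof -
  obtain B where B: "\<not> eventually (\<lambda>n. B \<le> f n) sequentially"
    using assms unfolding filterlim_at_top by blast
  then have "infinite {n. f n < B}"
    unfolding eventually_sequentially infinite_nat_iff_unbounded_le by (force simp: not_le)
  then obtain r :: "nat \<Rightarrow> nat" where "strict_mono r" "\<And>n. r n \<in> {n. f n < B}"
    using infinite_enumerate by blast
  then show ?thesis by blast
qed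

text \<open>
  A sequence of extraction steps. Everything is evaluated along the diagonal subsequence, and
  \<open>concentration_le\<close> bounds the weak limits that remain at each stage.
\<close>

locale profile_extraction =
  fixes a :: "nat \<Rightarrow> stage" and S :: "spectrum \<Rightarrow> ennreal" and F :: "nat \<Rightarrow> spectrum" and C :: real
  assumes F_sq: "F n \<in> square_integrable lborel" and F_le: "sqnorm lborel (F n) \<le> C"
    and subseq0: "stage_subseq (a 0) = id" and rem0: "stage_rem (a 0) = F"
    and valid: "valid_stage (a j)" and step: "extraction_step S (a j) (a (Suc j))"
begin

definition diag :: "nat \<Rightarrow> nat" where "diag n = stage_subseq (a n) n"
definition rem :: "nat \<Rightarrow> nat \<Rightarrow> spectrum" where "rem M n = stage_rem (a M) (diag n)"
definition prof :: "nat \<Rightarrow> spectrum" where "prof j = stage_profile (a j)"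
definition shift :: "nat \<Rightarrow> nat \<Rightarrow> real \<times> (real^2)" where "shift j n = stage_shift (a j) (diag n)"

lemma subseq_step: "\<exists>\<tau>. strict_mono \<tau> \<and> stage_subseq (a (Suc j)) = stage_subseq (a j) \<circ> \<tau>"
  using step[of j] unfolding extraction_step_def by blast

lemma diag_strict_mono: "strict_mono diag"
  unfolding diag_def using diagonal_subsequence(1)[of "\<lambda>j. stage_subseq (a j)"] subseq_step
  by (simp add: subseq0 strict_mono_def)

lemma diag_eventually_subseq: "\<exists>\<theta>. strict_mono \<theta> \<and> (\<forall>n. diag (n + j) = stage_subseq (a j) (\<theta> n))"
  unfolding diag_def using diagonal_subsequence(2)[of "\<lambda>j. stage_subseq (a j)" j] subseq_step
  by (simp add: subseq0 strict_mono_def)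

lemma rem_square_integrable: "rem M n \<in> square_integrable lborel"
  using valid[of M] by (simp add: rem_def valid_stage_def)

lemma rem_bounded: "\<exists>B. \<forall>n. sqnorm lborel (rem M n) \<le> B"
  using valid[of M] unfolding rem_def valid_stage_def by blast

lemma rem_0: "rem 0 n = F (diag n)"
  by (simp add: rem_def rem0)

lemma rem_Suc: "rem (Suc M) n = (\<lambda>\<xi>. rem M n \<xi> - phase (shift (Suc M) n) \<xi> * prof (Suc M) \<xi>)"
  using step[of M] unfolding extraction_step_def rem_def prof_def shift_def by blast

lemma weak_limit: "weakly_converges lborel (\<lambda>n \<xi>. phase (- shift (Suc M) n) \<xi> * rem M n \<xi>) (prof (Suc M))"
proof -
  obtain \<theta> where \<theta>: "strict_mono \<theta>" "\<And>n. diag (n + Suc M) = stage_subseq (a (Suc M)) (\<theta> n)"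
    using diag_eventually_subseq by blast
  have "weakly_converges lborel (\<lambda>n \<xi>. phase (- stage_shift (a (Suc M)) (stage_subseq (a (Suc M)) n)) \<xi> * stage_rem (a M) (stage_subseq (a (Suc M)) n) \<xi>) (prof (Suc M))"
    using step[of M] unfolding extraction_step_def prof_def by blast
  from weakly_converges_subseq[OF this \<theta>(1)]
  have "weakly_converges lborel (\<lambda>n \<xi>. phase (- shift (Suc M) (n + Suc M)) \<xi> * rem M (n + Suc M) \<xi>) (prof (Suc M))"
    unfolding \<theta>(2)[symmetric] shift_def rem_def .
  then show ?thesis by (rule weakly_converges_offset)
qed

lemma prof_square_integrable: "prof (Suc M) \<in> square_integrable lborel"
  using weak_limit[of M] by (simp add: weakly_converges_def)

lemma rem_eq: "F (diag n) \<xi> = (\<Sum>j=1..M. phase (shift j n) \<xi> * prof j \<xi>) + rem M n \<xi>"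
  by (induction M) (simp_all add: rem_0 rem_Suc)

lemma S_convergent: "convergent (\<lambda>n. S (rem (Suc M) n))"
proof -
  obtain \<theta> where \<theta>: "strict_mono \<theta>" "\<And>n. diag (n + Suc M) = stage_subseq (a (Suc M)) (\<theta> n)"
    using diag_eventually_subseq by blast
  have "convergent (\<lambda>n. S (stage_rem (a (Suc M)) (stage_subseq (a (Suc M)) n)))"
    using step[of M] unfolding extraction_step_def by blast
  from convergent_subseq_convergent[OF this \<theta>(1)]
  have "convergent (\<lambda>n. S (rem (Suc M) (n + Suc M)))"
    by (simp add: o_def rem_def \<theta>(2)[symmetric])
  then show ?thesis by (rule convergent_ignore_initial_segment[THEN iffD1])
qed

lemma concentration_le:
  assumes "concentrates_to (rem M) \<Psi>"
  shows "sqnorm lborel \<Psi> \<le> 4 * sqnorm lborel (prof (Suc M))"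
proof -
  obtain p r where r: "strict_mono (r :: nat \<Rightarrow> nat)" and w: "weakly_converges lborel (\<lambda>n \<xi>. phase (- p n) \<xi> * rem M (r n) \<xi>) \<Psi>"
    using assms unfolding concentrates_to_def by blast
  obtain \<theta> where \<theta>: "strict_mono \<theta>" "\<And>n. diag (n + M) = stage_subseq (a M) (\<theta> n)"
    using diag_eventually_subseq by blast
  have ge: "M \<le> r (n + M)" for n
    using seq_suble[OF r, of "n + M"] by simp
  define q where "q n = \<theta> (r (n + M) - M)" for n
  have q: "strict_mono q"
  proof (rule strict_monoI)
    fix m n :: nat assume "m < n"
    then have "r (m + M) < r (n + M)" using strict_monoD[OF r] by simp
    then show "q m < q n" unfolding q_def using ge[of m] by (intro strict_monoD[OF \<theta>(1)]) simp
  qed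
  have rq: "rem M (r (n + M)) = stage_rem (a M) (stage_subseq (a M) (q n))" for n
    unfolding rem_def q_def \<theta>(2)[symmetric] using ge[of n] by simp
  have "weakly_converges lborel (\<lambda>n \<xi>. phase (- p (n + M)) \<xi> * rem M (r (n + M)) \<xi>) \<Psi>"
    by (rule weakly_converges_subseq[OF w, of "\<lambda>n. n + M"]) (simp add: strict_mono_def)
  then have "concentrates_to (\<lambda>n. stage_rem (a M) (stage_subseq (a M) n)) \<Psi>"
    unfolding concentrates_to_def rq using q by (intro exI[of _ "\<lambda>n. p (n + M)"] exI[of _ q] conjI)
  then show ?thesis using step[of M] unfolding extraction_step_def prof_def by blast
qed

lemma shift_norm_le_radius: "1 \<le> k \<Longrightarrow> k \<le> j \<Longrightarrow> norm (stage_shift (a k) n) \<le> stage_radius (a j) n"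
proof (induction j)
  case (Suc j)
  have r: "stage_radius (a (Suc j)) n = max (stage_radius (a j) n) (norm (stage_shift (a (Suc j)) n))"
    using step[of j] unfolding extraction_step_def by blast
  show ?case
    using Suc unfolding r by (cases "k = Suc j") (auto simp: le_max_iff_disj)
qed simp

text \<open>
  Removing the profile \<open>k\<close> makes the remainder, seen from the shift
  \<open>k\<close>, tend weakly to zero. The profiles between \<open>k\<close> and
  \<open>m\<close> do not change this, because their shifts diverge from the shift
  \<open>k\<close>.
\<close>

lemma phase_rem_weakly_0:
  assumes k: "1 \<le> k" "k \<le> m"
    and far: "\<And>l. k < l \<Longrightarrow> l \<le> m \<Longrightarrow> filterlim (\<lambda>n. norm (shift l n - shift k n)) at_top sequentially"
  shows "weakly_converges lborel (\<lambda>n \<xi>. phase (- shift k n) \<xi> * rem m n \<xi>) (\<lambda>_. 0)"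
  using k(2) far
proof (induction m rule: dec_induct)
  case base
  obtain i where i: "k = Suc i" using k(1) by (cases k) auto
  have pp: "phase (- shift k n) \<xi> * rem k n \<xi> = phase (- shift k n) \<xi> * rem i n \<xi> - prof k \<xi>" for n \<xi>
    unfolding i rem_Suc right_diff_distrib mult.assoc[symmetric] phase_minus_mult by simp
  have const: "weakly_converges lborel (\<lambda>n. prof k) (prof k)"
    unfolding i weakly_converges_def using prof_square_integrable by auto
  have "weakly_converges lborel (\<lambda>n \<xi>. phase (- shift k n) \<xi> * rem i n \<xi> - prof k \<xi>) (\<lambda>\<xi>. prof k \<xi> - prof k \<xi>)"
    using weak_limit[of i] prof_square_integrable[of i] unfolding i
    by (intro weakly_converges_diff const[unfolded i]) (auto intro: phase_square_integrable rem_square_integrable)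
  then show ?case unfolding pp by simp
next
  case (step m)
  have IH: "weakly_converges lborel (\<lambda>n \<xi>. phase (- shift k n) \<xi> * rem m n \<xi>) (\<lambda>_. 0)"
    using step by auto
  have far': "filterlim (\<lambda>n. norm (shift (Suc m) n - shift k n)) at_top sequentially"
    using step.prems[of "Suc m"] step.hyps by simp
  have "weakly_converges lborel (\<lambda>n \<xi>. phase (shift (Suc m) n - shift k n) \<xi> * prof (Suc m) \<xi>) (\<lambda>_. 0)"
    by (rule phase_weakly_converges_0[OF prof_square_integrable far'])
  then have "weakly_converges lborel (\<lambda>n \<xi>. phase (- shift k n) \<xi> * rem m n \<xi> - phase (shift (Suc m) n - shift k n) \<xi> * prof (Suc m) \<xi>) (\<lambda>\<xi>. 0 - 0)"
    by (intro weakly_converges_diff IH) (auto intro: phase_square_integrable rem_square_integrable prof_square_integrable)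
  moreover have "phase (- shift k n) \<xi> * rem (Suc m) n \<xi> = phase (- shift k n) \<xi> * rem m n \<xi> - phase (shift (Suc m) n - shift k n) \<xi> * prof (Suc m) \<xi>" for n \<xi>
    using phase_add[of "- shift k n" "shift (Suc m) n" \<xi>] unfolding rem_Suc by (simp add: right_diff_distrib mult.assoc)
  ultimately show ?case by simp
qed

text \<open>
  If the shifts of the profiles \<open>k < j\<close> stayed close along a subsequence, their
  difference would converge along a further one. The remainder seen from the shift
  \<open>j\<close> would then be the one seen from the shift \<open>k\<close>, which tends
  weakly to zero, times a convergent factor. Hence the profile \<open>j\<close> would vanish;
  zero profiles have divergent shifts by construction.
\<close>

theorem shifts_diverge:
  "1 \<le> k \<Longrightarrow> k < j \<Longrightarrow> filterlim (\<lambda>n. norm (shift j n - shift k n)) at_top sequentially"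
proof (induction j arbitrary: k rule: less_induct)
  case (less j)
  obtain i where i: "j = Suc i" using less.prems by (cases j) auto
  show ?case
  proof (cases "sqnorm lborel (prof j) = 0")
    case True
    \<comment> \<open>the shift of a zero profile leaves the ball that contains all the earlier
    shifts\<close>
    have sh: "shift j n = (stage_radius (a i) (diag n) + real (diag n), 0)" for n
      using step[of i] True unfolding extraction_step_def shift_def prof_def i by blast
    have "real n \<le> norm (shift j n - shift k n)" for n
    proof -
      have rad: "0 \<le> stage_radius (a i) (diag n)" using valid[of i] by (simp add: valid_stage_def)
      have nj: "norm (shift j n) = stage_radius (a i) (diag n) + real (diag n)"
        unfolding sh using rad by (simp add: norm_Pair)
      have sk: "norm (shift k n) \<le> stage_radius (a i) (diag n)"
        unfolding shift_def using less.prems i by (intro shift_norm_le_radius) auto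
      have "real n \<le> real (diag n)" using seq_suble[OF diag_strict_mono, of n] by simp
      also have "\<dots> \<le> norm (shift j n) - norm (shift k n)"
        using sk nj by simp
      also have "\<dots> \<le> norm (shift j n - shift k n)" by (rule norm_triangle_ineq2)
      finally show ?thesis .
    qed
    then show ?thesis
      by (intro filterlim_at_top_mono[OF filterlim_real_sequentially]) auto
  next
    case False
    show ?thesis
    proof (rule ccontr)
      assume "\<not> ?thesis"
      then obtain B r where r: "strict_mono (r::nat \<Rightarrow> nat)" and B: "\<And>n. norm (shift j (r n) - shift k (r n)) < B"
        using not_at_top_subsequence by blast
      have "bounded (range (\<lambda>n. shift j (r n) - shift k (r n)))"
        using B by (intro boundedI[of _ B]) (auto intro: less_imp_le)
      then obtain q s where s: "strict_mono (s :: nat \<Rightarrow> nat)" and q: "((\<lambda>n. shift j (r n) - shift k (r n)) \<circ> s) \<longlonglongrightarrow> q"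
        using bounded_imp_convergent_subsequence by blast
      define u where "u n = r (s n)" for n
      have u: "strict_mono u" unfolding u_def using strict_mono_o[OF r s] by (simp add: o_def)
      have q': "(\<lambda>n. - (shift j (u n) - shift k (u n))) \<longlonglongrightarrow> - q"
        using tendsto_minus[OF q] by (simp add: o_def u_def)
      have w0: "weakly_converges lborel (\<lambda>n \<xi>. phase (- shift k (u n)) \<xi> * rem i (u n) \<xi>) (\<lambda>_. 0)"
        using less.prems less.IH unfolding i
        by (intro weakly_converges_subseq[OF phase_rem_weakly_0 u]) auto
      obtain D where D: "\<And>n. sqnorm lborel (rem i n) \<le> D" using rem_bounded by blast
      have w1: "weakly_converges lborel (\<lambda>n \<xi>. phase (- (shift j (u n) - shift k (u n))) \<xi> * (phase (- shift k (u n)) \<xi> * rem i (u n) \<xi>)) (\<lambda>\<xi>. phase (- q) \<xi> * 0)"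
      proof (rule weakly_converges_mult_tendsto[OF w0, where C=D])
        show "(\<lambda>\<xi>. phase (- shift k (u n)) \<xi> * rem i (u n) \<xi>) \<in> square_integrable lborel" for n
          by (intro phase_square_integrable rem_square_integrable)
        show "sqnorm lborel (\<lambda>\<xi>. phase (- shift k (u n)) \<xi> * rem i (u n) \<xi>) \<le> D" for n
          by (simp add: sqnorm_phase D)
        show "(\<lambda>n. phase (- (shift j (u n) - shift k (u n))) \<xi>) \<longlonglongrightarrow> phase (- q) \<xi>" for \<xi>
          by (rule phase_tendsto[OF q'])
      qed simp_all
      have eq: "phase (- (shift j (u n) - shift k (u n))) \<xi> * (phase (- shift k (u n)) \<xi> * rem i (u n) \<xi>) = phase (- shift j (u n)) \<xi> * rem i (u n) \<xi>" for n \<xi>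
        using phase_add[of "- (shift j (u n) - shift k (u n))" "- shift k (u n)" \<xi>] by (simp add: mult.assoc)
      have "weakly_converges lborel (\<lambda>n \<xi>. phase (- shift j (u n)) \<xi> * rem i (u n) \<xi>) (\<lambda>_. 0)"
        using w1 unfolding eq by simp
      moreover have "weakly_converges lborel (\<lambda>n \<xi>. phase (- shift j (u n)) \<xi> * rem i (u n) \<xi>) (prof j)"
        unfolding i by (rule weakly_converges_subseq[OF weak_limit u])
      ultimately have "AE \<xi> in lborel. prof j \<xi> = 0"
        using weakly_converges_unique by blast
      then have "sqnorm lborel (prof j) = 0"
        using sqnorm_zero_iff prof_square_integrable i by metis
      then show False using False by simp
    qed
  qed
qed

theorem pythagoras:
  assumes [measurable]: "\<omega> \<in> borel_measurable lborel" and le: "\<And>x. \<bar>\<omega> x\<bar> \<le> (1::real)"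
  shows "(\<lambda>n. (LINT x|lborel. \<omega> x * (cmod (F (diag n) x))\<^sup>2)
     - ((\<Sum>j=1..M. LINT x|lborel. \<omega> x * (cmod (prof j x))\<^sup>2) + (LINT x|lborel. \<omega> x * (cmod (rem M n x))\<^sup>2))) \<longlonglongrightarrow> 0"
proof (induction M)
  case 0
  show ?case by (simp add: rem_0)
next
  case (Suc M)
  have w: "(\<lambda>n. (LINT x|lborel. \<omega> x * (cmod (phase (- shift (Suc M) n) x * rem M n x))\<^sup>2)
     - ((LINT x|lborel. \<omega> x * (cmod (prof (Suc M) x))\<^sup>2)
       + (LINT x|lborel. \<omega> x * (cmod (phase (- shift (Suc M) n) x * rem M n x - prof (Suc M) x))\<^sup>2))) \<longlonglongrightarrow> 0"
    by (rule weakly_converges_Pythagoras[OF weak_limit]) (auto intro: phase_square_integrable rem_square_integrable le)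
  have eq: "cmod (phase (- shift (Suc M) n) x * rem M n x - prof (Suc M) x) = cmod (rem (Suc M) n x)" for n x
  proof -
    have "phase (- shift (Suc M) n) x * rem (Suc M) n x = phase (- shift (Suc M) n) x * rem M n x - prof (Suc M) x"
      unfolding rem_Suc right_diff_distrib mult.assoc[symmetric] phase_minus_mult by simp
    then show ?thesis by (metis mult_1 norm_mult norm_phase)
  qed
  have "(\<lambda>n. (LINT x|lborel. \<omega> x * (cmod (rem M n x))\<^sup>2)
     - ((LINT x|lborel. \<omega> x * (cmod (prof (Suc M) x))\<^sup>2) + (LINT x|lborel. \<omega> x * (cmod (rem (Suc M) n x))\<^sup>2))) \<longlonglongrightarrow> 0"
    using w unfolding eq by (simp add: norm_mult)
  from tendsto_add[OF Suc this] show ?case by (simp add: algebra_simps)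
qed

lemma sqnorm_decoupling:
  "(\<lambda>n. sqnorm lborel (F (diag n)) - ((\<Sum>j=1..M. sqnorm lborel (prof j)) + sqnorm lborel (rem M n))) \<longlonglongrightarrow> 0"
  using pythagoras[of "\<lambda>_. 1" M] by (simp add: sqnorm_def)

lemma rem_eventually_le: "\<forall>\<^sub>F n in sequentially. sqnorm lborel (rem M n) \<le> C + 1"
proof -
  have "\<forall>\<^sub>F n in sequentially. - 1 < sqnorm lborel (F (diag n)) - ((\<Sum>j=1..M. sqnorm lborel (prof j)) + sqnorm lborel (rem M n))"
    using order_tendstoD(1)[OF sqnorm_decoupling, of "- 1"] by simp
  then show ?thesis
  proof eventually_elim
    case (elim n)
    have "0 \<le> (\<Sum>j=1..M. sqnorm lborel (prof j))" by (simp add: sum_nonneg)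
    then show ?case using elim F_le[of "diag n"] by simp
  qed
qed

lemma sum_prof_le: "(\<Sum>j=1..M. sqnorm lborel (prof j)) \<le> C"
proof -
  have "0 \<le> C - (\<Sum>j=1..M. sqnorm lborel (prof j))"
  proof (rule LIMSEQ_le[OF sqnorm_decoupling[of M] tendsto_const])
    show "\<exists>N. \<forall>n\<ge>N. sqnorm lborel (F (diag n)) - ((\<Sum>j=1..M. sqnorm lborel (prof j)) + sqnorm lborel (rem M n)) \<le> C - (\<Sum>j=1..M. sqnorm lborel (prof j))"
    proof (intro exI[of _ 0] allI impI)
      fix n
      show "sqnorm lborel (F (diag n)) - ((\<Sum>j=1..M. sqnorm lborel (prof j)) + sqnorm lborel (rem M n)) \<le> C - (\<Sum>j=1..M. sqnorm lborel (prof j))"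
        using F_le[of "diag n"] sqnorm_nonneg[of lborel "rem M n"] by linarith
    qed
  qed
  then show ?thesis by simp
qed

lemma prof_tendsto_0: "(\<lambda>M. sqnorm lborel (prof (Suc M))) \<longlonglongrightarrow> 0"
proof -
  have "summable (\<lambda>M. sqnorm lborel (prof (Suc M)))"
  proof (rule summableI_nonneg_bounded)
    show "(\<Sum>M<n. sqnorm lborel (prof (Suc M))) \<le> C" for n
      using sum_prof_le[of n] by (simp add: sum.atLeast1_atMost_eq)
  qed simp
  then show ?thesis by (rule summable_LIMSEQ_zero)
qed

text \<open>
  Otherwise there are arbitrarily late shifts for which the pairing stays above
  \<open>\<epsilon>\<close>. A weak limit along these shifts has a norm bounded by twice that of
  the next profile, which is too small for large \<open>M\<close>.
\<close>

lemma l2_pairing_vanishes: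
  assumes k: "k \<in> square_integrable lborel" and \<epsilon>: "0 < \<epsilon>"
  shows "\<exists>M0. \<forall>M\<ge>M0. \<forall>\<^sub>F n in sequentially. \<forall>p. cmod (l2_inner lborel (\<lambda>\<xi>. phase (- p) \<xi> * rem M n \<xi>) k) \<le> \<epsilon>"
proof -
  have "(\<lambda>M. sqrt (4 * sqnorm lborel (prof (Suc M))) * sqrt (sqnorm lborel k)) \<longlonglongrightarrow> sqrt (4 * 0) * sqrt (sqnorm lborel k)"
    by (intro tendsto_intros prof_tendsto_0)
  then have "\<forall>\<^sub>F M in sequentially. sqrt (4 * sqnorm lborel (prof (Suc M))) * sqrt (sqnorm lborel k) < \<epsilon>"
    using \<epsilon> by (intro order_tendstoD(2)[where y="sqrt (4 * 0) * sqrt (sqnorm lborel k)"]) auto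
  then obtain M0 where M0: "\<And>M. M \<ge> M0 \<Longrightarrow> sqrt (4 * sqnorm lborel (prof (Suc M))) * sqrt (sqnorm lborel k) < \<epsilon>"
    by (auto simp: eventually_sequentially)
  have "\<forall>\<^sub>F n in sequentially. \<forall>p. cmod (l2_inner lborel (\<lambda>\<xi>. phase (- p) \<xi> * rem M n \<xi>) k) \<le> \<epsilon>" if M: "M \<ge> M0" for M
  proof (rule ccontr)
    assume no: "\<not> ?thesis"
    define Bad where "Bad = {n. \<exists>p. \<epsilon> < cmod (l2_inner lborel (\<lambda>\<xi>. phase (- p) \<xi> * rem M n \<xi>) k)}"
    have "infinite Bad"
      using no unfolding Bad_def eventually_sequentially infinite_nat_iff_unbounded_le by (force simp: not_le)
    then obtain r :: "nat \<Rightarrow> nat" where r: "strict_mono r" "\<And>n. r n \<in> Bad"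
      using infinite_enumerate by blast
    then have "\<forall>n. \<exists>p. \<epsilon> < cmod (l2_inner lborel (\<lambda>\<xi>. phase (- p) \<xi> * rem M (r n) \<xi>) k)"
      by (auto simp: Bad_def)
    then obtain p where p: "\<And>n. \<epsilon> < cmod (l2_inner lborel (\<lambda>\<xi>. phase (- p n) \<xi> * rem M (r n) \<xi>) k)" by metis
    obtain D where D: "\<And>n. sqnorm lborel (rem M n) \<le> D" using rem_bounded by blast
    obtain s \<Psi> where s: "strict_mono (s :: nat \<Rightarrow> nat)" and w: "weakly_converges lborel (\<lambda>n \<xi>. phase (- p (s n)) \<xi> * rem M (r (s n)) \<xi>) \<Psi>"
      using concentration_exists[of "\<lambda>n. rem M (r n)" D p] rem_square_integrable D by blast
    have \<Psi>: "\<Psi> \<in> square_integrable lborel" using w by (simp add: weakly_converges_def)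
    have "concentrates_to (rem M) \<Psi>"
      unfolding concentrates_to_def using w strict_mono_o[OF r(1) s]
      by (intro exI[of _ "\<lambda>n. p (s n)"] exI[of _ "\<lambda>n. r (s n)"]) (simp add: o_def)
    then have le: "sqnorm lborel \<Psi> \<le> 4 * sqnorm lborel (prof (Suc M))" by (rule concentration_le)
    have "(\<lambda>n. cmod (l2_inner lborel (\<lambda>\<xi>. phase (- p (s n)) \<xi> * rem M (r (s n)) \<xi>) k)) \<longlonglongrightarrow> cmod (l2_inner lborel \<Psi> k)"
      using w k by (intro tendsto_norm) (auto simp: weakly_converges_def)
    then have "\<epsilon> \<le> cmod (l2_inner lborel \<Psi> k)"
      by (rule LIMSEQ_le_const) (use p in \<open>auto intro: less_imp_le\<close>)
    also have "\<dots> \<le> sqrt (sqnorm lborel \<Psi>) * sqrt (sqnorm lborel k)" by (rule l2_inner_le[OF \<Psi> k])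
    also have "\<dots> \<le> sqrt (4 * sqnorm lborel (prof (Suc M))) * sqrt (sqnorm lborel k)"
      using le by (intro mult_right_mono real_sqrt_le_mono) auto
    also have "\<dots> < \<epsilon>" by (rule M0[OF M])
    finally show False by simp
  qed
  then show ?thesis by blast
qed

end

section \<open>From spectra to functions\<close>

text \<open>
  Multiplication by this weight turns the \<open>H\<^sup>1\<close> norm of a function into the
  \<open>L\<^sup>2\<close> norm of its spectrum.
\<close>

definition bessel_weight :: "real^2 \<Rightarrow> real" where
  "bessel_weight \<xi> = sqrt (1 + (norm \<xi>)\<^sup>2)"

definition unweight :: "spectrum \<Rightarrow> spectrum" where
  "unweight G \<xi> = complex_of_real (1 / bessel_weight \<xi>) * G \<xi>"

lemma bessel_weight_measurable [measurable]: "bessel_weight \<in> borel_measurable borel"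
  unfolding bessel_weight_def[abs_def] by measurable

lemma bessel_weight_ge_1: "1 \<le> bessel_weight \<xi>"
  by (simp add: bessel_weight_def)

lemma bessel_weight_pos: "0 < bessel_weight \<xi>"
  using bessel_weight_ge_1[of \<xi>] by linarith

lemma bessel_weight_sq: "(bessel_weight \<xi>)\<^sup>2 = 1 + (norm \<xi>)\<^sup>2"
  by (simp add: bessel_weight_def)

lemma cmod_unweight_sq: "(cmod (unweight G \<xi>))\<^sup>2 = (cmod (G \<xi>))\<^sup>2 / (1 + (norm \<xi>)\<^sup>2)"
  using bessel_weight_pos[of \<xi>] by (simp add: unweight_def norm_mult norm_divide power_divide bessel_weight_sq)

lemma one_plus_norm_pos: "0 < 1 + (norm (\<xi> :: real^2))\<^sup>2"
  by (simp add: add_pos_nonneg)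

lemma unweight_square_integrable:
  assumes "G \<in> square_integrable lborel"
  shows "unweight G \<in> square_integrable lborel"
  unfolding unweight_def[abs_def]
proof (rule square_integrable_mult_bounded[OF _ assms, where c=1])
  show "cmod (complex_of_real (1 / bessel_weight \<xi>)) \<le> 1" for \<xi>
    using bessel_weight_ge_1[of \<xi>] bessel_weight_pos[of \<xi>] by (simp add: norm_divide)
qed measurable

lemma h1_energy_unweight:
  assumes "G \<in> square_integrable lborel"
  shows "h1_energy (unweight G) = ennreal (sqnorm lborel G)"
proof -
  have "(1 + (norm \<xi>)\<^sup>2) * (cmod (unweight G \<xi>))\<^sup>2 = (cmod (G \<xi>))\<^sup>2" for \<xi>
    unfolding cmod_unweight_sq using one_plus_norm_pos[of \<xi>] by simp
  then show ?thesis unfolding h1_energy_def using nn_integral_eq_sqnorm[OF assms] by simp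
qed

lemma synthesized_H1:
  assumes G: "G \<in> square_integrable lborel" and f: "f = inverse_fourier (unweight G)"
  shows "f \<in> H1" and "AE \<xi> in lborel. fourier f \<xi> = unweight G \<xi>"
proof -
  have uG: "unweight G \<in> square_integrable lborel" by (rule unweight_square_integrable[OF G])
  have fsq: "f \<in> square_integrable lborel" unfolding f by (rule inverse_fourier_square_integrable[OF uG])
  show AE: "AE \<xi> in lborel. fourier f \<xi> = unweight G \<xi>" unfolding f by (rule fourier_inverse_fourier[OF uG])
  have [measurable]: "fourier f \<in> borel_measurable borel" "G \<in> borel_measurable borel"
    using fourier_square_integrable[OF fsq] G by (auto intro: square_integrable_borel)
  have "integrable lborel (\<lambda>\<xi>. (1 + (norm \<xi>)\<^sup>2) * (cmod (fourier f \<xi>))\<^sup>2)"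
  proof (rule integrable_cong_AE_imp[OF square_integrable_integrable[OF G]])
    show "AE \<xi> in lborel. (cmod (G \<xi>))\<^sup>2 = (1 + (norm \<xi>)\<^sup>2) * (cmod (fourier f \<xi>))\<^sup>2"
      using AE
    proof eventually_elim
      case (elim \<xi>)
      show ?case unfolding elim cmod_unweight_sq using one_plus_norm_pos[of \<xi>] by simp
    qed
  qed measurable
  then show "f \<in> H1" using fsq by (simp add: H1_def L2_eq_square_integrable)
qed

definition sobolev_weight :: "real \<Rightarrow> real^2 \<Rightarrow> real" where
  "sobolev_weight s \<xi> = norm \<xi> powr (2 * s) / (1 + (norm \<xi>)\<^sup>2)"

lemma sobolev_weight_measurable [measurable]: "sobolev_weight s \<in> borel_measurable borel"
  unfolding sobolev_weight_def[abs_def] by measurable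

lemma sobolev_weight_le_1:
  assumes "s \<in> {0..1}"
  shows "\<bar>sobolev_weight s \<xi>\<bar> \<le> 1"
proof -
  have "norm \<xi> powr (2 * s) \<le> 1 + (norm \<xi>)\<^sup>2"
  proof (cases "norm \<xi> \<le> 1")
    case True
    have "norm \<xi> powr (2 * s) \<le> 1 powr (2 * s)" using True assms by (intro powr_mono2) auto
    also have "1 powr (2 * s) \<le> 1 + (norm \<xi>)\<^sup>2" by simp
    finally show ?thesis .
  next
    case False
    have "norm \<xi> powr (2 * s) \<le> norm \<xi> powr 2" using False assms by (intro powr_mono) auto
    also have "\<dots> = (norm \<xi>)\<^sup>2" using False by (simp add: powr_numeral)
    finally show ?thesis by simp
  qed
  then show ?thesis unfolding sobolev_weight_def using one_plus_norm_pos[of \<xi>] by (simp add: abs_mult divide_le_eq)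
qed

lemma Hdot_norm_sq:
  assumes G: "G \<in> square_integrable lborel" and m: "fourier f \<in> borel_measurable borel"
    and AE: "AE \<xi> in lborel. fourier f \<xi> = unweight G \<xi>"
  shows "(Hdot_norm s f)\<^sup>2 = (LINT \<xi>|lborel. sobolev_weight s \<xi> * (cmod (G \<xi>))\<^sup>2)"
proof -
  have [measurable]: "G \<in> borel_measurable borel" using G by (rule square_integrable_borel)
  note m[measurable]
  have "(Hdot_norm s f)\<^sup>2 = (LINT \<xi>|lborel. norm \<xi> powr (2 * s) * (cmod (fourier f \<xi>))\<^sup>2)"
    unfolding Hdot_norm_def by (intro real_sqrt_pow2 integral_nonneg_AE) auto
  also have "\<dots> = (LINT \<xi>|lborel. sobolev_weight s \<xi> * (cmod (G \<xi>))\<^sup>2)"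
  proof (rule integral_cong_AE)
    show "AE \<xi> in lborel. norm \<xi> powr (2 * s) * (cmod (fourier f \<xi>))\<^sup>2 = sobolev_weight s \<xi> * (cmod (G \<xi>))\<^sup>2"
      using AE by eventually_elim (simp add: cmod_unweight_sq sobolev_weight_def)
  qed measurable
  finally show ?thesis .
qed

lemma schroedinger_of_AE:
  assumes G: "G \<in> square_integrable lborel" and m: "fourier f \<in> borel_measurable borel"
    and AE: "AE \<xi> in lborel. fourier f \<xi> = G \<xi>"
  shows "schroedinger t f = inverse_fourier (propagate t G)"
  unfolding schroedinger_eq
proof (rule inverse_fourier_cong_AE)
  have [measurable]: "G \<in> borel_measurable borel" using G by (rule square_integrable_borel)
  note m[measurable]
  show "propagate t (fourier f) \<in> borel_measurable borel" "propagate t G \<in> borel_measurable borel"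
    unfolding propagate_def[abs_def] by measurable
  show "AE x in lborel. propagate t (fourier f) x = propagate t G x"
    using AE by eventually_elim (simp add: propagate_def)
qed

lemma inverse_fourier_sum:
  assumes "finite I" "\<And>i. i \<in> I \<Longrightarrow> f i \<in> square_integrable lborel"
  shows "AE x in lborel. inverse_fourier (\<lambda>\<xi>. \<Sum>i\<in>I. f i \<xi>) x = (\<Sum>i\<in>I. inverse_fourier (f i) x)"
  using assms
proof (induction I rule: finite_induct)
  case empty
  show ?case using inverse_fourier_linear[OF square_integrable_zero square_integrable_zero, of 0 0] by simp
next
  case (insert i I)
  have "AE x in lborel. inverse_fourier (\<lambda>\<xi>. f i \<xi> + (\<Sum>i\<in>I. f i \<xi>)) x = inverse_fourier (f i) x + inverse_fourier (\<lambda>\<xi>. \<Sum>i\<in>I. f i \<xi>) x"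
    using insert by (intro inverse_fourier_add square_integrable_sum) auto
  moreover have "AE x in lborel. inverse_fourier (\<lambda>\<xi>. \<Sum>i\<in>I. f i \<xi>) x = (\<Sum>i\<in>I. inverse_fourier (f i) x)"
    using insert by auto
  ultimately show ?case by eventually_elim (use insert in simp)
qed

text \<open>
  The physical meaning of \<open>phase\<close>.
\<close>

lemma shifted_wave:
  assumes G: "G \<in> square_integrable lborel"
  shows "AE y in lborel. inverse_fourier (\<lambda>\<xi>. phase p \<xi> * G \<xi>) y = inverse_fourier (propagate (- fst p) G) (y - snd p)"
proof -
  have "phase p \<xi> * G \<xi> = cis (- (snd p \<bullet> \<xi>)) * propagate (- fst p) G \<xi>" for \<xi>
    by (simp add: phase_def propagate_def mult.assoc[symmetric] cis_mult add.commute)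
  then show ?thesis using inverse_fourier_modulation[OF propagate_square_integrable[OF G]] by simp
qed

context profile_extraction
begin

text \<open>
  The value of a frequency-truncated wave at \<open>(t, x)\<close> is the pairing of the
  remainder, shifted by \<open>phase (- t, - x)\<close>, with the fixed function
  \<open>unweight\<close> of the indicator of the ball.
\<close>

lemma low_frequency_vanishes:
  assumes s: "0 < s"
  shows "\<exists>M0. \<forall>M\<ge>M0. \<forall>\<^sub>F n in sequentially. \<forall>t x. cmod (free_wave (cutoff R (unweight (rem M n))) t x) \<le> s"
proof -
  define k where "k = unweight (\<lambda>\<xi>. complex_of_real (indicat_real (cball 0 R) \<xi>))"
  have k: "k \<in> square_integrable lborel"
    unfolding k_def by (intro unweight_square_integrable indicator_cball_square_integrable)
  obtain M0 where M0: "\<And>M. M \<ge> M0 \<Longrightarrow> \<forall>\<^sub>F n in sequentially. \<forall>p. cmod (l2_inner lborel (\<lambda>\<xi>. phase (- p) \<xi> * rem M n \<xi>) k) \<le> 2 * pi * s"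
    using l2_pairing_vanishes[OF k, of "2 * pi * s"] s by auto
  have eq: "free_wave (cutoff R (unweight G)) t x = l2_inner lborel (\<lambda>\<xi>. phase (- (t, x)) \<xi> * G \<xi>) k / complex_of_real (2 * pi)" for G t x
    unfolding free_wave_eq_phase l2_inner_def k_def cutoff_eq_mult unweight_def
    by (simp add: mult_ac)
  have "\<forall>\<^sub>F n in sequentially. \<forall>t x. cmod (free_wave (cutoff R (unweight (rem M n))) t x) \<le> s" if "M \<ge> M0" for M
    using M0[OF that]
  proof eventually_elim
    case (elim n)
    show ?case
    proof (intro allI)
      fix t x
      show "cmod (free_wave (cutoff R (unweight (rem M n))) t x) \<le> s"
        using elim[rule_format, of "(t, x)"] unfolding eq by (simp add: norm_divide field_simps)
    qed
  qed
  then show ?thesis by blast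
qed

lemma L4_vanishes:
  assumes d: "0 < d"
  shows "\<exists>M0. \<forall>M\<ge>M0. \<forall>\<^sub>F n in sequentially. \<forall>t.
    (\<integral>\<^sup>+ x. ennreal (cmod (inverse_fourier (propagate t (unweight (rem M n))) x) ^ 4) \<partial>lborel) \<le> ennreal d"
proof -
  define E where "E = C + 1"
  have E: "0 < E" using order_trans[OF sqnorm_nonneg F_le] by (simp add: E_def add_nonneg_pos)
  \<comment> \<open>\<open>R\<close> and \<open>s\<close> make both summands in
  \<open>L4_low_high_split\<close> at most \<open>d / 16\<close>; the factor in front of them is
  \<open>8\<close>\<close>
  define R where "R = sqrt (16 * pi * E\<^sup>2 / d)"
  have R: "0 \<le> R" "R\<^sup>2 = 16 * pi * E\<^sup>2 / d" using d E by (simp_all add: R_def)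
  define s where "s = sqrt (d / (16 * E))"
  have s: "0 < s" "s\<^sup>2 = d / (16 * E)" using d E by (simp_all add: s_def)
  have hi: "pi / (1 + R\<^sup>2) * E\<^sup>2 \<le> d / 16"
  proof -
    have "pi * E\<^sup>2 = d / 16 * R\<^sup>2" using d by (simp add: R(2))
    also have "\<dots> \<le> d / 16 * (1 + R\<^sup>2)" using d by (intro mult_left_mono) auto
    finally have "pi * E\<^sup>2 / (1 + R\<^sup>2) \<le> d / 16" by (simp add: divide_le_eq add_pos_nonneg)
    then show ?thesis by simp
  qed
  have lo: "s\<^sup>2 * E = d / 16" using E by (simp add: s(2))
  have total: "8 * (s\<^sup>2 * E + pi / (1 + R\<^sup>2) * E\<^sup>2) \<le> d" 
  proof -
    have "8 * (d / 16 + pi / (1 + R\<^sup>2) * E\<^sup>2) \<le> 8 * (d / 16 + d / 16)"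
      using hi by (intro mult_left_mono add_left_mono) auto
    then show ?thesis unfolding lo by simp
  qed
  obtain M0 where M0: "\<And>M. M \<ge> M0 \<Longrightarrow> \<forall>\<^sub>F n in sequentially. \<forall>t x. cmod (free_wave (cutoff R (unweight (rem M n))) t x) \<le> s"
    using low_frequency_vanishes[OF s(1)] by blast
  have "\<forall>\<^sub>F n in sequentially. \<forall>t. (\<integral>\<^sup>+ x. ennreal (cmod (inverse_fourier (propagate t (unweight (rem M n))) x) ^ 4) \<partial>lborel) \<le> ennreal d" if "M \<ge> M0" for M
    using M0[OF that] rem_eventually_le[of M]
  proof eventually_elim
    case (elim n)
    have e: "h1_energy (unweight (rem M n)) \<le> ennreal E"
      unfolding h1_energy_unweight[OF rem_square_integrable] E_def using elim(2) by (rule ennreal_leI)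
    show ?case
    proof
      fix t
      have "(\<integral>\<^sup>+ x. ennreal (cmod (inverse_fourier (propagate t (unweight (rem M n))) x) ^ 4) \<partial>lborel) \<le> ennreal (8 * (s\<^sup>2 * E + pi / (1 + R\<^sup>2) * E\<^sup>2))"
        using elim(1) E R by (intro L4_low_high_split unweight_square_integrable rem_square_integrable e) auto
      also have "\<dots> \<le> ennreal d" using total by (rule ennreal_leI)
      finally show "(\<integral>\<^sup>+ x. ennreal (cmod (inverse_fourier (propagate t (unweight (rem M n))) x) ^ 4) \<partial>lborel) \<le> ennreal d" .
    qed
  qed
  then show ?thesis by blast
qed

theorem S_norm_vanishes:
  assumes b: "4 < b" and \<epsilon>: "0 < \<epsilon>"
  shows "\<exists>M0. \<forall>M\<ge>M0. \<forall>\<^sub>F n in sequentially. S_norm b (\<lambda>t. inverse_fourier (propagate t (unweight (rem M n)))) \<le> ennreal \<epsilon>"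
proof -
  define E where "E = C + 1"
  have E: "0 < E" using order_trans[OF sqnorm_nonneg F_le] by (simp add: E_def add_nonneg_pos)
  define K where "K = max 1 (strichartz_const * E\<^sup>2)"
  have K: "1 \<le> K" by (simp add: K_def)
  define c where "c = plus_dual 4 b"
  have c: "0 < c" unfolding c_def plus_dual_def using b by simp
  \<comment> \<open>\<open>d\<close> inverts the power in
  \<open>S_norm_interpolation\<close>\<close>
  define d where "d = min 1 ((\<epsilon> / K) powr c)"
  have d: "0 < d" "d \<le> 1" using \<epsilon> K by (simp_all add: d_def)
  have Kd: "K * d powr (1 / c) \<le> \<epsilon>"
  proof -
    have "d powr (1 / c) \<le> ((\<epsilon> / K) powr c) powr (1 / c)"
      using d c by (intro powr_mono2) (auto simp: d_def)
    also have "\<dots> = \<epsilon> / K" using \<epsilon> K c by (simp add: powr_powr)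
    finally have "K * d powr (1 / c) \<le> K * (\<epsilon> / K)" using K by (intro mult_left_mono) auto
    then show ?thesis using K by simp
  qed
  obtain M0 where M0: "\<And>M. M \<ge> M0 \<Longrightarrow> \<forall>\<^sub>F n in sequentially. \<forall>t.
    (\<integral>\<^sup>+ x. ennreal (cmod (inverse_fourier (propagate t (unweight (rem M n))) x) ^ 4) \<partial>lborel) \<le> ennreal d"
    using L4_vanishes[OF d(1)] by blast
  have "\<forall>\<^sub>F n in sequentially. S_norm b (\<lambda>t. inverse_fourier (propagate t (unweight (rem M n)))) \<le> ennreal \<epsilon>" if "M \<ge> M0" for M
    using M0[OF that] rem_eventually_le[of M]
  proof eventually_elim
    case (elim n)
    have e: "h1_energy (unweight (rem M n)) \<le> ennreal E"
      unfolding h1_energy_unweight[OF rem_square_integrable] E_def using elim(2) by (rule ennreal_leI)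
    have "S_norm b (\<lambda>t. inverse_fourier (propagate t (unweight (rem M n)))) \<le> ennreal (max 1 (strichartz_const * E\<^sup>2) * d powr (1 / plus_dual 4 b))"
      using elim(1) E d by (intro S_norm_interpolation b unweight_square_integrable rem_square_integrable e) auto
    also have "\<dots> \<le> ennreal \<epsilon>" using Kd unfolding K_def c_def by (rule ennreal_leI)
    finally show ?case .
  qed
  then show ?thesis by blast
qed

end

lemma limits_tendsto_0:
  fixes X :: "nat \<Rightarrow> nat \<Rightarrow> ennreal" and L :: "nat \<Rightarrow> ennreal"
  assumes L: "\<And>M. X M \<longlonglongrightarrow> L M"
    and small: "\<And>\<epsilon>. 0 < \<epsilon> \<Longrightarrow> \<exists>M0. \<forall>M\<ge>M0. \<forall>\<^sub>F n in sequentially. X M n \<le> ennreal \<epsilon>"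
  shows "L \<longlonglongrightarrow> 0"
proof (rule order_tendstoI)
  fix y :: ennreal assume "0 < y"
  obtain \<epsilon> where \<epsilon>: "0 < \<epsilon>" "ennreal \<epsilon> < y"
  proof (cases y)
    case (real c)
    then have "0 < c" using \<open>0 < y\<close> by simp
    then show ?thesis using that[of "c / 2"] real by (simp add: ennreal_less_iff)
  next
    case top
    then show ?thesis using that[of 1] by simp
  qed
  obtain M0 where M0: "\<And>M. M \<ge> M0 \<Longrightarrow> \<forall>\<^sub>F n in sequentially. X M n \<le> ennreal \<epsilon>"
    using small[OF \<epsilon>(1)] by blast
  have "L M < y" if "M \<ge> M0" for M
    using tendsto_upperbound[OF L M0[OF that]] \<epsilon>(2) by simp
  then show "\<forall>\<^sub>F M in sequentially. L M < y" unfolding eventually_sequentially by blast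
qed simp

lemma sum_abs_norm_at_top:
  fixes p q :: "nat \<Rightarrow> real \<times> (real^2)"
  assumes "filterlim (\<lambda>n. norm (p n - q n)) at_top sequentially"
  shows "filterlim (\<lambda>n. \<bar>fst (p n) - fst (q n)\<bar> + norm (snd (p n) - snd (q n))) at_top sequentially"
proof (rule filterlim_at_top_mono[OF assms], rule always_eventually, rule allI)
  fix n
  have "norm (p n - q n) \<le> norm (fst (p n - q n)) + norm (snd (p n - q n))"
    using norm_Pair_le[of "fst (p n - q n)" "snd (p n - q n)"] unfolding prod.collapse .
  then show "norm (p n - q n) \<le> \<bar>fst (p n) - fst (q n)\<bar> + norm (snd (p n) - snd (q n))" by simp
qed

theorem proposition5p1:
  fixes \<phi> :: "nat \<Rightarrow> real^2 \<Rightarrow> complex" and four_plus :: real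
  assumes four_plus: "4 < four_plus"
    and H1: "\<And>n. \<phi> n \<in> H1"
    and bounded: "\<exists>C. \<forall>n. H1_norm (\<phi> n) \<le> C"
  shows "\<exists>(\<sigma> :: nat \<Rightarrow> nat) (\<psi> :: nat \<Rightarrow> real^2 \<Rightarrow> complex) (t :: nat \<Rightarrow> nat \<Rightarrow> real)
      (x :: nat \<Rightarrow> nat \<Rightarrow> real^2) (W :: nat \<Rightarrow> nat \<Rightarrow> real^2 \<Rightarrow> complex).
    strict_mono \<sigma> \<and>
    (\<forall>j\<ge>1. \<psi> j \<in> H1) \<and>
    (\<forall>M n. W M n \<in> H1) \<and>
    (\<forall>M n. AE y in lborel.
       \<phi> (\<sigma> n) y = (\<Sum>j=1..M. schroedinger (- t j n) (\<psi> j) (y - x j n)) + W M n y) \<and>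
    (\<forall>M. \<forall>k\<in>{1..M}. \<forall>j\<in>{1..M}. k \<noteq> j \<longrightarrow>
       filterlim (\<lambda>n. \<bar>t j n - t k n\<bar> + norm (x j n - x k n)) at_top sequentially) \<and>
    (\<exists>L :: nat \<Rightarrow> ennreal.
       (\<forall>M. (\<lambda>n. S_norm four_plus (\<lambda>\<tau>. schroedinger \<tau> (W M n))) \<longlonglongrightarrow> L M) \<and>
       L \<longlonglongrightarrow> 0) \<and>
    (\<forall>M. \<forall>s\<in>{0..1}.
       (\<lambda>n. (Hdot_norm s (\<phi> (\<sigma> n)))\<^sup>2
            - ((\<Sum>j=1..M. (Hdot_norm s (\<psi> j))\<^sup>2) + (Hdot_norm s (W M n))\<^sup>2)) \<longlonglongrightarrow> 0)"
proof -
  have \<phi>_sq: "\<phi> n \<in> square_integrable lborel" for n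
    using H1[of n] by (simp add: H1_def L2_eq_square_integrable)
  have \<Phi>_sq: "fourier (\<phi> n) \<in> square_integrable lborel" for n
    by (rule fourier_square_integrable[OF \<phi>_sq])
  have \<Phi>m[measurable]: "fourier (\<phi> n) \<in> borel_measurable borel" for n
    by (rule square_integrable_borel[OF \<Phi>_sq])
  define F where "F n \<xi> = complex_of_real (bessel_weight \<xi>) * fourier (\<phi> n) \<xi>" for n \<xi>
  have F_cmod: "(cmod (F n \<xi>))\<^sup>2 = (1 + (norm \<xi>)\<^sup>2) * (cmod (fourier (\<phi> n) \<xi>))\<^sup>2" for n \<xi>
    unfolding F_def norm_mult norm_of_real power_mult_distrib power2_abs bessel_weight_sq ..
  have F_sq: "F n \<in> square_integrable lborel" for n
  proof (rule square_integrable_bound)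
    show "integrable lborel (\<lambda>\<xi>. (1 + (norm \<xi>)\<^sup>2) * (cmod (fourier (\<phi> n) \<xi>))\<^sup>2)"
      using H1[of n] by (simp add: H1_def)
    show "F n \<in> borel_measurable lborel" unfolding F_def[abs_def] by measurable
  qed (simp add: F_cmod)
  have unweight_F: "unweight (F n) \<xi> = fourier (\<phi> n) \<xi>" for n \<xi>
    using bessel_weight_pos[of \<xi>] by (simp add: unweight_def F_def mult.assoc[symmetric])
  obtain C0 where C0: "\<And>n. H1_norm (\<phi> n) \<le> C0" using bounded by blast
  have F_le: "sqnorm lborel (F n) \<le> C0\<^sup>2" for n
  proof -
    have "sqnorm lborel (F n) = (H1_norm (\<phi> n))\<^sup>2"
      unfolding sqnorm_def H1_norm_def F_cmod by (rule real_sqrt_pow2[symmetric], rule integral_nonneg_AE) auto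
    also have "\<dots> \<le> C0\<^sup>2" using C0[of n] by (intro power_mono) (auto simp: H1_norm_def intro!: integral_nonneg_AE)
    finally show ?thesis .
  qed
  define S where "S G = S_norm four_plus (\<lambda>\<tau>. inverse_fourier (propagate \<tau> (unweight G)))" for G
  \<comment> \<open>an extraction step makes the norms of the new remainder converge; for
  \<open>M = 0\<close> the remainder is \<open>F\<close> itself\<close>
  obtain s0 where s0: "strict_mono s0" "convergent (\<lambda>n. S (F (s0 n)))"
    using ennreal_convergent_subseq[of "\<lambda>n. S (F n)"] by blast
  obtain a where a: "stage_subseq (a 0) = id" "stage_rem (a 0) = (\<lambda>n. F (s0 n))"
    "\<And>j. valid_stage (a j) \<and> extraction_step S (a j) (a (Suc j))"
    using extraction_sequence_exists[of "\<lambda>n. F (s0 n)" "C0\<^sup>2" S] F_sq F_le by blast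
  interpret profile_extraction a S "\<lambda>n. F (s0 n)" "C0\<^sup>2"
    using F_sq F_le a by unfold_locales auto
  define \<sigma> where "\<sigma> n = s0 (diag n)" for n
  define \<psi> where "\<psi> j = inverse_fourier (unweight (prof j))" for j
  define W where "W M n = inverse_fourier (unweight (rem M n))" for M n
  have prof_sq: "prof j \<in> square_integrable lborel" if "1 \<le> j" for j
    using prof_square_integrable[of "j - 1"] that by simp
  have \<psi>H1: "\<psi> j \<in> H1" and \<psi>_hat: "AE \<xi> in lborel. fourier (\<psi> j) \<xi> = unweight (prof j) \<xi>" if "1 \<le> j" for j
    using synthesized_H1[OF prof_sq[OF that] \<psi>_def] by auto
  have WH1: "W M n \<in> H1" and W_hat: "AE \<xi> in lborel. fourier (W M n) \<xi> = unweight (rem M n) \<xi>" for M n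
    using synthesized_H1[OF rem_square_integrable W_def] by auto
  have hat_m: "fourier f \<in> borel_measurable borel" if "f \<in> H1" for f
    using that by (intro square_integrable_borel fourier_square_integrable) (simp add: H1_def L2_eq_square_integrable)
  have schr_W: "schroedinger \<tau> (W M n) = inverse_fourier (propagate \<tau> (unweight (rem M n)))" for \<tau> M n
    by (rule schroedinger_of_AE[OF unweight_square_integrable[OF rem_square_integrable] hat_m[OF WH1] W_hat])
  have schr_\<psi>: "schroedinger \<tau> (\<psi> j) = inverse_fourier (propagate \<tau> (unweight (prof j)))" if "1 \<le> j" for \<tau> j
    by (rule schroedinger_of_AE[OF unweight_square_integrable[OF prof_sq[OF that]] hat_m[OF \<psi>H1[OF that]] \<psi>_hat[OF that]])
  have decomposition: "AE y in lborel. \<phi> (\<sigma> n) y = (\<Sum>j=1..M. schroedinger (- fst (shift j n)) (\<psi> j) (y - snd (shift j n))) + W M n y" for M n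
  proof -
    let ?g = "\<lambda>j \<xi>. phase (shift j n) \<xi> * unweight (prof j) \<xi>"
    have g_sq: "?g j \<in> square_integrable lborel" if "j \<in> {1..M}" for j
      using that by (intro phase_square_integrable unweight_square_integrable prof_sq) auto
    have sum_sq: "(\<lambda>\<xi>. \<Sum>j=1..M. ?g j \<xi>) \<in> square_integrable lborel"
      by (rule square_integrable_sum) (rule g_sq)
    have u_sq: "unweight (rem M n) \<in> square_integrable lborel"
      by (intro unweight_square_integrable rem_square_integrable)
    have "fourier (\<phi> (\<sigma> n)) = (\<lambda>\<xi>. (\<Sum>j=1..M. ?g j \<xi>) + unweight (rem M n) \<xi>)"
    proof
      fix \<xi>
      have "fourier (\<phi> (\<sigma> n)) \<xi> = unweight (F (s0 (diag n))) \<xi>" by (simp add: unweight_F \<sigma>_def)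
      also have "\<dots> = (\<Sum>j=1..M. ?g j \<xi>) + unweight (rem M n) \<xi>"
        unfolding unweight_def rem_eq[of n \<xi> M] by (simp add: distrib_left sum_distrib_left mult_ac)
      finally show "fourier (\<phi> (\<sigma> n)) \<xi> = (\<Sum>j=1..M. ?g j \<xi>) + unweight (rem M n) \<xi>" .
    qed
    then have "AE y in lborel. inverse_fourier (fourier (\<phi> (\<sigma> n))) y = inverse_fourier (\<lambda>\<xi>. \<Sum>j=1..M. ?g j \<xi>) y + W M n y"
      unfolding W_def using inverse_fourier_add[OF sum_sq u_sq] by simp
    moreover have "AE y in lborel. inverse_fourier (\<lambda>\<xi>. \<Sum>j=1..M. ?g j \<xi>) y = (\<Sum>j=1..M. inverse_fourier (?g j) y)"
      by (rule inverse_fourier_sum) (use g_sq in auto)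
    moreover have "AE y in lborel. \<forall>j\<in>{1..M}. inverse_fourier (?g j) y = schroedinger (- fst (shift j n)) (\<psi> j) (y - snd (shift j n))"
    proof (rule AE_finite_allI)
      fix j assume j: "j \<in> {1..M}"
      then show "AE y in lborel. inverse_fourier (?g j) y = schroedinger (- fst (shift j n)) (\<psi> j) (y - snd (shift j n))"
        using shifted_wave[OF unweight_square_integrable[OF prof_sq[of j]], of "shift j n"] by (simp add: schr_\<psi>)
    qed simp
    moreover have "AE y in lborel. inverse_fourier (fourier (\<phi> (\<sigma> n))) y = \<phi> (\<sigma> n) y"
      by (rule inverse_fourier_fourier[OF \<phi>_sq])
    ultimately show ?thesis
      by eventually_elim simp
  qed
  have divergence: "filterlim (\<lambda>n. \<bar>fst (shift j n) - fst (shift k n)\<bar> + norm (snd (shift j n) - snd (shift k n))) at_top sequentially"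
    if "1 \<le> k" "1 \<le> j" "k \<noteq> j" for j k
  proof (cases "k < j")
    case True
    then show ?thesis using shifts_diverge[OF that(1) True] by (rule_tac sum_abs_norm_at_top)
  next
    case False
    then have "filterlim (\<lambda>n. norm (shift j n - shift k n)) at_top sequentially"
      using shifts_diverge[OF that(2), of k] that(3) by (simp add: norm_minus_commute)
    then show ?thesis by (rule sum_abs_norm_at_top)
  qed
  have S_conv: "convergent (\<lambda>n. S (rem M n))" for M
  proof (cases M)
    case 0
    have "(\<lambda>n. S (rem 0 n)) = (\<lambda>n. S (F (s0 n))) \<circ> diag" by (simp add: rem_0 o_def)
    then show ?thesis unfolding 0 using convergent_subseq_convergent[OF s0(2) diag_strict_mono] by simp
  qed (simp add: S_convergent)
  define L where "L M = lim (\<lambda>n. S (rem M n))" for M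
  have L: "(\<lambda>n. S (rem M n)) \<longlonglongrightarrow> L M" for M
    unfolding L_def using S_conv by (simp add: convergent_LIMSEQ_iff)
  have L0: "L \<longlonglongrightarrow> 0"
    by (rule limits_tendsto_0[OF L]) (use S_norm_vanishes[OF four_plus] in \<open>simp add: S_def\<close>)
  have Pythagoras: "(\<lambda>n. (Hdot_norm s (\<phi> (\<sigma> n)))\<^sup>2
            - ((\<Sum>j=1..M. (Hdot_norm s (\<psi> j))\<^sup>2) + (Hdot_norm s (W M n))\<^sup>2)) \<longlonglongrightarrow> 0" if s: "s \<in> {0..1}" for M s
  proof -
    have "(Hdot_norm s (\<phi> (\<sigma> n)))\<^sup>2 = (LINT \<xi>|lborel. sobolev_weight s \<xi> * (cmod (F (s0 (diag n)) \<xi>))\<^sup>2)" for n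
      by (rule Hdot_norm_sq) (auto simp: F_sq unweight_F \<sigma>_def)
    moreover have "(Hdot_norm s (\<psi> j))\<^sup>2 = (LINT \<xi>|lborel. sobolev_weight s \<xi> * (cmod (prof j \<xi>))\<^sup>2)" if "j \<in> {1..M}" for j
      using that by (intro Hdot_norm_sq prof_sq hat_m \<psi>H1 \<psi>_hat) auto
    moreover have "(Hdot_norm s (W M n))\<^sup>2 = (LINT \<xi>|lborel. sobolev_weight s \<xi> * (cmod (rem M n \<xi>))\<^sup>2)" for n
      by (intro Hdot_norm_sq rem_square_integrable hat_m WH1 W_hat)
    ultimately show ?thesis
      using pythagoras[of "sobolev_weight s" M] sobolev_weight_le_1[OF s] by simp
  qed
  show ?thesis
  proof (rule exI[of _ \<sigma>], rule exI[of _ \<psi>], rule exI[of _ "\<lambda>j n. fst (shift j n)"],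
      rule exI[of _ "\<lambda>j n. snd (shift j n)"], rule exI[of _ W], intro conjI)
    show "strict_mono \<sigma>"
      using strict_mono_o[OF s0(1) diag_strict_mono] by (simp add: \<sigma>_def[abs_def] o_def)
    show "\<exists>L. (\<forall>M. (\<lambda>n. S_norm four_plus (\<lambda>\<tau>. schroedinger \<tau> (W M n))) \<longlonglongrightarrow> L M) \<and> L \<longlonglongrightarrow> 0"
      using L L0 unfolding schr_W S_def by blast
  qed (use \<psi>H1 WH1 decomposition divergence Pythagoras in auto)
qed

end
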